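(* Let $f$ be a bounded special function such that $\mu(f)=0$. Put $C(f)=\sup_{x\in E}\mathbb{E}_x\int_0^{R_1}|f|(X_s)\,ds$, $K(f)=\|f\|_\infty+C(f)$ and $B(f)=\max(K^2(f),K(f))$. 1. Suppose that $X$ is positive recurrent. Let $\hat F(\lambda)=\mathbb{E}(e^{-\lambda(R_2-R_1)})$ and $m=\mathbb{E}(R_2-R_1)$. Then for any $u<m$, $$\Lambda^*(u)=\sup_{\lambda>0}\left[-\lambda u-\log\hat F(\lambda)\right]>0,$$ and the following hold. (i) For any $0<\eta\le\frac12$, for all $x$, for any initial measure $\pi$ and for all $t>4m$, $$P_\pi\left(\left|\int_0^t f(X_s)ds\right|\ge t^{\frac12+\eta}\left(\frac2m\right)^{\frac12+\eta}x\right)\le 4\exp\left(-t^{2\eta}\frac{1}{42\,m\,B(f)}(x^2\wedge x)\right)+4e\exp\left(-\frac{2^{\frac12+\eta}}{6K(f)m^{\frac12+\eta}}t^{\frac12+\eta}x\right)+8\exp\left(-t(x\vee1)\frac{3}{4m}\Lambda^*\left(\tfrac23m\right)\right).$$ (ii) For all $x$, for any initial measure $\pi$ and for all $t>4m$, $$P_\pi\left(\left|\int_0^t f(X_s)ds\right|\ge\sqrt t\,x\,\frac{\sqrt2}{\sqrt m}\right)\le4\exp\left(-\frac{1}{42\,B(f)}(x^2\wedge x)\right)+4e\exp\left(-\frac{\sqrt2}{6K(f)\sqrt m}\sqrt t\,x\right)+8\exp\left(-t(x\vee1)\frac{3}{4m}\Lambda^*\left(\tfrac23m\right)\right).$$ 2.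 Suppose that $X$ is null-recurrent. Let $v^*_t=\mathbb{E}_\nu(N_t)+1$. Then there exists $t_0$, defined through $v^*_{t_0}=1$, such that for all $t\ge t_0$, for all $x$, for any $0<\eta\le\frac12$ and for any initial measure $\pi$, $$P_\pi\left(\left|\int_0^tf(X_s)ds\right|\ge(v^*_t)^{\frac12+\eta}x\right)\le4\exp\left(-\frac{1}{42\,B(f)}(v_t^* )^{\eta}(x^2\wedge x)\right)+4e\exp\left(-\frac{1}{6K(f)}(v_t^* )^{\frac12+\eta}x\right)+8\exp\left(-\frac12(v_t^* )^{\eta}(x\vee1)\right).$$
   Context: Process. $X=(X_t)_{t\ge0}$ is a strong Markov process with càdlàg paths on $(\Omega,\mathcal A,(P_x)_x)$, with values in a locally compact Polish space $(E,\mathcal E)$, $X_0=x$ $P_x$-a.s., with semigroup $(P_t)_t$. It is Harris recurrent with ($\sigma$-finite) invariant measure $\mu$, unique up to a multiplicative constant: $\mu(A)>0$ implies $\limsup_{t\to\infty}1_A(X_t)=1$ a.s. $X$ is positive recurrent if $\mu(E)<\infty$, null-recurrent otherwise. Standing assumption: there is a $\sigma$-finite positive measure $\Lambda$ on $E$ with $P_t(x,dy)=p_t(x,y)\Lambda(dy)$ for every $t>0$, $(t,x,y)\mapsto p_t(x,y)$ jointly measurable. $P_\pi,E_\pi$: law and expectation of $X$ with initial measure $\pi$ (a probability measure on $E$). Special functions. A measurable $f:E\to\mathbb{R}_+$ is special if for every bounded positive measurable $h$ with $\mu(h)>0$ the function $x\mapsto E_x\int_0^\infty\exp[-\int_0^th(X_s)ds]f(X_t)dt$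 is bounded. A signed $f$ is called special if $|f|$ is special. Nummelin splitting. Let $U^1(x,dy)=\int_0^\infty e^{-t}P_t(x,dy)dt$ and $u^1(x,x')=\int_0^\infty e^{-t}p_t(x,x')dt$. Fix $a\in(0,1)$, a set $C$ with $\mu(C)>0$ (which may be taken compact), and a probability $\nu$ equivalent to $\mu(\cdot\cap C)$ such that $U^1(x,dy)\ge a1_C(x)\nu(dy)$ (such a choice always exists). Define a kernel $Q$ from $E\times[0,1]$ to $E$: $Q((x,u),dy)=\nu(dy)$ if $x\in C,u\le a$; $=\frac1{1-a}(U^1(x,dy)-a\nu(dy))$ if $x\in C,u>a$; $=U^1(x,dy)$ if $x\notin C$. On an extension of the space, define the process $Z=(Z^1,Z^2,Z^3)$ in $E\times[0,1]\times E$ with jump times $0=T_0<T_1<\dots$: $Z_0^1$ has the initial law, $Z_0^2$ is uniform on $[0,1]$, $Z^3_0\sim Q((Z_0^1,Z_0^2),\cdot)$. Inductively, given $Z_{T_n}=(x,u,x')$: $\sigma_{n+1}=T_{n+1}-T_n$ has density $e^{-t}p_t(x,x')/u^1(x,x')$ on $\mathbb{R}_+$ (conventions $0/0:=b/\infty:=1$, $b\ge 0$); given $\sigma_{n+1}=t$, on $[T_n,T_{n+1})$ one has $Z^2=u$, $Z^3=x'$ and $Z^1$ evolves as the bridge of $X$ from $x$ to $x'$ of length $t$, i.e. $Z^1_{T_n+s}\sim\frac{p_s(x,y)p_{t-s}(y,x')}{p_t(x,x')}\Lambda(dy)$ and, given $Z^1_{T_n+s}=y$, $Z^1_{T_n+s+r}\sim\frac{p_r(y,y')p_{t-s-r}(y',x')}{p_{t-s}(y,x')}\Lambda(dy')$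 for $s+r<t$ (equal to a fixed point $x_0$ where the denominator vanishes); at $T_{n+1}$, $Z^1_{T_{n+1}}=x'$, $Z^2_{T_{n+1}}$ is a fresh independent uniform variable on $[0,1]$, and $Z^3_{T_{n+1}}\sim Q((Z^1_{T_{n+1}},Z^2_{T_{n+1}}),\cdot)$. Then $(Z^1,(T_n)_n)$ has the law of $X$ together with the partial sums of an independent i.i.d. exp(1) sequence; $X$ is identified with $Z^1$. $\mathbb{P}_\pi,\mathbb{E}_\pi$ denote law and expectation of $Z$ started from $\pi(dx)\otimes U(du)\otimes Q((x,u),dy)$, $U$ uniform on $[0,1]$; $\mathbb{E}_x=\mathbb{E}_{\delta_x}$. Regeneration times. $S_0=R_0=0$, $S_{n+1}=\inf\{T_k>R_n:Z_{T_k}\in C\times[0,a]\times E\}$, $R_{n+1}=\inf\{T_k:T_k>S_{n+1}\}$. For $n\ge1$, $Z_{R_n}\sim\nu(dx)U(du)Q((x,u),dx')$, so the law of $R_2-R_1$ does not depend on the initial measure (hence the notation $\mathbb{E}$ without index). $\mu$ is normalized by $\mu(g)=\mathbb{E}_\pi\int_{R_1}^{R_2}g(X_s)ds$ (independent of $\pi$). $N_t=\sup\{n:R_n\le t\}$. For special $f$ it is known that $C(f)=\sup_x\mathbb{E}_x\int_0^{R_1}|f|(X_s)ds<\infty$. $x\wedge y=\min(x,y)$, $x\vee y=\max(x,y)$. *)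

theory Defs
  imports "HOL-Probability.Probability"
begin

section \<open>The Markov process\<close>

text \<open>
  The process \<open>X\<close> lives on the measurable space \<open>Om\<close> and carries the laws \<open>P x\<close>; time is \<open>real\<close>, and
  only times \<open>t \<ge> 0\<close> matter.
\<close>

definition trans_kernel :: "('e::polish_space \<Rightarrow> 'w measure) \<Rightarrow> (real \<Rightarrow> 'w \<Rightarrow> 'e) \<Rightarrow> real \<Rightarrow> 'e \<Rightarrow> 'e measure"
  where "trans_kernel P X t x = distr (P x) borel (X t)"

definition law_from :: "('e::polish_space \<Rightarrow> 'w measure) \<Rightarrow> 'e measure \<Rightarrow> 'w measure"
  where "law_from P \<pi> = \<pi> \<bind> P"

text \<open>
  The natural filtration is indexed by \<open>[0,\<infinity>]\<close>, so that stopping times may be infinite.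
\<close>

definition nat_filt :: "'w measure \<Rightarrow> (real \<Rightarrow> 'w \<Rightarrow> 'e::polish_space) \<Rightarrow> ennreal \<Rightarrow> 'w measure"
  where "nat_filt Om X t =
    sigma (space Om) {X s -` A \<inter> space Om |s A. 0 \<le> s \<and> ennreal s \<le> t \<and> A \<in> sets borel}"

definition resolvent_kernel ::
  "('e::polish_space \<Rightarrow> 'w measure) \<Rightarrow> (real \<Rightarrow> 'w \<Rightarrow> 'e) \<Rightarrow> 'e \<Rightarrow> 'e measure"
  where "resolvent_kernel P X x = measure_of UNIV (sets borel)
    (\<lambda>A. \<integral>\<^sup>+t\<in>{0<..}. ennreal (exp (- t)) * emeasure (trans_kernel P X t x) A \<partial>lborel)"

definition resolvent_density :: "(real \<Rightarrow> 'e \<Rightarrow> 'e \<Rightarrow> real) \<Rightarrow> 'e \<Rightarrow> 'e \<Rightarrow> ennreal"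
  where "resolvent_density p x x' = (\<integral>\<^sup>+t\<in>{0<..}. ennreal (exp (- t) * p t x x') \<partial>lborel)"

locale harris_process =
  fixes Om :: "'w measure"
    and P :: "'e::polish_space \<Rightarrow> 'w measure"
    and X :: "real \<Rightarrow> 'w \<Rightarrow> 'e"
    and \<mu> :: "'e measure"
    and \<Lambda> :: "'e measure"
    and p :: "real \<Rightarrow> 'e \<Rightarrow> 'e \<Rightarrow> real"
  assumes locally_compact: "locally_compact_space (euclidean :: 'e topology)"
    and P_kernel: "P \<in> borel \<rightarrow>\<^sub>M prob_algebra Om"
    and X_measurable: "\<And>t. 0 \<le> t \<Longrightarrow> X t \<in> Om \<rightarrow>\<^sub>M borel"
    and X_right_continuous:
      "\<And>\<omega> t. \<omega> \<in> space Om \<Longrightarrow> 0 \<le> t \<Longrightarrow> ((\<lambda>s. X s \<omega>) \<longlongrightarrow> X t \<omega>) (at_right t)"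
    and X_left_limits:
      "\<And>\<omega> t. \<omega> \<in> space Om \<Longrightarrow> 0 < t \<Longrightarrow> \<exists>l. ((\<lambda>s. X s \<omega>) \<longlongrightarrow> l) (at_left t)"
    and X_start: "\<And>x. AE \<omega> in P x. X 0 \<omega> = x"
    and strong_markov:
      "\<And>\<tau> G x s A. stopping_time (nat_filt Om X) \<tau> \<Longrightarrow>
        G \<in> sets (filtration.pre_sigma (space Om) (nat_filt Om X) \<tau>) \<Longrightarrow> 0 \<le> s \<Longrightarrow> A \<in> sets borel \<Longrightarrow>
        emeasure (P x) {\<omega> \<in> G. \<tau> \<omega> < \<infinity> \<and> X (enn2real (\<tau> \<omega>) + s) \<omega> \<in> A} =
        (\<integral>\<^sup>+\<omega>\<in>{\<omega> \<in> G. \<tau> \<omega> < \<infinity>}. emeasure (trans_kernel P X s (X (enn2real (\<tau> \<omega>)) \<omega>)) A \<partial>P x)"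
    and sets_\<mu>: "sets \<mu> = sets borel"
    and \<mu>_sigma_finite: "sigma_finite_measure \<mu>"
    and \<mu>_invariant: "\<And>t A. 0 \<le> t \<Longrightarrow> A \<in> sets borel \<Longrightarrow>
        (\<integral>\<^sup>+x. emeasure (trans_kernel P X t x) A \<partial>\<mu>) = emeasure \<mu> A"
    and harris: "\<And>A x. A \<in> sets borel \<Longrightarrow> 0 < emeasure \<mu> A \<Longrightarrow>
        AE \<omega> in P x. Limsup at_top (\<lambda>t. indicator A (X t \<omega>) :: ereal) = 1"
    and sets_\<Lambda>: "sets \<Lambda> = sets borel"
    and \<Lambda>_sigma_finite: "sigma_finite_measure \<Lambda>"
    and p_nonneg: "\<And>t x y. 0 < t \<Longrightarrow> 0 \<le> p t x y"
    and p_measurable: "(\<lambda>(t, x, y). p t x y) \<in>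
        restrict_space borel {0<..} \<Otimes>\<^sub>M borel \<Otimes>\<^sub>M borel \<rightarrow>\<^sub>M borel"
    and p_density: "\<And>t x. 0 < t \<Longrightarrow> trans_kernel P X t x = density \<Lambda> (\<lambda>y. ennreal (p t x y))"

definition positive_recurrent :: "'e measure \<Rightarrow> bool"
  where "positive_recurrent \<mu> \<longleftrightarrow> emeasure \<mu> (space \<mu>) < \<infinity>"

definition null_recurrent :: "'e measure \<Rightarrow> bool"
  where "null_recurrent \<mu> \<longleftrightarrow> emeasure \<mu> (space \<mu>) = \<infinity>"

definition special_nonneg ::
  "('e::polish_space \<Rightarrow> 'w measure) \<Rightarrow> (real \<Rightarrow> 'w \<Rightarrow> 'e) \<Rightarrow> 'e measure \<Rightarrow> ('e \<Rightarrow> real) \<Rightarrow> bool"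
  where "special_nonneg P X \<mu> f \<longleftrightarrow>
    f \<in> borel_measurable borel \<and> (\<forall>x. 0 \<le> f x) \<and>
    (\<forall>h :: 'e \<Rightarrow> real. h \<in> borel_measurable borel \<and> (\<forall>x. 0 \<le> h x) \<and> bounded (range h) \<and>
        0 < (\<integral>\<^sup>+x. ennreal (h x) \<partial>\<mu>) \<longrightarrow>
      (\<exists>c :: real. \<forall>x.
        (\<integral>\<^sup>+\<omega>. (\<integral>\<^sup>+t\<in>{0..}. ennreal (exp (- (LINT s:{0..t}|lborel. h (X s \<omega>))) * f (X t \<omega>)) \<partial>lborel) \<partial>P x)
          \<le> ennreal c))"

definition special ::
  "('e::polish_space \<Rightarrow> 'w measure) \<Rightarrow> (real \<Rightarrow> 'w \<Rightarrow> 'e) \<Rightarrow> 'e measure \<Rightarrow> ('e \<Rightarrow> real) \<Rightarrow> bool"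
  where "special P X \<mu> f \<longleftrightarrow>
    f \<in> borel_measurable borel \<and> special_nonneg P X \<mu> (\<lambda>x. \<bar>f x\<bar>)"

section \<open>Nummelin splitting\<close>

text \<open>The second coordinate \<open>u\<close> ranges over \<open>[0,1]\<close>.\<close>

definition split_kernel ::
  "('e::polish_space \<Rightarrow> 'w measure) \<Rightarrow> (real \<Rightarrow> 'w \<Rightarrow> 'e) \<Rightarrow> real \<Rightarrow> 'e set \<Rightarrow> 'e measure \<Rightarrow>
    'e \<Rightarrow> real \<Rightarrow> 'e measure"
  where "split_kernel P X a C \<nu> x u =
    (if x \<in> C \<and> u \<le> a then \<nu>
     else if x \<in> C then scale_measure (ennreal (1 / (1 - a)))
       (diff_measure (resolvent_kernel P X x) (scale_measure (ennreal a) \<nu>))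
     else resolvent_kernel P X x)"

text \<open>
  Density at \<open>t\<close> of the waiting time \<open>\<sigma>\<close> given \<open>(x, x')\<close>, with the conventions \<open>0/0 = b/\<infinity> = 1\<close>
  applied to the quotient \<open>p\<^sub>t(x,x') / u\<^sup>1(x,x')\<close>.
\<close>

definition waiting_density :: "(real \<Rightarrow> 'e \<Rightarrow> 'e \<Rightarrow> real) \<Rightarrow> 'e \<Rightarrow> 'e \<Rightarrow> real \<Rightarrow> ennreal"
  where "waiting_density p x x' t = ennreal (exp (- t)) *
    (if resolvent_density p x x' = \<infinity> \<or> (resolvent_density p x x' = 0 \<and> p t x x' = 0) then 1
     else ennreal (p t x x') / resolvent_density p x x')"

text \<open>
  \<open>bridge_step \<Lambda> p x0 r y t x'\<close> is the law, \<open>r\<close> units of time later, of the bridge that is now in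
  \<open>y\<close> and has to be in \<open>x'\<close> after \<open>t > r\<close> units of time.
\<close>

definition bridge_step :: "'e::polish_space measure \<Rightarrow> (real \<Rightarrow> 'e \<Rightarrow> 'e \<Rightarrow> real) \<Rightarrow> 'e \<Rightarrow>
    real \<Rightarrow> 'e \<Rightarrow> real \<Rightarrow> 'e \<Rightarrow> 'e measure"
  where "bridge_step \<Lambda> p x0 r y t x' =
    (if p t y x' = 0 then return borel x0
     else density \<Lambda> (\<lambda>y'. ennreal (p r y y' * p (t - r) y' x' / p t y x')))"

text \<open>
  Finite-dimensional distributions of that bridge: in \<open>[(r\<^sub>1,A\<^sub>1),\<dots>,(r\<^sub>k,A\<^sub>k)]\<close> the \<open>r\<^sub>i\<close> are
  successive time increments, and \<open>A\<^sub>i\<close> is to be hit at time \<open>r\<^sub>1 + \<dots> + r\<^sub>i < t\<close>.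
\<close>

primrec bridge_fdd :: "'e::polish_space measure \<Rightarrow> (real \<Rightarrow> 'e \<Rightarrow> 'e \<Rightarrow> real) \<Rightarrow> 'e \<Rightarrow>
    (real \<times> 'e set) list \<Rightarrow> 'e \<Rightarrow> real \<Rightarrow> 'e \<Rightarrow> ennreal"
  where
    "bridge_fdd \<Lambda> p x0 [] y t x' = 1"
  | "bridge_fdd \<Lambda> p x0 (rA # l) y t x' =
      (\<integral>\<^sup>+y'\<in>snd rA. bridge_fdd \<Lambda> p x0 l y' (t - fst rA) x' \<partial>bridge_step \<Lambda> p x0 (fst rA) y t x')"

type_synonym ('v, 'e) split_process = "real \<Rightarrow> 'v \<Rightarrow> 'e \<times> real \<times> 'e"

abbreviation Z1 :: "('v, 'e) split_process \<Rightarrow> real \<Rightarrow> 'v \<Rightarrow> 'e"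
  where "Z1 Z t \<omega> \<equiv> fst (Z t \<omega>)"

abbreviation Z2 :: "('v, 'e) split_process \<Rightarrow> real \<Rightarrow> 'v \<Rightarrow> real"
  where "Z2 Z t \<omega> \<equiv> fst (snd (Z t \<omega>))"

abbreviation Z3 :: "('v, 'e) split_process \<Rightarrow> real \<Rightarrow> 'v \<Rightarrow> 'e"
  where "Z3 Z t \<omega> \<equiv> snd (snd (Z t \<omega>))"

text \<open>
  \<open>past_before\<close> contains \<open>Z\<^sup>1\<close> up to and including time \<open>T\<^sub>n\<close>, the jump times up to \<open>T\<^sub>n\<close>, and
  \<open>Z\<^sup>2, Z\<^sup>3\<close> before \<open>T\<^sub>n\<close>; \<open>past_at\<close> contains in addition \<open>Z\<^sup>2, Z\<^sup>3\<close> at time \<open>T\<^sub>n\<close>.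
\<close>

definition past_before :: "'v measure \<Rightarrow> ('v, 'e::polish_space) split_process \<Rightarrow> (nat \<Rightarrow> 'v \<Rightarrow> real) \<Rightarrow>
    nat \<Rightarrow> 'v measure"
  where "past_before Om' Z T n = sigma (space Om')
    ({T k -` B \<inter> space Om' |k B. k \<le> n \<and> B \<in> sets borel} \<union>
     {(\<lambda>\<omega>. Z1 Z (min s (T n \<omega>)) \<omega>) -` A \<inter> space Om' |s A. 0 \<le> s \<and> A \<in> sets borel} \<union>
     {(\<lambda>\<omega>. Z (T k \<omega>) \<omega>) -` D \<inter> space Om' |k D. k < n \<and> D \<in> sets (borel \<Otimes>\<^sub>M borel \<Otimes>\<^sub>M borel)})"

definition past_at :: "'v measure \<Rightarrow> ('v, 'e::polish_space) split_process \<Rightarrow> (nat \<Rightarrow> 'v \<Rightarrow> real) \<Rightarrow>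
    nat \<Rightarrow> 'v measure"
  where "past_at Om' Z T n = sigma (space Om')
    (sets (past_before Om' Z T n) \<union>
     {(\<lambda>\<omega>. Z (T n \<omega>) \<omega>) -` D \<inter> space Om' |D. D \<in> sets (borel \<Otimes>\<^sub>M borel \<Otimes>\<^sub>M borel)})"

text \<open>
  \<open>next_S C a Z T \<omega> (R\<^sub>n)\<close> is \<open>S\<close> with index \<open>n + 1\<close>, and \<open>regen_time C a Z T n\<close> is \<open>R\<^sub>n\<close>; both are
  \<open>\<infinity>\<close> where the set of admissible jump times is empty.
\<close>

definition next_S :: "'e set \<Rightarrow> real \<Rightarrow> ('v, 'e) split_process \<Rightarrow> (nat \<Rightarrow> 'v \<Rightarrow> real) \<Rightarrow>
    'v \<Rightarrow> ennreal \<Rightarrow> ennreal"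
  where "next_S C a Z T \<omega> r =
    Inf {ennreal (T k \<omega>) |k. r < ennreal (T k \<omega>) \<and> Z (T k \<omega>) \<omega> \<in> C \<times> {0..a} \<times> UNIV}"

primrec regen_time :: "'e set \<Rightarrow> real \<Rightarrow> ('v, 'e) split_process \<Rightarrow> (nat \<Rightarrow> 'v \<Rightarrow> real) \<Rightarrow>
    nat \<Rightarrow> 'v \<Rightarrow> ennreal"
  where
    "regen_time C a Z T 0 \<omega> = 0"
  | "regen_time C a Z T (Suc n) \<omega> =
      Inf {ennreal (T k \<omega>) |k. next_S C a Z T \<omega> (regen_time C a Z T n \<omega>) < ennreal (T k \<omega>)}"

definition regen_count :: "'e set \<Rightarrow> real \<Rightarrow> ('v, 'e) split_process \<Rightarrow> (nat \<Rightarrow> 'v \<Rightarrow> real) \<Rightarrow>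
    real \<Rightarrow> 'v \<Rightarrow> ennreal"
  where "regen_count C a Z T t \<omega> = (SUP n\<in>{n. regen_time C a Z T n \<omega> \<le> ennreal t}. of_nat n)"

text \<open>
  \<open>Om'\<close> with the laws \<open>PP \<pi>\<close> is an extension, through the projection \<open>\<phi>\<close>, of \<open>Om\<close> with the laws
  started from \<open>\<pi>\<close>, and \<open>X\<close> is identified with \<open>Z\<^sup>1\<close>. The conditional laws in the construction of
  \<open>Z\<close> are stated in integrated form.
\<close>

locale nummelin_splitting = harris_process Om P X \<mu> \<Lambda> p
  for Om :: "'w measure"
    and P :: "'e::polish_space \<Rightarrow> 'w measure"
    and X :: "real \<Rightarrow> 'w \<Rightarrow> 'e"
    and \<mu> \<Lambda> :: "'e measure"
    and p :: "real \<Rightarrow> 'e \<Rightarrow> 'e \<Rightarrow> real" +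
  fixes a :: real
    and C :: "'e set"
    and \<nu> :: "'e measure"
    and x0 :: 'e
    and Om' :: "'v measure"
    and PP :: "'e measure \<Rightarrow> 'v measure"
    and \<phi> :: "'v \<Rightarrow> 'w"
    and Z :: "('v, 'e) split_process"
    and T :: "nat \<Rightarrow> 'v \<Rightarrow> real"
  assumes a_bounds: "0 < a" "a < 1"
    and C_measurable: "C \<in> sets borel"
    and C_positive: "0 < emeasure \<mu> C"
    and \<nu>_prob: "\<nu> \<in> space (prob_algebra borel)"
    and \<nu>_equivalent: "\<And>A. A \<in> sets borel \<Longrightarrow> emeasure \<nu> A = 0 \<longleftrightarrow> emeasure \<mu> (A \<inter> C) = 0"
    and minorization: "\<And>x A. A \<in> sets borel \<Longrightarrow>
        ennreal a * indicator C x * emeasure \<nu> A \<le> emeasure (resolvent_kernel P X x) A"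
    and PP_prob: "\<And>\<pi>. \<pi> \<in> space (prob_algebra borel) \<Longrightarrow> PP \<pi> \<in> space (prob_algebra Om')"
    and extension_measurable: "\<phi> \<in> Om' \<rightarrow>\<^sub>M Om"
    and extension_law: "\<And>\<pi>. \<pi> \<in> space (prob_algebra borel) \<Longrightarrow>
        distr (PP \<pi>) Om \<phi> = law_from P \<pi>"
    and Z1_is_X: "\<And>\<omega> t. \<omega> \<in> space Om' \<Longrightarrow> 0 \<le> t \<Longrightarrow> Z1 Z t \<omega> = X t (\<phi> \<omega>)"
    and Z_measurable: "\<And>t. 0 \<le> t \<Longrightarrow> Z t \<in> Om' \<rightarrow>\<^sub>M borel \<Otimes>\<^sub>M borel \<Otimes>\<^sub>M borel"
    and Z2_range: "\<And>\<omega> t. \<omega> \<in> space Om' \<Longrightarrow> 0 \<le> t \<Longrightarrow> Z2 Z t \<omega> \<in> {0..1}"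
    and T_measurable: "\<And>n. T n \<in> Om' \<rightarrow>\<^sub>M borel"
    and T_0: "\<And>\<omega>. \<omega> \<in> space Om' \<Longrightarrow> T 0 \<omega> = 0"
    and T_increasing: "\<And>\<omega> n. \<omega> \<in> space Om' \<Longrightarrow> T n \<omega> < T (Suc n) \<omega>"
    and initial_law: "\<And>\<pi>. \<pi> \<in> space (prob_algebra borel) \<Longrightarrow> distr (PP \<pi>) borel (Z1 Z 0) = \<pi>"
    and split_law: "\<And>\<pi> n G B D. \<pi> \<in> space (prob_algebra borel) \<Longrightarrow>
        G \<in> sets (past_before Om' Z T n) \<Longrightarrow> B \<in> sets borel \<Longrightarrow> D \<in> sets borel \<Longrightarrow>
        emeasure (PP \<pi>) {\<omega> \<in> G. Z2 Z (T n \<omega>) \<omega> \<in> B \<and> Z3 Z (T n \<omega>) \<omega> \<in> D} =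
        (\<integral>\<^sup>+\<omega>\<in>G. (\<integral>\<^sup>+u\<in>B. emeasure (split_kernel P X a C \<nu> (Z1 Z (T n \<omega>) \<omega>) u) D
          \<partial>uniform_measure lborel {0..1}) \<partial>PP \<pi>)"
    and bridge_law: "\<And>\<pi> n G B l. \<pi> \<in> space (prob_algebra borel) \<Longrightarrow>
        G \<in> sets (past_at Om' Z T n) \<Longrightarrow> B \<in> sets borel \<Longrightarrow>
        (\<And>r A. (r, A) \<in> set l \<Longrightarrow> 0 < r \<and> A \<in> sets borel) \<Longrightarrow>
        emeasure (PP \<pi>) {\<omega> \<in> G. T (Suc n) \<omega> - T n \<omega> \<in> B \<and>
          sum_list (map fst l) < T (Suc n) \<omega> - T n \<omega> \<and>
          (\<forall>j < length l. Z1 Z (T n \<omega> + sum_list (map fst (take (Suc j) l))) \<omega> \<in> snd (l ! j))} =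
        (\<integral>\<^sup>+\<omega>\<in>G. (\<integral>\<^sup>+t\<in>B \<inter> {sum_list (map fst l)<..}.
            waiting_density p (Z1 Z (T n \<omega>) \<omega>) (Z3 Z (T n \<omega>) \<omega>) t *
            bridge_fdd \<Lambda> p x0 l (Z1 Z (T n \<omega>) \<omega>) t (Z3 Z (T n \<omega>) \<omega>) \<partial>lborel) \<partial>PP \<pi>)"
    and Z23_constant: "\<And>\<omega> n s. \<omega> \<in> space Om' \<Longrightarrow> T n \<omega> \<le> s \<Longrightarrow> s < T (Suc n) \<omega> \<Longrightarrow>
        snd (Z s \<omega>) = snd (Z (T n \<omega>) \<omega>)"
    and Z1_jump: "\<And>\<omega> n. \<omega> \<in> space Om' \<Longrightarrow> Z1 Z (T (Suc n) \<omega>) \<omega> = Z3 Z (T n \<omega>) \<omega>"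
    and \<mu>_normalized: "\<And>\<pi> g. \<pi> \<in> space (prob_algebra borel) \<Longrightarrow> g \<in> borel_measurable borel \<Longrightarrow>
        (\<integral>\<^sup>+x. (g x :: ennreal) \<partial>\<mu>) =
        (\<integral>\<^sup>+\<omega>. (\<integral>\<^sup>+s\<in>{s. 0 \<le> s \<and> regen_time C a Z T 1 \<omega> \<le> ennreal s \<and> ennreal s < regen_time C a Z T 2 \<omega>}.
            g (Z1 Z s \<omega>) \<partial>lborel) \<partial>PP \<pi>)"

section \<open>Constants in the deviation bounds\<close>

text \<open>
  The law of \<open>R\<^sub>2 - R\<^sub>1\<close> is the same for all initial measures; expectations without index are taken
  under the initial measure \<open>\<nu>\<close>.
\<close>

definition cycle_length :: "'e set \<Rightarrow> real \<Rightarrow> ('v, 'e) split_process \<Rightarrow> (nat \<Rightarrow> 'v \<Rightarrow> real) \<Rightarrow> 'v \<Rightarrow> ennreal"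
  where "cycle_length C a Z T \<omega> = regen_time C a Z T 2 \<omega> - regen_time C a Z T 1 \<omega>"

definition cycle_mean :: "'e set \<Rightarrow> real \<Rightarrow> 'e measure \<Rightarrow> ('e measure \<Rightarrow> 'v measure) \<Rightarrow>
    ('v, 'e) split_process \<Rightarrow> (nat \<Rightarrow> 'v \<Rightarrow> real) \<Rightarrow> real"
  where "cycle_mean C a \<nu> PP Z T = enn2real (\<integral>\<^sup>+\<omega>. cycle_length C a Z T \<omega> \<partial>PP \<nu>)"

definition cycle_laplace :: "'e set \<Rightarrow> real \<Rightarrow> 'e measure \<Rightarrow> ('e measure \<Rightarrow> 'v measure) \<Rightarrow>
    ('v, 'e) split_process \<Rightarrow> (nat \<Rightarrow> 'v \<Rightarrow> real) \<Rightarrow> real \<Rightarrow> real"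
  where "cycle_laplace C a \<nu> PP Z T l =
    (LINT \<omega>|PP \<nu>. exp (- l * enn2real (cycle_length C a Z T \<omega>)))"

definition cycle_rate :: "'e set \<Rightarrow> real \<Rightarrow> 'e measure \<Rightarrow> ('e measure \<Rightarrow> 'v measure) \<Rightarrow>
    ('v, 'e) split_process \<Rightarrow> (nat \<Rightarrow> 'v \<Rightarrow> real) \<Rightarrow> real \<Rightarrow> ereal"
  where "cycle_rate C a \<nu> PP Z T u =
    (SUP l\<in>{0<..}. ereal (- l * u - ln (cycle_laplace C a \<nu> PP Z T l)))"

definition v_star :: "'e set \<Rightarrow> real \<Rightarrow> 'e measure \<Rightarrow> ('e measure \<Rightarrow> 'v measure) \<Rightarrow>
    ('v, 'e) split_process \<Rightarrow> (nat \<Rightarrow> 'v \<Rightarrow> real) \<Rightarrow> real \<Rightarrow> real"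
  where "v_star C a \<nu> PP Z T t = enn2real (\<integral>\<^sup>+\<omega>. regen_count C a Z T t \<omega> \<partial>PP \<nu>) + 1"

definition C_const :: "'e::polish_space set \<Rightarrow> real \<Rightarrow> ('e measure \<Rightarrow> 'v measure) \<Rightarrow>
    ('v, 'e) split_process \<Rightarrow> (nat \<Rightarrow> 'v \<Rightarrow> real) \<Rightarrow> ('e \<Rightarrow> real) \<Rightarrow> ennreal"
  where "C_const C a PP Z T f =
    (SUP x. \<integral>\<^sup>+\<omega>. (\<integral>\<^sup>+s\<in>{s. 0 \<le> s \<and> ennreal s < regen_time C a Z T 1 \<omega>}.
        ennreal \<bar>f (Z1 Z s \<omega>)\<bar> \<partial>lborel) \<partial>PP (return borel x))"

definition K_const :: "'e::polish_space set \<Rightarrow> real \<Rightarrow> ('e measure \<Rightarrow> 'v measure) \<Rightarrow>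
    ('v, 'e) split_process \<Rightarrow> (nat \<Rightarrow> 'v \<Rightarrow> real) \<Rightarrow> ('e \<Rightarrow> real) \<Rightarrow> ereal"
  where "K_const C a PP Z T f = (SUP x. ereal \<bar>f x\<bar>) + enn2ereal (C_const C a PP Z T f)"

definition B_const :: "'e::polish_space set \<Rightarrow> real \<Rightarrow> ('e measure \<Rightarrow> 'v measure) \<Rightarrow>
    ('v, 'e) split_process \<Rightarrow> (nat \<Rightarrow> 'v \<Rightarrow> real) \<Rightarrow> ('e \<Rightarrow> real) \<Rightarrow> ereal"
  where "B_const C a PP Z T f = max ((K_const C a PP Z T f)\<^sup>2) (K_const C a PP Z T f)"

text \<open>
  The bounds involve \<open>\<Lambda>\<^sup>*(2m/3)\<close>, which may be \<open>\<infinity>\<close>, and quotients by \<open>K(f)\<close> and \<open>B(f)\<close>, which are \<open>0\<close>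
  for \<open>f = 0\<close>; hence the exponential on the extended reals.
\<close>

definition eexp :: "ereal \<Rightarrow> ennreal"
  where "eexp z = (if z = \<infinity> then \<infinity> else if z = - \<infinity> then 0 else ennreal (exp (real_of_ereal z)))"

end

(* Let W n be the value of Z at T n together with the waiting time T (n+1) - T n. Given the past before
   T n, the sequence W n, W (n+1), ... has the law of the whole sequence started at X (T n), and after a
   visit to C x [0,a] x E it has the law of the sequence started from nu. This regeneration cuts the path
   into cycles; consecutive cycles share the point at which the first one ends, so that only cycles whose
   indices have the same parity are treated as independent, and the odd and the even cycles are estimated
   separately.

   The integral of |f| up to the next regeneration has conditional expectation at most C(f) at every T n,
   and single increments have an exponential moment bound in terms of sup |f|; an expansion in the manner
   of Khas'minskii then bounds the exponential moments of the integral over a cycle, the centering mu(f) = 0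
   removes the linear term, and a maximal inequality of Bernstein type follows for the sums over the odd and
   the even cycles. The incomplete cycles at time 0 and at time t contribute the middle term of the
   bounds, and the last term bounds the probability of too many regenerations before t: by a Chernoff
   bound with the Laplace transform of the cycle length if X is positive recurrent, and by Markov's
   inequality for N(t) applied to independent blocks of cycles if it is null-recurrent. *)

theory Submission
  imports Defs
begin

text \<open>A hit at \<open>T j\<close> gives \<open>X\<close> at \<open>T (j+1)\<close> the law
  \<open>\<nu>\<close>, independently of the past before \<open>T j\<close>, but not of the path on
  \<open>[T j, T (j+1))\<close>, which is a bridge to that very point. A cycle can therefore be
  estimated only against events known before the hit, which excludes the last interval of its
  predecessor; hence the parity classes and the skipped cycles between blocks. Conditional laws
  appear as identities of integrals over events of the past.

  The exponential moment of one increment is delicate, since a waiting time and the path on it are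
  dependent. By memorylessness the residual waiting time is exponential and independent of the
  current position, so weights of the residual time factor out.

  A threshold c is divided into 29/100 for each parity class and 21/100 for each end. At
  \<open>t\<close> the part of the cycle after \<open>t\<close> is estimated, because it is
  controlled given the past of \<open>t\<close>. The parameter 50/(63 K) turns 21/100 of c into the
  exponent c/(6 K), and 42 times the square of 29/100 just exceeds 3.53, the coefficient collected
  in Bernstein's denominator.\<close>

section \<open>Sampling right-continuous paths at random times\<close>

text \<open>Countably valued times strictly above \<open>\<tau>\<close> converge to
  \<open>\<tau>\<close>, so a right limit at the sampled time itself is enough; nothing is asked of
  the rest of the path.\<close>

lemma borel_measurable_right_limit_sample:
  fixes X :: "real \<Rightarrow> 'a \<Rightarrow> 'b::metric_space"
  assumes X: "\<And>t. 0 \<le> t \<Longrightarrow> X t \<in> M \<rightarrow>\<^sub>M borel"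
    and \<tau>: "\<tau> \<in> M \<rightarrow>\<^sub>M borel" "\<And>w. w \<in> space M \<Longrightarrow> 0 \<le> \<tau> w"
    and lim: "\<And>w. w \<in> space M \<Longrightarrow> ((\<lambda>s. X s w) \<longlongrightarrow> X (\<tau> w) w) (at_right (\<tau> w))"
  shows "(\<lambda>w. X (\<tau> w) w) \<in> M \<rightarrow>\<^sub>M borel"
proof -
  \<comment> \<open>Rounding down and then adding 1 keeps the approximation strictly above
    \<open>t\<close> even at grid points, as \<open>at_right\<close> requires.\<close>
  define q where "q n t = (real_of_int \<lfloor>t * real (Suc n)\<rfloor> + 1) / real (Suc n)" for n t
  have meas: "(\<lambda>w. X (max 0 (q n (\<tau> w))) w) \<in> M \<rightarrow>\<^sub>M borel" for n
  proof -
    note \<tau>(1)[measurable]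
    have "(\<lambda>w. (\<lambda>i w. X (max 0 ((real_of_int i + 1) / real (Suc n))) w) \<lfloor>\<tau> w * real (Suc n)\<rfloor> w) \<in> M \<rightarrow>\<^sub>M borel"
      by (rule measurable_compose_countable) (auto intro!: X simp del: of_nat_Suc)
    then show ?thesis by (simp add: q_def)
  qed
  show ?thesis
  proof (rule borel_measurable_LIMSEQ_metric[OF meas])
    fix w assume w: "w \<in> space M"
    let ?t = "\<tau> w"
    have gt: "?t < q n ?t" for n
    proof -
      have "?t * real (Suc n) < real_of_int \<lfloor>?t * real (Suc n)\<rfloor> + 1" by linarith
      then show ?thesis by (simp add: q_def less_divide_eq del: of_nat_Suc)
    qed
    have le: "q n ?t \<le> ?t + 1 / real (Suc n)" for n
    proof -
      have "real_of_int \<lfloor>?t * real (Suc n)\<rfloor> + 1 \<le> ?t * real (Suc n) + 1" by linarith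
      then have "q n ?t \<le> (?t * real (Suc n) + 1) / real (Suc n)"
        unfolding q_def by (intro divide_right_mono) auto
      also have "\<dots> = ?t + 1 / real (Suc n)" by (simp add: add_divide_distrib del: of_nat_Suc)
      finally show ?thesis .
    qed
    have "(\<lambda>n. ?t + 1 / real (Suc n)) \<longlonglongrightarrow> ?t + 0"
      by (intro tendsto_add tendsto_const LIMSEQ_Suc[OF lim_1_over_n])
    then have "(\<lambda>n. q n ?t) \<longlonglongrightarrow> ?t"
      by (intro tendsto_sandwich[of "\<lambda>_. ?t" "\<lambda>n. q n ?t" _ "\<lambda>n. ?t + 1 / real (Suc n)"])
        (use gt le in \<open>auto intro!: always_eventually less_imp_le\<close>)
    then have "filterlim (\<lambda>n. q n ?t) (at_right ?t) sequentially"
      using gt by (auto simp: filterlim_at less_imp_neq[THEN not_sym] intro!: always_eventually)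
    from filterlim_compose[OF lim[OF w] this]
    have "(\<lambda>n. X (q n ?t) w) \<longlonglongrightarrow> X ?t w" .
    \<comment> \<open>The maximum only kept the grid times in the range where \<open>X\<close> is
      known to be measurable.\<close>
    moreover have "max 0 (q n ?t) = q n ?t" for n
      using gt[of n] \<tau>(2)[OF w] by (auto simp: max_def)
    ultimately show "(\<lambda>n. X (max 0 (q n ?t)) w) \<longlonglongrightarrow> X ?t w" by simp
  qed
qed

text \<open>The sampling lemma on the product space, with the time coordinate as the random time;
  \<open>max 0\<close> extends the process to negative times, about which nothing is known.\<close>

lemma right_continuous_measurable_pair:
  fixes X :: "real \<Rightarrow> 'a \<Rightarrow> 'b::metric_space"
  assumes X: "\<And>t. 0 \<le> t \<Longrightarrow> X t \<in> M \<rightarrow>\<^sub>M borel"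
    and rc: "\<And>w t. w \<in> space M \<Longrightarrow> 0 \<le> t \<Longrightarrow> ((\<lambda>s. X s w) \<longlongrightarrow> X t w) (at_right t)"
  shows "(\<lambda>z. X (max 0 (fst z)) (snd z)) \<in> borel \<Otimes>\<^sub>M M \<rightarrow>\<^sub>M borel"
  by (rule borel_measurable_right_limit_sample[where X = "\<lambda>t z. X t (snd z)" and \<tau> = "\<lambda>z. max 0 (fst z)"])
    (auto simp: space_pair_measure intro!: rc measurable_compose[OF measurable_snd X])

context harris_process
begin

lemma X_measurable_pair: "(\<lambda>z. X (max 0 (fst z)) (snd z)) \<in> borel \<Otimes>\<^sub>M Om \<rightarrow>\<^sub>M borel"
  by (rule right_continuous_measurable_pair[OF X_measurable X_right_continuous])

end

section \<open>The past before a jump time\<close>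

context nummelin_splitting
begin

abbreviation Y :: "nat \<Rightarrow> 'v \<Rightarrow> 'e" where "Y n w \<equiv> Z1 Z (T n w) w"
abbreviation F :: "nat \<Rightarrow> 'v measure" where "F n \<equiv> past_before Om' Z T n"
abbreviation wait :: "nat \<Rightarrow> 'v \<Rightarrow> real" where "wait n w \<equiv> T (Suc n) w - T n w"
abbreviation inits :: "'e measure set" where "inits \<equiv> space (prob_algebra borel)"
abbreviation SZ :: "('e \<times> real \<times> 'e) measure" where "SZ \<equiv> borel \<Otimes>\<^sub>M borel \<Otimes>\<^sub>M borel"

lemma T_less: "w \<in> space Om' \<Longrightarrow> i < j \<Longrightarrow> T i w < T j w"
  by (rule lift_Suc_mono_less[of "\<lambda>n. T n w"]) (auto intro: T_increasing)

lemma T_le: "w \<in> space Om' \<Longrightarrow> i \<le> j \<Longrightarrow> T i w \<le> T j w"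
  using T_less[of w i j] by (cases "i = j") auto

lemma T_nonneg: "w \<in> space Om' \<Longrightarrow> 0 \<le> T n w"
  using T_le[of w 0 n] T_0[of w] by simp

lemma Z1_right_continuous:
  assumes w: "w \<in> space Om'" and t: "0 \<le> t"
  shows "((\<lambda>s. Z1 Z s w) \<longlongrightarrow> Z1 Z t w) (at_right t)"
proof -
  have "\<phi> w \<in> space Om" using measurable_space[OF extension_measurable w] .
  from X_right_continuous[OF this t] have "((\<lambda>s. X s (\<phi> w)) \<longlongrightarrow> Z1 Z t w) (at_right t)"
    by (simp add: Z1_is_X[OF w t])
  then show ?thesis
    by (rule Lim_transform_eventually)
      (use t in \<open>auto simp: eventually_at_filter Z1_is_X[OF w]\<close>)
qed

lemma Z1_measurable: "0 \<le> t \<Longrightarrow> Z1 Z t \<in> Om' \<rightarrow>\<^sub>M borel"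
  by (rule measurable_compose[OF Z_measurable measurable_fst])

lemma Z1_measurable_pair: "(\<lambda>z. Z1 Z (max 0 (fst z)) (snd z)) \<in> borel \<Otimes>\<^sub>M Om' \<rightarrow>\<^sub>M borel"
  by (rule right_continuous_measurable_pair[OF Z1_measurable Z1_right_continuous])

lemma Z1_sample_measurable:
  assumes [measurable]: "\<tau> \<in> Om' \<rightarrow>\<^sub>M borel" and "\<And>w. w \<in> space Om' \<Longrightarrow> 0 \<le> \<tau> w"
  shows "(\<lambda>w. Z1 Z (\<tau> w) w) \<in> Om' \<rightarrow>\<^sub>M borel"
  by (rule borel_measurable_right_limit_sample[OF Z1_measurable])
    (use assms in \<open>auto intro!: Z1_right_continuous\<close>)

text \<open>\<open>Z2\<close> and \<open>Z3\<close> are constant on \<open>[T n, T (n+1))\<close>,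
  so \<open>Z\<close> is right-continuous at the jump times, which is all that sampling
  requires.\<close>

lemma Z_T_measurable: "(\<lambda>w. Z (T n w) w) \<in> Om' \<rightarrow>\<^sub>M SZ"
proof -
  have "(\<lambda>w. Z (T n w) w) \<in> Om' \<rightarrow>\<^sub>M borel"
  proof (rule borel_measurable_right_limit_sample[OF _ T_measurable T_nonneg])
    fix t :: real assume "0 \<le> t"
    then show "Z t \<in> Om' \<rightarrow>\<^sub>M borel" using Z_measurable[of t] by (simp add: borel_prod)
  next
    fix w assume w: "w \<in> space Om'"
    have "((\<lambda>s. snd (Z s w)) \<longlongrightarrow> snd (Z (T n w) w)) (at_right (T n w))"
      by (rule tendsto_eventually)
        (use T_increasing[OF w, of n] in \<open>auto simp: eventually_at_right intro!: exI[of _ "T (Suc n) w"] Z23_constant[OF w]\<close>)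
    from tendsto_Pair[OF Z1_right_continuous[OF w T_nonneg[OF w]] this]
    show "((\<lambda>s. Z s w) \<longlongrightarrow> Z (T n w) w) (at_right (T n w))" by simp
  qed
  then show ?thesis by (simp add: borel_prod)
qed

lemma Z1_stopped_measurable:
  "(\<lambda>w. Z1 Z (min s (T n w)) w) \<in> Om' \<rightarrow>\<^sub>M borel" if "0 \<le> s"
  using T_measurable[of n] by (intro Z1_sample_measurable) (auto simp: that T_nonneg)

definition past_gen :: "nat \<Rightarrow> 'v set set" where "past_gen n =
    ({T k -` B \<inter> space Om' |k B. k \<le> n \<and> B \<in> sets borel} \<union>
     {(\<lambda>w. Z1 Z (min s (T n w)) w) -` A \<inter> space Om' |s A. 0 \<le> s \<and> A \<in> sets borel} \<union>
     {(\<lambda>w. Z (T k w) w) -` D \<inter> space Om' |k D. k < n \<and> D \<in> sets SZ})"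

lemma past_gen_sets: "past_gen n \<subseteq> sets Om'"
  using measurable_sets[OF T_measurable] measurable_sets[OF Z_T_measurable]
    measurable_sets[OF Z1_stopped_measurable, of _ _ n]
  unfolding past_gen_def by auto

lemma F_eq: "F n = sigma (space Om') (past_gen n)"
  by (simp add: past_before_def past_gen_def)

lemma past_gen_Pow: "past_gen n \<subseteq> Pow (space Om')"
  using past_gen_sets sets.sets_into_space by blast

lemma space_F[simp]: "space (F n) = space Om'"
  unfolding F_eq by (rule space_measure_of) (rule past_gen_Pow)

lemma sets_F: "sets (F n) = sigma_sets (space Om') (past_gen n)"
  unfolding F_eq by (rule sets_measure_of) (rule past_gen_Pow)

lemma F_subset_Om': "sets (F n) \<subseteq> sets Om'"
  unfolding sets_F by (rule sets.sigma_sets_subset) (rule past_gen_sets)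

lemma F_into_Om': "A \<in> sets (F n) \<Longrightarrow> A \<in> sets Om'"
  using F_subset_Om' by blast

lemma past_genI: "A \<in> past_gen n \<Longrightarrow> A \<in> sets (F n)"
  by (auto simp: sets_F)

lemma T_F: "k \<le> n \<Longrightarrow> T k \<in> F n \<rightarrow>\<^sub>M borel"
  by (rule measurableI) (auto intro!: past_genI simp: past_gen_def)

lemma Z_T_F: "k < n \<Longrightarrow> (\<lambda>w. Z (T k w) w) \<in> F n \<rightarrow>\<^sub>M SZ"
  by (rule measurableI)
    (use measurable_space[OF Z_T_measurable] in \<open>auto intro!: past_genI simp: past_gen_def\<close>)

lemma Z1_stopped_F: "0 \<le> s \<Longrightarrow> (\<lambda>w. Z1 Z (min s (T n w)) w) \<in> F n \<rightarrow>\<^sub>M borel"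
  by (rule measurableI, simp) (rule past_genI, unfold past_gen_def space_F, blast)

text \<open>The generator of \<open>F n\<close> contains the path stopped at \<open>T n\<close> only
  at deterministic times; this passes to random times. The map \<open>h\<close> lets
  \<open>N\<close> be a product with the time axis, as integrals over time demand.\<close>

lemma Z1_stopped_sample_F:
  assumes \<tau>[measurable]: "\<tau> \<in> N \<rightarrow>\<^sub>M borel" and \<tau>0: "\<And>z. z \<in> space N \<Longrightarrow> 0 \<le> \<tau> z" and h: "h \<in> N \<rightarrow>\<^sub>M F n"
  shows "(\<lambda>z. Z1 Z (min (\<tau> z) (T n (h z))) (h z)) \<in> N \<rightarrow>\<^sub>M borel"
proof (rule borel_measurable_right_limit_sample[where X = "\<lambda>s z. Z1 Z (min s (T n (h z))) (h z)", OF _ \<tau> \<tau>0])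
  fix t :: real assume "0 \<le> t"
  then show "(\<lambda>z. Z1 Z (min t (T n (h z))) (h z)) \<in> N \<rightarrow>\<^sub>M borel"
    using measurable_compose[OF h Z1_stopped_F] by simp
next
  fix z assume z: "z \<in> space N"
  have w: "h z \<in> space Om'" using measurable_space[OF h z] by simp
  show "((\<lambda>s. Z1 Z (min s (T n (h z))) (h z)) \<longlongrightarrow> Z1 Z (min (\<tau> z) (T n (h z))) (h z)) (at_right (\<tau> z))"
  proof (cases "\<tau> z < T n (h z)")
    case True
    then have "((\<lambda>s. Z1 Z s (h z)) \<longlongrightarrow> Z1 Z (min (\<tau> z) (T n (h z))) (h z)) (at_right (\<tau> z))"
      using Z1_right_continuous[OF w \<tau>0[OF z]] by simp
    then show ?thesis
      by (rule Lim_transform_eventually)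
        (use True in \<open>auto simp: eventually_at_right intro!: exI[of _ "T n (h z)"]\<close>)
  next
    case False
    show ?thesis
      by (rule tendsto_eventually) (use False in \<open>auto simp: eventually_at_filter min_def\<close>)
  qed
qed

lemma Y_F: "k \<le> n \<Longrightarrow> Y k \<in> F n \<rightarrow>\<^sub>M borel"
proof -
  assume k: "k \<le> n"
  have "(\<lambda>w. Z1 Z (min (T k w) (T n w)) w) \<in> F n \<rightarrow>\<^sub>M borel"
    by (rule Z1_stopped_sample_F[where h = "\<lambda>x. x"]) (use T_F[OF k] T_nonneg in auto)
  then show ?thesis
    by (rule measurable_cong[THEN iffD1, rotated]) (use T_le k in \<open>simp add: min_def\<close>)
qed

text \<open>The path stopped at \<open>T n\<close> is the path stopped at \<open>T (n+1)\<close>,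
  sampled at the random time \<open>min s (T n)\<close>.\<close>

lemma F_Suc: "sets (F n) \<subseteq> sets (F (Suc n))"
  unfolding sets_F[of n]
proof (rule sets.sigma_sets_subset[of "past_gen n" "F (Suc n)", simplified])
  have 1: "(\<lambda>w. Z1 Z (min s (T n w)) w) -` A \<inter> space Om' \<in> sets (F (Suc n))"
    if "0 \<le> s" "A \<in> sets borel" for s A
  proof -
    have "(\<lambda>w. Z1 Z (min (min s (T n w)) (T (Suc n) w)) w) \<in> F (Suc n) \<rightarrow>\<^sub>M borel"
      by (rule Z1_stopped_sample_F[where h = "\<lambda>x. x"])
        (use T_F[of n "Suc n"] T_nonneg that in auto)
    then have "(\<lambda>w. Z1 Z (min s (T n w)) w) \<in> F (Suc n) \<rightarrow>\<^sub>M borel"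
      by (rule measurable_cong[THEN iffD1, rotated])
        (use T_increasing in \<open>auto simp: min_def intro!: arg_cong[where f = "\<lambda>t. Z1 Z t _"] dest: less_imp_le order_trans\<close>)
    from measurable_sets[OF this that(2)] show ?thesis by simp
  qed
  have 2: "T k -` B \<inter> space Om' \<in> sets (F (Suc n))" if "k \<le> n" "B \<in> sets borel" for k B
    using measurable_sets[OF T_F[of k "Suc n"] that(2)] that by simp
  have 3: "(\<lambda>w. Z (T k w) w) -` D \<inter> space Om' \<in> sets (F (Suc n))" if "k < n" "D \<in> sets SZ" for k D
    using measurable_sets[OF Z_T_F[of k "Suc n"] that(2)] that by simp
  show "past_gen n \<subseteq> sets (F (Suc n))"
    using 1 2 3 unfolding past_gen_def by blast
qed

lemma F_mono: "i \<le> j \<Longrightarrow> sets (F i) \<subseteq> sets (F j)"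
  by (rule lift_Suc_mono_le[of "\<lambda>n. sets (F n)"]) (rule F_Suc)

lemma measurable_F_mono: "i \<le> j \<Longrightarrow> f \<in> F i \<rightarrow>\<^sub>M N \<Longrightarrow> f \<in> F j \<rightarrow>\<^sub>M N"
  using F_mono[of i j] by (auto simp: measurable_def)

lemma measurable_F_Om': "f \<in> F i \<rightarrow>\<^sub>M N \<Longrightarrow> f \<in> Om' \<rightarrow>\<^sub>M N"
  using F_subset_Om'[of i] by (auto simp: measurable_def)

lemma space_past_at[simp]: "space (past_at Om' Z T n) = space Om'"
  unfolding past_at_def
  by (rule space_measure_of) (use sets.sets_into_space[of _ "F n"] in auto)

lemma sets_past_at: "sets (past_at Om' Z T n) = sigma_sets (space Om') (sets (F n) \<union>
     {(\<lambda>w. Z (T n w) w) -` D \<inter> space Om' |D. D \<in> sets SZ})"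
  unfolding past_at_def
  by (rule sets_measure_of) (use sets.sets_into_space[of _ "F n"] in auto)

lemma F_past_at: "A \<in> sets (F n) \<Longrightarrow> A \<in> sets (past_at Om' Z T n)"
  by (auto simp: sets_past_at)

lemma Z_T_past_at: "D \<in> sets SZ \<Longrightarrow> {w\<in>space Om'. Z (T n w) w \<in> D} \<in> sets (past_at Om' Z T n)"
  unfolding sets_past_at by (rule sigma_sets.Basic) auto

lemma past_at_subset: "sets (past_at Om' Z T n) \<subseteq> sets (F (Suc n))"
  unfolding sets_past_at
  by (rule sets.sigma_sets_subset[of _ "F (Suc n)", simplified])
    (use F_Suc measurable_sets[OF Z_T_F[of n "Suc n"]] in auto)

definition occ :: "('e \<Rightarrow> ennreal) \<Rightarrow> nat \<Rightarrow> 'v \<Rightarrow> ennreal" where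
  "occ g n w = (\<integral>\<^sup>+s. indicator {T n w..<T (Suc n) w} s * g (Z1 Z s w) \<partial>lborel)"

text \<open>Up to \<open>T (n+1)\<close> the path agrees with the path stopped there, which belongs
  to \<open>F (n+1)\<close>; the integral is then measurable by Fubini's theorem.\<close>

lemma occ_F: assumes [measurable]: "g \<in> borel_measurable borel"
  shows "occ g n \<in> F (Suc n) \<rightarrow>\<^sub>M borel"
proof -
  note [measurable] = T_F[of n "Suc n", simplified] T_F[of "Suc n" "Suc n", simplified]
  have *: "(\<lambda>z. Z1 Z (min (max 0 (snd z)) (T (Suc n) (fst z))) (fst z)) \<in> F (Suc n) \<Otimes>\<^sub>M lborel \<rightarrow>\<^sub>M borel"
    by (rule Z1_stopped_sample_F) auto
  have [measurable]: "(\<lambda>z. g (Z1 Z (min (max 0 (snd z)) (T (Suc n) (fst z))) (fst z))) \<in> F (Suc n) \<Otimes>\<^sub>M lborel \<rightarrow>\<^sub>M borel"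
    by (rule measurable_compose[OF * assms])
  have 1: "(\<lambda>w. \<integral>\<^sup>+s. (if T n w \<le> s \<and> s < T (Suc n) w then 1 else 0) * g (Z1 Z (min (max 0 s) (T (Suc n) w)) w) \<partial>lborel)
     \<in> F (Suc n) \<rightarrow>\<^sub>M borel"
    by (rule lborel.borel_measurable_nn_integral) (simp add: split_beta')
  have 2: "(\<integral>\<^sup>+s. (if T n w \<le> s \<and> s < T (Suc n) w then 1 else 0) * g (Z1 Z (min (max 0 s) (T (Suc n) w)) w) \<partial>lborel)
     = occ g n w" if "w \<in> space (F (Suc n))" for w
    unfolding occ_def using T_nonneg[of w n] that
    by (intro nn_integral_cong) (auto simp: indicator_def max_def min_def)
  show ?thesis
    by (rule measurable_cong[THEN iffD1, OF _ 1]) (rule 2)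
qed

end

lemma nn_integral_le_of_subalgebra:
  assumes sub: "sets N \<subseteq> sets M" "space N = space M"
    and [measurable]: "a \<in> borel_measurable M" "b \<in> borel_measurable M"
    and le: "\<And>G. G \<in> sets N \<Longrightarrow> (\<integral>\<^sup>+w. indicator G w * a w \<partial>M) \<le> (\<integral>\<^sup>+w. indicator G w * b w \<partial>M)"
    and \<xi>: "\<xi> \<in> borel_measurable N"
  shows "(\<integral>\<^sup>+w. \<xi> w * a w \<partial>M) \<le> (\<integral>\<^sup>+w. \<xi> w * b w \<partial>M)"
proof -
  have id: "(\<lambda>x. x) \<in> M \<rightarrow>\<^sub>M N" using sub by (auto simp: measurable_def)
  have [measurable]: "\<xi> \<in> borel_measurable M" using measurable_compose[OF id \<xi>] by simp
  have int: "(\<integral>\<^sup>+w. \<xi> w * c w \<partial>M) = (\<integral>\<^sup>+w. \<xi> w \<partial>distr (density M c) N (\<lambda>x. x))"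
    if [measurable]: "c \<in> borel_measurable M" for c
  proof -
    have "(\<lambda>x. x) \<in> density M c \<rightarrow>\<^sub>M N" using id by simp
    then show ?thesis
      using \<xi> by (simp add: nn_integral_distr nn_integral_density mult.commute)
  qed
  have em: "emeasure (distr (density M c) N (\<lambda>x. x)) G = (\<integral>\<^sup>+w. indicator G w * c w \<partial>M)"
    if [measurable]: "c \<in> borel_measurable M" and G: "G \<in> sets N" for c G
  proof -
    have "(\<lambda>x. x) \<in> density M c \<rightarrow>\<^sub>M N" using id by simp
    moreover have "G \<inter> space M = G" "G \<in> sets M" using G sub sets.sets_into_space by blast+
    ultimately show ?thesis
      using G by (simp add: emeasure_distr emeasure_density mult.commute)
  qed
  have "distr (density M a) N (\<lambda>x. x) \<le> distr (density M b) N (\<lambda>x. x)"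
    by (rule iffD2[OF le_measure]) (simp_all add: em le)
  then show ?thesis
    unfolding int[OF assms(3)] int[OF assms(4)] by (intro nn_integral_mono_measure) auto
qed

section \<open>Transition and resolvent densities\<close>

context harris_process
begin

text \<open>Extension by 0 to \<open>t \<le> 0\<close>: \<open>p\<close> is known to be measurable
  on positive times only, while Fubini's theorem is applied over the whole real line.\<close>

definition pos_density :: "real \<Rightarrow> 'e \<Rightarrow> 'e \<Rightarrow> real"
  where "pos_density t x y = (if 0 < t then p t x y else 0)"

lemma pos_density_nonneg: "0 \<le> pos_density t x y"
  by (simp add: pos_density_def p_nonneg)

lemma pos_density_measurable:
  assumes [measurable]: "t \<in> N \<rightarrow>\<^sub>M borel" "x \<in> N \<rightarrow>\<^sub>M borel" "y \<in> N \<rightarrow>\<^sub>M borel"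
  shows "(\<lambda>z. pos_density (t z) (x z) (y z)) \<in> borel_measurable N"
proof -
  have [measurable]: "(\<lambda>z. if 0 < t z then t z else 1) \<in> N \<rightarrow>\<^sub>M restrict_space borel {0<..}"
    by (rule measurable_restrict_space2) auto
  have "(\<lambda>z. (if 0 < t z then t z else 1, x z, y z)) \<in> N \<rightarrow>\<^sub>M restrict_space borel {0<..} \<Otimes>\<^sub>M borel \<Otimes>\<^sub>M borel"
    by measurable
  from measurable_compose[OF this p_measurable]
  have [measurable]: "(\<lambda>z. p (if 0 < t z then t z else 1) (x z) (y z)) \<in> borel_measurable N" by simp
  have "(\<lambda>z. if 0 < t z then p (if 0 < t z then t z else 1) (x z) (y z) else 0) \<in> borel_measurable N"
    by measurable
  then show ?thesis by (rule measurable_cong[THEN iffD1, rotated]) (simp add: pos_density_def)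
qed

lemma resolvent_density_eq:
  "resolvent_density p x y = (\<integral>\<^sup>+t. ennreal (exp (- t)) * ennreal (pos_density t x y) \<partial>lborel)"
  unfolding resolvent_density_def
  by (intro nn_integral_cong) (auto simp: pos_density_def indicator_def ennreal_mult' p_nonneg)

lemma sets_Lam[measurable_cong]: "sets \<Lambda> = sets borel" by (rule sets_\<Lambda>)

lemma space_Lam[simp]: "space \<Lambda> = UNIV" using sets_eq_imp_space_eq[OF sets_\<Lambda>] by simp

lemma resolvent_density_measurable:
  assumes [measurable]: "x \<in> N \<rightarrow>\<^sub>M borel" "y \<in> N \<rightarrow>\<^sub>M borel"
  shows "(\<lambda>z. resolvent_density p (x z) (y z)) \<in> borel_measurable N"
proof -
  have [measurable]: "(\<lambda>zt. pos_density (snd zt) (x (fst zt)) (y (fst zt))) \<in> borel_measurable (N \<Otimes>\<^sub>M lborel)"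
    by (rule pos_density_measurable) auto
  have "(\<lambda>z. \<integral>\<^sup>+t. ennreal (exp (- t)) * ennreal (pos_density t (x z) (y z)) \<partial>lborel) \<in> borel_measurable N"
    by (rule lborel.borel_measurable_nn_integral) (simp add: split_beta')
  then show ?thesis by (simp add: resolvent_density_eq)
qed

lemma resolvent_density_measurable1: "resolvent_density p x \<in> borel_measurable borel"
proof -
  have "(\<lambda>_. x) \<in> borel \<rightarrow>\<^sub>M borel" "(\<lambda>y. y) \<in> borel \<rightarrow>\<^sub>M borel" by measurable
  from resolvent_density_measurable[OF this] show ?thesis .
qed

lemma trans_kernel_prob: "0 \<le> t \<Longrightarrow> prob_space (trans_kernel P X t x)"
proof -
  assume t: "0 \<le> t"
  have P: "P x \<in> space (prob_algebra Om)" using measurable_space[OF P_kernel] by simp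
  then interpret prob_space "P x" by (simp add: space_prob_algebra)
  have "X t \<in> P x \<rightarrow>\<^sub>M borel" using X_measurable[OF t] P
    by (simp add: space_prob_algebra cong: measurable_cong_sets)
  then show ?thesis unfolding trans_kernel_def by (rule prob_space_distr)
qed

lemma emeasure_trans_kernel:
  assumes "0 < t" "A \<in> sets borel"
  shows "emeasure (trans_kernel P X t x) A = (\<integral>\<^sup>+y. ennreal (pos_density t x y) * indicator A y \<partial>\<Lambda>)"
proof -
  have [measurable]: "(\<lambda>y. pos_density t x y) \<in> borel_measurable \<Lambda>"
    by (rule pos_density_measurable) auto
  have "trans_kernel P X t x = density \<Lambda> (\<lambda>y. ennreal (pos_density t x y))"
    using p_density[OF assms(1)] assms(1) by (simp add: pos_density_def)
  then show ?thesis using assms(2) by (simp add: emeasure_density)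
qed

lemma pos_density_total: "0 < t \<Longrightarrow> (\<integral>\<^sup>+y. ennreal (pos_density t x y) \<partial>\<Lambda>) = 1"
proof -
  assume t: "0 < t"
  interpret prob_space "trans_kernel P X t x" using trans_kernel_prob[of t x] t by simp
  have "space (trans_kernel P X t x) = UNIV" by (simp add: trans_kernel_def)
  then show ?thesis
    using emeasure_space_1 emeasure_trans_kernel[OF t, of UNIV x] by simp
qed

lemma nn_integral_exp: "0 \<le> s \<Longrightarrow> 0 < c \<Longrightarrow>
  (\<integral>\<^sup>+t. indicator {s<..} t * ennreal (exp (- (c * t))) \<partial>lborel) = ennreal (exp (- (c * s)) / c)"
proof -
  assume s: "0 \<le> s" and c: "0 < c"
  have lim: "((\<lambda>t. - (exp (- (c * t)) / c)) \<longlongrightarrow> - (0 / c)) at_top"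
    by (intro tendsto_intros filterlim_compose[OF exp_at_bot]
        filterlim_compose[OF filterlim_uminus_at_bot_at_top] filterlim_tendsto_pos_mult_at_top[OF tendsto_const c] filterlim_ident) (use c in auto)
  have "(\<integral>\<^sup>+t. ennreal (exp (- (c * t))) * indicator {s..} t \<partial>lborel) = ennreal (0 - (- (exp (- (c * s)) / c)))"
    by (rule nn_integral_FTC_atLeast[where F = "\<lambda>t. - (exp (- (c * t)) / c)"])
      (use c lim in \<open>auto intro!: derivative_eq_intros simp: field_simps\<close>)
  also have "(\<integral>\<^sup>+t. ennreal (exp (- (c * t))) * indicator {s..} t \<partial>lborel) =
    (\<integral>\<^sup>+t. indicator {s<..} t * ennreal (exp (- (c * t))) \<partial>lborel)"
  proof (rule nn_integral_cong_AE)
    show "AE t in lborel. ennreal (exp (- (c * t))) * indicator {s..} t = indicator {s<..} t * ennreal (exp (- (c * t)))"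
      using AE_lborel_singleton[of s] by eventually_elim (auto simp: indicator_def)
  qed
  finally show ?thesis by simp
qed

lemma nn_integral_resolvent_density:
  assumes [measurable]: "g \<in> borel_measurable borel"
  shows "(\<integral>\<^sup>+y. resolvent_density p x y * g y \<partial>\<Lambda>) =
    (\<integral>\<^sup>+t. ennreal (exp (- t)) * (\<integral>\<^sup>+y. ennreal (pos_density t x y) * g y \<partial>\<Lambda>) \<partial>lborel)"
proof -
  interpret L: sigma_finite_measure \<Lambda> by (rule \<Lambda>_sigma_finite)
  interpret pair_sigma_finite lborel \<Lambda> ..
  have [measurable]: "(\<lambda>z. pos_density (fst z) x (snd z)) \<in> borel_measurable (lborel \<Otimes>\<^sub>M \<Lambda>)"
    "(\<lambda>z. pos_density (snd z) x (fst z)) \<in> borel_measurable (\<Lambda> \<Otimes>\<^sub>M lborel)"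
    by (rule pos_density_measurable; measurable)+
  have [measurable]: "(\<lambda>y. pos_density t x y) \<in> borel_measurable \<Lambda>"  "(\<lambda>s. pos_density s x z) \<in> borel_measurable lborel" for t z
    by (rule pos_density_measurable; measurable)+
  have "(\<integral>\<^sup>+y. resolvent_density p x y * g y \<partial>\<Lambda>) =
     (\<integral>\<^sup>+y. (\<integral>\<^sup>+t. ennreal (exp (- t)) * ennreal (pos_density t x y) * g y \<partial>lborel) \<partial>\<Lambda>)"
    unfolding resolvent_density_eq by (intro nn_integral_cong nn_integral_multc[symmetric]) auto
  also have "\<dots> = (\<integral>\<^sup>+t. (\<integral>\<^sup>+y. ennreal (exp (- t)) * ennreal (pos_density t x y) * g y \<partial>\<Lambda>) \<partial>lborel)"
    by (rule Fubini') (simp add: split_beta')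
  also have "\<dots> = (\<integral>\<^sup>+t. ennreal (exp (- t)) * (\<integral>\<^sup>+y. ennreal (pos_density t x y) * g y \<partial>\<Lambda>) \<partial>lborel)"
    by (intro nn_integral_cong) (simp add: nn_integral_cmult[symmetric] mult.assoc)
  finally show ?thesis .
qed

text \<open>\<open>measure_of\<close> takes the prescribed values only if they form a measure.
  Fubini's theorem identifies them with the values of a density, and the resolvent is used in this
  form from here on.\<close>

lemma resolvent_kernel_eq: "resolvent_kernel P X x = density \<Lambda> (resolvent_density p x)"
proof -
  note [measurable] = resolvent_density_measurable1[of x]
  have eq: "(\<integral>\<^sup>+t\<in>{0<..}. ennreal (exp (- t)) * emeasure (trans_kernel P X t x) A \<partial>lborel) =
      emeasure (density \<Lambda> (resolvent_density p x)) A" if A[measurable]: "A \<in> sets borel" for A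
  proof -
    have "(\<integral>\<^sup>+t\<in>{0<..}. ennreal (exp (- t)) * emeasure (trans_kernel P X t x) A \<partial>lborel) =
       (\<integral>\<^sup>+t. ennreal (exp (- t)) * (\<integral>\<^sup>+y. ennreal (pos_density t x y) * indicator A y \<partial>\<Lambda>) \<partial>lborel)"
      by (intro nn_integral_cong) (auto simp: indicator_def emeasure_trans_kernel[OF _ A] pos_density_def)
    also have "\<dots> = emeasure (density \<Lambda> (resolvent_density p x)) A"
      using nn_integral_resolvent_density[of "indicator A" x] by (simp add: emeasure_density)
    finally show ?thesis .
  qed
  have "resolvent_kernel P X x = measure_of UNIV (sets borel) (emeasure (density \<Lambda> (resolvent_density p x)))"
    unfolding resolvent_kernel_def
    by (rule measure_of_eq) (use eq in \<open>auto simp: sets.sigma_sets_eq[of borel, simplified]\<close>)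
  also have "\<dots> = density \<Lambda> (resolvent_density p x)"
    using measure_of_of_measure[of "density \<Lambda> (resolvent_density p x)"] by (simp add: sets_\<Lambda>)
  finally show ?thesis .
qed

lemma resolvent_density_total: "(\<integral>\<^sup>+y. resolvent_density p x y \<partial>\<Lambda>) = 1"
proof -
  have "(\<integral>\<^sup>+y. resolvent_density p x y \<partial>\<Lambda>) =
    (\<integral>\<^sup>+t. ennreal (exp (- t)) * (\<integral>\<^sup>+y. ennreal (pos_density t x y) \<partial>\<Lambda>) \<partial>lborel)"
    using nn_integral_resolvent_density[of "\<lambda>_. 1" x] by simp
  also have "\<dots> = (\<integral>\<^sup>+t. indicator {0<..} t * ennreal (exp (- (1 * t))) \<partial>lborel)"
  proof (intro nn_integral_cong)
    fix t :: real
    show "ennreal (exp (- t)) * (\<integral>\<^sup>+y. ennreal (pos_density t x y) \<partial>\<Lambda>) = indicator {0<..} t * ennreal (exp (- (1 * t)))"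
      using pos_density_total[of t x] by (cases "0 < t") (simp_all add: pos_density_def)
  qed
  also have "\<dots> = ennreal (exp (- (1 * 0)) / 1)" by (rule nn_integral_exp) auto
  finally show ?thesis by simp
qed

lemma resolvent_kernel_prob: "prob_space (resolvent_kernel P X x)"
proof
  note [measurable] = resolvent_density_measurable1[of x]
  show "emeasure (resolvent_kernel P X x) (space (resolvent_kernel P X x)) = 1"
    by (simp add: resolvent_kernel_eq emeasure_density resolvent_density_total)
qed

lemma sets_resolvent_kernel[simp, measurable_cong]: "sets (resolvent_kernel P X x) = sets borel"
  by (simp add: resolvent_kernel_eq sets_\<Lambda>)

lemma emeasure_resolvent_kernel_measurable:
  assumes [measurable]: "D \<in> sets borel"
  shows "(\<lambda>x. emeasure (resolvent_kernel P X x) D) \<in> borel_measurable borel"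
proof -
  interpret L: sigma_finite_measure \<Lambda> by (rule \<Lambda>_sigma_finite)
  note [measurable] = resolvent_density_measurable1
  have [measurable]: "(\<lambda>z. resolvent_density p (fst z) (snd z)) \<in> borel_measurable (borel \<Otimes>\<^sub>M \<Lambda>)"
    by (rule resolvent_density_measurable) auto
  have "(\<lambda>x. \<integral>\<^sup>+y. resolvent_density p x y * indicator D y \<partial>\<Lambda>) \<in> borel_measurable borel"
    by (rule L.borel_measurable_nn_integral) (simp add: split_beta')
  then show ?thesis by (simp add: resolvent_kernel_eq emeasure_density)
qed

end

section \<open>The Markov property in integrated form\<close>

context nummelin_splitting
begin

lemma PP_prob_space: "\<pi> \<in> inits \<Longrightarrow> prob_space (PP \<pi>)"
  using PP_prob by (auto simp: space_prob_algebra)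

lemma sets_PP: "\<pi> \<in> inits \<Longrightarrow> sets (PP \<pi>) = sets Om'"
  using PP_prob by (auto simp: space_prob_algebra)

lemma space_PP: "\<pi> \<in> inits \<Longrightarrow> space (PP \<pi>) = space Om'"
  by (rule sets_eq_imp_space_eq) (rule sets_PP)

lemma measurable_PP: "\<pi> \<in> inits \<Longrightarrow> f \<in> Om' \<rightarrow>\<^sub>M N \<Longrightarrow> f \<in> PP \<pi> \<rightarrow>\<^sub>M N"
  by (simp add: sets_PP cong: measurable_cong_sets)

lemma return_inits: "return borel x \<in> inits"
  by (auto simp: space_prob_algebra intro: prob_space_return)

lemma nu_inits: "\<nu> \<in> inits" by (rule \<nu>_prob)

lemma nn_integral_Y0:
  assumes \<pi>: "\<pi> \<in> inits" and q: "q \<in> borel_measurable borel"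
  shows "(\<integral>\<^sup>+w. q (Y 0 w) \<partial>PP \<pi>) = (\<integral>\<^sup>+x. q x \<partial>\<pi>)"
proof -
  have "(\<integral>\<^sup>+w. q (Y 0 w) \<partial>PP \<pi>) = (\<integral>\<^sup>+w. q (Z1 Z 0 w) \<partial>PP \<pi>)"
    by (intro nn_integral_cong) (simp add: space_PP[OF \<pi>] T_0)
  also have "\<dots> = (\<integral>\<^sup>+x. q x \<partial>distr (PP \<pi>) borel (Z1 Z 0))"
    by (rule nn_integral_distr[symmetric]) (use measurable_PP[OF \<pi> Z1_measurable] q in auto)
  finally show ?thesis by (simp add: initial_law[OF \<pi>])
qed

text \<open>The kernel is read off the laws started in points and not constructed; its measurability
  in \<open>x\<close> becomes a part of \<open>markov_seq\<close>.\<close>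

definition start_law :: "'s measure \<Rightarrow> (nat \<Rightarrow> 'v \<Rightarrow> 's) \<Rightarrow> 'e \<Rightarrow> 's measure" where
  "start_law S U x = distr (PP (return borel x)) S (U 0)"

text \<open>Given the past before \<open>T\<^sub>n\<close>, the variable \<open>U n\<close> is distributed like \<open>U 0\<close> for the process
  started in \<open>X\<^bsub>T n\<^esub>\<close>.\<close>

definition markov_seq :: "'s measure \<Rightarrow> (nat \<Rightarrow> 'v \<Rightarrow> 's) \<Rightarrow> bool" where
  "markov_seq S U \<longleftrightarrow> (\<forall>n. U n \<in> Om' \<rightarrow>\<^sub>M S) \<and> start_law S U \<in> borel \<rightarrow>\<^sub>M prob_algebra S \<and>
     (\<forall>\<pi>\<in>inits. \<forall>n. \<forall>G\<in>sets (F n). distr (density (PP \<pi>) (indicator G)) S (U n) =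
        density (PP \<pi>) (indicator G) \<bind> (\<lambda>w. start_law S U (Y n w)))"

lemma markov_seq_measurable: "markov_seq S U \<Longrightarrow> U n \<in> Om' \<rightarrow>\<^sub>M S"
  by (simp add: markov_seq_def)

lemma markov_seq_kernel: "markov_seq S U \<Longrightarrow> start_law S U \<in> borel \<rightarrow>\<^sub>M prob_algebra S"
  by (simp add: markov_seq_def)

lemma markov_seq_kernel_nn:
  assumes "markov_seq S U" "\<psi> \<in> borel_measurable S"
  shows "(\<lambda>x. \<integral>\<^sup>+u. \<psi> u \<partial>start_law S U x) \<in> borel_measurable borel"
  using measurable_compose[OF measurable_prob_algebraD[OF markov_seq_kernel[OF assms(1)]]
    nn_integral_measurable_subprob_algebra[OF assms(2)]] by simp

lemma start_law_nn:
  assumes U: "U 0 \<in> Om' \<rightarrow>\<^sub>M S" and \<psi>: "\<psi> \<in> borel_measurable S"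
  shows "(\<integral>\<^sup>+u. \<psi> u \<partial>start_law S U x) = (\<integral>\<^sup>+w. \<psi> (U 0 w) \<partial>PP (return borel x))"
  unfolding start_law_def
  by (rule nn_integral_distr[OF measurable_PP[OF return_inits U]]) (simp add: \<psi>)

lemma indicator_PP:
  assumes "\<pi> \<in> inits" "G \<in> sets (F n)" shows "(indicator G :: _ \<Rightarrow> ennreal) \<in> borel_measurable (PP \<pi>)"
  using F_into_Om'[OF assms(2)] by (intro borel_measurable_indicator) (simp add: sets_PP[OF assms(1)])

lemma markov_seq_nn:
  assumes M: "markov_seq S U" and \<pi>: "\<pi> \<in> inits" and G: "G \<in> sets (F n)"
    and \<psi>[measurable]: "\<psi> \<in> borel_measurable S"
  shows "(\<integral>\<^sup>+w. indicator G w * \<psi> (U n w) \<partial>PP \<pi>) =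
    (\<integral>\<^sup>+w. indicator G w * (\<integral>\<^sup>+u. \<psi> u \<partial>start_law S U (Y n w)) \<partial>PP \<pi>)"
proof -
  note [measurable] = measurable_PP[OF \<pi> markov_seq_measurable[OF M, of n]]
    measurable_PP[OF \<pi> measurable_F_Om'[OF Y_F[OF order_refl]], of n]
    indicator_PP[OF \<pi> G] markov_seq_kernel[OF M, THEN measurable_prob_algebraD]
  have "(\<integral>\<^sup>+w. indicator G w * \<psi> (U n w) \<partial>PP \<pi>) = (\<integral>\<^sup>+u. \<psi> u \<partial>distr (density (PP \<pi>) (indicator G)) S (U n))"
    by (simp add: nn_integral_distr nn_integral_density)
  also have "\<dots> = (\<integral>\<^sup>+u. \<psi> u \<partial>(density (PP \<pi>) (indicator G) \<bind> (\<lambda>w. start_law S U (Y n w))))"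
    using M \<pi> G by (simp add: markov_seq_def)
  also have "\<dots> = (\<integral>\<^sup>+w. (\<integral>\<^sup>+u. \<psi> u \<partial>start_law S U (Y n w)) \<partial>density (PP \<pi>) (indicator G))"
    by (rule nn_integral_bind[where B = S]) auto
  also have "\<dots> = (\<integral>\<^sup>+w. indicator G w * (\<integral>\<^sup>+u. \<psi> u \<partial>start_law S U (Y n w)) \<partial>PP \<pi>)"
    using markov_seq_kernel_nn[OF M \<psi>] by (subst nn_integral_density) auto
  finally show ?thesis .
qed

text \<open>The function \<open>q\<close> is forced: the identity for \<open>n = 0\<close>, the
  initial point \<open>x\<close> and the whole space gives
  \<open>q x = emeasure (start_law S U x) A\<close>. Measurability of the kernel and equality of two
  finite measures then have to be checked on the generator only.\<close>

lemma markov_seqI: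
  assumes U: "\<And>n. U n \<in> Om' \<rightarrow>\<^sub>M S"
    and gen: "sets S = sigma_sets (space S) \<Gamma>" "Int_stable \<Gamma>" "\<Gamma> \<subseteq> Pow (space S)" "space S \<in> \<Gamma>"
    and q: "\<And>A. A \<in> \<Gamma> \<Longrightarrow> \<exists>q\<in>borel_measurable borel. \<forall>\<pi>\<in>inits. \<forall>n. \<forall>G\<in>sets (F n).
      (\<integral>\<^sup>+w. indicator G w * indicator A (U n w) \<partial>PP \<pi>) = (\<integral>\<^sup>+w. indicator G w * q (Y n w) \<partial>PP \<pi>)"
  shows "markov_seq S U"
proof -
  have \<Gamma>S: "A \<in> sets S" if "A \<in> \<Gamma>" for A using that by (simp add: gen(1) sigma_sets.Basic)
  have start: "emeasure (start_law S U x) A = q x"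
    if A: "A \<in> \<Gamma>" and qm: "q \<in> borel_measurable borel"
     and q: "\<forall>\<pi>\<in>inits. \<forall>n. \<forall>G\<in>sets (F n).
      (\<integral>\<^sup>+w. indicator G w * indicator A (U n w) \<partial>PP \<pi>) = (\<integral>\<^sup>+w. indicator G w * q (Y n w) \<partial>PP \<pi>)" for A q x
  proof -
    note [measurable] = \<Gamma>S[OF A]
    have top: "space Om' \<in> sets (F 0)" using sets.top[of "F 0"] by simp
    have "emeasure (start_law S U x) A = (\<integral>\<^sup>+u. indicator A u \<partial>start_law S U x)"
      by (rule nn_integral_indicator[symmetric]) (simp add: start_law_def)
    also have "\<dots> = (\<integral>\<^sup>+w. indicator A (U 0 w) \<partial>PP (return borel x))"
      by (rule start_law_nn[OF U]) auto
    also have "\<dots> = (\<integral>\<^sup>+w. indicator (space Om') w * indicator A (U 0 w) \<partial>PP (return borel x))"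
      by (intro nn_integral_cong) (simp add: space_PP[OF return_inits])
    also have "\<dots> = (\<integral>\<^sup>+w. indicator (space Om') w * q (Y 0 w) \<partial>PP (return borel x))"
      using q return_inits top by blast
    also have "\<dots> = (\<integral>\<^sup>+w. q (Y 0 w) \<partial>PP (return borel x))"
      by (intro nn_integral_cong) (simp add: space_PP[OF return_inits])
    also have "\<dots> = q x"
      by (simp add: nn_integral_Y0[OF return_inits qm] nn_integral_return qm)
    finally show ?thesis .
  qed
  have kernel: "start_law S U \<in> borel \<rightarrow>\<^sub>M prob_algebra S"
  proof (rule measurable_prob_algebra_generated[OF gen(1-3)])
    fix x show "prob_space (start_law S U x)"
      unfolding start_law_def
      by (rule prob_space.prob_space_distr[OF PP_prob_space[OF return_inits] measurable_PP[OF return_inits U]])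
    show "sets (start_law S U x) = sets S" unfolding start_law_def by (rule sets_distr)
  next
    fix A assume A: "A \<in> \<Gamma>"
    from q[OF A] obtain q where qm: "q \<in> borel_measurable borel" and
      q: "\<forall>\<pi>\<in>inits. \<forall>n. \<forall>G\<in>sets (F n).
          (\<integral>\<^sup>+w. indicator G w * indicator A (U n w) \<partial>PP \<pi>) = (\<integral>\<^sup>+w. indicator G w * q (Y n w) \<partial>PP \<pi>)" by blast
    show "(\<lambda>x. emeasure (start_law S U x) A) \<in> borel_measurable borel"
      unfolding start[OF A qm q] by (rule qm)
  qed
  moreover have "distr (density (PP \<pi>) (indicator G)) S (U n) =
        density (PP \<pi>) (indicator G) \<bind> (\<lambda>w. start_law S U (Y n w))" (is "?l = ?r")
    if \<pi>: "\<pi> \<in> inits" and G: "G \<in> sets (F n)" for \<pi> n G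
  proof -
    note [measurable] = measurable_PP[OF \<pi> U]
      measurable_PP[OF \<pi> measurable_F_Om'[OF Y_F[OF order_refl]], of n]
      indicator_PP[OF \<pi> G] kernel[THEN measurable_prob_algebraD]
    interpret PP: prob_space "PP \<pi>" by (rule PP_prob_space[OF \<pi>])
    have ne: "space (density (PP \<pi>) (indicator G)) \<noteq> {}" using PP.not_empty by simp
    have Gm: "G \<in> sets (PP \<pi>)" using F_into_Om'[OF G] sets_PP[OF \<pi>] by simp
    have l: "emeasure ?l A = (\<integral>\<^sup>+w. indicator G w * indicator A (U n w) \<partial>PP \<pi>)" if [measurable]: "A \<in> sets S" for A
    proof -
      have "emeasure ?l A = (\<integral>\<^sup>+u. indicator A u \<partial>?l)" by simp
      also have "\<dots> = (\<integral>\<^sup>+w. indicator G w * indicator A (U n w) \<partial>PP \<pi>)"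
        by (subst nn_integral_distr) (auto simp: nn_integral_density)
      finally show ?thesis .
    qed
    show ?thesis
    proof (rule measure_eqI_generator_eq[OF gen(2,3), where A = "\<lambda>_. space S"])
      fix A assume A: "A \<in> \<Gamma>"
      note [measurable] = \<Gamma>S[OF A]
      from q[OF A] obtain q where qm: "q \<in> borel_measurable borel" and
        q: "\<forall>\<pi>\<in>inits. \<forall>n. \<forall>G\<in>sets (F n).
          (\<integral>\<^sup>+w. indicator G w * indicator A (U n w) \<partial>PP \<pi>) = (\<integral>\<^sup>+w. indicator G w * q (Y n w) \<partial>PP \<pi>)" by blast
      have "emeasure ?r A = (\<integral>\<^sup>+w. emeasure (start_law S U (Y n w)) A \<partial>density (PP \<pi>) (indicator G))"
        by (rule emeasure_bind[OF ne, where N = S]) auto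
      also have "\<dots> = (\<integral>\<^sup>+w. q (Y n w) \<partial>density (PP \<pi>) (indicator G))"
        by (simp add: start[OF A qm q])
      also have "\<dots> = (\<integral>\<^sup>+w. indicator G w * q (Y n w) \<partial>PP \<pi>)"
        using qm by (subst nn_integral_density) auto
      finally show "emeasure ?l A = emeasure ?r A" using l[OF \<Gamma>S[OF A]] q \<pi> G by simp
    next
      show "sets ?l = sigma_sets (space S) \<Gamma>" using gen(1) by simp
      have "sets ?r = sets S"
        by (rule sets_bind) (use ne in \<open>auto simp: start_law_def\<close>)
      then show "sets ?r = sigma_sets (space S) \<Gamma>" using gen(1) by simp
    next
      have "emeasure ?l (space S) = (\<integral>\<^sup>+w. indicator G w * indicator (space S) (U n w) \<partial>PP \<pi>)"
        by (rule l) auto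
      also have "\<dots> \<le> (\<integral>\<^sup>+w. 1 \<partial>PP \<pi>)" by (intro nn_integral_mono) (auto simp: indicator_def)
      also have "\<dots> < \<infinity>" by (simp add: PP.emeasure_space_1)
      finally show "emeasure ?l (space S) \<noteq> \<infinity>" by simp
    qed (use gen(4) in auto)
  qed
  ultimately show ?thesis using U by (auto simp: markov_seq_def)
qed

lemma markov_seq_pairI:
  assumes U: "\<And>n. U n \<in> Om' \<rightarrow>\<^sub>M S1" and V: "\<And>n. V n \<in> Om' \<rightarrow>\<^sub>M S2"
    and q: "\<And>A B. A \<in> sets S1 \<Longrightarrow> B \<in> sets S2 \<Longrightarrow> \<exists>q\<in>borel_measurable borel. \<forall>\<pi>\<in>inits. \<forall>n. \<forall>G\<in>sets (F n).
      (\<integral>\<^sup>+w. indicator G w * (indicator A (U n w) * indicator B (V n w)) \<partial>PP \<pi>) = (\<integral>\<^sup>+w. indicator G w * q (Y n w) \<partial>PP \<pi>)"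
  shows "markov_seq (S1 \<Otimes>\<^sub>M S2) (\<lambda>n w. (U n w, V n w))"
proof (rule markov_seqI)
  show "sets (S1 \<Otimes>\<^sub>M S2) = sigma_sets (space (S1 \<Otimes>\<^sub>M S2)) {a \<times> b |a b. a \<in> sets S1 \<and> b \<in> sets S2}"
    by (simp add: sets_pair_measure space_pair_measure)
  show "Int_stable {a \<times> b |a b. a \<in> sets S1 \<and> b \<in> sets S2}"
    by (rule Int_stable_pair_measure_generator)
  show "{a \<times> b |a b. a \<in> sets S1 \<and> b \<in> sets S2} \<subseteq> Pow (space (S1 \<Otimes>\<^sub>M S2))"
    using pair_measure_closed[of S1 S2] by (simp add: space_pair_measure)
  show "space (S1 \<Otimes>\<^sub>M S2) \<in> {a \<times> b |a b. a \<in> sets S1 \<and> b \<in> sets S2}"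
    by (auto simp: space_pair_measure)
  show "(\<lambda>w. (U n w, V n w)) \<in> Om' \<rightarrow>\<^sub>M S1 \<Otimes>\<^sub>M S2" for n
    by (intro measurable_Pair U V)
next
  fix A assume "A \<in> {a \<times> b |a b. a \<in> sets S1 \<and> b \<in> sets S2}"
  then obtain a b where A: "A = a \<times> b" "a \<in> sets S1" "b \<in> sets S2" by blast
  have ind: "(indicator A (U n w, V n w) :: ennreal) = indicator a (U n w) * indicator b (V n w)" for n w
    unfolding A by (auto simp: indicator_def)
  show "\<exists>q\<in>borel_measurable borel. \<forall>\<pi>\<in>inits. \<forall>n. \<forall>G\<in>sets (F n).
      (\<integral>\<^sup>+w. indicator G w * indicator A (U n w, V n w) \<partial>PP \<pi>) = (\<integral>\<^sup>+w. indicator G w * q (Y n w) \<partial>PP \<pi>)"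
    unfolding ind by (rule q[OF A(2,3)])
qed

lemma indicator_Int_vimage:
  "G \<subseteq> space Om' \<Longrightarrow> (indicator G w * indicator A (h w) :: ennreal) = indicator (G \<inter> (h -` A \<inter> space Om')) w"
  by (auto simp: indicator_def)

text \<open>\<open>Y n\<close> belongs to the past, so an event for it can be absorbed into
  \<open>G\<close>.\<close>

lemma markov_seq_with_Y:
  assumes M: "markov_seq S U"
  shows "markov_seq (borel \<Otimes>\<^sub>M S) (\<lambda>n w. (Y n w, U n w))"
proof (rule markov_seq_pairI)
  show "Y n \<in> Om' \<rightarrow>\<^sub>M borel" for n by (rule measurable_F_Om'[OF Y_F[OF order_refl]])
  show "U n \<in> Om' \<rightarrow>\<^sub>M S" for n by (rule markov_seq_measurable[OF M])
  fix A B assume [measurable]: "A \<in> sets (borel :: 'e measure)" "B \<in> sets S"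
  show "\<exists>q\<in>borel_measurable borel. \<forall>\<pi>\<in>inits. \<forall>n. \<forall>G\<in>sets (F n).
      (\<integral>\<^sup>+w. indicator G w * (indicator A (Y n w) * indicator B (U n w)) \<partial>PP \<pi>) = (\<integral>\<^sup>+w. indicator G w * q (Y n w) \<partial>PP \<pi>)"
  proof (intro bexI ballI allI)
    show m: "(\<lambda>x. indicator A x * (\<integral>\<^sup>+u. indicator B u \<partial>start_law S U x)) \<in> borel_measurable borel"
      using markov_seq_kernel_nn[OF M, of "indicator B"] by simp
    fix \<pi> n G assume \<pi>: "\<pi> \<in> inits" and G: "G \<in> sets (F n)"
    have GA: "G \<inter> (Y n -` A \<inter> space Om') \<in> sets (F n)"
      using G measurable_sets[OF Y_F[OF order_refl], of A n] by simp
    have sub: "G \<subseteq> space Om'" using sets.sets_into_space[OF G] by simp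
    show "(\<integral>\<^sup>+w. indicator G w * (indicator A (Y n w) * indicator B (U n w)) \<partial>PP \<pi>) =
       (\<integral>\<^sup>+w. indicator G w * (indicator A (Y n w) * (\<integral>\<^sup>+u. indicator B u \<partial>start_law S U (Y n w))) \<partial>PP \<pi>)"
      using markov_seq_nn[OF M \<pi> GA, of "indicator B"]
      by (simp only: indicator_Int_vimage[OF sub, symmetric] mult.assoc borel_measurable_indicator \<open>B \<in> sets S\<close>)
  qed
qed

text \<open>The conditional law of \<open>Z2\<close> and \<open>Z3\<close> on the rectangle of
  \<open>B\<close> and \<open>D\<close>, given the position \<open>x\<close>.\<close>

definition split_mass :: "'e \<Rightarrow> real set \<Rightarrow> 'e set \<Rightarrow> ennreal" where
  "split_mass x B D = (\<integral>\<^sup>+u\<in>B. emeasure (split_kernel P X a C \<nu> x u) D \<partial>uniform_measure lborel {0..1})"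

lemma nu_borel: "prob_space \<nu>" "sets \<nu> = sets borel" "space \<nu> = UNIV"
  using \<nu>_prob sets_eq_imp_space_eq[of \<nu> borel] by (auto simp: space_prob_algebra)

text \<open>The minorization makes \<open>diff_measure\<close> a genuine difference for
  \<open>x\<close> in \<open>C\<close>.\<close>

lemma emeasure_split_kernel:
  assumes D: "D \<in> sets borel"
  shows "emeasure (split_kernel P X a C \<nu> x u) D =
    (if x \<in> C then if u \<le> a then emeasure \<nu> D
       else ennreal (1 / (1 - a)) * (emeasure (resolvent_kernel P X x) D - ennreal a * emeasure \<nu> D)
     else emeasure (resolvent_kernel P X x) D)"
proof -
  interpret N: prob_space \<nu> by (rule nu_borel)
  interpret U: prob_space "resolvent_kernel P X x" by (rule resolvent_kernel_prob)
  have "emeasure (diff_measure (resolvent_kernel P X x) (scale_measure (ennreal a) \<nu>)) D =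
     emeasure (resolvent_kernel P X x) D - ennreal a * emeasure \<nu> D" if "x \<in> C"
  proof (subst emeasure_diff_measure)
    show "finite_measure (scale_measure (ennreal a) \<nu>)"
      by (rule finite_measureI) (simp add: N.emeasure_space_1 space_scale_measure)
    show "emeasure (scale_measure (ennreal a) \<nu>) A \<le> emeasure (resolvent_kernel P X x) A"
      if "A \<in> sets (resolvent_kernel P X x)" for A
      using minorization[of A x] that \<open>x \<in> C\<close> by simp
  qed (use D nu_borel in \<open>auto intro: U.finite_measure_axioms\<close>)
  then show ?thesis by (auto simp: split_kernel_def)
qed

lemma split_kernel_measurable_pair:
  assumes [measurable]: "D \<in> sets borel"
  shows "(\<lambda>z. emeasure (split_kernel P X a C \<nu> (fst z) (snd z)) D) \<in> borel_measurable (borel \<Otimes>\<^sub>M borel)"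
proof -
  note [measurable] = emeasure_resolvent_kernel_measurable[of D] C_measurable
  show ?thesis unfolding emeasure_split_kernel[OF assms] by measurable
qed

lemma split_mass_measurable:
  assumes [measurable]: "B \<in> sets borel" "D \<in> sets borel"
  shows "(\<lambda>x. split_mass x B D) \<in> borel_measurable borel"
proof -
  interpret u: prob_space "uniform_measure lborel {0..1::real}"
    by (rule prob_space_uniform_measure) auto
  note [measurable] = split_kernel_measurable_pair[of D]
  have [measurable]: "(\<lambda>z. emeasure (split_kernel P X a C \<nu> (fst z) (snd z)) D) \<in>
     borel_measurable (borel \<Otimes>\<^sub>M uniform_measure lborel {0..1})"
    by measurable
  show ?thesis unfolding split_mass_def
    by (rule u.borel_measurable_nn_integral) (simp add: split_beta')
qed

lemma nn_integral_uniform: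
  assumes [measurable]: "h \<in> borel_measurable borel"
  shows "(\<integral>\<^sup>+u. h u \<partial>uniform_measure lborel {0..1::real}) = (\<integral>\<^sup>+u. h u * indicator {0..1} u \<partial>lborel)"
  by (subst nn_integral_uniform_measure) (auto simp: divide_ennreal_def)

text \<open>The weights \<open>a\<close> and \<open>1 - a\<close> recombine \<nu> and the normalized
  rest to the resolvent, so splitting leaves the law of the embedded chain unchanged.\<close>

lemma split_mass_UNIV:
  assumes D: "D \<in> sets borel"
  shows "split_mass x UNIV D = emeasure (resolvent_kernel P X x) D"
proof (cases "x \<in> C")
  case False
  then show ?thesis by (simp add: split_mass_def emeasure_split_kernel[OF D] nn_integral_uniform)
next
  case True
  define n where "n = emeasure \<nu> D"
  define U where "U = emeasure (resolvent_kernel P X x) D"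
  have le: "ennreal a * n \<le> U" using minorization[OF D, of x] True by (simp add: n_def U_def)
  have "split_mass x UNIV D = (\<integral>\<^sup>+u. (if u \<le> a then n else ennreal (1 / (1 - a)) * (U - ennreal a * n)) * indicator {0..1} u \<partial>lborel)"
    unfolding n_def U_def using True
    by (simp add: split_mass_def emeasure_split_kernel[OF D] nn_integral_uniform)
  also have "\<dots> = (\<integral>\<^sup>+u. n * indicator {0..a} u + ennreal (1 / (1 - a)) * (U - ennreal a * n) * indicator {a<..1} u \<partial>lborel)"
    using a_bounds by (intro nn_integral_cong) (auto simp: indicator_def)
  also have "\<dots> = n * ennreal a + ennreal (1 / (1 - a)) * (U - ennreal a * n) * ennreal (1 - a)"
    using a_bounds by (simp add: nn_integral_add nn_integral_cmult)
  also have "\<dots> = ennreal a * n + (ennreal (1 / (1 - a)) * ennreal (1 - a)) * (U - ennreal a * n)"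
    by (simp add: ac_simps)
  also have "ennreal (1 / (1 - a)) * ennreal (1 - a) = 1"
    using a_bounds by (simp add: ennreal_mult[symmetric])
  finally show ?thesis using le by (simp add: U_def add_diff_inverse_ennreal)
qed

lemma markov_seq_Z23: "markov_seq (borel \<Otimes>\<^sub>M borel) (\<lambda>n w. (Z2 Z (T n w) w, Z3 Z (T n w) w))"
proof (rule markov_seq_pairI)
  have Z: "(\<lambda>w. Z (T n w) w) \<in> Om' \<rightarrow>\<^sub>M SZ" for n by (rule Z_T_measurable)
  show "(\<lambda>w. Z2 Z (T n w) w) \<in> Om' \<rightarrow>\<^sub>M borel" "(\<lambda>w. Z3 Z (T n w) w) \<in> Om' \<rightarrow>\<^sub>M borel" for n
    using Z[of n] by measurable
  fix B D assume [measurable]: "B \<in> sets (borel :: real measure)" "D \<in> sets (borel :: 'e measure)"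
  show "\<exists>q\<in>borel_measurable borel. \<forall>\<pi>\<in>inits. \<forall>n. \<forall>G\<in>sets (F n).
      (\<integral>\<^sup>+w. indicator G w * (indicator B (Z2 Z (T n w) w) * indicator D (Z3 Z (T n w) w)) \<partial>PP \<pi>) = (\<integral>\<^sup>+w. indicator G w * q (Y n w) \<partial>PP \<pi>)"
  proof (intro bexI ballI allI)
    show "(\<lambda>x. split_mass x B D) \<in> borel_measurable borel" by (rule split_mass_measurable) auto
    fix \<pi> n G assume \<pi>: "\<pi> \<in> inits" and G: "G \<in> sets (F n)"
    have sub: "G \<subseteq> space Om'" using sets.sets_into_space[OF G] by simp
    have "{w \<in> G. Z2 Z (T n w) w \<in> B \<and> Z3 Z (T n w) w \<in> D} = G \<inter> ((\<lambda>w. Z (T n w) w) -` (UNIV \<times> B \<times> D) \<inter> space Om')"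
      using sub by (auto simp: mem_Times_iff)
    moreover have "\<dots> \<in> sets (PP \<pi>)"
      using F_into_Om'[OF G] measurable_sets[OF Z, of "UNIV \<times> B \<times> D" n] by (simp add: sets_PP[OF \<pi>])
    ultimately have m: "{w \<in> G. Z2 Z (T n w) w \<in> B \<and> Z3 Z (T n w) w \<in> D} \<in> sets (PP \<pi>)" by simp
    have "(\<integral>\<^sup>+w. indicator G w * (indicator B (Z2 Z (T n w) w) * indicator D (Z3 Z (T n w) w)) \<partial>PP \<pi>) =
      (\<integral>\<^sup>+w. indicator {w \<in> G. Z2 Z (T n w) w \<in> B \<and> Z3 Z (T n w) w \<in> D} w \<partial>PP \<pi>)"
      by (intro nn_integral_cong) (auto simp: indicator_def)
    also have "\<dots> = emeasure (PP \<pi>) {w \<in> G. Z2 Z (T n w) w \<in> B \<and> Z3 Z (T n w) w \<in> D}"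
      using m by simp
    also have "\<dots> = (\<integral>\<^sup>+w. indicator G w * split_mass (Y n w) B D \<partial>PP \<pi>)"
      by (subst split_law[OF \<pi> G]) (auto simp: split_mass_def mult.commute)
    finally show "(\<integral>\<^sup>+w. indicator G w * (indicator B (Z2 Z (T n w) w) * indicator D (Z3 Z (T n w) w)) \<partial>PP \<pi>) = \<dots>" .
  qed
qed

lemma markov_seq_Z: "markov_seq SZ (\<lambda>n w. Z (T n w) w)"
  using markov_seq_with_Y[OF markov_seq_Z23] by simp

end

section \<open>The sequence of jumps as one random variable\<close>

text \<open>Cylinders over a prefix, rather than over arbitrary finite index sets, fit an induction
  that removes one coordinate at a time.\<close>

lemma sets_PiM_cylinders:
  fixes S :: "'s measure"
  shows "sets (\<Pi>\<^sub>M i\<in>(UNIV :: nat set). S) = sigma_sets (space (\<Pi>\<^sub>M i\<in>(UNIV :: nat set). S))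
     {{f \<in> space (\<Pi>\<^sub>M i\<in>(UNIV :: nat set). S). \<forall>i<k. f i \<in> A i} |k A. \<forall>i. A i \<in> sets S}" (is "?l = sigma_sets ?\<Omega> ?\<Gamma>")
proof
  have "sets (\<Pi>\<^sub>M i\<in>(UNIV :: nat set). S) = sigma_sets ?\<Omega> {{f \<in> ?\<Omega>. f i \<in> A} |i A. A \<in> sets S}"
    by (simp add: sets_PiM_single space_PiM)
  also have "\<dots> \<subseteq> sigma_sets ?\<Omega> ?\<Gamma>"
  proof (rule sigma_sets_mono'', safe)
    fix i :: nat and A assume A: "A \<in> sets S"
    have "{f \<in> ?\<Omega>. f i \<in> A} = {f \<in> ?\<Omega>. \<forall>j<Suc i. f j \<in> (if j = i then A else space S)}"
      by (auto simp: space_PiM PiE_def Pi_def less_Suc_eq)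
    then show "\<exists>k A'. {f \<in> ?\<Omega>. f i \<in> A} = {f \<in> ?\<Omega>. \<forall>i<k. f i \<in> A' i} \<and> (\<forall>i. A' i \<in> sets S)"
      using A by (intro exI[of _ "Suc i"] exI[of _ "\<lambda>j. if j = i then A else space S"]) auto
  qed (rule sigma_sets_top)
  finally show "?l \<subseteq> sigma_sets ?\<Omega> ?\<Gamma>" .
  show "sigma_sets ?\<Omega> ?\<Gamma> \<subseteq> ?l"
  proof (rule sets.sigma_sets_subset, safe)
    fix k :: nat and A :: "nat \<Rightarrow> 's set" assume A: "\<forall>i. A i \<in> sets S"
    have "{f \<in> ?\<Omega>. \<forall>i<k. f i \<in> A i} = {f \<in> ?\<Omega>. \<forall>i\<in>{..<k}. f i \<in> A i}" by auto
    also have "\<dots> \<in> sets (\<Pi>\<^sub>M i\<in>(UNIV :: nat set). S)"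
    proof (rule sets.sets_Collect_finite_All)
      fix i
      note [measurable] = A[rule_format, of i]
      show "{f \<in> ?\<Omega>. f i \<in> A i} \<in> sets (\<Pi>\<^sub>M i\<in>(UNIV :: nat set). S)" by measurable
    qed auto
    finally show "{f \<in> ?\<Omega>. \<forall>i<k. f i \<in> A i} \<in> sets (\<Pi>\<^sub>M i\<in>(UNIV :: nat set). S)" .
  qed
qed

lemma Int_stable_cylinders:
  fixes S :: "'s measure"
  shows "Int_stable {{f \<in> space (\<Pi>\<^sub>M i\<in>(UNIV :: nat set). S). \<forall>i<k. f i \<in> A i} |k A. \<forall>i. A i \<in> sets S}"
proof (rule Int_stableI, safe)
  fix k k' :: nat and A A' :: "nat \<Rightarrow> 's set"
  assume A: "\<forall>i. A i \<in> sets S" and A': "\<forall>i. A' i \<in> sets S"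
  let ?\<Omega> = "space (\<Pi>\<^sub>M i\<in>(UNIV :: nat set). S)"
  let ?B = "\<lambda>i. (if i < k then A i else space S) \<inter> (if i < k' then A' i else space S)"
  have "{f \<in> ?\<Omega>. \<forall>i<k. f i \<in> A i} \<inter> {f \<in> ?\<Omega>. \<forall>i<k'. f i \<in> A' i} = {f \<in> ?\<Omega>. \<forall>i<max k k'. f i \<in> ?B i}"
    by (auto simp: space_PiM PiE_def Pi_def less_max_iff_disj)
  then show "\<exists>k'' A''. {f \<in> ?\<Omega>. \<forall>i<k. f i \<in> A i} \<inter> {f \<in> ?\<Omega>. \<forall>i<k'. f i \<in> A' i} =
      {f \<in> ?\<Omega>. \<forall>i<k''. f i \<in> A'' i} \<and> (\<forall>i. A'' i \<in> sets S)"
    using A A' by (intro exI[of _ "max k k'"] exI[of _ ?B]) auto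
qed

context nummelin_splitting
begin

text \<open>The restriction to positive times is the one that \<open>bridge_law\<close> contains for
  an empty list of increments, whose sum is 0.\<close>

definition wait_mass :: "'e \<Rightarrow> 'e \<Rightarrow> real set \<Rightarrow> ennreal" where
  "wait_mass x x' B = (\<integral>\<^sup>+t\<in>B \<inter> {0<..}. waiting_density p x x' t \<partial>lborel)"

lemma waiting_density_eq: "0 < t \<Longrightarrow> waiting_density p x x' t = ennreal (exp (- t)) *
    (if resolvent_density p x x' = \<infinity> \<or> (resolvent_density p x x' = 0 \<and> pos_density t x x' = 0) then 1
     else ennreal (pos_density t x x') / resolvent_density p x x')"
  by (simp add: waiting_density_def pos_density_def)

lemma waiting_density_measurable:
  assumes [measurable]: "x \<in> N \<rightarrow>\<^sub>M borel" "x' \<in> N \<rightarrow>\<^sub>M borel" "t \<in> N \<rightarrow>\<^sub>M borel"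
  shows "(\<lambda>z. indicator {0<..} (t z) * waiting_density p (x z) (x' z) (t z)) \<in> borel_measurable N"
proof -
  note [measurable] = resolvent_density_measurable[of x N x'] pos_density_measurable[of t N x x']
  have "(\<lambda>z. indicator {0<..} (t z) * (ennreal (exp (- t z)) *
    (if resolvent_density p (x z) (x' z) = \<infinity> \<or> (resolvent_density p (x z) (x' z) = 0 \<and> pos_density (t z) (x z) (x' z) = 0) then 1
     else ennreal (pos_density (t z) (x z) (x' z)) / resolvent_density p (x z) (x' z)))) \<in> borel_measurable N"
    by measurable
  then show ?thesis
    by (rule measurable_cong[THEN iffD1, rotated]) (simp add: indicator_def waiting_density_eq)
qed

lemma wait_mass_measurable:
  assumes [measurable]: "B \<in> sets borel"
  shows "(\<lambda>z. wait_mass (fst z) (snd (snd z)) B) \<in> borel_measurable SZ"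
proof -
  have [measurable]: "(\<lambda>zt. indicator {0<..} (snd zt) * waiting_density p (fst (fst zt)) (snd (snd (fst zt))) (snd zt))
     \<in> borel_measurable (SZ \<Otimes>\<^sub>M lborel)"
    by (rule waiting_density_measurable; measurable)
  have "(\<lambda>z. \<integral>\<^sup>+t. indicator B t * (indicator {0<..} t * waiting_density p (fst z) (snd (snd z)) t) \<partial>lborel)
     \<in> borel_measurable SZ"
    by (rule lborel.borel_measurable_nn_integral) (simp add: split_beta')
  also have "(\<lambda>z. \<integral>\<^sup>+t. indicator B t * (indicator {0<..} t * waiting_density p (fst z) (snd (snd z)) t) \<partial>lborel) =
     (\<lambda>z. wait_mass (fst z) (snd (snd z)) B)"
    unfolding wait_mass_def by (intro ext nn_integral_cong) (auto simp: indicator_def)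
  finally show ?thesis .
qed

lemma wait_measurable: "wait n \<in> Om' \<rightarrow>\<^sub>M borel"
  using T_measurable[of n] T_measurable[of "Suc n"] by measurable

lemma wait_F: "Suc k \<le> n \<Longrightarrow> wait k \<in> F n \<rightarrow>\<^sub>M borel"
  using T_F[of k n] T_F[of "Suc k" n] by measurable

lemma wait_pos: "w \<in> space Om' \<Longrightarrow> 0 < wait n w"
  using T_increasing by simp

text \<open>The value determines the next position, because \<open>Z3\<close> at \<open>T n\<close>
  is \<open>X\<close> at \<open>T (n+1)\<close>; this is what allows conditioning along the sequence
  to be iterated.\<close>

definition W :: "nat \<Rightarrow> 'v \<Rightarrow> ('e \<times> real \<times> 'e) \<times> real" where
  "W n w = (Z (T n w) w, wait n w)"

abbreviation SW :: "(('e \<times> real \<times> 'e) \<times> real) measure" where "SW \<equiv> SZ \<Otimes>\<^sub>M borel"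

lemma markov_seq_W: "markov_seq SW W"
proof -
  have "markov_seq SW (\<lambda>n w. (Z (T n w) w, wait n w))"
  proof (rule markov_seq_pairI)
    show "(\<lambda>w. Z (T n w) w) \<in> Om' \<rightarrow>\<^sub>M SZ" for n by (rule Z_T_measurable)
    show "wait n \<in> Om' \<rightarrow>\<^sub>M borel" for n by (rule wait_measurable)
    fix D B assume D[measurable]: "D \<in> sets SZ" and B[measurable]: "B \<in> sets (borel :: real measure)"
    show "\<exists>q\<in>borel_measurable borel. \<forall>\<pi>\<in>inits. \<forall>n. \<forall>G\<in>sets (F n).
      (\<integral>\<^sup>+w. indicator G w * (indicator D (Z (T n w) w) * indicator B (wait n w)) \<partial>PP \<pi>) = (\<integral>\<^sup>+w. indicator G w * q (Y n w) \<partial>PP \<pi>)"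
    proof (intro bexI ballI allI)
      let ?\<psi> = "\<lambda>z. indicator D z * wait_mass (fst z) (snd (snd z)) B"
      have \<psi>: "?\<psi> \<in> borel_measurable SZ"
        by (intro borel_measurable_times_ennreal borel_measurable_indicator D wait_mass_measurable B)
      show "(\<lambda>x. \<integral>\<^sup>+z. ?\<psi> z \<partial>start_law SZ (\<lambda>n w. Z (T n w) w) x) \<in> borel_measurable borel"
        by (rule markov_seq_kernel_nn[OF markov_seq_Z \<psi>])
      fix \<pi> n G assume \<pi>: "\<pi> \<in> inits" and G: "G \<in> sets (F n)"
      have sub: "G \<subseteq> space Om'" using sets.sets_into_space[OF G] by simp
      define H where "H = G \<inter> {w\<in>space Om'. Z (T n w) w \<in> D}"
      have H: "H \<in> sets (past_at Om' Z T n)"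
        unfolding H_def by (intro sets.Int F_past_at G Z_T_past_at D)
      have Hm: "H \<in> sets Om'" using H past_at_subset F_into_Om' by blast
      have m: "{w \<in> H. wait n w \<in> B} \<in> sets (PP \<pi>)"
      proof -
        have "{w \<in> H. wait n w \<in> B} = H \<inter> (wait n -` B \<inter> space Om')" using sub by (auto simp: H_def)
        then show ?thesis using Hm measurable_sets[OF wait_measurable B, of n] by (simp add: sets_PP[OF \<pi>])
      qed
      have "(\<integral>\<^sup>+w. indicator G w * (indicator D (Z (T n w) w) * indicator B (wait n w)) \<partial>PP \<pi>) =
         (\<integral>\<^sup>+w. indicator {w \<in> H. wait n w \<in> B} w \<partial>PP \<pi>)"
        using sub by (intro nn_integral_cong) (auto simp: H_def indicator_def)
      also have "\<dots> = emeasure (PP \<pi>) {w \<in> H. wait n w \<in> B}" using m by simp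
      \<comment> \<open>The empty list turns \<open>bridge_law\<close> into the law of the waiting
        time alone; its side condition becomes positivity of the waiting time.\<close>
      also have "{w \<in> H. wait n w \<in> B} = {w \<in> H. wait n w \<in> B \<and> sum_list (map fst ([] :: (real \<times> 'e set) list)) < wait n w \<and>
          (\<forall>j < length ([] :: (real \<times> 'e set) list). Z1 Z (T n w + sum_list (map fst (take (Suc j) ([] :: (real \<times> 'e set) list)))) w \<in> snd (([] :: (real \<times> 'e set) list) ! j))}"
        using wait_pos sub by (auto simp: H_def)
      also have "emeasure (PP \<pi>) \<dots> = (\<integral>\<^sup>+w. wait_mass (Y n w) (Z3 Z (T n w) w) B * indicator H w \<partial>PP \<pi>)"
        by (subst bridge_law[OF \<pi> H B]) (auto simp: wait_mass_def)
      also have "\<dots> = (\<integral>\<^sup>+w. indicator G w * ?\<psi> (Z (T n w) w) \<partial>PP \<pi>)"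
        using sub by (intro nn_integral_cong) (auto simp: H_def indicator_def)
      also have "\<dots> = (\<integral>\<^sup>+w. indicator G w * (\<integral>\<^sup>+z. ?\<psi> z \<partial>start_law SZ (\<lambda>n w. Z (T n w) w) (Y n w)) \<partial>PP \<pi>)"
        by (rule markov_seq_nn[OF markov_seq_Z \<pi> G \<psi>])
      finally show "(\<integral>\<^sup>+w. indicator G w * (indicator D (Z (T n w) w) * indicator B (wait n w)) \<partial>PP \<pi>) = \<dots>" .
    qed
  qed
  then show ?thesis by (simp add: W_def[abs_def])
qed

lemma W_measurable: "W n \<in> Om' \<rightarrow>\<^sub>M SW" by (rule markov_seq_measurable[OF markov_seq_W])

lemma W_F: "k < n \<Longrightarrow> W k \<in> F n \<rightarrow>\<^sub>M SW"
  unfolding W_def[abs_def] by (intro measurable_Pair Z_T_F wait_F) auto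

definition W_seq :: "nat \<Rightarrow> 'v \<Rightarrow> nat \<Rightarrow> ('e \<times> real \<times> 'e) \<times> real" where
  "W_seq n w i = W (n + i) w"

abbreviation SWs :: "(nat \<Rightarrow> ('e \<times> real \<times> 'e) \<times> real) measure" where "SWs \<equiv> \<Pi>\<^sub>M i\<in>UNIV. SW"

lemma W_seq_measurable: "W_seq n \<in> Om' \<rightarrow>\<^sub>M SWs"
  unfolding W_seq_def[abs_def]
  by (rule measurable_PiM_single') (use W_measurable measurable_space[OF W_measurable] in \<open>auto simp: space_pair_measure\<close>)

lemma nn_integral_past_le:
  assumes \<pi>: "\<pi> \<in> inits" and \<alpha>: "\<alpha> \<in> borel_measurable Om'" "\<beta> \<in> borel_measurable Om'"
    and eq: "\<And>G. G \<in> sets (F n) \<Longrightarrow> (\<integral>\<^sup>+w. indicator G w * \<alpha> w \<partial>PP \<pi>) \<le> (\<integral>\<^sup>+w. indicator G w * \<beta> w \<partial>PP \<pi>)"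
    and \<xi>: "\<xi> \<in> borel_measurable (F n)"
  shows "(\<integral>\<^sup>+w. \<xi> w * \<alpha> w \<partial>PP \<pi>) \<le> (\<integral>\<^sup>+w. \<xi> w * \<beta> w \<partial>PP \<pi>)"
  by (rule nn_integral_le_of_subalgebra[OF _ _ _ _ eq \<xi>])
    (use F_subset_Om' sets_PP[OF \<pi>] space_PP[OF \<pi>] measurable_PP[OF \<pi>] \<alpha> in auto)

lemma Y_measurable: "Y n \<in> Om' \<rightarrow>\<^sub>M borel" by (rule measurable_F_Om'[OF Y_F[OF order_refl]])

text \<open>The first factor is an event of \<open>F (n+1)\<close>, and the function obtained for
  the remaining factors is evaluated at \<open>Y (n+1)\<close>, which is a component of
  \<open>W n\<close>.\<close>

lemma W_cylinder:
  "\<forall>i. A i \<in> sets SW \<Longrightarrow> \<exists>q\<in>borel_measurable borel. \<forall>\<pi>\<in>inits. \<forall>n. \<forall>G\<in>sets (F n).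
      (\<integral>\<^sup>+w. indicator G w * (\<Prod>i<k. indicator (A i) (W (n + i) w)) \<partial>PP \<pi>) = (\<integral>\<^sup>+w. indicator G w * q (Y n w) \<partial>PP \<pi>)"
proof (induction k arbitrary: A)
  case 0
  show ?case by (intro bexI[of _ "\<lambda>_. 1"]) auto
next
  case (Suc k)
  from Suc.IH[of "\<lambda>i. A (Suc i)"] Suc.prems obtain q where qm: "q \<in> borel_measurable borel" and
    q: "\<And>\<pi> n G. \<pi> \<in> inits \<Longrightarrow> G \<in> sets (F n) \<Longrightarrow>
      (\<integral>\<^sup>+w. indicator G w * (\<Prod>i<k. indicator (A (Suc i)) (W (n + i) w)) \<partial>PP \<pi>) = (\<integral>\<^sup>+w. indicator G w * q (Y n w) \<partial>PP \<pi>)"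
    by auto
  note [measurable] = Suc.prems[rule_format, of 0] qm
  \<comment> \<open>\<open>snd (snd (fst wt))\<close> is the \<open>Z3\<close> component, the
    position from which the remaining factors start.\<close>
  define \<psi> :: "('e \<times> real \<times> 'e) \<times> real \<Rightarrow> ennreal" where "\<psi> wt = indicator (A 0) wt * q (snd (snd (fst wt)))" for wt
  have \<psi>: "\<psi> \<in> borel_measurable SW" unfolding \<psi>_def by measurable
  show ?case
  proof (intro bexI ballI allI)
    show "(\<lambda>x. \<integral>\<^sup>+wt. \<psi> wt \<partial>start_law SW W x) \<in> borel_measurable borel"
      by (rule markov_seq_kernel_nn[OF markov_seq_W \<psi>])
    fix \<pi> n G assume \<pi>: "\<pi> \<in> inits" and G: "G \<in> sets (F n)"
    have sub: "G \<subseteq> space Om'" using sets.sets_into_space[OF G] by simp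
    define H where "H = G \<inter> (W n -` A 0 \<inter> space Om')"
    have H: "H \<in> sets (F (Suc n))"
      using G F_Suc[of n] measurable_sets[OF W_F[of n "Suc n"], of "A 0"] Suc.prems by (auto simp: H_def)
    have ind: "indicator H w = (indicator G w * indicator (A 0) (W n w) :: ennreal)" for w
      using sub by (auto simp: H_def indicator_def)
    have "(\<integral>\<^sup>+w. indicator G w * (\<Prod>i<Suc k. indicator (A i) (W (n + i) w)) \<partial>PP \<pi>) =
       (\<integral>\<^sup>+w. indicator H w * (\<Prod>i<k. indicator (A (Suc i)) (W (Suc n + i) w)) \<partial>PP \<pi>)"
      unfolding ind prod.lessThan_Suc_shift by (simp add: mult.assoc)
    also have "\<dots> = (\<integral>\<^sup>+w. indicator H w * q (Y (Suc n) w) \<partial>PP \<pi>)" by (rule q[OF \<pi> H])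
    also have "\<dots> = (\<integral>\<^sup>+w. indicator G w * \<psi> (W n w) \<partial>PP \<pi>)"
      unfolding ind by (intro nn_integral_cong) (simp add: \<psi>_def W_def space_PP[OF \<pi>] Z1_jump mult.assoc)
    also have "\<dots> = (\<integral>\<^sup>+w. indicator G w * (\<integral>\<^sup>+wt. \<psi> wt \<partial>start_law SW W (Y n w)) \<partial>PP \<pi>)"
      by (rule markov_seq_nn[OF markov_seq_W \<pi> G \<psi>])
    finally show "(\<integral>\<^sup>+w. indicator G w * (\<Prod>i<Suc k. indicator (A i) (W (n + i) w)) \<partial>PP \<pi>) = \<dots>" .
  qed
qed

lemma markov_seq_W_seq: "markov_seq SWs W_seq"
proof (rule markov_seqI[OF W_seq_measurable sets_PiM_cylinders Int_stable_cylinders])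
  let ?\<Omega> = "space SWs"
  let ?\<Gamma> = "{{f \<in> ?\<Omega>. \<forall>i<k. f i \<in> A i} |k A. \<forall>i. A i \<in> sets SW}"
  show "?\<Gamma> \<subseteq> Pow ?\<Omega>" by auto
  show "?\<Omega> \<in> ?\<Gamma>" by (rule CollectI, intro exI[of _ 0] exI[of _ "\<lambda>_. {}"]) auto
  fix B assume "B \<in> ?\<Gamma>"
  then obtain k A where B: "B = {f \<in> ?\<Omega>. \<forall>i<k. f i \<in> A i}" and A: "\<forall>i. A i \<in> sets SW" by blast
  have ind: "(\<Prod>i<k. indicator (A i) (W (n + i) w)) = (if \<forall>i<k. W (n + i) w \<in> A i then 1 else 0 :: ennreal)" for n w
    by (induction k) (auto simp: less_Suc_eq)
  have "(indicator B (W_seq n w) :: ennreal) = (\<Prod>i<k. indicator (A i) (W (n + i) w))" if "w \<in> space Om'" for n w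
    unfolding ind using measurable_space[OF W_seq_measurable that, of n] by (simp add: B W_seq_def indicator_def)
  then have "(\<integral>\<^sup>+w. indicator G w * indicator B (W_seq n w) \<partial>PP \<pi>) =
     (\<integral>\<^sup>+w. indicator G w * (\<Prod>i<k. indicator (A i) (W (n + i) w)) \<partial>PP \<pi>)" if "\<pi> \<in> inits" for G n \<pi>
    using that by (intro nn_integral_cong) (simp add: space_PP)
  with W_cylinder[OF A, of k]
  show "\<exists>q\<in>borel_measurable borel. \<forall>\<pi>\<in>inits. \<forall>n. \<forall>G\<in>sets (F n).
      (\<integral>\<^sup>+w. indicator G w * indicator B (W_seq n w) \<partial>PP \<pi>) = (\<integral>\<^sup>+w. indicator G w * q (Y n w) \<partial>PP \<pi>)"
    by simp
qed

section \<open>Hits of the splitting set and regeneration\<close>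

definition hits :: "nat \<Rightarrow> 'v set" where
  "hits j = {w \<in> space Om'. Z (T j w) w \<in> C \<times> {0..a} \<times> UNIV}"

lemma hits_F: "j < n \<Longrightarrow> hits j \<in> sets (F n)"
proof -
  assume "j < n"
  note [measurable] = Z_T_F[OF this] C_measurable
  have "{w \<in> space (F n). Z (T j w) w \<in> C \<times> {0..a} \<times> UNIV} \<in> sets (F n)" by measurable
  then show ?thesis by (simp add: hits_def)
qed

lemma hits_measurable: "hits j \<in> sets Om'"
  using hits_F[of j "Suc j"] F_into_Om' by blast

text \<open>For \<open>Z2 \<le> a\<close> and a position in \<open>C\<close> the splitting kernel is
  \<open>\<nu>\<close>, whatever the position. The event \<open>G\<close> has to lie in the past
  before \<open>T j\<close>: the waiting time that begins at \<open>T j\<close> may already depend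
  on the next position.\<close>

lemma hit_law:
  assumes \<pi>: "\<pi> \<in> inits" and G: "G \<in> sets (F j)" and g: "g \<in> borel_measurable borel"
  shows "(\<integral>\<^sup>+w. indicator (G \<inter> hits j) w * g (Y (Suc j) w) \<partial>PP \<pi>) = emeasure (PP \<pi>) (G \<inter> hits j) * (\<integral>\<^sup>+x. g x \<partial>\<nu>)"
proof -
  interpret N: prob_space \<nu> by (rule nu_borel)
  have sub: "G \<subseteq> space Om'" using sets.sets_into_space[OF G] by simp
  define H where "H = G \<inter> (Y j -` C \<inter> space Om')"
  have H: "H \<in> sets (F j)" using G measurable_sets[OF Y_F[OF order_refl] C_measurable] by (simp add: H_def)
  have Gh: "G \<inter> hits j \<in> sets (PP \<pi>)" using F_into_Om'[OF G] hits_measurable by (simp add: sets_PP[OF \<pi>])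
  have [measurable]: "G \<inter> hits j \<in> sets (PP \<pi>)" "Y (Suc j) \<in> PP \<pi> \<rightarrow>\<^sub>M borel"
    "(indicator (G \<inter> hits j) :: _ \<Rightarrow> ennreal) \<in> borel_measurable (PP \<pi>)"
    using Gh measurable_PP[OF \<pi> Y_measurable] by auto
  have c: "split_mass x {0..a} D = ennreal a * emeasure \<nu> D" if D: "D \<in> sets borel" and x: "x \<in> C" for x D
  proof -
    have "split_mass x {0..a} D = (\<integral>\<^sup>+u. emeasure \<nu> D * indicator {0..a} u \<partial>uniform_measure lborel {0..1})"
      unfolding split_mass_def
      by (intro nn_integral_cong) (auto simp: indicator_def emeasure_split_kernel[OF D] x)
    also have "\<dots> = (\<integral>\<^sup>+u. emeasure \<nu> D * indicator {0..a} u \<partial>lborel)"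
      using a_bounds by (subst nn_integral_uniform) (auto intro!: nn_integral_cong simp: indicator_def)
    also have "\<dots> = emeasure \<nu> D * ennreal a" using a_bounds by (simp add: nn_integral_cmult)
    finally show ?thesis by (simp add: mult.commute)
  qed
  have em: "emeasure (PP \<pi>) {w\<in>space Om'. w \<in> G \<inter> hits j \<and> Y (Suc j) w \<in> D} = ennreal a * emeasure (PP \<pi>) H * emeasure \<nu> D"
    if D: "D \<in> sets borel" for D
  proof -
    have "{w\<in>space Om'. w \<in> G \<inter> hits j \<and> Y (Suc j) w \<in> D} = {w \<in> H. Z2 Z (T j w) w \<in> {0..a} \<and> Z3 Z (T j w) w \<in> D}"
      using sub by (auto simp: H_def hits_def mem_Times_iff Z1_jump)
    also have "emeasure (PP \<pi>) \<dots> = (\<integral>\<^sup>+w. split_mass (Y j w) {0..a} D * indicator H w \<partial>PP \<pi>)"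
      by (subst split_law[OF \<pi> H]) (use D in \<open>auto simp: split_mass_def\<close>)
    also have "\<dots> = (\<integral>\<^sup>+w. (ennreal a * emeasure \<nu> D) * indicator H w \<partial>PP \<pi>)"
      by (intro nn_integral_cong) (auto simp: indicator_def H_def c[OF D])
    also have "\<dots> = ennreal a * emeasure (PP \<pi>) H * emeasure \<nu> D"
      using F_into_Om'[OF H] sets_PP[OF \<pi>] by (subst nn_integral_cmult_indicator) (simp_all add: ac_simps)
    finally show ?thesis .
  qed
  \<comment> \<open>Taking the whole space for \<open>D\<close> identifies the factor in front of
    \<open>\<nu>\<close>.\<close>
  have tot: "emeasure (PP \<pi>) (G \<inter> hits j) = ennreal a * emeasure (PP \<pi>) H"
  proof -
    have "{w\<in>space Om'. w \<in> G \<inter> hits j \<and> Y (Suc j) w \<in> UNIV} = G \<inter> hits j" using sub by (auto simp: hits_def)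
    then show ?thesis using em[of UNIV] N.emeasure_space_1 by (simp add: nu_borel)
  qed
  have "distr (density (PP \<pi>) (indicator (G \<inter> hits j))) borel (Y (Suc j)) = scale_measure (emeasure (PP \<pi>) (G \<inter> hits j)) \<nu>" (is "?l = ?r")
  proof (rule measure_eqI)
    fix D assume "D \<in> sets ?l"
    then have D[measurable]: "D \<in> sets borel" by simp
    have "emeasure ?l D = (\<integral>\<^sup>+u. indicator D u \<partial>?l)" by simp
    also have "\<dots> = (\<integral>\<^sup>+w. indicator (G \<inter> hits j) w * indicator D (Y (Suc j) w) \<partial>PP \<pi>)"
      by (subst nn_integral_distr) (auto simp: nn_integral_density)
    also have "\<dots> = (\<integral>\<^sup>+w. indicator {w\<in>space Om'. w \<in> G \<inter> hits j \<and> Y (Suc j) w \<in> D} w \<partial>PP \<pi>)"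
      by (intro nn_integral_cong) (auto simp: indicator_def space_PP[OF \<pi>])
    also have "\<dots> = emeasure (PP \<pi>) {w\<in>space Om'. w \<in> G \<inter> hits j \<and> Y (Suc j) w \<in> D}"
    proof (rule nn_integral_indicator)
      have "{w\<in>space Om'. w \<in> G \<inter> hits j \<and> Y (Suc j) w \<in> D} = (G \<inter> hits j) \<inter> (Y (Suc j) -` D \<inter> space (PP \<pi>))"
        by (auto simp: space_PP[OF \<pi>])
      also have "\<dots> \<in> sets (PP \<pi>)" by measurable
      finally show "{w\<in>space Om'. w \<in> G \<inter> hits j \<and> Y (Suc j) w \<in> D} \<in> sets (PP \<pi>)" .
    qed
    finally show "emeasure ?l D = emeasure ?r D" using em[OF D] tot by simp
  qed (simp add: nu_borel)
  then have "(\<integral>\<^sup>+x. g x \<partial>?l) = (\<integral>\<^sup>+x. g x \<partial>?r)" by simp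
  moreover have "(\<integral>\<^sup>+x. g x \<partial>?l) = (\<integral>\<^sup>+w. indicator (G \<inter> hits j) w * g (Y (Suc j) w) \<partial>PP \<pi>)"
    using g by (subst nn_integral_distr) (auto simp: nn_integral_density)
  moreover have "(\<integral>\<^sup>+x. g x \<partial>?r) = emeasure (PP \<pi>) (G \<inter> hits j) * (\<integral>\<^sup>+x. g x \<partial>\<nu>)"
    using g nu_borel by (intro nn_integral_scale_measure) (simp cong: measurable_cong_sets)
  ultimately show ?thesis by simp
qed

lemma markov_seq_start:
  assumes M: "markov_seq S U" and \<pi>: "\<pi> \<in> inits" and \<psi>: "\<psi> \<in> borel_measurable S"
  shows "(\<integral>\<^sup>+w. \<psi> (U 0 w) \<partial>PP \<pi>) = (\<integral>\<^sup>+x. (\<integral>\<^sup>+u. \<psi> u \<partial>start_law S U x) \<partial>\<pi>)"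
proof -
  have "space Om' \<in> sets (F 0)" using sets.top[of "F 0"] by simp
  from markov_seq_nn[OF M \<pi> this \<psi>]
  have "(\<integral>\<^sup>+w. indicator (space (PP \<pi>)) w * \<psi> (U 0 w) \<partial>PP \<pi>) =
    (\<integral>\<^sup>+w. indicator (space (PP \<pi>)) w * (\<integral>\<^sup>+u. \<psi> u \<partial>start_law S U (Y 0 w)) \<partial>PP \<pi>)"
    by (simp add: space_PP[OF \<pi>])
  then have "(\<integral>\<^sup>+w. \<psi> (U 0 w) \<partial>PP \<pi>) = (\<integral>\<^sup>+w. (\<integral>\<^sup>+u. \<psi> u \<partial>start_law S U (Y 0 w)) \<partial>PP \<pi>)"
    by (simp cong: nn_integral_cong_simp)
  then show ?thesis using nn_integral_Y0[OF \<pi> markov_seq_kernel_nn[OF M \<psi>]] by simp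
qed

text \<open>The Markov property at \<open>T (j+1)\<close> is combined with \<open>hit_law\<close>
  for the position there; averaging the kernel over \<open>\<nu>\<close> gives the process started
  from \<open>\<nu>\<close>.\<close>

lemma regeneration:
  assumes M: "markov_seq S U" and \<pi>: "\<pi> \<in> inits" and G: "G \<in> sets (F j)" and \<psi>: "\<psi> \<in> borel_measurable S"
  shows "(\<integral>\<^sup>+w. indicator (G \<inter> hits j) w * \<psi> (U (Suc j) w) \<partial>PP \<pi>) =
    emeasure (PP \<pi>) (G \<inter> hits j) * (\<integral>\<^sup>+w. \<psi> (U 0 w) \<partial>PP \<nu>)"
proof -
  have "G \<inter> hits j \<in> sets (F (Suc j))" using G F_Suc[of j] hits_F[of j "Suc j"] by auto
  from markov_seq_nn[OF M \<pi> this \<psi>] hit_law[OF \<pi> G markov_seq_kernel_nn[OF M \<psi>]]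
    markov_seq_start[OF M nu_inits \<psi>]
  show ?thesis by simp
qed

end

section \<open>Waiting times\<close>

text \<open>Two upper bounds whose finite sums agree are both attained; this turns one-sided
  estimates for an event and its complement into equalities.\<close>

lemma ennreal_add_eq_imp_eq:
  fixes x y x' y' :: ennreal
  assumes "x \<le> x'" "y \<le> y'" "x + y = x' + y'" "x' + y' < \<infinity>"
  shows "x = x'"
proof (rule antisym[OF assms(1)])
  have "x' + y' \<le> x + y'" using assms(2,3) by (metis add_left_mono)
  moreover have "y' < \<infinity>" using assms(4) by (cases y') auto
  ultimately show "x' \<le> x" by (metis add.commute ennreal_add_left_cancel_le infinity_ennreal_def not_less_iff_gr_or_eq)
qed

lemma ennreal_cancel_divide:
  fixes r :: ennreal
  assumes "r \<noteq> 0" "r \<noteq> \<infinity>"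
  shows "r * (e * (x / r)) = e * x"
proof -
  have "r * (e * (x / r)) = (e * x) * r / r"
    by (simp add: ennreal_times_divide ac_simps)
  also have "\<dots> = e * x" using assms by (intro mult_divide_eq_ennreal) auto
  finally show ?thesis .
qed

context nummelin_splitting
begin

lemma AE_Y0_return: "AE w in PP (return borel x). Y 0 w = x"
proof -
  have [measurable]: "Z1 Z 0 \<in> PP (return borel x) \<rightarrow>\<^sub>M borel"
    by (rule measurable_PP[OF return_inits Z1_measurable]) simp
  have "AE y in distr (PP (return borel x)) borel (Z1 Z 0). y = x"
    unfolding initial_law[OF return_inits] by (subst AE_return) auto
  then have "AE w in PP (return borel x). Z1 Z 0 w = x"
    by (subst (asm) AE_distr_iff) auto
  with AE_space show ?thesis by eventually_elim (simp add: space_PP[OF return_inits] T_0)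
qed

text \<open>The uniform variable is integrated out, and by \<open>split_mass_UNIV\<close> the
  resolvent density remains.\<close>

lemma Z3_law:
  assumes \<pi>: "\<pi> \<in> inits" and G: "G \<in> sets (F n)" and \<psi>[measurable]: "\<psi> \<in> borel_measurable (borel \<Otimes>\<^sub>M borel)"
  shows "(\<integral>\<^sup>+w. indicator G w * \<psi> (Y n w, Z3 Z (T n w) w) \<partial>PP \<pi>) =
    (\<integral>\<^sup>+w. indicator G w * (\<integral>\<^sup>+x'. resolvent_density p (Y n w) x' * \<psi> (Y n w, x') \<partial>\<Lambda>) \<partial>PP \<pi>)"
proof -
  define \<psi>' :: "'e \<times> real \<times> 'e \<Rightarrow> ennreal" where "\<psi>' z = \<psi> (fst z, snd (snd z))" for z
  have \<psi>': "\<psi>' \<in> borel_measurable SZ" unfolding \<psi>'_def by measurable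
  \<comment> \<open>The kernel is computed for the start in a point, where \<open>Y 0\<close> is
    almost surely constant.\<close>
  have K: "(\<integral>\<^sup>+z. \<psi>' z \<partial>start_law SZ (\<lambda>n w. Z (T n w) w) x) = (\<integral>\<^sup>+x'. resolvent_density p x x' * \<psi> (x, x') \<partial>\<Lambda>)" for x
  proof -
    let ?R = "return borel x"
    note [measurable] = resolvent_density_measurable1
    have Z3m: "(\<lambda>w. Z3 Z (T 0 w) w) \<in> PP ?R \<rightarrow>\<^sub>M borel"
      by (rule measurable_PP[OF return_inits]) (use Z_T_measurable[of 0] in measurable)
    have "distr (PP ?R) borel (\<lambda>w. Z3 Z (T 0 w) w) = resolvent_kernel P X x"
    proof (rule measure_eqI)
      fix D assume "D \<in> sets (distr (PP ?R) borel (\<lambda>w. Z3 Z (T 0 w) w))"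
      then have D: "D \<in> sets borel" by simp
      have top: "space Om' \<in> sets (F 0)" using sets.top[of "F 0"] by simp
      have "emeasure (distr (PP ?R) borel (\<lambda>w. Z3 Z (T 0 w) w)) D =
          emeasure (PP ?R) {w \<in> space Om'. Z2 Z (T 0 w) w \<in> UNIV \<and> Z3 Z (T 0 w) w \<in> D}"
        using D by (subst emeasure_distr[OF Z3m]) (auto simp: space_PP[OF return_inits] intro!: arg_cong[where f = "emeasure _"])
      also have "\<dots> = (\<integral>\<^sup>+w. split_mass (Y 0 w) UNIV D * indicator (space Om') w \<partial>PP ?R)"
        by (subst split_law[OF return_inits top]) (use D in \<open>auto simp: split_mass_def\<close>)
      also have "\<dots> = (\<integral>\<^sup>+w. emeasure (resolvent_kernel P X x) D \<partial>PP ?R)"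
        by (intro nn_integral_cong_AE) (use AE_Y0_return AE_space in eventually_elim, simp add: space_PP[OF return_inits] split_mass_UNIV[OF D])
      also have "\<dots> = emeasure (resolvent_kernel P X x) D"
        using prob_space.emeasure_space_1[OF PP_prob_space[OF return_inits]] by simp
      finally show "emeasure (distr (PP ?R) borel (\<lambda>w. Z3 Z (T 0 w) w)) D = emeasure (resolvent_kernel P X x) D" .
    qed simp
    then have "(\<integral>\<^sup>+x'. \<psi> (x, x') \<partial>distr (PP ?R) borel (\<lambda>w. Z3 Z (T 0 w) w)) = (\<integral>\<^sup>+x'. resolvent_density p x x' * \<psi> (x, x') \<partial>\<Lambda>)"
      by (simp add: resolvent_kernel_eq nn_integral_density)
    moreover have "(\<integral>\<^sup>+x'. \<psi> (x, x') \<partial>distr (PP ?R) borel (\<lambda>w. Z3 Z (T 0 w) w)) = (\<integral>\<^sup>+w. \<psi> (x, Z3 Z (T 0 w) w) \<partial>PP ?R)"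
      by (rule nn_integral_distr[OF Z3m]) measurable
    moreover have "(\<integral>\<^sup>+z. \<psi>' z \<partial>start_law SZ (\<lambda>n w. Z (T n w) w) x) = (\<integral>\<^sup>+w. \<psi>' (Z (T 0 w) w) \<partial>PP ?R)"
      by (rule start_law_nn[OF Z_T_measurable \<psi>'])
    moreover have "\<dots> = (\<integral>\<^sup>+w. \<psi> (x, Z3 Z (T 0 w) w) \<partial>PP ?R)"
      by (intro nn_integral_cong_AE) (use AE_Y0_return in eventually_elim, simp add: \<psi>'_def)
    ultimately show ?thesis by simp
  qed
  show ?thesis
    using markov_seq_nn[OF markov_seq_Z \<pi> G \<psi>'] unfolding K by (simp add: \<psi>'_def)
qed

definition exp_mass :: "real set \<Rightarrow> ennreal" where
  "exp_mass B = (\<integral>\<^sup>+t. indicator (B \<inter> {0<..}) t * ennreal (exp (- t)) \<partial>lborel)"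

text \<open>The denominator of the waiting density cancels against the law of \<open>Z3\<close>, and
  integrating the transition density over the end point leaves \<open>exp (- t)\<close>. The
  conventions for a vanishing or infinite denominator concern sets that this law does not
  charge.\<close>

lemma wait_mass_resolvent:
  assumes B[measurable]: "B \<in> sets borel"
  shows "(\<integral>\<^sup>+x'. resolvent_density p x x' * wait_mass x x' B \<partial>\<Lambda>) = exp_mass B"
proof -
  interpret L: sigma_finite_measure \<Lambda> by (rule \<Lambda>_sigma_finite)
  interpret pair_sigma_finite lborel \<Lambda> ..
  note [measurable] = resolvent_density_measurable1
  have [measurable]: "(\<lambda>z. pos_density (fst z) x (snd z)) \<in> borel_measurable (lborel \<Otimes>\<^sub>M \<Lambda>)"
    by (rule pos_density_measurable; measurable)
  have [measurable]: "(\<lambda>y. pos_density t x y) \<in> borel_measurable \<Lambda>"  "(\<lambda>s. pos_density s x z) \<in> borel_measurable lborel" for t z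
    by (rule pos_density_measurable; measurable)+
  have [measurable]: "(\<lambda>t. indicator {0<..} t * waiting_density p x z t) \<in> borel_measurable lborel" for z
    by (rule waiting_density_measurable; measurable)
  have wm: "wait_mass x z B = (\<integral>\<^sup>+t. indicator B t * (indicator {0<..} t * waiting_density p x z t) \<partial>lborel)" for z
    unfolding wait_mass_def by (intro nn_integral_cong) (auto simp: indicator_def)
  have "AE x' in \<Lambda>. resolvent_density p x x' \<noteq> \<infinity>"
    by (rule nn_integral_PInf_AE) (auto simp: resolvent_density_total)
  then have "(\<integral>\<^sup>+x'. resolvent_density p x x' * wait_mass x x' B \<partial>\<Lambda>) =
     (\<integral>\<^sup>+x'. (\<integral>\<^sup>+t. indicator (B \<inter> {0<..}) t * (ennreal (exp (- t)) * ennreal (pos_density t x x')) \<partial>lborel) \<partial>\<Lambda>)"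
  proof (intro nn_integral_cong_AE, eventually_elim)
    fix x' assume fin: "resolvent_density p x x' \<noteq> \<infinity>"
    show "resolvent_density p x x' * wait_mass x x' B =
      (\<integral>\<^sup>+t. indicator (B \<inter> {0<..}) t * (ennreal (exp (- t)) * ennreal (pos_density t x x')) \<partial>lborel)"
    proof (cases "resolvent_density p x x' = 0")
      case True
      have "(\<integral>\<^sup>+t. indicator (B \<inter> {0<..}) t * (ennreal (exp (- t)) * ennreal (pos_density t x x')) \<partial>lborel) \<le> resolvent_density p x x'"
        unfolding resolvent_density_eq by (intro nn_integral_mono) (auto simp: indicator_def)
      then show ?thesis using True by simp
    next
      case False
      have "resolvent_density p x x' * wait_mass x x' B = (\<integral>\<^sup>+t. resolvent_density p x x' * (indicator B t * (indicator {0<..} t * waiting_density p x x' t)) \<partial>lborel)"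
        unfolding wm by (rule nn_integral_cmult[symmetric]) measurable
      also have "\<dots> = (\<integral>\<^sup>+t. indicator (B \<inter> {0<..}) t * (ennreal (exp (- t)) * ennreal (pos_density t x x')) \<partial>lborel)"
        using fin False
        by (intro nn_integral_cong)
          (auto simp: indicator_def waiting_density_eq ennreal_cancel_divide)
      finally show ?thesis .
    qed
  qed
  also have "\<dots> = (\<integral>\<^sup>+t. (\<integral>\<^sup>+x'. indicator (B \<inter> {0<..}) t * (ennreal (exp (- t)) * ennreal (pos_density t x x')) \<partial>\<Lambda>) \<partial>lborel)"
    by (rule Fubini') (simp add: split_beta')
  also have "\<dots> = exp_mass B"
    unfolding exp_mass_def
    by (intro nn_integral_cong) (auto simp: indicator_def nn_integral_cmult pos_density_total)
  finally show ?thesis .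
qed

text \<open>\<open>G\<close> lies in the past before \<open>Z3\<close> is drawn; given
  \<open>Z3\<close> as well, the waiting time need not be exponential.\<close>

lemma wait_law:
  assumes \<pi>: "\<pi> \<in> inits" and G: "G \<in> sets (F n)" and B[measurable]: "B \<in> sets borel"
  shows "(\<integral>\<^sup>+w. indicator G w * indicator B (wait n w) \<partial>PP \<pi>) = emeasure (PP \<pi>) G * exp_mass B"
proof -
  have sub: "G \<subseteq> space Om'" using sets.sets_into_space[OF G] by simp
  have Gm[measurable]: "G \<in> sets (PP \<pi>)" using F_into_Om'[OF G] by (simp add: sets_PP[OF \<pi>])
  have wm: "wait n \<in> PP \<pi> \<rightarrow>\<^sub>M borel" by (rule measurable_PP[OF \<pi> wait_measurable])
  have "(\<integral>\<^sup>+w. indicator G w * indicator B (wait n w) \<partial>PP \<pi>) = (\<integral>\<^sup>+w. indicator (G \<inter> (wait n -` B \<inter> space (PP \<pi>))) w \<partial>PP \<pi>)"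
    by (intro nn_integral_cong) (auto simp: indicator_def)
  also have "\<dots> = emeasure (PP \<pi>) (G \<inter> (wait n -` B \<inter> space (PP \<pi>)))"
    using measurable_sets[OF wm B] by (intro nn_integral_indicator) auto
  also have "G \<inter> (wait n -` B \<inter> space (PP \<pi>)) = {w \<in> G. wait n w \<in> B \<and> sum_list (map fst ([] :: (real \<times> 'e set) list)) < wait n w \<and>
        (\<forall>j < length ([] :: (real \<times> 'e set) list). Z1 Z (T n w + sum_list (map fst (take (Suc j) ([] :: (real \<times> 'e set) list)))) w \<in> snd (([] :: (real \<times> 'e set) list) ! j))}"
    using wait_pos sub by (auto simp: space_PP[OF \<pi>])
  also have "emeasure (PP \<pi>) \<dots> = (\<integral>\<^sup>+w. indicator G w * wait_mass (Y n w) (Z3 Z (T n w) w) B \<partial>PP \<pi>)"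
    by (subst bridge_law[OF \<pi> F_past_at[OF G] B]) (auto simp: wait_mass_def mult.commute)
  also have "\<dots> = (\<integral>\<^sup>+w. indicator G w * exp_mass B \<partial>PP \<pi>)"
  proof -
    have "(\<lambda>z. wait_mass (fst z) (snd z) B) \<in> borel_measurable (borel \<Otimes>\<^sub>M borel)"
      using measurable_compose[OF _ wait_mass_measurable[OF B], of "\<lambda>z. (fst z, 0, snd z)" "borel \<Otimes>\<^sub>M borel"] by simp
    from Z3_law[OF \<pi> G this] show ?thesis by (simp add: wait_mass_resolvent[OF B])
  qed
  also have "\<dots> = emeasure (PP \<pi>) G * exp_mass B"
    by (simp add: nn_integral_multc)
  finally show ?thesis .
qed

lemma exp_mass_shift:
  assumes [measurable]: "B \<in> sets borel" and s: "0 \<le> s"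
  shows "exp_mass {t. s < t \<and> t - s \<in> B} = ennreal (exp (- s)) * exp_mass B"
proof -
  have "exp_mass {t. s < t \<and> t - s \<in> B} = (\<integral>\<^sup>+t. indicator ({t. s < t \<and> t - s \<in> B} \<inter> {0<..}) (s + 1 * t) * ennreal (exp (- (s + 1 * t))) \<partial>lborel)"
  proof -
    have [measurable]: "{t. s < t \<and> t - s \<in> B} \<in> sets borel"
    proof -
      have "{t \<in> space borel. s < t \<and> t - s \<in> B} \<in> sets borel" by measurable
      then show ?thesis by simp
    qed
    have "(\<lambda>t. indicator ({t. s < t \<and> t - s \<in> B} \<inter> {0<..}) t * ennreal (exp (- t))) \<in> borel_measurable borel"
      by measurable
    from nn_integral_real_affine[OF this, of 1 s] show ?thesis unfolding exp_mass_def by simp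
  qed
  also have "\<dots> = (\<integral>\<^sup>+t. ennreal (exp (- s)) * (indicator (B \<inter> {0<..}) t * ennreal (exp (- t))) \<partial>lborel)"
    using s by (intro nn_integral_cong) (auto simp: indicator_def exp_diff exp_minus ennreal_mult[symmetric] field_simps)
  also have "\<dots> = ennreal (exp (- s)) * exp_mass B"
    unfolding exp_mass_def by (rule nn_integral_cmult) measurable
  finally show ?thesis .
qed

lemma exp_mass_UNIV: "exp_mass UNIV = 1"
  using nn_integral_exp[of 0 1] by (simp add: exp_mass_def)

text \<open>The bridge density multiplied by the resolvent density; the densities cancel except where the
  resolvent density is \<open>0\<close> or \<open>\<infinity>\<close>, which the law of \<open>Z\<^sup>3\<close> does not charge.\<close>

lemma bridge_position_le:
  assumes \<pi>: "\<pi> \<in> inits" and G: "G \<in> sets (F n)" and s: "0 < s"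
    and A[measurable]: "A \<in> sets borel" and B[measurable]: "B \<in> sets borel"
  shows "(\<integral>\<^sup>+w. indicator G w * (indicator (B \<inter> {s<..}) (wait n w) * indicator A (Z1 Z (T n w + s) w)) \<partial>PP \<pi>) \<le>
    (\<integral>\<^sup>+w. indicator G w * (emeasure (trans_kernel P X s (Y n w)) A * exp_mass (B \<inter> {s<..})) \<partial>PP \<pi>)"
proof -
  interpret L: sigma_finite_measure \<Lambda> by (rule \<Lambda>_sigma_finite)
  interpret LL: pair_sigma_finite \<Lambda> \<Lambda> ..
  interpret BL: pair_sigma_finite lborel \<Lambda> ..
  have sub: "G \<subseteq> space Om'" using sets.sets_into_space[OF G] by simp
  have Gm[measurable]: "G \<in> sets (PP \<pi>)" using F_into_Om'[OF G] by (simp add: sets_PP[OF \<pi>])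
  have wm: "wait n \<in> PP \<pi> \<rightarrow>\<^sub>M borel" by (rule measurable_PP[OF \<pi> wait_measurable])
  have zm: "(\<lambda>w. Z1 Z (T n w + s) w) \<in> PP \<pi> \<rightarrow>\<^sub>M borel"
    by (rule measurable_PP[OF \<pi> Z1_sample_measurable]) (use s T_measurable[of n] T_nonneg in \<open>auto intro: add_nonneg_nonneg\<close>)
  note [measurable] = resolvent_density_measurable1
  define J where "J t x x' = (\<integral>\<^sup>+y. indicator A y * (ennreal (pos_density s x y) * ennreal (pos_density (t - s) y x')) \<partial>\<Lambda>)" for t x x'
  have Jm: "(\<lambda>z. J (t z) (x z) (x' z)) \<in> borel_measurable N"
    if [measurable]: "t \<in> N \<rightarrow>\<^sub>M borel" "x \<in> N \<rightarrow>\<^sub>M borel" "x' \<in> N \<rightarrow>\<^sub>M borel" for t x x' and N :: "'n measure"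
  proof -
    have [measurable]: "(\<lambda>zy. pos_density s (x (fst zy)) (snd zy)) \<in> borel_measurable (N \<Otimes>\<^sub>M \<Lambda>)"
      "(\<lambda>zy. pos_density (t (fst zy) - s) (snd zy) (x' (fst zy))) \<in> borel_measurable (N \<Otimes>\<^sub>M \<Lambda>)"
      by (rule pos_density_measurable; measurable)+
    show ?thesis unfolding J_def
      by (rule L.borel_measurable_nn_integral) (simp add: split_beta')
  qed
  \<comment> \<open>The value \<infinity> makes the pointwise bound trivial where the bridge is
    degenerate. Multiplied by \<open>resolvent_density\<close> it gives 0 where that density
    vanishes, and the density is infinite on a null set only.\<close>
  define h where "h x x' = (if resolvent_density p x x' = 0 \<or> resolvent_density p x x' = \<infinity> then \<infinity>
     else (\<integral>\<^sup>+t. indicator (B \<inter> {s<..}) t * (ennreal (exp (- t)) * J t x x') \<partial>lborel) / resolvent_density p x x')" for x x'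
  have hm: "(\<lambda>z. h (fst z) (snd z)) \<in> borel_measurable (borel \<Otimes>\<^sub>M borel)"
  proof -
    have [measurable]: "(\<lambda>zt. J (snd zt) (fst (fst zt)) (snd (fst zt))) \<in> borel_measurable ((borel \<Otimes>\<^sub>M borel) \<Otimes>\<^sub>M lborel)"
      by (rule Jm) measurable
    have [measurable]: "(\<lambda>z. resolvent_density p (fst z) (snd z)) \<in> borel_measurable (borel \<Otimes>\<^sub>M borel)"
      by (rule resolvent_density_measurable) auto
    have [measurable]: "(\<lambda>z. \<integral>\<^sup>+t. indicator (B \<inter> {s<..}) t * (ennreal (exp (- t)) * J t (fst z) (snd z)) \<partial>lborel) \<in> borel_measurable (borel \<Otimes>\<^sub>M borel)"
      by (rule lborel.borel_measurable_nn_integral) (simp add: split_beta')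
    show ?thesis unfolding h_def by measurable
  qed
  have le: "(\<integral>\<^sup>+t\<in>B \<inter> {s<..}. waiting_density p x x' t * bridge_fdd \<Lambda> p x0 [(s, A)] x t x' \<partial>lborel) \<le> h x x'" for x x'
  proof (cases "resolvent_density p x x' = 0 \<or> resolvent_density p x x' = \<infinity>")
    case False
    have jm: "(\<lambda>t. J t x x') \<in> borel_measurable lborel" by (rule Jm) measurable
    have "(\<integral>\<^sup>+t\<in>B \<inter> {s<..}. waiting_density p x x' t * bridge_fdd \<Lambda> p x0 [(s, A)] x t x' \<partial>lborel) \<le>
      (\<integral>\<^sup>+t. (indicator (B \<inter> {s<..}) t * (ennreal (exp (- t)) * J t x x')) / resolvent_density p x x' \<partial>lborel)"
    proof (intro nn_integral_mono)
      fix t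
      show "waiting_density p x x' t * bridge_fdd \<Lambda> p x0 [(s, A)] x t x' * indicator (B \<inter> {s<..}) t \<le>
        (indicator (B \<inter> {s<..}) t * (ennreal (exp (- t)) * J t x x')) / resolvent_density p x x'"
      proof (cases "t \<in> B \<and> s < t")
        case True
        then have ts: "s < t" "0 < t" "0 < t - s" using s by auto
        show ?thesis
        proof (cases "p t x x' = 0")
          \<comment> \<open>The waiting density vanishes as well, so the default point of the bridge
            is immaterial.\<close>
          case z: True
          have "waiting_density p x x' t = 0"
            using False ts z by (simp add: waiting_density_eq pos_density_def)
          then show ?thesis by simp
        next
          case nz: False
          then have ppos: "0 < p t x x'" using p_nonneg[OF ts(2), of x x'] by simp
          have [measurable]: "(\<lambda>y. pos_density s x y) \<in> borel_measurable \<Lambda>" "(\<lambda>y. pos_density (t - s) y x') \<in> borel_measurable \<Lambda>"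
            by (rule pos_density_measurable; measurable)+
          have "bridge_fdd \<Lambda> p x0 [(s, A)] x t x' = (\<integral>\<^sup>+y. indicator A y \<partial>density \<Lambda> (\<lambda>y. ennreal (pos_density s x y * pos_density (t - s) y x' / p t x x')))"
            using nz ts s by (simp add: bridge_step_def pos_density_def)
          also have "\<dots> = (\<integral>\<^sup>+y. ennreal (pos_density s x y * pos_density (t - s) y x' / p t x x') * indicator A y \<partial>\<Lambda>)"
            by (rule nn_integral_density) measurable
          also have "\<dots> = (\<integral>\<^sup>+y. ennreal (1 / p t x x') * (indicator A y * (ennreal (pos_density s x y) * ennreal (pos_density (t - s) y x'))) \<partial>\<Lambda>)"
            using ppos by (intro nn_integral_cong)
              (simp add: indicator_def pos_density_nonneg ennreal_mult[symmetric] field_simps)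
          also have "\<dots> = ennreal (1 / p t x x') * J t x x'"
            unfolding J_def by (rule nn_integral_cmult) measurable
          finally have b: "bridge_fdd \<Lambda> p x0 [(s, A)] x t x' = ennreal (1 / p t x x') * J t x x'" .
          have "waiting_density p x x' t = ennreal (exp (- t)) * (ennreal (p t x x') / resolvent_density p x x')"
            using False ts by (auto simp: waiting_density_eq pos_density_def)
          then have "waiting_density p x x' t * bridge_fdd \<Lambda> p x0 [(s, A)] x t x' =
             (ennreal (p t x x') * ennreal (1 / p t x x')) * (ennreal (exp (- t)) * J t x x' / resolvent_density p x x')"
            unfolding b by (simp add: divide_ennreal_def ac_simps)
          also have "ennreal (p t x x') * ennreal (1 / p t x x') = 1"
            using ppos by (simp add: ennreal_mult[symmetric])
          finally show ?thesis using True by simp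
        qed
      qed auto
    qed
    also have "\<dots> = h x x'"
      using False jm unfolding h_def by (subst nn_integral_divide) auto
    finally show ?thesis .
  qed (simp add: h_def)
  have bound: "(\<integral>\<^sup>+x'. resolvent_density p x x' * h x x' \<partial>\<Lambda>) \<le> emeasure (trans_kernel P X s x) A * exp_mass (B \<inter> {s<..})" for x
  proof -
    have [measurable]: "(\<lambda>z. J (fst z) x (snd z)) \<in> borel_measurable (lborel \<Otimes>\<^sub>M \<Lambda>)"
      by (rule Jm) measurable
    have [measurable]: "(\<lambda>y. pos_density s x y) \<in> borel_measurable \<Lambda>" "(\<lambda>y. pos_density t y z) \<in> borel_measurable \<Lambda>"
      "(\<lambda>y. pos_density t z y) \<in> borel_measurable \<Lambda>" for t z
      by (rule pos_density_measurable; measurable)+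
    have [measurable]: "(\<lambda>z. pos_density s x (fst z)) \<in> borel_measurable (\<Lambda> \<Otimes>\<^sub>M \<Lambda>)"
      "(\<lambda>z. pos_density t (fst z) (snd z)) \<in> borel_measurable (\<Lambda> \<Otimes>\<^sub>M \<Lambda>)" for t
      by (rule pos_density_measurable; measurable)+
    \<comment> \<open>After the exchange the end point is integrated first and contributes total
      mass 1; the law of the intermediate position is left.\<close>
    have Jint: "(\<integral>\<^sup>+x'. J t x x' \<partial>\<Lambda>) = emeasure (trans_kernel P X s x) A" if t: "s < t" for t
    proof -
      have "(\<integral>\<^sup>+x'. J t x x' \<partial>\<Lambda>) = (\<integral>\<^sup>+y. (\<integral>\<^sup>+x'. indicator A y * (ennreal (pos_density s x y) * ennreal (pos_density (t - s) y x')) \<partial>\<Lambda>) \<partial>\<Lambda>)"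
        unfolding J_def by (rule LL.Fubini') (simp add: split_beta')
      also have "\<dots> = (\<integral>\<^sup>+y. ennreal (pos_density s x y) * indicator A y \<partial>\<Lambda>)"
      proof (intro nn_integral_cong)
        fix y
        have "(\<integral>\<^sup>+x'. indicator A y * (ennreal (pos_density s x y) * ennreal (pos_density (t - s) y x')) \<partial>\<Lambda>) =
          (\<integral>\<^sup>+x'. (ennreal (pos_density s x y) * indicator A y) * ennreal (pos_density (t - s) y x') \<partial>\<Lambda>)"
          by (simp only: ac_simps)
        also have "\<dots> = (ennreal (pos_density s x y) * indicator A y) * (\<integral>\<^sup>+x'. ennreal (pos_density (t - s) y x') \<partial>\<Lambda>)"
          by (rule nn_integral_cmult) measurable
        finally show "(\<integral>\<^sup>+x'. indicator A y * (ennreal (pos_density s x y) * ennreal (pos_density (t - s) y x')) \<partial>\<Lambda>) =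
          ennreal (pos_density s x y) * indicator A y"
          using t by (simp add: pos_density_total)
      qed
      finally show ?thesis using s by (simp add: emeasure_trans_kernel)
    qed
    have "AE x' in \<Lambda>. resolvent_density p x x' \<noteq> \<infinity>"
      by (rule nn_integral_PInf_AE) (auto simp: resolvent_density_total)
    then have "(\<integral>\<^sup>+x'. resolvent_density p x x' * h x x' \<partial>\<Lambda>) \<le>
       (\<integral>\<^sup>+x'. (\<integral>\<^sup>+t. indicator (B \<inter> {s<..}) t * (ennreal (exp (- t)) * J t x x') \<partial>lborel) \<partial>\<Lambda>)"
    proof (intro nn_integral_mono_AE, eventually_elim)
      fix x' assume "resolvent_density p x x' \<noteq> \<infinity>"
      then show "resolvent_density p x x' * h x x' \<le> (\<integral>\<^sup>+t. indicator (B \<inter> {s<..}) t * (ennreal (exp (- t)) * J t x x') \<partial>lborel)"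
        unfolding h_def using ennreal_cancel_divide[of "resolvent_density p x x'" 1] by auto
    qed
    also have "\<dots> = (\<integral>\<^sup>+t. (\<integral>\<^sup>+x'. indicator (B \<inter> {s<..}) t * (ennreal (exp (- t)) * J t x x') \<partial>\<Lambda>) \<partial>lborel)"
      by (rule BL.Fubini') (simp add: split_beta')
    also have "\<dots> = (\<integral>\<^sup>+t. emeasure (trans_kernel P X s x) A * (indicator ((B \<inter> {s<..}) \<inter> {0<..}) t * ennreal (exp (- t))) \<partial>lborel)"
    proof (intro nn_integral_cong)
      fix t
      have [measurable]: "(\<lambda>x'. J t x x') \<in> borel_measurable \<Lambda>" by (rule Jm) measurable
      show "(\<integral>\<^sup>+x'. indicator (B \<inter> {s<..}) t * (ennreal (exp (- t)) * J t x x') \<partial>\<Lambda>) =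
        emeasure (trans_kernel P X s x) A * (indicator ((B \<inter> {s<..}) \<inter> {0<..}) t * ennreal (exp (- t)))"
        using s by (auto simp: indicator_def nn_integral_cmult Jint mult.commute)
    qed
    also have "\<dots> = emeasure (trans_kernel P X s x) A * exp_mass (B \<inter> {s<..})"
      unfolding exp_mass_def by (rule nn_integral_cmult) measurable
    finally show ?thesis .
  qed
  have "(\<integral>\<^sup>+w. indicator G w * (indicator (B \<inter> {s<..}) (wait n w) * indicator A (Z1 Z (T n w + s) w)) \<partial>PP \<pi>) =
     (\<integral>\<^sup>+w. indicator (G \<inter> (wait n -` (B \<inter> {s<..}) \<inter> space (PP \<pi>)) \<inter> ((\<lambda>w. Z1 Z (T n w + s) w) -` A \<inter> space (PP \<pi>))) w \<partial>PP \<pi>)"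
    by (intro nn_integral_cong) (auto simp: indicator_def)
  also have "\<dots> = emeasure (PP \<pi>) (G \<inter> (wait n -` (B \<inter> {s<..}) \<inter> space (PP \<pi>)) \<inter> ((\<lambda>w. Z1 Z (T n w + s) w) -` A \<inter> space (PP \<pi>)))"
    using measurable_sets[OF wm, of "B \<inter> {s<..}"] measurable_sets[OF zm A] by (intro nn_integral_indicator) auto
  also have "G \<inter> (wait n -` (B \<inter> {s<..}) \<inter> space (PP \<pi>)) \<inter> ((\<lambda>w. Z1 Z (T n w + s) w) -` A \<inter> space (PP \<pi>)) =
     {w \<in> G. wait n w \<in> B \<and> sum_list (map fst [(s, A)]) < wait n w \<and>
        (\<forall>j < length [(s, A)]. Z1 Z (T n w + sum_list (map fst (take (Suc j) [(s, A)]))) w \<in> snd ([(s, A)] ! j))}"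
    using sub by (auto simp: space_PP[OF \<pi>])
  also have "emeasure (PP \<pi>) \<dots> = (\<integral>\<^sup>+w\<in>G. (\<integral>\<^sup>+t\<in>B \<inter> {sum_list (map fst [(s, A)])<..}.
      waiting_density p (Y n w) (Z3 Z (T n w) w) t * bridge_fdd \<Lambda> p x0 [(s, A)] (Y n w) t (Z3 Z (T n w) w) \<partial>lborel) \<partial>PP \<pi>)"
    by (rule bridge_law[OF \<pi> F_past_at[OF G] B]) (use s in auto)
  also have "\<dots> \<le> (\<integral>\<^sup>+w. indicator G w * h (Y n w) (Z3 Z (T n w) w) \<partial>PP \<pi>)"
    using le by (intro nn_integral_mono) (auto simp: indicator_def simp del: bridge_fdd.simps)
  also have "\<dots> = (\<integral>\<^sup>+w. indicator G w * (\<integral>\<^sup>+x'. resolvent_density p (Y n w) x' * h (Y n w) x' \<partial>\<Lambda>) \<partial>PP \<pi>)"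
    using Z3_law[OF \<pi> G hm] by simp
  also have "\<dots> \<le> (\<integral>\<^sup>+w. indicator G w * (emeasure (trans_kernel P X s (Y n w)) A * exp_mass (B \<inter> {s<..})) \<partial>PP \<pi>)"
    using bound by (intro nn_integral_mono mult_left_mono) auto
  finally show ?thesis .
qed

end

section \<open>Memorylessness inside a waiting time\<close>

definition exp_law :: "real measure" where
  "exp_law = density lborel (\<lambda>r. indicator {0<..} r * ennreal (exp (- r)))"

lemma sets_exp_law[simp, measurable_cong]: "sets exp_law = sets borel"
  by (simp add: exp_law_def)

lemma space_exp_law[simp]: "space exp_law = UNIV"
  by (simp add: exp_law_def)

lemma nn_integral_exp_law:
  assumes [measurable]: "wt \<in> borel_measurable borel"
  shows "(\<integral>\<^sup>+r. wt r \<partial>exp_law) = (\<integral>\<^sup>+r. indicator {0<..} r * ennreal (exp (- r)) * wt r \<partial>lborel)"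
  unfolding exp_law_def by (rule nn_integral_density) measurable

lemma exp_law_shift:
  assumes [measurable]: "wt \<in> borel_measurable borel" and s: "0 \<le> s"
  shows "(\<integral>\<^sup>+r. indicator {s<..} r * wt (r - s) \<partial>exp_law) = ennreal (exp (- s)) * (\<integral>\<^sup>+r. wt r \<partial>exp_law)"
proof -
  have "(\<integral>\<^sup>+r. indicator {s<..} r * wt (r - s) \<partial>exp_law) =
    (\<integral>\<^sup>+r. indicator {0<..} r * ennreal (exp (- r)) * (indicator {s<..} r * wt (r - s)) \<partial>lborel)"
    by (rule nn_integral_exp_law) measurable
  also have "\<dots> = (\<integral>\<^sup>+r. indicator {0<..} (s + r) * ennreal (exp (- (s + r))) * (indicator {s<..} (s + r) * wt (s + r - s)) \<partial>lborel)"
  proof -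
    have "(\<lambda>r. indicator {0<..} r * ennreal (exp (- r)) * (indicator {s<..} r * wt (r - s))) \<in> borel_measurable borel"
      by measurable
    from nn_integral_real_affine[OF this, of 1 s] show ?thesis by simp
  qed
  also have "\<dots> = (\<integral>\<^sup>+r. ennreal (exp (- s)) * (indicator {0<..} r * ennreal (exp (- r)) * wt r) \<partial>lborel)"
  proof (intro nn_integral_cong)
    fix r :: real
    have "ennreal (exp (- (s + r))) = ennreal (exp (- s)) * ennreal (exp (- r))"
      by (simp add: ennreal_mult[symmetric] exp_add[symmetric])
    then show "indicator {0<..} (s + r) * ennreal (exp (- (s + r))) * (indicator {s<..} (s + r) * wt (s + r - s)) =
      ennreal (exp (- s)) * (indicator {0<..} r * ennreal (exp (- r)) * wt r)"
      using s by (cases "0 < r") (simp_all add: mult.assoc)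
  qed
  also have "\<dots> = ennreal (exp (- s)) * (\<integral>\<^sup>+r. wt r \<partial>exp_law)"
    by (subst nn_integral_cmult) (auto simp: nn_integral_exp_law)
  finally show ?thesis .
qed

context harris_process
begin

definition potential :: "('e \<Rightarrow> ennreal) \<Rightarrow> 'e \<Rightarrow> ennreal" where
  "potential g x = (\<integral>\<^sup>+y. resolvent_density p x y * g y \<partial>\<Lambda>)"

lemma potential_measurable:
  assumes [measurable]: "g \<in> borel_measurable borel"
  shows "potential g \<in> borel_measurable borel"
proof -
  interpret L: sigma_finite_measure \<Lambda> by (rule \<Lambda>_sigma_finite)
  have [measurable]: "(\<lambda>z. resolvent_density p (fst z) (snd z)) \<in> borel_measurable (borel \<Otimes>\<^sub>M \<Lambda>)"
    by (rule resolvent_density_measurable) auto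
  show ?thesis unfolding potential_def[abs_def]
    by (rule L.borel_measurable_nn_integral) (simp add: split_beta')
qed

end

context nummelin_splitting
begin

lemma emeasure_exp_law: "B \<in> sets borel \<Longrightarrow> emeasure exp_law B = exp_mass B"
  unfolding exp_law_def exp_mass_def
  by (subst emeasure_density) (auto intro!: nn_integral_cong simp: indicator_def)

lemma exp_law_prob: "prob_space exp_law"
  by (rule prob_spaceI) (simp add: emeasure_exp_law exp_mass_UNIV)

lemma exp_mass_above:
  assumes "0 \<le> s" shows "exp_mass (UNIV \<inter> {s<..}) = ennreal (exp (- s))"
proof -
  have "{t. s < t \<and> t - s \<in> UNIV} = UNIV \<inter> {s<..}" by auto
  then show ?thesis using exp_mass_shift[of UNIV s] assms by (simp add: exp_mass_UNIV)
qed

lemma exp_mass_le_1: "B \<in> sets borel \<Longrightarrow> exp_mass B \<le> 1"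
  using prob_space.emeasure_le_1[OF exp_law_prob, of B] by (simp add: emeasure_exp_law)

lemma emeasure_trans_kernel_measurable:
  assumes s: "0 < s" and [measurable]: "A \<in> sets borel"
  shows "(\<lambda>x. emeasure (trans_kernel P X s x) A) \<in> borel_measurable borel"
proof -
  interpret L: sigma_finite_measure \<Lambda> by (rule \<Lambda>_sigma_finite)
  have [measurable]: "(\<lambda>z. pos_density s (fst z) (snd z)) \<in> borel_measurable (borel \<Otimes>\<^sub>M \<Lambda>)"
    by (rule pos_density_measurable; measurable)
  show ?thesis unfolding emeasure_trans_kernel[OF assms]
    by (rule L.borel_measurable_nn_integral) (simp add: split_beta')
qed

lemma Z1_shift_measurable: "0 \<le> s \<Longrightarrow> (\<lambda>w. Z1 Z (T n w + s) w) \<in> Om' \<rightarrow>\<^sub>M borel"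
  using T_measurable[of n] T_nonneg by (intro Z1_sample_measurable) auto

lemma G_PP: "\<pi> \<in> inits \<Longrightarrow> G \<in> sets (F n) \<Longrightarrow> G \<in> sets (PP \<pi>)"
  using F_into_Om' by (simp add: sets_PP)

text \<open>\<open>bridge_position_le\<close> holds for \<open>A\<close> and for its complement, and
  both sides have the same finite sum, so neither inequality is strict. The product form says that
  the position carries no information on how far beyond \<open>s\<close> the waiting time
  extends.\<close>

lemma position_law:
  assumes \<pi>: "\<pi> \<in> inits" and G: "G \<in> sets (F n)" and s: "0 < s"
    and A[measurable]: "A \<in> sets borel" and B[measurable]: "B \<in> sets borel"
  shows "(\<integral>\<^sup>+w. indicator G w * (indicator (B \<inter> {s<..}) (wait n w) * indicator A (Z1 Z (T n w + s) w)) \<partial>PP \<pi>) =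
    (\<integral>\<^sup>+w. indicator G w * emeasure (trans_kernel P X s (Y n w)) A \<partial>PP \<pi>) * exp_mass (B \<inter> {s<..})"
proof -
  interpret PP: prob_space "PP \<pi>" by (rule PP_prob_space[OF \<pi>])
  note [measurable] = G_PP[OF \<pi> G] measurable_PP[OF \<pi> wait_measurable, of n]
    measurable_PP[OF \<pi> Z1_shift_measurable, of s n] measurable_PP[OF \<pi> Y_measurable, of n]
  let ?l = "\<lambda>A. \<integral>\<^sup>+w. indicator G w * (indicator (B \<inter> {s<..}) (wait n w) * indicator A (Z1 Z (T n w + s) w)) \<partial>PP \<pi>"
  let ?r = "\<lambda>A. \<integral>\<^sup>+w. indicator G w * (emeasure (trans_kernel P X s (Y n w)) A * exp_mass (B \<inter> {s<..})) \<partial>PP \<pi>"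
  have km[measurable]: "(\<lambda>w. emeasure (trans_kernel P X s (Y n w)) A) \<in> borel_measurable (PP \<pi>)" if "A \<in> sets borel" for A
    using measurable_compose[OF measurable_PP[OF \<pi> Y_measurable] emeasure_trans_kernel_measurable[OF s that]] .
  have "?l A + ?l (- A) = (\<integral>\<^sup>+w. indicator G w * (indicator (B \<inter> {s<..}) (wait n w) * indicator A (Z1 Z (T n w + s) w)) +
       indicator G w * (indicator (B \<inter> {s<..}) (wait n w) * indicator (- A) (Z1 Z (T n w + s) w)) \<partial>PP \<pi>)"
    using s by (intro nn_integral_add[symmetric]) auto
  also have "\<dots> = (\<integral>\<^sup>+w. indicator G w * indicator (B \<inter> {s<..}) (wait n w) \<partial>PP \<pi>)"
    by (intro nn_integral_cong) (auto simp: indicator_def)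
  also have "\<dots> = emeasure (PP \<pi>) G * exp_mass (B \<inter> {s<..})" by (rule wait_law[OF \<pi> G]) simp
  finally have l: "?l A + ?l (- A) = emeasure (PP \<pi>) G * exp_mass (B \<inter> {s<..})" .
  have "?r A + ?r (- A) = (\<integral>\<^sup>+w. indicator G w * (emeasure (trans_kernel P X s (Y n w)) A * exp_mass (B \<inter> {s<..})) +
      indicator G w * (emeasure (trans_kernel P X s (Y n w)) (- A) * exp_mass (B \<inter> {s<..})) \<partial>PP \<pi>)"
    by (intro nn_integral_add[symmetric] borel_measurable_times_ennreal km) auto
  also have "\<dots> = (\<integral>\<^sup>+w. exp_mass (B \<inter> {s<..}) * indicator G w \<partial>PP \<pi>)"
  proof (intro nn_integral_cong)
    fix w
    interpret K: prob_space "trans_kernel P X s (Y n w)" using s by (intro trans_kernel_prob) simp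
    have sp: "space (trans_kernel P X s (Y n w)) = UNIV" "sets (trans_kernel P X s (Y n w)) = sets borel"
      by (simp_all add: trans_kernel_def)
    have "emeasure (trans_kernel P X s (Y n w)) A + emeasure (trans_kernel P X s (Y n w)) (- A) =
       emeasure (trans_kernel P X s (Y n w)) (A \<union> - A)"
      using sp by (intro plus_emeasure) auto
    also have "A \<union> - A = UNIV" by auto
    finally have "emeasure (trans_kernel P X s (Y n w)) A + emeasure (trans_kernel P X s (Y n w)) (- A) = 1"
      using K.emeasure_space_1 sp by simp
    then show "indicator G w * (emeasure (trans_kernel P X s (Y n w)) A * exp_mass (B \<inter> {s<..})) +
      indicator G w * (emeasure (trans_kernel P X s (Y n w)) (- A) * exp_mass (B \<inter> {s<..})) = exp_mass (B \<inter> {s<..}) * indicator G w"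
      by (simp flip: distrib_left distrib_right add: mult.commute)
  qed
  also have "\<dots> = emeasure (PP \<pi>) G * exp_mass (B \<inter> {s<..})"
    by (subst nn_integral_cmult_indicator) (auto simp: mult.commute)
  finally have r: "?r A + ?r (- A) = emeasure (PP \<pi>) G * exp_mass (B \<inter> {s<..})" .
  have "emeasure (PP \<pi>) G * exp_mass (B \<inter> {s<..}) < \<infinity>"
  proof -
    have "emeasure (PP \<pi>) G < top" using PP.emeasure_finite[of G] by (simp only: less_top infinity_ennreal_def)
    moreover have "exp_mass (B \<inter> {s<..}) < top" by (rule le_less_trans[OF exp_mass_le_1 ennreal_one_less_top]) simp
    ultimately show ?thesis by (simp only: ennreal_mult_less_top infinity_ennreal_def simp_thms)
  qed
  then have "?l A = ?r A"
    using bridge_position_le[OF \<pi> G s A B] bridge_position_le[OF \<pi> G s _ B, of "- A"] l r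
    by (intro ennreal_add_eq_imp_eq[of "?l A" "?r A" "?l (- A)" "?r (- A)"]) auto
  also have "?r A = (\<integral>\<^sup>+w. indicator G w * emeasure (trans_kernel P X s (Y n w)) A \<partial>PP \<pi>) * exp_mass (B \<inter> {s<..})"
    by (subst nn_integral_multc[symmetric]) (auto simp: mult.assoc)
  finally show ?thesis .
qed

text \<open>On rectangles this is \<open>position_law\<close> together with the shift of the
  exponential mass; hence position and residual time have a product measure as joint law on the
  event that the waiting time exceeds \<open>s\<close>.\<close>

lemma residual_wait:
  assumes \<pi>: "\<pi> \<in> inits" and G: "G \<in> sets (F n)" and s: "0 < s"
    and \<psi>: "\<psi> \<in> borel_measurable (borel \<Otimes>\<^sub>M borel)"
  shows "(\<integral>\<^sup>+w. indicator G w * (indicator {s<..} (wait n w) * \<psi> (Z1 Z (T n w + s) w, wait n w - s)) \<partial>PP \<pi>) =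
    (\<integral>\<^sup>+w. indicator G w * (indicator {s<..} (wait n w) * (\<integral>\<^sup>+r. \<psi> (Z1 Z (T n w + s) w, r) \<partial>exp_law)) \<partial>PP \<pi>)"
proof -
  interpret PP: prob_space "PP \<pi>" by (rule PP_prob_space[OF \<pi>])
  interpret E: prob_space exp_law by (rule exp_law_prob)
  note [measurable] = G_PP[OF \<pi> G] measurable_PP[OF \<pi> wait_measurable, of n]
    measurable_PP[OF \<pi> Z1_shift_measurable[OF less_imp_le[OF s]], of n] \<psi>
  define D where "D = density (PP \<pi>) (\<lambda>w. indicator G w * indicator {s<..} (wait n w))"
  define Zs where "Zs w = Z1 Z (T n w + s) w" for w
  have [measurable]: "Zs \<in> PP \<pi> \<rightarrow>\<^sub>M borel" unfolding Zs_def[abs_def] by measurable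
  have Zm[measurable]: "Zs \<in> D \<rightarrow>\<^sub>M borel" by (simp add: D_def)
  have wm[measurable]: "wait n \<in> D \<rightarrow>\<^sub>M borel" by (simp add: D_def)
  have Dnn: "(\<integral>\<^sup>+w. f w \<partial>D) = (\<integral>\<^sup>+w. indicator G w * (indicator {s<..} (wait n w) * f w) \<partial>PP \<pi>)"
    if [measurable]: "f \<in> borel_measurable (PP \<pi>)" for f
    unfolding D_def by (subst nn_integral_density) (auto simp: mult.assoc)
  have Dfin: "finite_measure D"
  proof (rule finite_measureI)
    have "emeasure D (space D) = (\<integral>\<^sup>+w. 1 \<partial>D)" by simp
    also have "\<dots> = (\<integral>\<^sup>+w. indicator G w * (indicator {s<..} (wait n w) * 1) \<partial>PP \<pi>)" by (rule Dnn) simp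
    also have "\<dots> \<le> (\<integral>\<^sup>+w. 1 \<partial>PP \<pi>)" by (intro nn_integral_mono) (auto simp: indicator_def)
    also have "\<dots> = 1" by (simp add: PP.emeasure_space_1)
    finally have "emeasure D (space D) < \<infinity>" by (rule order.strict_trans1) simp
    then show "emeasure D (space D) \<noteq> \<infinity>" by simp
  qed
  define M1 where "M1 = distr D borel Zs"
  define M where "M = distr D (borel \<Otimes>\<^sub>M borel) (\<lambda>w. (Zs w, wait n w - s))"
  interpret M1: finite_measure M1 unfolding M1_def by (rule finite_measure.finite_measure_distr[OF Dfin Zm])
  have rect: "(\<integral>\<^sup>+w. indicator A (Zs w) * indicator B (wait n w - s) \<partial>D) =
     (\<integral>\<^sup>+w. indicator G w * emeasure (trans_kernel P X s (Y n w)) A \<partial>PP \<pi>) * (ennreal (exp (- s)) * exp_mass B)"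
    if [measurable]: "A \<in> sets borel" "B \<in> sets borel" for A B
  proof -
    have Bs[measurable]: "{t. s < t \<and> t - s \<in> B} \<in> sets borel"
    proof -
      have "{t \<in> space borel. s < t \<and> t - s \<in> B} \<in> sets borel" by measurable
      then show ?thesis by simp
    qed
    have e: "{t. s < t \<and> t - s \<in> B} \<inter> {s<..} = {t. s < t \<and> t - s \<in> B}" by auto
    have "(\<integral>\<^sup>+w. indicator A (Zs w) * indicator B (wait n w - s) \<partial>D) =
      (\<integral>\<^sup>+w. indicator G w * (indicator ({t. s < t \<and> t - s \<in> B} \<inter> {s<..}) (wait n w) * indicator A (Z1 Z (T n w + s) w)) \<partial>PP \<pi>)"
      by (subst Dnn) (auto intro!: nn_integral_cong simp: indicator_def Zs_def)
    also have "\<dots> = (\<integral>\<^sup>+w. indicator G w * emeasure (trans_kernel P X s (Y n w)) A \<partial>PP \<pi>) * exp_mass ({t. s < t \<and> t - s \<in> B} \<inter> {s<..})"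
      by (rule position_law[OF \<pi> G s]) measurable
    finally show ?thesis unfolding e using s by (simp add: exp_mass_shift)
  qed
  have "M1 \<Otimes>\<^sub>M exp_law = M"
  proof (rule pair_measure_eqI)
    show "sigma_finite_measure M1" "sigma_finite_measure exp_law" by unfold_locales
    show "sets (M1 \<Otimes>\<^sub>M exp_law) = sets M"
      unfolding M_def M1_def by (simp cong: sets_pair_measure_cong)
    fix A B assume "A \<in> sets M1" "B \<in> sets exp_law"
    then have [measurable]: "A \<in> sets borel" "B \<in> sets borel" by (auto simp: M1_def)
    have "emeasure M1 A = (\<integral>\<^sup>+x. indicator A x \<partial>M1)" by (simp add: M1_def)
    also have "\<dots> = (\<integral>\<^sup>+w. indicator A (Zs w) * indicator UNIV (wait n w - s) \<partial>D)"
      unfolding M1_def by (subst nn_integral_distr) auto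
    also have "\<dots> = (\<integral>\<^sup>+w. indicator G w * emeasure (trans_kernel P X s (Y n w)) A \<partial>PP \<pi>) * ennreal (exp (- s))"
      by (subst rect) (auto simp: exp_mass_UNIV)
    finally have 1: "emeasure M1 A = \<dots>" .
    have "emeasure M (A \<times> B) = (\<integral>\<^sup>+z. indicator (A \<times> B) z \<partial>M)" by (simp add: M_def)
    also have "\<dots> = (\<integral>\<^sup>+w. indicator A (Zs w) * indicator B (wait n w - s) \<partial>D)"
      unfolding M_def by (subst nn_integral_distr) (auto intro!: nn_integral_cong simp: indicator_def)
    also have "\<dots> = (\<integral>\<^sup>+w. indicator G w * emeasure (trans_kernel P X s (Y n w)) A \<partial>PP \<pi>) * (ennreal (exp (- s)) * exp_mass B)"
      by (rule rect) auto
    finally show "emeasure M1 A * emeasure exp_law B = emeasure M (A \<times> B)"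
      unfolding 1 by (simp add: emeasure_exp_law mult.assoc)
  qed
  moreover have \<psi>M: "\<psi> \<in> borel_measurable (M1 \<Otimes>\<^sub>M exp_law)"
    unfolding M1_def using \<psi> by (simp cong: measurable_cong_sets sets_pair_measure_cong)
  ultimately have "(\<integral>\<^sup>+x. (\<integral>\<^sup>+r. \<psi> (x, r) \<partial>exp_law) \<partial>M1) = (\<integral>\<^sup>+z. \<psi> z \<partial>M)"
    using E.nn_integral_fst[OF \<psi>M] by simp
  moreover have "(\<integral>\<^sup>+z. \<psi> z \<partial>M) = (\<integral>\<^sup>+w. \<psi> (Zs w, wait n w - s) \<partial>D)"
    unfolding M_def by (rule nn_integral_distr) (auto simp: \<psi>)
  moreover have "(\<integral>\<^sup>+x. (\<integral>\<^sup>+r. \<psi> (x, r) \<partial>exp_law) \<partial>M1) = (\<integral>\<^sup>+w. (\<integral>\<^sup>+r. \<psi> (Zs w, r) \<partial>exp_law) \<partial>D)"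
    unfolding M1_def by (rule nn_integral_distr) measurable
  ultimately show ?thesis by (simp add: Dnn Zs_def)
qed

text \<open>Stated through a product measure, so that integrands depending jointly on the past and
  the waiting time are covered, such as the overshoot over a fixed time.\<close>

lemma wait_independent:
  assumes \<pi>: "\<pi> \<in> inits" and \<psi>: "\<psi> \<in> borel_measurable (F n \<Otimes>\<^sub>M borel)"
  shows "(\<integral>\<^sup>+w. \<psi> (w, wait n w) \<partial>PP \<pi>) = (\<integral>\<^sup>+w. (\<integral>\<^sup>+r. \<psi> (w, r) \<partial>exp_law) \<partial>PP \<pi>)"
proof -
  interpret PP: prob_space "PP \<pi>" by (rule PP_prob_space[OF \<pi>])
  interpret E: prob_space exp_law by (rule exp_law_prob)
  note wm[measurable] = measurable_PP[OF \<pi> wait_measurable, of n]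
  have id[measurable]: "(\<lambda>w. w) \<in> PP \<pi> \<rightarrow>\<^sub>M F n"
    by (rule measurable_PP[OF \<pi>]) (rule measurable_F_Om'[of _ n], simp)
  define M1 where "M1 = distr (PP \<pi>) (F n) (\<lambda>w. w)"
  define M where "M = distr (PP \<pi>) (F n \<Otimes>\<^sub>M borel) (\<lambda>w. (w, wait n w))"
  interpret M1: prob_space M1 unfolding M1_def by (rule PP.prob_space_distr[OF id])
  have "M1 \<Otimes>\<^sub>M exp_law = M"
  proof (rule pair_measure_eqI)
    show "sigma_finite_measure M1" "sigma_finite_measure exp_law" by unfold_locales
    show "sets (M1 \<Otimes>\<^sub>M exp_law) = sets M"
      unfolding M_def M1_def by (simp cong: sets_pair_measure_cong)
    fix G B assume "G \<in> sets M1" "B \<in> sets exp_law"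
    then have G[measurable]: "G \<in> sets (F n)" and [measurable]: "B \<in> sets borel" by (auto simp: M1_def)
    note [measurable] = G_PP[OF \<pi> G]
    have sub: "G \<subseteq> space Om'" using sets.sets_into_space[OF G] by simp
    have "emeasure M1 G = emeasure (PP \<pi>) G"
      unfolding M1_def using sub by (subst emeasure_distr[OF id G]) (auto simp: space_PP[OF \<pi>] intro!: arg_cong[where f = "emeasure _"])
    moreover have "emeasure M (G \<times> B) = (\<integral>\<^sup>+z. indicator (G \<times> B) z \<partial>M)" by (simp add: M_def)
    moreover have "\<dots> = (\<integral>\<^sup>+w. indicator G w * indicator B (wait n w) \<partial>PP \<pi>)"
      unfolding M_def by (subst nn_integral_distr) (auto intro!: nn_integral_cong simp: indicator_def)
    ultimately show "emeasure M1 G * emeasure exp_law B = emeasure M (G \<times> B)"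
      using wait_law[OF \<pi> G, of B] by (simp add: emeasure_exp_law)
  qed
  moreover have \<psi>M: "\<psi> \<in> borel_measurable (M1 \<Otimes>\<^sub>M exp_law)"
    unfolding M1_def using \<psi> by (simp cong: measurable_cong_sets sets_pair_measure_cong)
  ultimately have "(\<integral>\<^sup>+x. (\<integral>\<^sup>+r. \<psi> (x, r) \<partial>exp_law) \<partial>M1) = (\<integral>\<^sup>+z. \<psi> z \<partial>M)"
    using E.nn_integral_fst[OF \<psi>M] by simp
  moreover have "(\<integral>\<^sup>+z. \<psi> z \<partial>M) = (\<integral>\<^sup>+w. \<psi> (w, wait n w) \<partial>PP \<pi>)"
    unfolding M_def by (rule nn_integral_distr) (auto simp: \<psi>)
  moreover have "(\<integral>\<^sup>+x. (\<integral>\<^sup>+r. \<psi> (x, r) \<partial>exp_law) \<partial>M1) = (\<integral>\<^sup>+w. (\<integral>\<^sup>+r. \<psi> (w, r) \<partial>exp_law) \<partial>PP \<pi>)"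
    unfolding M1_def using \<psi> by (intro nn_integral_distr) (auto intro!: E.borel_measurable_nn_integral simp: split_beta' cong: measurable_cong_sets sets_pair_measure_cong)
  ultimately show ?thesis by simp
qed

section \<open>Occupation integrals over one waiting time\<close>

text \<open>The weight is a function of the time left until \<open>T (n+1)\<close>. With an
  exponential weight this dominates the exponential of the plain integral, as
  \<open>exp_piece_le\<close> shows.\<close>

definition weighted_occ :: "('e \<Rightarrow> ennreal) \<Rightarrow> (real \<Rightarrow> ennreal) \<Rightarrow> nat \<Rightarrow> 'v \<Rightarrow> ennreal" where
  "weighted_occ g wt n w = (\<integral>\<^sup>+s. indicator {T n w..<T (Suc n) w} s * (g (Z1 Z s w) * wt (T (Suc n) w - s)) \<partial>lborel)"

lemma occ_eq_weighted: "occ g n w = weighted_occ g (\<lambda>_. 1) n w"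
  by (simp add: occ_def weighted_occ_def)

lemma Z1_max_pair_measurable:
  "(\<lambda>z. Z1 Z (max 0 (T n (fst z) + snd z)) (fst z)) \<in> Om' \<Otimes>\<^sub>M borel \<rightarrow>\<^sub>M borel"
proof -
  note [measurable] = T_measurable[of n]
  have "(\<lambda>z. (T n (fst z) + snd z, fst z)) \<in> Om' \<Otimes>\<^sub>M borel \<rightarrow>\<^sub>M borel \<Otimes>\<^sub>M Om'" by measurable
  from measurable_compose[OF this Z1_measurable_pair] show ?thesis by simp
qed

text \<open>Time is counted from \<open>T n\<close>, so that the domain of integration no longer
  depends on \<open>w\<close> and the two integrals can be exchanged.\<close>

lemma weighted_occ_shift:
  assumes w: "w \<in> space Om'" and [measurable]: "g \<in> borel_measurable borel" "wt \<in> borel_measurable borel"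
  shows "weighted_occ g wt n w = (\<integral>\<^sup>+s. indicator {0<..} s * (indicator {s<..} (wait n w) * (g (Z1 Z (max 0 (T n w + s)) w) * wt (wait n w - s))) \<partial>lborel)"
proof -
  have [measurable]: "(\<lambda>s. Z1 Z (max 0 s) w) \<in> borel \<rightarrow>\<^sub>M borel"
    using measurable_compose[OF _ Z1_measurable_pair, of "\<lambda>s. (s, w)" borel] w by simp
  have "weighted_occ g wt n w = (\<integral>\<^sup>+s. indicator {T n w..<T (Suc n) w} s * (g (Z1 Z (max 0 s) w) * wt (T (Suc n) w - s)) \<partial>lborel)"
    unfolding weighted_occ_def using T_nonneg[OF w, of n]
    by (intro nn_integral_cong) (auto simp: indicator_def max_def)
  also have "\<dots> = (\<integral>\<^sup>+s. indicator {T n w..<T (Suc n) w} (T n w + s) * (g (Z1 Z (max 0 (T n w + s)) w) * wt (T (Suc n) w - (T n w + s))) \<partial>lborel)"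
  proof -
    have "(\<lambda>s. indicator {T n w..<T (Suc n) w} s * (g (Z1 Z (max 0 s) w) * wt (T (Suc n) w - s))) \<in> borel_measurable borel"
      by measurable
    from nn_integral_real_affine[OF this, of 1 "T n w"] show ?thesis by simp
  qed
  also have "\<dots> = (\<integral>\<^sup>+s. indicator {0<..} s * (indicator {s<..} (wait n w) * (g (Z1 Z (max 0 (T n w + s)) w) * wt (wait n w - s))) \<partial>lborel)"
    by (intro nn_integral_cong_AE, use AE_lborel_singleton[of 0] in eventually_elim) (auto simp: indicator_def diff_diff_eq)
  finally show ?thesis .
qed

lemma nn_integral_weighted_occ:
  assumes \<pi>: "\<pi> \<in> inits" and G: "G \<in> sets (F n)"
    and [measurable]: "g \<in> borel_measurable borel" "wt \<in> borel_measurable borel"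
  shows "(\<integral>\<^sup>+w. indicator G w * weighted_occ g wt n w \<partial>PP \<pi>) =
    (\<integral>\<^sup>+s. indicator {0<..} s * (\<integral>\<^sup>+w. indicator G w * (indicator {s<..} (wait n w) * (g (Z1 Z (T n w + s) w) * wt (wait n w - s))) \<partial>PP \<pi>) \<partial>lborel)"
proof -
  interpret PP: prob_space "PP \<pi>" by (rule PP_prob_space[OF \<pi>])
  interpret pair_sigma_finite lborel "PP \<pi>" ..
  note [measurable] = G_PP[OF \<pi> G] measurable_PP[OF \<pi> wait_measurable, of n]
  have Zm: "(\<lambda>z. Z1 Z (max 0 (T n (snd z) + fst z)) (snd z)) \<in> lborel \<Otimes>\<^sub>M PP \<pi> \<rightarrow>\<^sub>M borel"
  proof -
    have "(\<lambda>z. (snd z, fst z)) \<in> lborel \<Otimes>\<^sub>M PP \<pi> \<rightarrow>\<^sub>M Om' \<Otimes>\<^sub>M borel"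
      using sets_PP[OF \<pi>] by (intro measurable_Pair) (auto cong: measurable_cong_sets)
    from measurable_compose[OF this Z1_max_pair_measurable] show ?thesis by simp
  qed
  note [measurable] = Zm
  have [measurable]: "(\<lambda>w. Z1 Z (max 0 (T n w + s)) w) \<in> PP \<pi> \<rightarrow>\<^sub>M borel" for s
    using measurable_compose[OF _ Zm, of "\<lambda>w. (s, w)" "PP \<pi>"] by simp
  have [measurable]: "(\<lambda>s. Z1 Z (max 0 (T n w + s)) w) \<in> borel \<rightarrow>\<^sub>M borel" if "w \<in> space (PP \<pi>)" for w
    using measurable_compose[OF _ Zm, of "\<lambda>s. (s, w)" borel] that by simp
  have [measurable]: "(\<lambda>z. indicator {fst z<..} (wait n (snd z)) :: ennreal) \<in> borel_measurable (lborel \<Otimes>\<^sub>M PP \<pi>)"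
  proof -
    have "(\<lambda>z. if fst z < wait n (snd z) then 1 else 0 :: ennreal) \<in> borel_measurable (lborel \<Otimes>\<^sub>M PP \<pi>)" by measurable
    then show ?thesis by (simp add: indicator_def)
  qed
  have [measurable]: "(\<lambda>s. indicator {s<..} (c::real) :: ennreal) \<in> borel_measurable borel" for c
  proof -
    have "(\<lambda>s. if s < c then 1 else 0 :: ennreal) \<in> borel_measurable borel" by measurable
    then show ?thesis by (simp add: indicator_def)
  qed
  let ?f = "\<lambda>s w. indicator {s<..} (wait n w) * (g (Z1 Z (max 0 (T n w + s)) w) * wt (wait n w - s))"
  have "(\<integral>\<^sup>+w. indicator G w * weighted_occ g wt n w \<partial>PP \<pi>) =
     (\<integral>\<^sup>+w. (\<integral>\<^sup>+s. indicator G w * (indicator {0<..} s * ?f s w) \<partial>lborel) \<partial>PP \<pi>)"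
  proof (intro nn_integral_cong)
    fix w assume w: "w \<in> space (PP \<pi>)"
    note [measurable] = \<open>w \<in> space (PP \<pi>) \<Longrightarrow> (\<lambda>s. Z1 Z (max 0 (T n w + s)) w) \<in> borel \<rightarrow>\<^sub>M borel\<close>[OF w]
    show "indicator G w * weighted_occ g wt n w = (\<integral>\<^sup>+s. indicator G w * (indicator {0<..} s * ?f s w) \<partial>lborel)"
      using w by (subst nn_integral_cmult) (auto simp: weighted_occ_shift space_PP[OF \<pi>])
  qed
  also have "\<dots> = (\<integral>\<^sup>+s. (\<integral>\<^sup>+w. indicator G w * (indicator {0<..} s * ?f s w) \<partial>PP \<pi>) \<partial>lborel)"
    by (rule Fubini') (simp add: split_beta')
  also have "\<dots> = (\<integral>\<^sup>+s. indicator {0<..} s * (\<integral>\<^sup>+w. indicator G w * (indicator {s<..} (wait n w) * (g (Z1 Z (T n w + s) w) * wt (wait n w - s))) \<partial>PP \<pi>) \<partial>lborel)"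
  proof (intro nn_integral_cong)
    fix s :: real
    show "(\<integral>\<^sup>+w. indicator G w * (indicator {0<..} s * ?f s w) \<partial>PP \<pi>) =
      indicator {0<..} s * (\<integral>\<^sup>+w. indicator G w * (indicator {s<..} (wait n w) * (g (Z1 Z (T n w + s) w) * wt (wait n w - s))) \<partial>PP \<pi>)"
    proof (cases "0 < s")
      case True
      then have "max 0 (T n w + s) = T n w + s" if "w \<in> space Om'" for w
        using T_nonneg[OF that, of n] by simp
      then show ?thesis using True by (auto simp: space_PP[OF \<pi>] intro!: nn_integral_cong)
    qed simp
  qed
  finally show ?thesis .
qed

text \<open>At each instant of the waiting time its residual is exponential and independent of the
  position, so the weight factors out of the time integral.\<close>

lemma weighted_occ_law:
  assumes \<pi>: "\<pi> \<in> inits" and G: "G \<in> sets (F n)"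
    and g[measurable]: "g \<in> borel_measurable borel" and wt[measurable]: "wt \<in> borel_measurable borel"
  shows "(\<integral>\<^sup>+w. indicator G w * weighted_occ g wt n w \<partial>PP \<pi>) = (\<integral>\<^sup>+r. wt r \<partial>exp_law) * (\<integral>\<^sup>+w. indicator G w * occ g n w \<partial>PP \<pi>)"
proof -
  note [measurable] = G_PP[OF \<pi> G] measurable_PP[OF \<pi> wait_measurable, of n]
  have *: "(\<integral>\<^sup>+w. indicator G w * (indicator {s<..} (wait n w) * (g (Z1 Z (T n w + s) w) * wt (wait n w - s))) \<partial>PP \<pi>) =
    (\<integral>\<^sup>+r. wt r \<partial>exp_law) * (\<integral>\<^sup>+w. indicator G w * (indicator {s<..} (wait n w) * g (Z1 Z (T n w + s) w)) \<partial>PP \<pi>)" if s: "0 < s" for s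
  proof -
    note [measurable] = measurable_PP[OF \<pi> Z1_shift_measurable[OF less_imp_le[OF s]], of n]
    have "(\<lambda>z. g (fst z) * wt (snd z)) \<in> borel_measurable (borel \<Otimes>\<^sub>M borel)" by measurable
    from residual_wait[OF \<pi> G s this]
    have "(\<integral>\<^sup>+w. indicator G w * (indicator {s<..} (wait n w) * (g (Z1 Z (T n w + s) w) * wt (wait n w - s))) \<partial>PP \<pi>) =
      (\<integral>\<^sup>+w. indicator G w * (indicator {s<..} (wait n w) * (\<integral>\<^sup>+r. g (Z1 Z (T n w + s) w) * wt r \<partial>exp_law)) \<partial>PP \<pi>)" by simp
    also have "\<dots> = (\<integral>\<^sup>+w. (\<integral>\<^sup>+r. wt r \<partial>exp_law) * (indicator G w * (indicator {s<..} (wait n w) * g (Z1 Z (T n w + s) w))) \<partial>PP \<pi>)"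
    proof -
      have K: "(\<integral>\<^sup>+r. g z * wt r \<partial>exp_law) = g z * (\<integral>\<^sup>+r. wt r \<partial>exp_law)" for z
        by (rule nn_integral_cmult) measurable
      show ?thesis unfolding K by (simp add: ac_simps)
    qed
    also have "\<dots> = (\<integral>\<^sup>+r. wt r \<partial>exp_law) * (\<integral>\<^sup>+w. indicator G w * (indicator {s<..} (wait n w) * g (Z1 Z (T n w + s) w)) \<partial>PP \<pi>)"
      by (rule nn_integral_cmult) measurable
    finally show ?thesis .
  qed
  have gm: "(\<lambda>s. indicator {0<..} s * (\<integral>\<^sup>+w. indicator G w * (indicator {s<..} (wait n w) * g (Z1 Z (T n w + s) w)) \<partial>PP \<pi>)) \<in> borel_measurable lborel"
  proof -
    interpret PP: prob_space "PP \<pi>" by (rule PP_prob_space[OF \<pi>])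
    have "(\<lambda>z. (snd z, fst z)) \<in> lborel \<Otimes>\<^sub>M PP \<pi> \<rightarrow>\<^sub>M Om' \<Otimes>\<^sub>M borel"
      using sets_PP[OF \<pi>] by (intro measurable_Pair) (auto cong: measurable_cong_sets)
    from measurable_compose[OF this Z1_max_pair_measurable[of n]]
    have [measurable]: "(\<lambda>z. Z1 Z (max 0 (T n (snd z) + fst z)) (snd z)) \<in> lborel \<Otimes>\<^sub>M PP \<pi> \<rightarrow>\<^sub>M borel" by simp
    have "(\<lambda>s. \<integral>\<^sup>+w. indicator {0<..} s * (indicator G w * ((if s < wait n w then 1 else 0) * g (Z1 Z (max 0 (T n w + s)) w))) \<partial>PP \<pi>) \<in> borel_measurable lborel"
      by (rule PP.borel_measurable_nn_integral) (simp add: split_beta')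
    also have "(\<lambda>s. \<integral>\<^sup>+w. indicator {0<..} s * (indicator G w * ((if s < wait n w then 1 else 0) * g (Z1 Z (max 0 (T n w + s)) w))) \<partial>PP \<pi>) =
       (\<lambda>s. indicator {0<..} s * (\<integral>\<^sup>+w. indicator G w * (indicator {s<..} (wait n w) * g (Z1 Z (T n w + s) w)) \<partial>PP \<pi>))"
    proof
      fix s show "(\<integral>\<^sup>+w. indicator {0<..} s * (indicator G w * ((if s < wait n w then 1 else 0) * g (Z1 Z (max 0 (T n w + s)) w))) \<partial>PP \<pi>) =
       indicator {0<..} s * (\<integral>\<^sup>+w. indicator G w * (indicator {s<..} (wait n w) * g (Z1 Z (T n w + s) w)) \<partial>PP \<pi>)"
      proof (cases "0 < s")
        case True
        have "max 0 (T n w + s) = T n w + s" if "w \<in> space Om'" for w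
          using T_nonneg[OF that, of n] True by simp
        then show ?thesis using True by (auto simp: space_PP[OF \<pi>] indicator_def intro!: nn_integral_cong)
      qed simp
    qed
    finally show ?thesis .
  qed
  have "(\<integral>\<^sup>+w. indicator G w * weighted_occ g wt n w \<partial>PP \<pi>) =
    (\<integral>\<^sup>+s. (\<integral>\<^sup>+r. wt r \<partial>exp_law) * (indicator {0<..} s * (\<integral>\<^sup>+w. indicator G w * (indicator {s<..} (wait n w) * g (Z1 Z (T n w + s) w)) \<partial>PP \<pi>)) \<partial>lborel)"
    unfolding nn_integral_weighted_occ[OF \<pi> G g wt]
  proof (intro nn_integral_cong)
    fix s :: real
    show "indicator {0<..} s * (\<integral>\<^sup>+w. indicator G w * (indicator {s<..} (wait n w) * (g (Z1 Z (T n w + s) w) * wt (wait n w - s))) \<partial>PP \<pi>) =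
      (\<integral>\<^sup>+r. wt r \<partial>exp_law) * (indicator {0<..} s * (\<integral>\<^sup>+w. indicator G w * (indicator {s<..} (wait n w) * g (Z1 Z (T n w + s) w)) \<partial>PP \<pi>))"
      by (cases "0 < s") (simp_all add: *)
  qed
  also have "\<dots> = (\<integral>\<^sup>+r. wt r \<partial>exp_law) * (\<integral>\<^sup>+s. (indicator {0<..} s * (\<integral>\<^sup>+w. indicator G w * (indicator {s<..} (wait n w) * g (Z1 Z (T n w + s) w)) \<partial>PP \<pi>)) \<partial>lborel)"
    by (rule nn_integral_cmult[OF gm])
  also have "(\<integral>\<^sup>+s. (indicator {0<..} s * (\<integral>\<^sup>+w. indicator G w * (indicator {s<..} (wait n w) * g (Z1 Z (T n w + s) w)) \<partial>PP \<pi>)) \<partial>lborel) =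
     (\<integral>\<^sup>+w. indicator G w * occ g n w \<partial>PP \<pi>)"
    using nn_integral_weighted_occ[OF \<pi> G g, of "\<lambda>_. 1"] by (simp add: occ_eq_weighted)
  finally show ?thesis .
qed

text \<open>The passage from events to functions: the law of the position, restricted to the event
  in question, is identified as a measure with density with respect to
  \<open>\<Lambda>\<close>.\<close>

lemma position_mean:
  assumes \<pi>: "\<pi> \<in> inits" and G: "G \<in> sets (F n)" and s: "0 < s" and g[measurable]: "g \<in> borel_measurable borel"
  shows "(\<integral>\<^sup>+w. indicator G w * (indicator {s<..} (wait n w) * g (Z1 Z (T n w + s) w)) \<partial>PP \<pi>) =
    (\<integral>\<^sup>+w. indicator G w * (ennreal (exp (- s)) * (\<integral>\<^sup>+y. ennreal (pos_density s (Y n w) y) * g y \<partial>\<Lambda>)) \<partial>PP \<pi>)"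
proof -
  interpret PP: prob_space "PP \<pi>" by (rule PP_prob_space[OF \<pi>])
  interpret L: sigma_finite_measure \<Lambda> by (rule \<Lambda>_sigma_finite)
  interpret pair_sigma_finite \<Lambda> "PP \<pi>" ..
  note [measurable] = G_PP[OF \<pi> G] measurable_PP[OF \<pi> wait_measurable, of n]
    measurable_PP[OF \<pi> Z1_shift_measurable[OF less_imp_le[OF s]], of n] measurable_PP[OF \<pi> Y_measurable, of n]
  have [measurable]: "(\<lambda>z. pos_density s (Y n (snd z)) (fst z)) \<in> borel_measurable (\<Lambda> \<Otimes>\<^sub>M PP \<pi>)"
    "(\<lambda>y. pos_density s (Y n w) y) \<in> borel_measurable \<Lambda>" "(\<lambda>w. pos_density s (Y n w) y) \<in> borel_measurable (PP \<pi>)" for w y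
    by (rule pos_density_measurable; measurable)+
  define k where "k y = (\<integral>\<^sup>+w. indicator G w * ennreal (pos_density s (Y n w) y) \<partial>PP \<pi>)" for y
  have km[measurable]: "k \<in> borel_measurable \<Lambda>" unfolding k_def[abs_def]
    by (rule PP.borel_measurable_nn_integral) (simp add: split_beta')
  have fub: "(\<integral>\<^sup>+w. indicator G w * (\<integral>\<^sup>+y. ennreal (pos_density s (Y n w) y) * h y \<partial>\<Lambda>) \<partial>PP \<pi>) = (\<integral>\<^sup>+y. k y * h y \<partial>\<Lambda>)"
    if [measurable]: "h \<in> borel_measurable borel" for h
  proof -
    have "(\<integral>\<^sup>+w. indicator G w * (\<integral>\<^sup>+y. ennreal (pos_density s (Y n w) y) * h y \<partial>\<Lambda>) \<partial>PP \<pi>) =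
      (\<integral>\<^sup>+w. (\<integral>\<^sup>+y. indicator G w * ennreal (pos_density s (Y n w) y) * h y \<partial>\<Lambda>) \<partial>PP \<pi>)"
      by (intro nn_integral_cong) (simp add: nn_integral_cmult mult.assoc)
    also have "\<dots> = (\<integral>\<^sup>+y. (\<integral>\<^sup>+w. indicator G w * ennreal (pos_density s (Y n w) y) * h y \<partial>PP \<pi>) \<partial>\<Lambda>)"
      by (rule Fubini') (simp add: split_beta')
    also have "\<dots> = (\<integral>\<^sup>+y. k y * h y \<partial>\<Lambda>)"
      unfolding k_def by (intro nn_integral_cong nn_integral_multc) measurable
    finally show ?thesis .
  qed
  define D where "D = density (PP \<pi>) (\<lambda>w. indicator G w * indicator {s<..} (wait n w))"
  define Zs where "Zs w = Z1 Z (T n w + s) w" for w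
  have [measurable]: "Zs \<in> PP \<pi> \<rightarrow>\<^sub>M borel" unfolding Zs_def[abs_def] by measurable
  have [measurable]: "Zs \<in> D \<rightarrow>\<^sub>M borel" by (simp add: D_def)
  have Dnn: "(\<integral>\<^sup>+w. f w \<partial>D) = (\<integral>\<^sup>+w. indicator G w * (indicator {s<..} (wait n w) * f w) \<partial>PP \<pi>)"
    if [measurable]: "f \<in> borel_measurable (PP \<pi>)" for f
    unfolding D_def by (subst nn_integral_density) (auto simp: mult.assoc)
  have "distr D borel Zs = density \<Lambda> (\<lambda>y. ennreal (exp (- s)) * k y)"
  proof (rule measure_eqI)
    fix A assume "A \<in> sets (distr D borel Zs)"
    then have A[measurable]: "A \<in> sets borel" by simp
    have "emeasure (distr D borel Zs) A = (\<integral>\<^sup>+x. indicator A x \<partial>distr D borel Zs)" by simp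
    also have "\<dots> = (\<integral>\<^sup>+w. indicator G w * (indicator {s<..} (wait n w) * indicator A (Zs w)) \<partial>PP \<pi>)"
      by (subst nn_integral_distr) (auto simp: Dnn)
    also have "\<dots> = (\<integral>\<^sup>+w. indicator G w * emeasure (trans_kernel P X s (Y n w)) A \<partial>PP \<pi>) * ennreal (exp (- s))"
      using position_law[OF \<pi> G s A, of UNIV] exp_mass_above[of s] s by (simp add: Zs_def)
    also have "(\<integral>\<^sup>+w. indicator G w * emeasure (trans_kernel P X s (Y n w)) A \<partial>PP \<pi>) = (\<integral>\<^sup>+y. k y * indicator A y \<partial>\<Lambda>)"
      using fub[of "indicator A"] by (simp add: emeasure_trans_kernel[OF s A])
    also have "(\<integral>\<^sup>+y. k y * indicator A y \<partial>\<Lambda>) * ennreal (exp (- s)) = emeasure (density \<Lambda> (\<lambda>y. ennreal (exp (- s)) * k y)) A"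
      by (simp add: emeasure_density mult.assoc nn_integral_cmult mult.commute[of _ "ennreal (exp (- s))"])
    finally show "emeasure (distr D borel Zs) A = emeasure (density \<Lambda> (\<lambda>y. ennreal (exp (- s)) * k y)) A" .
  qed (simp add: sets_\<Lambda>)
  then have "(\<integral>\<^sup>+x. g x \<partial>distr D borel Zs) = (\<integral>\<^sup>+y. ennreal (exp (- s)) * (k y * g y) \<partial>\<Lambda>)"
    by (simp add: nn_integral_density mult.assoc)
  also have "\<dots> = ennreal (exp (- s)) * (\<integral>\<^sup>+w. indicator G w * (\<integral>\<^sup>+y. ennreal (pos_density s (Y n w) y) * g y \<partial>\<Lambda>) \<partial>PP \<pi>)"
    by (simp add: nn_integral_cmult fub[OF g])
  also have "\<dots> = (\<integral>\<^sup>+w. ennreal (exp (- s)) * (indicator G w * (\<integral>\<^sup>+y. ennreal (pos_density s (Y n w) y) * g y \<partial>\<Lambda>)) \<partial>PP \<pi>)"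
  proof (rule nn_integral_cmult[symmetric])
    have [measurable]: "(\<lambda>z. pos_density s (Y n (fst z)) (snd z)) \<in> borel_measurable (PP \<pi> \<Otimes>\<^sub>M \<Lambda>)"
      by (rule pos_density_measurable; measurable)
    have [measurable]: "(\<lambda>w. \<integral>\<^sup>+y. ennreal (pos_density s (Y n w) y) * g y \<partial>\<Lambda>) \<in> borel_measurable (PP \<pi>)"
      by (rule L.borel_measurable_nn_integral) (simp add: split_beta')
    show "(\<lambda>w. indicator G w * (\<integral>\<^sup>+y. ennreal (pos_density s (Y n w) y) * g y \<partial>\<Lambda>)) \<in> borel_measurable (PP \<pi>)" by measurable
  qed
  also have "\<dots> = (\<integral>\<^sup>+w. indicator G w * (ennreal (exp (- s)) * (\<integral>\<^sup>+y. ennreal (pos_density s (Y n w) y) * g y \<partial>\<Lambda>)) \<partial>PP \<pi>)"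
    by (intro nn_integral_cong) (rule mult.left_commute)
  also have "(\<integral>\<^sup>+x. g x \<partial>distr D borel Zs) = (\<integral>\<^sup>+w. g (Zs w) \<partial>D)"
    by (rule nn_integral_distr) measurable
  also have "\<dots> = (\<integral>\<^sup>+w. indicator G w * (indicator {s<..} (wait n w) * g (Zs w)) \<partial>PP \<pi>)"
    by (rule Dnn) measurable
  finally show ?thesis unfolding Zs_def .
qed

text \<open>The probability \<open>exp (- s)\<close> that the waiting time exceeds \<open>s\<close>
  and the transition density at \<open>s\<close> integrate to the resolvent density.\<close>

lemma occ_law:
  assumes \<pi>: "\<pi> \<in> inits" and G: "G \<in> sets (F n)" and g[measurable]: "g \<in> borel_measurable borel"
  shows "(\<integral>\<^sup>+w. indicator G w * occ g n w \<partial>PP \<pi>) = (\<integral>\<^sup>+w. indicator G w * potential g (Y n w) \<partial>PP \<pi>)"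
proof -
  interpret PP: prob_space "PP \<pi>" by (rule PP_prob_space[OF \<pi>])
  interpret L: sigma_finite_measure \<Lambda> by (rule \<Lambda>_sigma_finite)
  interpret pair_sigma_finite lborel "PP \<pi>" ..
  note [measurable] = G_PP[OF \<pi> G] measurable_PP[OF \<pi> Y_measurable, of n]
  have Lm[measurable]: "(\<lambda>z. \<integral>\<^sup>+y. ennreal (pos_density (fst z) (Y n (snd z)) y) * g y \<partial>\<Lambda>) \<in> borel_measurable (lborel \<Otimes>\<^sub>M PP \<pi>)"
  proof -
    have [measurable]: "(\<lambda>z. pos_density (fst (fst z)) (Y n (snd (fst z))) (snd z)) \<in> borel_measurable ((lborel \<Otimes>\<^sub>M PP \<pi>) \<Otimes>\<^sub>M \<Lambda>)"
      by (rule pos_density_measurable; measurable)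
    show ?thesis by (rule L.borel_measurable_nn_integral) (simp add: split_beta')
  qed
  have Lm2: "(\<lambda>s. \<integral>\<^sup>+y. ennreal (pos_density s (Y n w) y) * g y \<partial>\<Lambda>) \<in> borel_measurable lborel" if "w \<in> space (PP \<pi>)" for w
    using measurable_compose[OF _ Lm, of "\<lambda>s. (s, w)" lborel] that by simp
  have "(\<integral>\<^sup>+w. indicator G w * occ g n w \<partial>PP \<pi>) =
    (\<integral>\<^sup>+s. indicator {0<..} s * (\<integral>\<^sup>+w. indicator G w * (indicator {s<..} (wait n w) * g (Z1 Z (T n w + s) w)) \<partial>PP \<pi>) \<partial>lborel)"
    using nn_integral_weighted_occ[OF \<pi> G g, of "\<lambda>_. 1"] by (simp add: occ_eq_weighted)
  also have "\<dots> = (\<integral>\<^sup>+s. (\<integral>\<^sup>+w. indicator G w * (ennreal (exp (- s)) * (\<integral>\<^sup>+y. ennreal (pos_density s (Y n w) y) * g y \<partial>\<Lambda>)) \<partial>PP \<pi>) \<partial>lborel)"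
  proof (intro nn_integral_cong)
    fix s :: real
    show "indicator {0<..} s * (\<integral>\<^sup>+w. indicator G w * (indicator {s<..} (wait n w) * g (Z1 Z (T n w + s) w)) \<partial>PP \<pi>) =
       (\<integral>\<^sup>+w. indicator G w * (ennreal (exp (- s)) * (\<integral>\<^sup>+y. ennreal (pos_density s (Y n w) y) * g y \<partial>\<Lambda>)) \<partial>PP \<pi>)"
    proof (cases "0 < s")
      case True
      then show ?thesis using position_mean[OF \<pi> G True g] by simp
    next
      case False
      then show ?thesis by (simp add: pos_density_def)
    qed
  qed
  also have "\<dots> = (\<integral>\<^sup>+w. (\<integral>\<^sup>+s. indicator G w * (ennreal (exp (- s)) * (\<integral>\<^sup>+y. ennreal (pos_density s (Y n w) y) * g y \<partial>\<Lambda>)) \<partial>lborel) \<partial>PP \<pi>)"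
    by (rule Fubini'[symmetric]) (simp add: split_beta')
  also have "\<dots> = (\<integral>\<^sup>+w. indicator G w * potential g (Y n w) \<partial>PP \<pi>)"
  proof (intro nn_integral_cong)
    fix w assume w: "w \<in> space (PP \<pi>)"
    note [measurable] = Lm2[OF w]
    show "(\<integral>\<^sup>+s. indicator G w * (ennreal (exp (- s)) * (\<integral>\<^sup>+y. ennreal (pos_density s (Y n w) y) * g y \<partial>\<Lambda>)) \<partial>lborel) =
      indicator G w * potential g (Y n w)"
      unfolding potential_def nn_integral_resolvent_density[OF g]
      by (rule nn_integral_cmult) measurable
  qed
  finally show ?thesis .
qed

end

section \<open>Regeneration cycles\<close>

context nummelin_splitting
begin

lemma exp_half: "(\<integral>\<^sup>+r. ennreal (exp (- r)) \<partial>exp_law) = ennreal (1 / 2)"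
proof -
  have "(\<integral>\<^sup>+r. ennreal (exp (- r)) \<partial>exp_law) = (\<integral>\<^sup>+r. indicator {0<..} r * ennreal (exp (- r)) * ennreal (exp (- r)) \<partial>lborel)"
    by (rule nn_integral_exp_law) measurable
  also have "\<dots> = (\<integral>\<^sup>+r. indicator {0<..} r * ennreal (exp (- (2 * r))) \<partial>lborel)"
    by (intro nn_integral_cong) (simp add: mult.assoc ennreal_mult[symmetric] exp_add[symmetric])
  finally show ?thesis using nn_integral_exp[of 0 2] by simp
qed

text \<open>The transform of a waiting time at 1 is 1/2, and each waiting time is independent of the
  past. The geometric decay excludes accumulation of jumps and makes the mean number of
  regenerations finite.\<close>

lemma T_laplace:
  assumes \<pi>: "\<pi> \<in> inits"
  shows "(\<integral>\<^sup>+w. ennreal (exp (- T n w)) \<partial>PP \<pi>) = ennreal ((1 / 2) ^ n)"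
proof (induction n)
  case 0
  interpret PP: prob_space "PP \<pi>" by (rule PP_prob_space[OF \<pi>])
  have "(\<integral>\<^sup>+w. ennreal (exp (- T 0 w)) \<partial>PP \<pi>) = (\<integral>\<^sup>+w. 1 \<partial>PP \<pi>)"
    by (intro nn_integral_cong) (simp add: T_0 space_PP[OF \<pi>])
  then show ?case by (simp add: PP.emeasure_space_1)
next
  case (Suc n)
  note [measurable] = T_F[of n n, simplified] measurable_PP[OF \<pi> T_measurable, of n]
  have "(\<lambda>z. ennreal (exp (- T n (fst z))) * ennreal (exp (- snd z))) \<in> borel_measurable (F n \<Otimes>\<^sub>M borel)"
    by measurable
  from wait_independent[OF \<pi> this]
  have "(\<integral>\<^sup>+w. ennreal (exp (- T n w)) * ennreal (exp (- wait n w)) \<partial>PP \<pi>) =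
    (\<integral>\<^sup>+w. (\<integral>\<^sup>+r. ennreal (exp (- T n w)) * ennreal (exp (- r)) \<partial>exp_law) \<partial>PP \<pi>)"
    by simp
  also have "\<dots> = (\<integral>\<^sup>+w. ennreal (exp (- T n w)) * ennreal (1 / 2) \<partial>PP \<pi>)"
    by (intro nn_integral_cong) (subst nn_integral_cmult, auto simp: exp_half)
  also have "\<dots> = ennreal ((1 / 2) ^ n) * ennreal (1 / 2)"
    by (subst nn_integral_multc) (auto simp: Suc.IH)
  also have "\<dots> = ennreal ((1 / 2) ^ n * (1 / 2))" by (rule ennreal_mult[symmetric]) auto
  also have "(1 / 2) ^ n * (1 / 2) = (1 / 2 :: real) ^ Suc n" by simp
  finally show ?case by (simp add: ennreal_mult[symmetric] exp_add[symmetric])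
qed

lemma T_tail:
  assumes \<pi>: "\<pi> \<in> inits"
  shows "emeasure (PP \<pi>) {w\<in>space Om'. T n w \<le> t} \<le> ennreal (exp t * (1 / 2) ^ n)"
proof -
  note [measurable] = measurable_PP[OF \<pi> T_measurable, of n]
  have "emeasure (PP \<pi>) {w\<in>space Om'. T n w \<le> t} = (\<integral>\<^sup>+w. indicator {w\<in>space (PP \<pi>). T n w \<le> t} w \<partial>PP \<pi>)"
    by (simp add: space_PP[OF \<pi>, symmetric])
  also have "\<dots> \<le> (\<integral>\<^sup>+w. ennreal (exp t) * ennreal (exp (- T n w)) \<partial>PP \<pi>)"
  proof (intro nn_integral_mono)
    fix w
    have "1 \<le> ennreal (exp (t - T n w))" if "T n w \<le> t"
      using ennreal_leI[of 1 "exp (t - T n w)"] that by simp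
    then show "indicator {w\<in>space (PP \<pi>). T n w \<le> t} w \<le> ennreal (exp t) * ennreal (exp (- T n w))"
      by (auto simp: indicator_def ennreal_mult[symmetric] exp_add[symmetric])
  qed
  also have "\<dots> = ennreal (exp t * (1 / 2) ^ n)"
    by (subst nn_integral_cmult) (auto simp: T_laplace[OF \<pi>] ennreal_mult)
  finally show ?thesis .
qed

lemma AE_T_unbounded:
  assumes \<pi>: "\<pi> \<in> inits"
  shows "AE w in PP \<pi>. \<forall>t. \<exists>n. t < T n w"
proof -
  note [measurable] = measurable_PP[OF \<pi> T_measurable]
  have "AE w in PP \<pi>. \<forall>k::nat. \<exists>n. real k < T n w"
  proof (subst AE_all_countable, intro allI)
    fix k :: nat
    have m: "{w \<in> space Om'. \<forall>n. T n w \<le> real k} \<in> sets (PP \<pi>)"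
      unfolding space_PP[OF \<pi>, symmetric] by measurable
    have "emeasure (PP \<pi>) {w \<in> space Om'. \<forall>n. T n w \<le> real k} \<le> ennreal (exp (real k) * (1 / 2) ^ n)" for n
    proof -
      have "{w \<in> space Om'. T n w \<le> real k} \<in> sets (PP \<pi>)" unfolding space_PP[OF \<pi>, symmetric] by measurable
      then have "emeasure (PP \<pi>) {w \<in> space Om'. \<forall>n. T n w \<le> real k} \<le> emeasure (PP \<pi>) {w\<in>space Om'. T n w \<le> real k}"
        by (intro emeasure_mono) auto
      with T_tail[OF \<pi>, of n "real k"] show ?thesis by simp
    qed
    moreover have "(\<lambda>n. ennreal (exp (real k) * (1 / 2) ^ n)) \<longlonglongrightarrow> ennreal (exp (real k) * 0)"
      by (intro tendsto_ennrealI tendsto_mult tendsto_const LIMSEQ_realpow_zero) auto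
    ultimately have "emeasure (PP \<pi>) {w \<in> space Om'. \<forall>n. T n w \<le> real k} \<le> ennreal (exp (real k) * 0)"
      by (intro LIMSEQ_le_const) auto
    then have "emeasure (PP \<pi>) {w \<in> space Om'. \<forall>n. T n w \<le> real k} = 0" by simp
    with m have "{w \<in> space Om'. \<forall>n. T n w \<le> real k} \<in> null_sets (PP \<pi>)" by (simp add: null_sets_def)
    from AE_not_in[OF this] AE_space show "AE w in PP \<pi>. \<exists>n. real k < T n w"
      by eventually_elim (auto simp: space_PP[OF \<pi>] not_le)
  qed
  then show ?thesis
  proof eventually_elim
    fix w assume k: "\<forall>k::nat. \<exists>n. real k < T n w"
    show "\<forall>t. \<exists>n. t < T n w"
    proof
      fix t :: real
      obtain k :: nat where "t < real k" using reals_Archimedean2 by blast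
      with k show "\<exists>n. t < T n w" by (meson less_trans)
    qed
  qed
qed

text \<open>An index \<open>j\<close> is not eligible exactly if a regeneration cycle starts at \<open>T\<^sub>j\<close>: a hit at \<open>R\<^sub>n\<close> itself does
  not count towards \<open>S\<close> with index \<open>n + 1\<close>. The number \<open>cyc_index j\<close> is the index of the cycle to which
  \<open>[T\<^sub>j, T\<^bsub>j+1\<^esub>)\<close> belongs.\<close>

primrec elig :: "nat \<Rightarrow> 'v \<Rightarrow> bool" where
  "elig 0 w = False"
| "elig (Suc j) w = (\<not> (elig j w \<and> w \<in> hits j))"

primrec cyc_index :: "nat \<Rightarrow> 'v \<Rightarrow> nat" where
  "cyc_index 0 w = 0"
| "cyc_index (Suc j) w = (if elig j w \<and> w \<in> hits j then Suc (cyc_index j w) else cyc_index j w)"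

text \<open>Both ends are excluded: a hit at the start \<open>n\<close> does not count, and a hit at
  \<open>j\<close> ends the cycle only one jump later.\<close>

definition no_hit :: "nat \<Rightarrow> nat \<Rightarrow> 'v \<Rightarrow> bool" where
  "no_hit n j w \<longleftrightarrow> (\<forall>i. n < i \<and> i < j \<longrightarrow> w \<notin> hits i)"

lemma cyc_index_mono: "i \<le> j \<Longrightarrow> cyc_index i w \<le> cyc_index j w"
  by (rule lift_Suc_mono_le[of "\<lambda>n. cyc_index n w"]) auto

text \<open>Beyond its start \<open>r\<close> a cycle stays eligible until it ends, so the automaton
  advances exactly at the first hit after \<open>r\<close>.\<close>

lemma cycle_no_hit:
  "\<not> elig r w \<Longrightarrow> (no_hit r (r + i) w \<longleftrightarrow> cyc_index (r + i) w = cyc_index r w) \<and>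
    (cyc_index (r + i) w = cyc_index r w \<longrightarrow> (elig (r + i) w \<longleftrightarrow> 0 < i))"
proof (induction i)
  case 0
  then show ?case by (auto simp: no_hit_def)
next
  case (Suc i)
  have split: "no_hit r (r + Suc i) w \<longleftrightarrow> no_hit r (r + i) w \<and> (0 < i \<longrightarrow> w \<notin> hits (r + i))"
    unfolding no_hit_def by (auto simp: less_Suc_eq)
  have "cyc_index r w \<le> cyc_index (r + i) w" by (rule cyc_index_mono) simp
  then show ?case using Suc.IH[OF Suc.prems] Suc.prems unfolding split by (cases i) auto
qed

lemma cycle_start_exists: "\<exists>r\<le>j. \<not> elig r w \<and> cyc_index r w = cyc_index j w"
proof (induction j)
  case (Suc j)
  show ?case
  proof (cases "elig j w \<and> w \<in> hits j")
    case True
    then show ?thesis by (intro exI[of _ "Suc j"]) auto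
  next
    case False
    with Suc show ?thesis by (auto intro: le_SucI)
  qed
qed auto

lemma cycle_start_less:
  assumes "\<not> elig r' w" "r < r'" shows "cyc_index r w < cyc_index r' w"
proof -
  obtain i where i: "r' = Suc i" using assms(2) by (cases r') auto
  with assms have "cyc_index r' w = Suc (cyc_index i w)" by auto
  moreover have "cyc_index r w \<le> cyc_index i w" using assms(2) i by (intro cyc_index_mono) auto
  ultimately show ?thesis by simp
qed

lemma cycle_start_unique:
  assumes "\<not> elig r w" "\<not> elig r' w" "cyc_index r w = cyc_index r' w" shows "r = r'"
  using cycle_start_less[of r' w r] cycle_start_less[of r w r'] assms by (cases r r' rule: linorder_cases) auto

lemma suminf_single_ennreal:
  fixes f :: "nat \<Rightarrow> ennreal"
  assumes "\<And>j. j \<noteq> i \<Longrightarrow> f j = 0" shows "(\<Sum>j. f j) = f i"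
proof -
  have "f = (\<lambda>r. if r = i then f r else 0)" using assms by auto
  then show ?thesis using sums_unique[OF sums_single[of i f]] by simp
qed

lemma suminf_eq_offset_ennreal:
  fixes f :: "nat \<Rightarrow> ennreal"
  assumes "\<And>j. j < n \<Longrightarrow> f j = 0" shows "(\<Sum>j. f j) = (\<Sum>i. f (n + i))"
  using suminf_offset[of f n] assms by (simp add: add.commute)

text \<open>The sum over a cycle as if one began at \<open>n\<close>. The term at the first hit
  after \<open>n\<close> is included, because the regeneration takes place one jump after the
  hit.\<close>

definition csum :: "(nat \<Rightarrow> 'v \<Rightarrow> ennreal) \<Rightarrow> nat \<Rightarrow> 'v \<Rightarrow> ennreal" where
  "csum u n w = (\<Sum>i. if no_hit n (n + i) w then u (n + i) w else 0)"

text \<open>On the right at most one index can satisfy the condition, the true start of cycle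
  \<open>k\<close>. In this form the sum can be integrated term by term against events of the
  past.\<close>

lemma cycle_sum_eq:
  "(\<Sum>j. if cyc_index j w = k then u j w else 0) = (\<Sum>r. if \<not> elig r w \<and> cyc_index r w = k then csum u r w else 0)"
proof (cases "\<exists>j. cyc_index j w = k")
  case True
  then obtain r where r: "\<not> elig r w" "cyc_index r w = k" using cycle_start_exists by metis
  have "cyc_index j w \<noteq> k" if "j < r" for j using cycle_start_less[OF r(1) that] r(2) by simp
  then have "(\<Sum>j. if cyc_index j w = k then u j w else 0) = (\<Sum>i. if cyc_index (r + i) w = k then u (r + i) w else 0)"
    by (intro suminf_eq_offset_ennreal) auto
  also have "\<dots> = csum u r w"
  proof -
    have nh: "no_hit r (r + i) w = (cyc_index (r + i) w = k)" for i
      using cycle_no_hit[OF r(1), of i] r(2) by metis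
    show ?thesis unfolding csum_def nh ..
  qed
  finally have l: "(\<Sum>j. if cyc_index j w = k then u j w else 0) = csum u r w" .
  have "(\<Sum>r. if \<not> elig r w \<and> cyc_index r w = k then csum u r w else 0) =
    (if \<not> elig r w \<and> cyc_index r w = k then csum u r w else 0)"
  proof (rule suminf_single_ennreal)
    fix j assume "j \<noteq> r"
    then have "\<not> (\<not> elig j w \<and> cyc_index j w = k)" using r cycle_start_unique[of j w r] by metis
    then show "(if \<not> elig j w \<and> cyc_index j w = k then csum u j w else 0) = 0" by (rule if_not_P)
  qed
  then show ?thesis using l r by simp
qed auto

text \<open>The nested infima are resolved against the automaton: \<open>regen_time\<close> with
  index \<open>k\<close> is \<open>T r\<close> for the start \<open>r\<close> of cycle
  \<open>k\<close>, and infinite if no such start exists.\<close>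

lemma regen_time_le_iff:
  assumes w: "w \<in> space Om'"
  shows "0 \<le> t \<Longrightarrow> regen_time C a Z T k w \<le> ennreal t \<longleftrightarrow> (\<exists>j. k \<le> cyc_index j w \<and> T j w \<le> t)"
proof -
  have lt: "ennreal (T i w) < ennreal (T j w) \<longleftrightarrow> i < j" for i j
    using T_less[OF w, of i j] T_less[OF w, of j i] T_nonneg[OF w, of i]
    by (cases i j rule: linorder_cases) (auto simp: ennreal_less_iff)
  have le: "ennreal (T i w) \<le> ennreal (T j w) \<longleftrightarrow> i \<le> j" for i j
    using lt[of j i] by (simp flip: not_less)
  have Inf_eq: "Inf {ennreal (T j w) |j. Q j} = ennreal (T r w)" if "Q r" "\<And>j. Q j \<Longrightarrow> r \<le> j" for Q r
    using that by (intro antisym Inf_lower Inf_greatest) (auto simp: le)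
  have Inf_empty: "Inf {ennreal (T j w) |j. Q j} = \<infinity>" if "\<And>j. \<not> Q j" for Q
    using that by simp
  have hit: "Z (T j w) w \<in> C \<times> {0..a} \<times> UNIV \<longleftrightarrow> w \<in> hits j" for j
    using w by (simp add: hits_def)
  have key: "(\<forall>r. \<not> elig r w \<and> cyc_index r w = k \<longrightarrow> regen_time C a Z T k w = ennreal (T r w)) \<and>
     ((\<forall>j. cyc_index j w < k) \<longrightarrow> regen_time C a Z T k w = \<infinity>)" for k
  proof (induction k)
    case 0
    have "r = 0" if "\<not> elig r w" "cyc_index r w = 0" for r
      using cycle_start_unique[of r w 0] that by simp
    then have "T r w = 0" if "\<not> elig r w" "cyc_index r w = 0" for r
      using that T_0[OF w] by metis
    then show ?case by simp
  next
    case (Suc k)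
    have S: "next_S C a Z T w r = Inf {ennreal (T j w) |j. r < ennreal (T j w) \<and> w \<in> hits j}" for r
      unfolding next_S_def hit ..
    show ?case
    proof (cases "\<exists>j. cyc_index j w = k")
      case False
      \<comment> \<open>The index grows by steps of at most 1, so a value that is never taken is
        never exceeded.\<close>
      have nl: "cyc_index j w < k" for j
      proof (induction j)
        case 0
        then show ?case using False by (metis cyc_index.simps(1) gr0I)
      next
        case (Suc j)
        then show ?case using False[simplified, rule_format, of "Suc j"] by (auto split: if_splits)
      qed
      have inf: "regen_time C a Z T k w = \<infinity>" using Suc nl by blast
      have "next_S C a Z T w (regen_time C a Z T k w) = \<infinity>"
        unfolding S inf by (rule Inf_empty) simp
      then have "regen_time C a Z T (Suc k) w = \<infinity>"
        by (simp only: regen_time.simps, intro Inf_empty) simp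
      then show ?thesis using nl less_SucI by (metis less_irrefl)
    next
      case True
      then obtain r where r: "\<not> elig r w" "cyc_index r w = k" using cycle_start_exists by metis
      have R: "regen_time C a Z T k w = ennreal (T r w)" using Suc r by blast
      show ?thesis
      proof (cases "\<exists>s>r. w \<in> hits s")
        case False
        then have "no_hit r j w" for j by (auto simp: no_hit_def)
        then have ck: "cyc_index (r + i) w = k" for i using cycle_no_hit[OF r(1), of i] r(2) by simp
        have ck': "cyc_index j w \<le> k" for j
          using ck[of j] cyc_index_mono[of j "r + j" w] by simp
        have "next_S C a Z T w (ennreal (T r w)) = \<infinity>"
          unfolding S using False by (intro Inf_empty) (auto simp: lt)
        then have "regen_time C a Z T (Suc k) w = \<infinity>"
          by (simp only: regen_time.simps R, intro Inf_empty) simp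
        then show ?thesis using ck' by (metis Suc_n_not_le_n)
      next
        case True
        \<comment> \<open>\<open>T s\<close> is the time \<open>S\<close> that belongs to this
          cycle, so the next regeneration is at \<open>T (Suc s)\<close>.\<close>
        define s where "s = (LEAST s. r < s \<and> w \<in> hits s)"
        from True obtain s0 where "r < s0 \<and> w \<in> hits s0" by blast
        then have s: "r < s \<and> w \<in> hits s" unfolding s_def by (rule LeastI)
        have least: "s \<le> j" if "r < j \<and> w \<in> hits j" for j unfolding s_def using that by (rule Least_le)
        have S': "next_S C a Z T w (ennreal (T r w)) = ennreal (T s w)"
          unfolding S by (rule Inf_eq) (use s least in \<open>auto simp: lt\<close>)
        have R': "regen_time C a Z T (Suc k) w = ennreal (T (Suc s) w)"
          unfolding regen_time.simps R S' by (rule Inf_eq) (auto simp: lt)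
        have "no_hit r (r + (s - r)) w" unfolding no_hit_def
        proof (intro allI impI notI)
          fix i assume "r < i \<and> i < r + (s - r)" "w \<in> hits i"
          with least[of i] s show False by auto
        qed
        then have "cyc_index s w = k" "elig s w" using cycle_no_hit[OF r(1), of "s - r"] r(2) s by auto
        then have st: "\<not> elig (Suc s) w" "cyc_index (Suc s) w = Suc k" using s by auto
        show ?thesis using R' st cycle_start_unique[of "Suc s" w] by (metis less_irrefl)
      qed
    qed
  qed
  assume t: "0 \<le> t"
  show ?thesis
  proof (cases "\<exists>j. cyc_index j w = k")
    case True
    then obtain r where r: "\<not> elig r w" "cyc_index r w = k" using cycle_start_exists by metis
    have "r \<le> j" if "k \<le> cyc_index j w" for j
      using cycle_start_less[OF r(1), of j] r(2) that by (meson leI leD)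
    then show ?thesis using key[of k] r T_le[OF w, of r] t T_nonneg[OF w, of r]
      by (auto simp: ennreal_le_iff intro: order_trans intro!: exI[of _ r])
  next
    case False
    have nl: "cyc_index j w < k" for j
    proof (induction j)
      case 0
      then show ?case using False by (metis cyc_index.simps(1) gr0I)
    next
      case (Suc j)
      then show ?case using False[simplified, rule_format, of "Suc j"] by (auto split: if_splits)
    qed
    then have "\<not> k \<le> cyc_index j w" for j by (simp add: not_le)
    moreover have "regen_time C a Z T k w = \<infinity>" using key[of k] nl by blast
    ultimately show ?thesis by (simp add: top_unique)
  qed
qed

lemma current_index_exists:
  assumes w: "w \<in> space Om'" and unb: "\<forall>t. \<exists>n. t < T n w" and t: "0 \<le> t"
  shows "\<exists>j. T j w \<le> t \<and> t < T (Suc j) w"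
proof -
  obtain n where n: "t < T n w" using unb by blast
  define m where "m = (LEAST n. t < T n w)"
  have m: "t < T m w" unfolding m_def by (rule LeastI[of _ n]) (rule n)
  have "m \<noteq> 0" using m t T_0[OF w] by (metis not_less)
  then obtain j where j: "m = Suc j" by (cases m) auto
  have "\<not> t < T j w" using not_less_Least[of j "\<lambda>n. t < T n w"] j by (simp add: m_def)
  then show ?thesis using m j by (auto simp: not_less)
qed

lemma regen_time_le_current:
  assumes w: "w \<in> space Om'" and j: "T j w \<le> t" "t < T (Suc j) w"
  shows "regen_time C a Z T k w \<le> ennreal t \<longleftrightarrow> k \<le> cyc_index j w"
proof -
  have t: "0 \<le> t" using j(1) T_nonneg[OF w, of j] by simp
  have "i \<le> j" if "T i w \<le> t" for i
    using T_le[OF w, of "Suc j" i] that j(2) by (meson leI less_le_trans not_less_eq_eq order_trans not_less)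
  then show ?thesis unfolding regen_time_le_iff[OF w t] using cyc_index_mono[of _ j w] j(1)
    by (meson order_trans)
qed

text \<open>A time lies in the interval of cycle \<open>k\<close> exactly if the waiting interval
  that contains it has cycle index \<open>k\<close>; unbounded jump times guarantee that such a
  waiting interval exists.\<close>

lemma regen_interval_integral:
  assumes w: "w \<in> space Om'" and unb: "\<forall>t. \<exists>n. t < T n w" and [measurable]: "g \<in> borel_measurable borel"
  shows "(\<integral>\<^sup>+s. g (Z1 Z s w) * indicator {s. 0 \<le> s \<and> regen_time C a Z T k w \<le> ennreal s \<and> ennreal s < regen_time C a Z T (Suc k) w} s \<partial>lborel)
    = (\<Sum>j. if cyc_index j w = k then occ g j w else 0)"
proof -
  have Zm[measurable]: "(\<lambda>s. Z1 Z (max 0 s) w) \<in> borel \<rightarrow>\<^sub>M borel"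
    using measurable_compose[OF _ Z1_measurable_pair, of "\<lambda>s. (s, w)" borel] w by simp
  let ?I = "{s. 0 \<le> s \<and> regen_time C a Z T k w \<le> ennreal s \<and> ennreal s < regen_time C a Z T (Suc k) w}"
  have eq: "g (Z1 Z s w) * indicator ?I s =
     (\<Sum>j. (if cyc_index j w = k then 1 else 0) * (indicator {T j w..<T (Suc j) w} s * g (Z1 Z (max 0 s) w)))" for s
  proof (cases "0 \<le> s")
    case False
    then have "s < T j w" for j using T_nonneg[OF w, of j] by simp
    then have "indicator {T j w..<T (Suc j) w} s = (0 :: ennreal)" for j by (simp add: indicator_def not_le)
    then show ?thesis using False by simp
  next
    case True
    obtain j where j: "T j w \<le> s" "s < T (Suc j) w" using current_index_exists[OF w unb True] by blast
    have other: "indicator {T i w..<T (Suc i) w} s = (0 :: ennreal)" if "i \<noteq> j" for i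
    proof (cases "i < j")
      case True
      then have "T (Suc i) w \<le> T j w" by (intro T_le[OF w]) auto
      then show ?thesis using j by (simp add: indicator_def)
    next
      case False
      then have "T (Suc j) w \<le> T i w" using that by (intro T_le[OF w]) auto
      then show ?thesis using j by (simp add: indicator_def)
    qed
    have "s \<in> ?I \<longleftrightarrow> cyc_index j w = k"
      using True regen_time_le_current[OF w j, of k] regen_time_le_current[OF w j, of "Suc k"] by (auto simp flip: not_le)
    then have ind: "indicator ?I s = (if cyc_index j w = k then 1 else 0 :: ennreal)" by (simp only: indicator_def of_bool_def)
    have "(\<Sum>j. (if cyc_index j w = k then 1 else 0) * (indicator {T j w..<T (Suc j) w} s * g (Z1 Z (max 0 s) w))) =
      (if cyc_index j w = k then 1 else 0) * (indicator {T j w..<T (Suc j) w} s * g (Z1 Z (max 0 s) w))"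
      by (rule suminf_single_ennreal) (simp add: other)
    moreover have "indicator {T j w..<T (Suc j) w} s = (1 :: ennreal)" using j by simp
    moreover have "max 0 s = s" using True by simp
    ultimately show ?thesis unfolding ind by (simp add: mult.commute)
  qed
  have "(\<integral>\<^sup>+s. g (Z1 Z s w) * indicator ?I s \<partial>lborel) =
     (\<integral>\<^sup>+s. (\<Sum>j. (if cyc_index j w = k then 1 else 0) * (indicator {T j w..<T (Suc j) w} s * g (Z1 Z (max 0 s) w))) \<partial>lborel)"
    by (rule nn_integral_cong) (rule eq)
  also have "\<dots> = (\<Sum>j. \<integral>\<^sup>+s. (if cyc_index j w = k then 1 else 0) * (indicator {T j w..<T (Suc j) w} s * g (Z1 Z (max 0 s) w)) \<partial>lborel)"
    by (rule nn_integral_suminf) measurable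
  also have "\<dots> = (\<Sum>j. if cyc_index j w = k then occ g j w else 0)"
  proof (intro suminf_cong)
    fix j
    have "(\<integral>\<^sup>+s. indicator {T j w..<T (Suc j) w} s * g (Z1 Z (max 0 s) w) \<partial>lborel) = occ g j w"
      unfolding occ_def using T_nonneg[OF w, of j] by (intro nn_integral_cong) (auto simp: indicator_def max_def)
    then show "(\<integral>\<^sup>+s. (if cyc_index j w = k then 1 else 0) * (indicator {T j w..<T (Suc j) w} s * g (Z1 Z (max 0 s) w)) \<partial>lborel) =
      (if cyc_index j w = k then occ g j w else 0)" by simp
  qed
  finally show ?thesis .
qed

end

section \<open>Mean integrals over a cycle\<close>

context nummelin_splitting
begin

lemma no_hit_F: "{w\<in>space Om'. no_hit n j w} \<in> sets (F j)"
proof -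
  have "{w\<in>space (F j). \<forall>i\<in>{n<..<j}. w \<notin> hits i} \<in> sets (F j)"
  proof (rule sets.sets_Collect_finite_All)
    fix i assume "i \<in> {n<..<j}"
    then have "hits i \<in> sets (F j)" by (intro hits_F) simp
    then have "space (F j) - hits i \<in> sets (F j)" by (rule sets.compl_sets)
    moreover have "{w\<in>space (F j). w \<notin> hits i} = space (F j) - hits i" by auto
    ultimately show "{w\<in>space (F j). w \<notin> hits i} \<in> sets (F j)" by simp
  qed simp
  moreover have "{w\<in>space (F j). \<forall>i\<in>{n<..<j}. w \<notin> hits i} = {w\<in>space Om'. no_hit n j w}"
    unfolding no_hit_def space_F by auto
  ultimately show ?thesis by (simp only:)
qed

lemma no_hit_measurable[measurable]: "Measurable.pred Om' (no_hit n j)"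
  using F_into_Om'[OF no_hit_F] by (simp add: pred_def)

lemma elig_F: "Measurable.pred (F j) (elig j)"
  and cyc_index_F: "cyc_index j \<in> F j \<rightarrow>\<^sub>M count_space UNIV"
proof (induction j)
  case (Suc j)
  have [measurable]: "Measurable.pred (F (Suc j)) (elig j)" "cyc_index j \<in> F (Suc j) \<rightarrow>\<^sub>M count_space UNIV"
    by (rule measurable_F_mono[OF _ Suc(1)], simp) (rule measurable_F_mono[OF _ Suc(2)], simp)
  have [measurable]: "hits j \<in> sets (F (Suc j))" by (rule hits_F) simp
  show "Measurable.pred (F (Suc j)) (elig (Suc j))" unfolding elig.simps by measurable
  show "cyc_index (Suc j) \<in> F (Suc j) \<rightarrow>\<^sub>M count_space UNIV" unfolding cyc_index.simps by measurable
next
  case 0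
  show "Measurable.pred (F 0) (elig 0)"
    by (subst measurable_cong[of _ _ "\<lambda>_. False"]) auto
  show "cyc_index 0 \<in> F 0 \<rightarrow>\<^sub>M count_space UNIV"
    by (subst measurable_cong[of _ _ "\<lambda>_. 0"]) auto
qed

lemma elig_measurable[measurable]: "Measurable.pred Om' (elig j)"
  by (rule measurable_F_Om'[OF elig_F])

lemma cyc_index_measurable[measurable]: "cyc_index j \<in> Om' \<rightarrow>\<^sub>M count_space UNIV"
  by (rule measurable_F_Om'[OF cyc_index_F])

declare hits_measurable[measurable]

lemma csum_measurable:
  assumes [measurable]: "\<And>j. u j \<in> borel_measurable Om'"
  shows "csum u n \<in> borel_measurable Om'"
  unfolding csum_def[abs_def] by measurable

lemma occ_measurable: "g \<in> borel_measurable borel \<Longrightarrow> occ g n \<in> borel_measurable Om'"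
  by (rule measurable_F_Om'[OF occ_F])

definition hit_set :: "('e \<times> real \<times> 'e) set" where "hit_set = C \<times> {0..a} \<times> UNIV"

lemma hit_set_measurable[measurable]: "hit_set \<in> sets SZ"
  unfolding hit_set_def using C_measurable by measurable

lemma hits_iff: "w \<in> space Om' \<Longrightarrow> w \<in> hits j \<longleftrightarrow> Z (T j w) w \<in> hit_set"
  by (simp add: hits_def hit_set_def)

text \<open>A sequence of values of \<open>W\<close> does not record the path between jumps, hence
  the potential in place of the occupation integral; the two have the same conditional mean.\<close>

definition cyc_fun :: "('e \<Rightarrow> ennreal) \<Rightarrow> (nat \<Rightarrow> ('e \<times> real \<times> 'e) \<times> real) \<Rightarrow> ennreal" where
  "cyc_fun g f = (\<Sum>j. if \<forall>i\<in>{0<..<j}. fst (f i) \<notin> hit_set then potential g (fst (fst (f j))) else 0)"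

lemma cyc_fun_measurable:
  assumes [measurable]: "g \<in> borel_measurable borel" shows "cyc_fun g \<in> borel_measurable SWs"
proof -
  note [measurable] = potential_measurable[of g]
  show ?thesis unfolding cyc_fun_def[abs_def] by measurable
qed

definition cyc_mean :: "('e \<Rightarrow> ennreal) \<Rightarrow> 'e \<Rightarrow> ennreal" where
  "cyc_mean g x = (\<integral>\<^sup>+f. cyc_fun g f \<partial>start_law SWs W_seq x)"

lemma cyc_mean_measurable: "g \<in> borel_measurable borel \<Longrightarrow> cyc_mean g \<in> borel_measurable borel"
  unfolding cyc_mean_def[abs_def] by (rule markov_seq_kernel_nn[OF markov_seq_W_seq cyc_fun_measurable])

lemma space_top_F: "space Om' \<in> sets (F n)"
  using sets.top[of "F n"] by simp

text \<open>Each occupation integral may be replaced by the potential at its left end because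
  \<open>no_hit n (n + i)\<close> is an event of \<open>F (n + i)\<close>. What remains is a
  function of the sequence of jumps, to which the Markov property applies.\<close>

lemma cyc_law:
  assumes \<pi>: "\<pi> \<in> inits" and G: "G \<in> sets (F n)" and g[measurable]: "g \<in> borel_measurable borel"
  shows "(\<integral>\<^sup>+w. indicator G w * csum (occ g) n w \<partial>PP \<pi>) = (\<integral>\<^sup>+w. indicator G w * cyc_mean g (Y n w) \<partial>PP \<pi>)"
proof -
  note [measurable] = G_PP[OF \<pi> G] measurable_PP[OF \<pi> Y_measurable] measurable_PP[OF \<pi> occ_measurable[OF g]]
    potential_measurable[OF g] measurable_PP[OF \<pi> no_hit_measurable]
  have "(\<integral>\<^sup>+w. indicator G w * csum (occ g) n w \<partial>PP \<pi>) =
     (\<integral>\<^sup>+w. (\<Sum>i. indicator G w * (if no_hit n (n + i) w then occ g (n + i) w else 0)) \<partial>PP \<pi>)"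
    unfolding csum_def by simp
  also have "\<dots> = (\<Sum>i. \<integral>\<^sup>+w. indicator G w * (if no_hit n (n + i) w then occ g (n + i) w else 0) \<partial>PP \<pi>)"
    by (rule nn_integral_suminf) measurable
  also have "\<dots> = (\<Sum>i. \<integral>\<^sup>+w. indicator G w * (if no_hit n (n + i) w then potential g (Y (n + i) w) else 0) \<partial>PP \<pi>)"
  proof (intro suminf_cong)
    fix i
    have H: "G \<inter> {w\<in>space Om'. no_hit n (n + i) w} \<in> sets (F (n + i))"
      using G F_mono[of n "n + i"] no_hit_F by auto
    have ind: "indicator G w * (if no_hit n (n + i) w then h w else 0) =
       indicator (G \<inter> {w\<in>space Om'. no_hit n (n + i) w}) w * h w" if "w \<in> space (PP \<pi>)" for w and h :: "'v \<Rightarrow> ennreal"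
      using that by (auto simp: indicator_def space_PP[OF \<pi>])
    show "(\<integral>\<^sup>+w. indicator G w * (if no_hit n (n + i) w then occ g (n + i) w else 0) \<partial>PP \<pi>) =
      (\<integral>\<^sup>+w. indicator G w * (if no_hit n (n + i) w then potential g (Y (n + i) w) else 0) \<partial>PP \<pi>)"
    proof -
      have i: "(\<integral>\<^sup>+w. indicator G w * (if no_hit n (n + i) w then h w else 0) \<partial>PP \<pi>) =
        (\<integral>\<^sup>+w. indicator (G \<inter> {w\<in>space Om'. no_hit n (n + i) w}) w * h w \<partial>PP \<pi>)" for h :: "'v \<Rightarrow> ennreal"
        by (rule nn_integral_cong) (rule ind)
      show ?thesis unfolding i by (rule occ_law[OF \<pi> H g])
    qed
  qed
  also have "\<dots> = (\<integral>\<^sup>+w. (\<Sum>i. indicator G w * (if no_hit n (n + i) w then potential g (Y (n + i) w) else 0)) \<partial>PP \<pi>)"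
    by (rule nn_integral_suminf[symmetric]) measurable
  also have "\<dots> = (\<integral>\<^sup>+w. indicator G w * cyc_fun g (W_seq n w) \<partial>PP \<pi>)"
  proof (intro nn_integral_cong)
    fix w assume "w \<in> space (PP \<pi>)"
    then have w: "w \<in> space Om'" by (simp add: space_PP[OF \<pi>])
    have nh: "no_hit n (n + i) w \<longleftrightarrow> (\<forall>j\<in>{0<..<i}. fst (W_seq n w j) \<notin> hit_set)" for i
    proof -
      have "(\<forall>j\<in>{0<..<i}. fst (W_seq n w j) \<notin> hit_set) \<longleftrightarrow> (\<forall>j. 0 < j \<and> j < i \<longrightarrow> w \<notin> hits (n + j))"
        by (simp add: W_seq_def W_def hits_iff[OF w] Ball_def)
      also have "\<dots> \<longleftrightarrow> no_hit n (n + i) w"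
        unfolding no_hit_def by (metis add_less_cancel_left add_cancel_left_right less_add_same_cancel1 less_imp_add_positive)
      finally show ?thesis by simp
    qed
    have Yeq: "fst (fst (W_seq n w i)) = Y (n + i) w" for i by (simp add: W_seq_def W_def)
    show "(\<Sum>i. indicator G w * (if no_hit n (n + i) w then potential g (Y (n + i) w) else 0)) = indicator G w * cyc_fun g (W_seq n w)"
      unfolding cyc_fun_def nh Yeq by simp
  qed
  also have "\<dots> = (\<integral>\<^sup>+w. indicator G w * cyc_mean g (Y n w) \<partial>PP \<pi>)"
    unfolding cyc_mean_def by (rule markov_seq_nn[OF markov_seq_W_seq \<pi> G cyc_fun_measurable[OF g]])
  finally show ?thesis .
qed

lemma nn_integral_space_indicator:
  "\<pi> \<in> inits \<Longrightarrow> (\<integral>\<^sup>+w. indicator (space Om') w * h w \<partial>PP \<pi>) = (\<integral>\<^sup>+w. h w \<partial>PP \<pi>)"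
  by (intro nn_integral_cong) (simp add: space_PP)

lemma cyc_mean_start:
  assumes "\<pi> \<in> inits" "g \<in> borel_measurable borel"
  shows "(\<integral>\<^sup>+w. csum (occ g) 0 w \<partial>PP \<pi>) = (\<integral>\<^sup>+x. cyc_mean g x \<partial>\<pi>)"
  using cyc_law[OF assms(1) space_top_F assms(2), of 0] nn_integral_Y0[OF assms(1) cyc_mean_measurable[OF assms(2)]]
  by (simp add: nn_integral_space_indicator[OF assms(1)])

lemma cyc_mean_return:
  assumes "g \<in> borel_measurable borel"
  shows "(\<integral>\<^sup>+w. csum (occ g) 0 w \<partial>PP (return borel x)) = cyc_mean g x"
  using cyc_mean_start[OF return_inits assms] cyc_mean_measurable[OF assms] by (simp add: nn_integral_return)

lemma cyc_regen:
  assumes \<pi>: "\<pi> \<in> inits" and G: "G \<in> sets (F j)" and g: "g \<in> borel_measurable borel"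
  shows "(\<integral>\<^sup>+w. indicator (G \<inter> hits j) w * csum (occ g) (Suc j) w \<partial>PP \<pi>) =
    emeasure (PP \<pi>) (G \<inter> hits j) * (\<integral>\<^sup>+x. cyc_mean g x \<partial>\<nu>)"
proof -
  have "G \<inter> hits j \<in> sets (F (Suc j))" using G F_Suc[of j] hits_F[of j "Suc j"] by auto
  from cyc_law[OF \<pi> this g] hit_law[OF \<pi> G cyc_mean_measurable[OF g]] show ?thesis by simp
qed

text \<open>Cycle \<open>k + 1\<close> starts at index \<open>i + 1\<close> exactly on
  \<open>pre_start k i \<inter> hits i\<close>; the first factor lies in \<open>F i\<close>, the
  form that \<open>hit_law\<close> requires.\<close>

definition pre_start :: "nat \<Rightarrow> nat \<Rightarrow> 'v set" where
  "pre_start k i = {w\<in>space Om'. elig i w \<and> cyc_index i w = k}"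

lemma pre_start_F: "pre_start k i \<in> sets (F i)"
proof -
  note [measurable] = elig_F[of i] cyc_index_F[of i]
  have "{w\<in>space (F i). elig i w \<and> cyc_index i w = k} \<in> sets (F i)" by measurable
  then show ?thesis by (simp add: pre_start_def)
qed

lemma pre_start_hits: "w \<in> space Om' \<Longrightarrow>
  w \<in> pre_start k i \<inter> hits i \<longleftrightarrow> \<not> elig (Suc i) w \<and> cyc_index (Suc i) w = Suc k"
  by (auto simp: pre_start_def)

lemma disjoint_pre_start: "disjoint_family (\<lambda>i. pre_start k i \<inter> hits i)"
  unfolding disjoint_family_on_def
proof (intro ballI impI)
  fix i j :: nat assume ne: "i \<noteq> j"
  have False if "w \<in> pre_start k i \<inter> hits i" "w \<in> pre_start k j \<inter> hits j" for w
  proof -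
    have "w \<in> space Om'" using that by (simp add: pre_start_def)
    then show False
      using that ne cycle_start_unique[of "Suc i" w "Suc j"] pre_start_hits[of w k] by auto
  qed
  then show "(pre_start k i \<inter> hits i) \<inter> (pre_start k j \<inter> hits j) = {}" by blast
qed

definition started :: "nat \<Rightarrow> 'v set" where
  "started k = {w\<in>space Om'. \<exists>j. cyc_index j w = k}"

lemma started_measurable[measurable]: "started k \<in> sets Om'"
  unfolding started_def by measurable

lemma started_Suc: "started (Suc k) = (\<Union>i. pre_start k i \<inter> hits i)"
proof (intro set_eqI iffI)
  fix w assume "w \<in> started (Suc k)"
  then obtain j where w: "w \<in> space Om'" and "cyc_index j w = Suc k" by (auto simp: started_def)
  then obtain r where r: "\<not> elig r w" "cyc_index r w = Suc k" using cycle_start_exists by metis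
  then obtain i where "r = Suc i" by (cases r) auto
  with r pre_start_hits[OF w] show "w \<in> (\<Union>i. pre_start k i \<inter> hits i)" by blast
next
  fix w assume "w \<in> (\<Union>i. pre_start k i \<inter> hits i)"
  then obtain i where i: "w \<in> pre_start k i \<inter> hits i" by blast
  then have w: "w \<in> space Om'" by (simp add: pre_start_def)
  from pre_start_hits[OF this, of k i] i have "cyc_index (Suc i) w = Suc k" by blast
  with w show "w \<in> started (Suc k)" unfolding started_def by blast
qed

lemma emeasure_started_Suc:
  "\<pi> \<in> inits \<Longrightarrow> emeasure (PP \<pi>) (started (Suc k)) = (\<Sum>i. emeasure (PP \<pi>) (pre_start k i \<inter> hits i))"
  unfolding started_Suc
  by (rule suminf_emeasure[symmetric])
    (use disjoint_pre_start F_into_Om'[OF pre_start_F] in \<open>auto simp: sets_PP\<close>)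

lemma cycle_sum_Suc:
  assumes "w \<in> space Om'"
  shows "(\<Sum>j. if cyc_index j w = Suc k then u j w else 0) = (\<Sum>i. indicator (pre_start k i \<inter> hits i) w * csum u (Suc i) w)"
proof -
  have "(\<Sum>j. if cyc_index j w = Suc k then u j w else 0) = (\<Sum>r. if \<not> elig r w \<and> cyc_index r w = Suc k then csum u r w else 0)"
    by (rule cycle_sum_eq)
  also have "\<dots> = (\<Sum>i. if \<not> elig (1 + i) w \<and> cyc_index (1 + i) w = Suc k then csum u (1 + i) w else 0)"
    by (rule suminf_eq_offset_ennreal) simp
  also have "\<dots> = (\<Sum>i. indicator (pre_start k i \<inter> hits i) w * csum u (Suc i) w)"
  proof (intro suminf_cong)
    fix i
    show "(if \<not> elig (1 + i) w \<and> cyc_index (1 + i) w = Suc k then csum u (1 + i) w else 0) =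
      indicator (pre_start k i \<inter> hits i) w * csum u (Suc i) w"
      unfolding indicator_def of_bool_def pre_start_hits[OF assms] plus_1_eq_Suc
      by (simp del: elig.simps cyc_index.simps)
  qed
  finally show ?thesis .
qed

lemma cycle_sum_0:
  "(\<Sum>j. if cyc_index j w = 0 then u j w else 0) = csum u 0 w"
proof -
  have "(\<Sum>j. if cyc_index j w = 0 then u j w else 0) = (\<Sum>r. if \<not> elig r w \<and> cyc_index r w = 0 then csum u r w else 0)"
    by (rule cycle_sum_eq)
  also have "\<dots> = (if \<not> elig 0 w \<and> cyc_index 0 w = 0 then csum u 0 w else 0)"
  proof (rule suminf_single_ennreal)
    fix j :: nat assume "j \<noteq> 0"
    then have "\<not> (\<not> elig j w \<and> cyc_index j w = 0)"
      using cycle_start_less[of j w 0] by (metis gr0I less_zeroE)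
    then show "(if \<not> elig j w \<and> cyc_index j w = 0 then csum u j w else 0) = 0" by (rule if_not_P)
  qed
  finally show ?thesis by simp
qed

lemma nn_integral_cycle:
  assumes \<pi>: "\<pi> \<in> inits" and g: "g \<in> borel_measurable borel"
  shows "(\<integral>\<^sup>+w. (\<Sum>j. if cyc_index j w = Suc k then occ g j w else 0) \<partial>PP \<pi>) =
    emeasure (PP \<pi>) (started (Suc k)) * (\<integral>\<^sup>+x. cyc_mean g x \<partial>\<nu>)"
proof -
  have "(\<integral>\<^sup>+w. (\<Sum>j. if cyc_index j w = Suc k then occ g j w else 0) \<partial>PP \<pi>) =
    (\<integral>\<^sup>+w. (\<Sum>i. indicator (pre_start k i \<inter> hits i) w * csum (occ g) (Suc i) w) \<partial>PP \<pi>)"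
    by (intro nn_integral_cong) (simp add: cycle_sum_Suc space_PP[OF \<pi>])
  also have "\<dots> = (\<Sum>i. \<integral>\<^sup>+w. indicator (pre_start k i \<inter> hits i) w * csum (occ g) (Suc i) w \<partial>PP \<pi>)"
  proof (rule nn_integral_suminf)
    fix i
    have [measurable]: "pre_start k i \<inter> hits i \<in> sets (PP \<pi>)"
      using F_into_Om'[OF pre_start_F] hits_measurable by (simp add: sets_PP[OF \<pi>])
    note [measurable] = measurable_PP[OF \<pi> csum_measurable[OF occ_measurable[OF g]]]
    show "(\<lambda>w. indicator (pre_start k i \<inter> hits i) w * csum (occ g) (Suc i) w) \<in> borel_measurable (PP \<pi>)" by measurable
  qed
  also have "\<dots> = (\<Sum>i. emeasure (PP \<pi>) (pre_start k i \<inter> hits i) * (\<integral>\<^sup>+x. cyc_mean g x \<partial>\<nu>))"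
    by (intro suminf_cong cyc_regen[OF \<pi> pre_start_F g])
  also have "\<dots> = emeasure (PP \<pi>) (started (Suc k)) * (\<integral>\<^sup>+x. cyc_mean g x \<partial>\<nu>)"
    by (simp add: emeasure_started_Suc[OF \<pi>])
  finally show ?thesis .
qed

text \<open>\<open>\<mu>\<close> is normalized by cycle 1. Decomposing according to the index at
  which this cycle starts leaves the mean over a cycle started from \<open>\<nu>\<close>, times the
  probability that cycle 1 occurs.\<close>

lemma mu_eq_started:
  assumes \<pi>: "\<pi> \<in> inits" and g[measurable]: "g \<in> borel_measurable borel"
  shows "(\<integral>\<^sup>+x. g x \<partial>\<mu>) = emeasure (PP \<pi>) (started 1) * (\<integral>\<^sup>+x. cyc_mean g x \<partial>\<nu>)"
proof -
  have "(\<integral>\<^sup>+x. g x \<partial>\<mu>) = (\<integral>\<^sup>+w. (\<integral>\<^sup>+s\<in>{s. 0 \<le> s \<and> regen_time C a Z T 1 w \<le> ennreal s \<and> ennreal s < regen_time C a Z T 2 w}.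
            g (Z1 Z s w) \<partial>lborel) \<partial>PP \<pi>)"
    by (rule \<mu>_normalized[OF \<pi> g])
  also have "\<dots> = (\<integral>\<^sup>+w. (\<Sum>j. if cyc_index j w = Suc 0 then occ g j w else 0) \<partial>PP \<pi>)"
  proof (rule nn_integral_cong_AE)
    show "AE w in PP \<pi>. (\<integral>\<^sup>+s\<in>{s. 0 \<le> s \<and> regen_time C a Z T 1 w \<le> ennreal s \<and> ennreal s < regen_time C a Z T 2 w}.
            g (Z1 Z s w) \<partial>lborel) = (\<Sum>j. if cyc_index j w = Suc 0 then occ g j w else 0)"
      using AE_T_unbounded[OF \<pi>] AE_space
    proof eventually_elim
      fix w assume unb: "\<forall>t. \<exists>n. t < T n w" and "w \<in> space (PP \<pi>)"
      then have w: "w \<in> space Om'" by (simp add: space_PP[OF \<pi>])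
      show "(\<integral>\<^sup>+s\<in>{s. 0 \<le> s \<and> regen_time C a Z T 1 w \<le> ennreal s \<and> ennreal s < regen_time C a Z T 2 w}.
            g (Z1 Z s w) \<partial>lborel) = (\<Sum>j. if cyc_index j w = Suc 0 then occ g j w else 0)"
        using regen_interval_integral[OF w unb g, of 1] by (simp only: One_nat_def numeral_2_eq_2)
    qed
  qed
  also have "\<dots> = emeasure (PP \<pi>) (started 1) * (\<integral>\<^sup>+x. cyc_mean g x \<partial>\<nu>)"
    using nn_integral_cycle[OF \<pi> g, of 0] by simp
  finally show ?thesis .
qed

text \<open>The integral before the first regeneration is the integral over cycle 0. Thus C(f)
  becomes the uniform bound on conditional means that the exponential estimates need.\<close>

lemma C_const_eq:
  fixes f :: "'e \<Rightarrow> real"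
  assumes [measurable]: "f \<in> borel_measurable borel"
  shows "C_const C a PP Z T f = (SUP x. cyc_mean (\<lambda>x. ennreal \<bar>f x\<bar>) x)"
  unfolding C_const_def
proof (rule SUP_cong[OF refl])
  fix x :: 'e
  let ?\<pi> = "return borel x" and ?g = "\<lambda>x. ennreal \<bar>f x\<bar>"
  have g: "?g \<in> borel_measurable borel" by measurable
  have "(\<integral>\<^sup>+w. (\<integral>\<^sup>+s\<in>{s. 0 \<le> s \<and> ennreal s < regen_time C a Z T 1 w}. ennreal \<bar>f (Z1 Z s w)\<bar> \<partial>lborel) \<partial>PP ?\<pi>) =
    (\<integral>\<^sup>+w. csum (occ ?g) 0 w \<partial>PP ?\<pi>)"
  proof (rule nn_integral_cong_AE)
    show "AE w in PP ?\<pi>. (\<integral>\<^sup>+s\<in>{s. 0 \<le> s \<and> ennreal s < regen_time C a Z T 1 w}. ennreal \<bar>f (Z1 Z s w)\<bar> \<partial>lborel) = csum (occ ?g) 0 w"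
      using AE_T_unbounded[OF return_inits] AE_space
    proof eventually_elim
      fix w assume unb: "\<forall>t. \<exists>n. t < T n w" and "w \<in> space (PP ?\<pi>)"
      then have w: "w \<in> space Om'" by (simp add: space_PP[OF return_inits])
      show "(\<integral>\<^sup>+s\<in>{s. 0 \<le> s \<and> ennreal s < regen_time C a Z T 1 w}. ennreal \<bar>f (Z1 Z s w)\<bar> \<partial>lborel) = csum (occ ?g) 0 w"
        using regen_interval_integral[OF w unb g, of 0] cycle_sum_0[of w "occ ?g"] by (simp del: regen_time.simps(2))
    qed
  qed
  also have "\<dots> = cyc_mean ?g x" by (rule cyc_mean_return[OF g])
  finally show "(\<integral>\<^sup>+w. (\<integral>\<^sup>+s\<in>{s. 0 \<le> s \<and> ennreal s < regen_time C a Z T 1 w}. ennreal \<bar>f (Z1 Z s w)\<bar> \<partial>lborel) \<partial>PP ?\<pi>) = cyc_mean ?g x" .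
qed

text \<open>\<open>mu_eq_started\<close> is evaluated on a set of positive finite
  \<open>\<mu>\<close>-measure; dividing by the mean over a cycle shows that the probability does
  not depend on the initial law.\<close>

lemma emeasure_started_const: "\<exists>c::real. 0 < c \<and> c \<le> 1 \<and> (\<forall>\<pi>\<in>inits. emeasure (PP \<pi>) (started 1) = ennreal c)"
proof -
  interpret mu: sigma_finite_measure \<mu> by (rule \<mu>_sigma_finite)
  have "\<exists>A. A \<in> sets \<mu> \<and> 0 < emeasure \<mu> A \<and> emeasure \<mu> A < \<infinity>"
    using mu.approx_PInf_emeasure_with_finite C_positive
  proof -
    obtain A :: "nat \<Rightarrow> 'e set" where A: "range A \<subseteq> sets \<mu>" "(\<Union>i. A i) = space \<mu>" "\<And>i. emeasure \<mu> (A i) \<noteq> \<infinity>"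
      using mu.sigma_finite by blast
    have "\<exists>i. emeasure \<mu> (A i) \<noteq> 0"
    proof (rule ccontr)
      assume "\<not> ?thesis"
      then have "emeasure \<mu> (\<Union>i. A i) = 0" using A(1) by (intro emeasure_UN_eq_0) auto
      moreover have "emeasure \<mu> C \<le> emeasure \<mu> (space \<mu>)" by (rule emeasure_space)
      ultimately show False using C_positive A(2) by simp
    qed
    then obtain i where "emeasure \<mu> (A i) \<noteq> 0" ..
    then show ?thesis using A by (intro exI[of _ "A i"]) (auto simp: zero_less_iff_neq_zero less_top)
  qed
  then obtain A where A: "A \<in> sets borel" "0 < emeasure \<mu> A" "emeasure \<mu> A < \<infinity>" by (auto simp: sets_\<mu>)
  define b where "b = (\<integral>\<^sup>+x. cyc_mean (indicator A) x \<partial>\<nu>)"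
  have eq: "emeasure \<mu> A = emeasure (PP \<pi>) (started 1) * b" if "\<pi> \<in> inits" for \<pi>
    using mu_eq_started[OF that, of "indicator A"] A by (simp add: b_def sets_\<mu>)
  have b0: "b \<noteq> 0" using eq[OF nu_inits] A by auto
  have p0: "emeasure (PP \<pi>) (started 1) \<noteq> 0" if "\<pi> \<in> inits" for \<pi> using eq[OF that] A by auto
  have bt: "b \<noteq> \<infinity>" using eq[OF nu_inits] p0[OF nu_inits] A by (auto simp: ennreal_mult_top)
  have val: "emeasure (PP \<pi>) (started 1) = emeasure \<mu> A / b" if "\<pi> \<in> inits" for \<pi>
    using eq[OF that] b0 bt by (simp add: mult_divide_eq_ennreal)
  have le: "emeasure (PP \<nu>) (started 1) \<le> 1" using prob_space.emeasure_le_1[OF PP_prob_space[OF nu_inits]] .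
  define c where "c = enn2real (emeasure (PP \<nu>) (started 1))"
  have lt: "emeasure (PP \<nu>) (started 1) < top" by (rule le_less_trans[OF le ennreal_one_less_top])
  have c: "emeasure (PP \<nu>) (started 1) = ennreal c"
    unfolding c_def using lt by (rule ennreal_enn2real[symmetric])
  have "0 < c" unfolding c_def using p0[OF nu_inits] lt by (simp only: enn2real_positive_iff zero_less_iff_neq_zero simp_thms not_False_eq_True)
  moreover have "c \<le> 1" using le unfolding c by (simp only: ennreal_le_1)
  ultimately show ?thesis using val nu_inits c by metis
qed

end

section \<open>Almost sure recurrence of hits\<close>

context nummelin_splitting
begin

definition never :: "nat \<Rightarrow> 'v set" where
  "never n = {w\<in>space Om'. \<forall>i>n. w \<notin> hits i}"

lemma never_measurable[measurable]: "never n \<in> sets Om'"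
proof -
  have "{w\<in>space Om'. \<forall>i. n < i \<longrightarrow> w \<notin> hits i} \<in> sets Om'" by measurable
  then show ?thesis unfolding never_def .
qed

lemma never_eq: "never 0 = space Om' - started 1"
proof -
  have "(\<forall>i>0. w \<notin> hits i) \<longleftrightarrow> (\<forall>j. cyc_index j w \<noteq> Suc 0)" for w
  proof
    assume "\<forall>i>0. w \<notin> hits i"
    then have "no_hit 0 (0 + j) w" for j by (simp add: no_hit_def)
    then have "cyc_index j w = 0" for j using cycle_no_hit[of 0 w j] by simp
    then show "\<forall>j. cyc_index j w \<noteq> Suc 0" by (metis nat.distinct(1))
  next
    assume ne: "\<forall>j. cyc_index j w \<noteq> Suc 0"
    have z: "cyc_index j w = 0" for j
    proof (induction j)
      case (Suc j)
      then show ?case using ne[rule_format, of "Suc j"] by (auto split: if_splits)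
    qed simp
    show "\<forall>i>0. w \<notin> hits i"
    proof (intro allI impI)
      fix i :: nat assume "0 < i"
      have "no_hit 0 (0 + Suc i) w" using cycle_no_hit[of 0 w "Suc i"] z[of "Suc i"] by simp
      then show "w \<notin> hits i" using \<open>0 < i\<close> by (simp add: no_hit_def)
    qed
  qed
  then show ?thesis unfolding never_def started_def by auto
qed

text \<open>The probability of no further hit is the same number from every starting point, hence
  independent of the past by the Markov property of the whole sequence.\<close>

lemma never_law:
  assumes \<pi>: "\<pi> \<in> inits" and G: "G \<in> sets (F n)" and c: "\<forall>\<pi>\<in>inits. emeasure (PP \<pi>) (never 0) = q"
  shows "emeasure (PP \<pi>) (G \<inter> never n) = emeasure (PP \<pi>) G * q"
proof -
  define N where "N = {f \<in> space SWs. \<forall>i. 0 < i \<longrightarrow> fst (f i) \<notin> hit_set}"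
  have N[measurable]: "N \<in> sets SWs" unfolding N_def by measurable
  have iff: "W_seq n w \<in> N \<longleftrightarrow> w \<in> never n" if w: "w \<in> space Om'" for n w
  proof -
    have sp: "W_seq n w \<in> space SWs" by (rule measurable_space[OF W_seq_measurable w])
    have e: "fst (W_seq n w i) \<in> hit_set \<longleftrightarrow> w \<in> hits (n + i)" for i
      unfolding hits_iff[OF w] by (simp add: W_seq_def W_def)
    have "W_seq n w \<in> N \<longleftrightarrow> (\<forall>i. 0 < i \<longrightarrow> w \<notin> hits (n + i))"
      unfolding N_def mem_Collect_eq e using sp by blast
    also have "\<dots> \<longleftrightarrow> w \<in> never n"
    proof
      assume h: "\<forall>i. 0 < i \<longrightarrow> w \<notin> hits (n + i)"
      have "w \<notin> hits i" if "n < i" for i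
        using h less_imp_add_positive[OF that] by metis
      then show "w \<in> never n" using w by (simp add: never_def)
    qed (simp add: never_def)
    finally show ?thesis .
  qed
  have ind: "(indicator N :: _ \<Rightarrow> ennreal) \<in> borel_measurable SWs" by measurable
  have "(\<integral>\<^sup>+f. indicator N f \<partial>start_law SWs W_seq x) = q" for x
  proof -
    have "(\<integral>\<^sup>+f. indicator N f \<partial>start_law SWs W_seq x) = (\<integral>\<^sup>+w. indicator N (W_seq 0 w) \<partial>PP (return borel x))"
      by (rule start_law_nn[OF W_seq_measurable ind])
    also have "\<dots> = (\<integral>\<^sup>+w. indicator (never 0) w \<partial>PP (return borel x))"
      by (intro nn_integral_cong) (simp add: space_PP[OF return_inits] iff indicator_def)
    also have "\<dots> = q" using c return_inits by (simp add: sets_PP[OF return_inits])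
    finally show ?thesis .
  qed
  with markov_seq_nn[OF markov_seq_W_seq \<pi> G ind]
  have "(\<integral>\<^sup>+w. indicator G w * indicator N (W_seq n w) \<partial>PP \<pi>) = (\<integral>\<^sup>+w. q * indicator G w \<partial>PP \<pi>)"
    by (simp add: mult.commute)
  also have "(\<integral>\<^sup>+w. indicator G w * indicator N (W_seq n w) \<partial>PP \<pi>) = (\<integral>\<^sup>+w. indicator (G \<inter> never n) w \<partial>PP \<pi>)"
    by (intro nn_integral_cong) (simp add: space_PP[OF \<pi>] iff indicator_def)
  also have "\<dots> = emeasure (PP \<pi>) (G \<inter> never n)"
    using G_PP[OF \<pi> G] by (intro nn_integral_indicator) (simp add: sets_PP[OF \<pi>])
  also have "(\<integral>\<^sup>+w. q * indicator G w \<partial>PP \<pi>) = q * emeasure (PP \<pi>) G"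
    by (rule nn_integral_cmult_indicator[OF G_PP[OF \<pi> G]])
  finally show ?thesis by (simp add: mult.commute)
qed

text \<open>A zero-one argument. If q is the probability of no hit, restarting at index n gives q
  \<le> P(no hit before n) q, and in the limit q \<le> q q. Since q < 1, it vanishes.\<close>

lemma started_1: "\<pi> \<in> inits \<Longrightarrow> emeasure (PP \<pi>) (started 1) = 1"
  and never_0: "\<pi> \<in> inits \<Longrightarrow> emeasure (PP \<pi>) (never n) = 0"
proof -
  obtain c :: real where c: "0 < c" "c \<le> 1" "\<And>\<pi>. \<pi> \<in> inits \<Longrightarrow> emeasure (PP \<pi>) (started 1) = ennreal c"
    using emeasure_started_const by blast
  have nv: "emeasure (PP \<pi>) (never 0) = ennreal (1 - c)" if \<pi>: "\<pi> \<in> inits" for \<pi>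
  proof -
    interpret PP: prob_space "PP \<pi>" by (rule PP_prob_space[OF \<pi>])
    have "emeasure (PP \<pi>) (space (PP \<pi>) - started 1) = emeasure (PP \<pi>) (space (PP \<pi>)) - emeasure (PP \<pi>) (started 1)"
      using c(3)[OF \<pi>] started_measurable by (intro emeasure_compl) (auto simp: sets_PP[OF \<pi>])
    also have "\<dots> = ennreal 1 - ennreal c" using c(3)[OF \<pi>] by (simp add: PP.emeasure_space_1)
    also have "\<dots> = ennreal (1 - c)" using c by (intro ennreal_minus) auto
    finally show ?thesis by (simp add: never_eq space_PP[OF \<pi>])
  qed
  have law: "emeasure (PP \<pi>) (G \<inter> never n) = emeasure (PP \<pi>) G * ennreal (1 - c)" if "\<pi> \<in> inits" "G \<in> sets (F n)" for \<pi> G n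
    using never_law[OF that] nv by blast
  let ?P = "PP \<nu>"
  have bound: "ennreal (1 - c) \<le> emeasure ?P {w\<in>space Om'. no_hit 0 n w} * ennreal (1 - c)" for n
  proof -
    have "never 0 \<subseteq> {w\<in>space Om'. no_hit 0 n w} \<inter> never n"
      by (auto simp: never_def no_hit_def)
    then have "emeasure ?P (never 0) \<le> emeasure ?P ({w\<in>space Om'. no_hit 0 n w} \<inter> never n)"
      using F_into_Om'[OF no_hit_F] by (intro emeasure_mono) (auto simp: sets_PP[OF nu_inits])
    then show ?thesis using law[OF nu_inits no_hit_F] nv[OF nu_inits] by simp
  qed
  have "(\<lambda>n. emeasure ?P {w\<in>space Om'. no_hit 0 n w}) \<longlonglongrightarrow> emeasure ?P (\<Inter>n. {w\<in>space Om'. no_hit 0 n w})"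
  proof (rule Lim_emeasure_decseq)
    show "range (\<lambda>n. {w\<in>space Om'. no_hit 0 n w}) \<subseteq> sets ?P"
      using F_into_Om'[OF no_hit_F] by (auto simp: sets_PP[OF nu_inits])
    show "decseq (\<lambda>n. {w\<in>space Om'. no_hit 0 n w})" by (auto simp: decseq_def no_hit_def)
    show "emeasure ?P {w\<in>space Om'. no_hit 0 n w} \<noteq> \<infinity>" for n
      using finite_measure.emeasure_finite[OF prob_space.finite_measure[OF PP_prob_space[OF nu_inits]]] by simp
  qed
  also have "(\<Inter>n. {w\<in>space Om'. no_hit 0 n w}) = never 0"
    unfolding never_def no_hit_def by auto
  finally have "(\<lambda>n. emeasure ?P {w\<in>space Om'. no_hit 0 n w} * ennreal (1 - c)) \<longlonglongrightarrow> ennreal (1 - c) * ennreal (1 - c)"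
    unfolding nv[OF nu_inits] by (intro tendsto_mult_ennreal tendsto_const) auto
  then have "ennreal (1 - c) \<le> ennreal (1 - c) * ennreal (1 - c)"
    using bound by (intro LIMSEQ_le_const) auto
  then have "1 - c \<le> (1 - c) * (1 - c)" using c by (simp add: ennreal_mult[symmetric])
  then have "0 \<le> - (c * (1 - c))" by (simp add: algebra_simps)
  then have c1: "c = 1" using c by (smt (verit) mult_pos_pos)
  show "emeasure (PP \<pi>) (started 1) = 1" if "\<pi> \<in> inits" using c(3)[OF that] c1 by simp
  show "emeasure (PP \<pi>) (never n) = 0" if "\<pi> \<in> inits"
  proof -
    have "space Om' \<inter> never n = never n" by (auto simp: never_def)
    then show ?thesis using law[OF that space_top_F[of n]] c1 by simp
  qed
qed

lemma cyc_index_reaches: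
  assumes "\<And>n. \<exists>i>n. w \<in> hits i" shows "\<exists>j. cyc_index j w = k"
proof (induction k)
  case 0
  then show ?case by (intro exI[of _ 0]) simp
next
  case (Suc k)
  then obtain r where r: "\<not> elig r w" "cyc_index r w = k" using cycle_start_exists by metis
  obtain i where i: "r < i" "w \<in> hits i" using assms by blast
  have "\<not> no_hit r (r + (Suc i - r)) w" using i by (auto simp: no_hit_def)
  then have "cyc_index (r + (Suc i - r)) w \<noteq> k" using cycle_no_hit[OF r(1), of "Suc i - r"] r(2) by metis
  moreover have "k \<le> cyc_index (r + (Suc i - r)) w" using cyc_index_mono[of r "r + (Suc i - r)" w] r(2) by simp
  ultimately have gt: "\<exists>j. k < cyc_index j w" by (intro exI[of _ "r + (Suc i - r)"]) (rule le_neq_implies_less, simp_all)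
  define j where "j = (LEAST j. k < cyc_index j w)"
  have j: "k < cyc_index j w" unfolding j_def using gt by (rule LeastI_ex)
  then obtain l where l: "j = Suc l" by (cases j) auto
  have "\<not> k < cyc_index l w" using not_less_Least[of l "\<lambda>j. k < cyc_index j w"] l by (simp add: j_def)
  then have "cyc_index j w = Suc k" using j l by (auto split: if_splits)
  then show ?case ..
qed

lemma AE_cyc_index:
  assumes \<pi>: "\<pi> \<in> inits"
  shows "AE w in PP \<pi>. (\<forall>n. \<exists>i>n. w \<in> hits i) \<and> (\<forall>k. \<exists>j. cyc_index j w = k)"
proof -
  have "AE w in PP \<pi>. \<forall>n. w \<notin> never n"
  proof (subst AE_all_countable, intro allI)
    fix n
    have "never n \<in> null_sets (PP \<pi>)" using never_0[OF \<pi>] by (simp add: null_sets_def sets_PP[OF \<pi>])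
    then show "AE w in PP \<pi>. w \<notin> never n" by (rule AE_not_in)
  qed
  with AE_space show ?thesis
  proof eventually_elim
    fix w assume "w \<in> space (PP \<pi>)" "\<forall>n. w \<notin> never n"
    then have h: "\<exists>i>n. w \<in> hits i" for n by (auto simp: never_def space_PP[OF \<pi>])
    with cyc_index_reaches[of w] show "(\<forall>n. \<exists>i>n. w \<in> hits i) \<and> (\<forall>k. \<exists>j. cyc_index j w = k)" by blast
  qed
qed

lemma mu_eq:
  "g \<in> borel_measurable borel \<Longrightarrow> (\<integral>\<^sup>+x. g x \<partial>\<mu>) = (\<integral>\<^sup>+x. cyc_mean g x \<partial>\<nu>)"
  using mu_eq_started[OF nu_inits, of g] started_1[OF nu_inits] by simp

lemma emeasure_started:
  assumes \<pi>: "\<pi> \<in> inits" shows "emeasure (PP \<pi>) (started k) = 1"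
proof -
  interpret PP: prob_space "PP \<pi>" by (rule PP_prob_space[OF \<pi>])
  have "AE w in PP \<pi>. w \<in> started k"
    using AE_cyc_index[OF \<pi>] AE_space by eventually_elim (auto simp: started_def space_PP[OF \<pi>])
  then show ?thesis using started_measurable by (intro PP.emeasure_eq_1_AE) (auto simp: sets_PP[OF \<pi>])
qed

lemma occ_one: "w \<in> space Om' \<Longrightarrow> occ (\<lambda>_. 1) n w = ennreal (wait n w)"
  using T_increasing[of w n] by (simp add: occ_def)

lemma nn_integral_occ_one:
  assumes \<pi>: "\<pi> \<in> inits" shows "(\<integral>\<^sup>+w. occ (\<lambda>_. 1) n w \<partial>PP \<pi>) = 1"
proof -
  interpret PP: prob_space "PP \<pi>" by (rule PP_prob_space[OF \<pi>])
  have "potential (\<lambda>_. 1) x = 1" for x by (simp add: potential_def resolvent_density_total)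
  moreover have "(\<integral>\<^sup>+w. indicator (space Om') w \<partial>PP \<pi>) = 1"
    using nn_integral_space_indicator[OF \<pi>, of "\<lambda>_. 1"] by (simp add: PP.emeasure_space_1)
  ultimately show ?thesis using occ_law[OF \<pi> space_top_F, of "\<lambda>_. 1" n]
    by (simp add: nn_integral_space_indicator[OF \<pi>])
qed

text \<open>A hit at the start of a cycle does not count, so every cycle contains at least two
  waiting times. The resulting bound 2 \<le> m is used to compare powers of 2/m in the positive
  recurrent case.\<close>

lemma cyc_mean_one_ge: "2 \<le> cyc_mean (\<lambda>_. 1) x"
proof -
  note [measurable] = measurable_PP[OF return_inits occ_measurable[of "\<lambda>_. 1"]]
  have "2 = (\<integral>\<^sup>+w. occ (\<lambda>_. 1) 0 w \<partial>PP (return borel x)) + (\<integral>\<^sup>+w. occ (\<lambda>_. 1) 1 w \<partial>PP (return borel x))"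
    by (simp add: nn_integral_occ_one[OF return_inits])
  also have "\<dots> = (\<integral>\<^sup>+w. occ (\<lambda>_. 1) 0 w + occ (\<lambda>_. 1) 1 w \<partial>PP (return borel x))"
    by (rule nn_integral_add[symmetric]) measurable
  also have "\<dots> \<le> (\<integral>\<^sup>+w. csum (occ (\<lambda>_. 1)) 0 w \<partial>PP (return borel x))"
  proof (intro nn_integral_mono)
    fix w
    have "(\<Sum>i<2. if no_hit 0 (0 + i) w then occ (\<lambda>_. 1) (0 + i) w else 0) \<le> csum (occ (\<lambda>_. 1)) 0 w"
      unfolding csum_def by (rule sum_le_suminf) auto
    then show "occ (\<lambda>_. 1) 0 w + occ (\<lambda>_. 1) 1 w \<le> csum (occ (\<lambda>_. 1)) 0 w"
      by (simp add: numeral_2_eq_2 no_hit_def)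
  qed
  also have "\<dots> = cyc_mean (\<lambda>_. 1) x" by (rule cyc_mean_return) simp
  finally show ?thesis .
qed

lemma exp_law_exp:
  assumes "th < 1" shows "(\<integral>\<^sup>+r. ennreal (exp (th * r)) \<partial>exp_law) = ennreal (1 / (1 - th))"
proof -
  have "(\<integral>\<^sup>+r. ennreal (exp (th * r)) \<partial>exp_law) = (\<integral>\<^sup>+r. indicator {0<..} r * ennreal (exp (- r)) * ennreal (exp (th * r)) \<partial>lborel)"
    by (rule nn_integral_exp_law) measurable
  also have "\<dots> = (\<integral>\<^sup>+r. indicator {0<..} r * ennreal (exp (- ((1 - th) * r))) \<partial>lborel)"
  proof (intro nn_integral_cong)
    fix r :: real
    have "ennreal (exp (- r)) * ennreal (exp (th * r)) = ennreal (exp (- ((1 - th) * r)))"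
      by (simp add: ennreal_mult[symmetric] exp_add[symmetric] algebra_simps)
    then show "indicator {0<..} r * ennreal (exp (- r)) * ennreal (exp (th * r)) = indicator {0<..} r * ennreal (exp (- ((1 - th) * r)))"
      by (simp only: mult.assoc)
  qed
  finally show ?thesis using nn_integral_exp[of 0 "1 - th"] assms by simp
qed

end

section \<open>Exponential moment of one increment\<close>

text \<open>\<open>Fb\<close> and \<open>Cc\<close> are real bounds that later become the supremum
  of |f| and C(f). The cases f = 0 and C(f) infinite are treated apart, which keeps the analysis on
  the reals.\<close>

locale bounded_functional = nummelin_splitting Om P X \<mu> \<Lambda> p a C \<nu> x0 Om' PP \<phi> Z T
  for Om :: "'w measure" and P :: "'e::polish_space \<Rightarrow> 'w measure" and X \<mu> \<Lambda> p a C \<nu> x0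
    and Om' :: "'v measure" and PP \<phi> Z T +
  fixes f :: "'e \<Rightarrow> real" and Fb :: real and Cc :: real
  assumes f_measurable[measurable]: "f \<in> borel_measurable borel"
    and Fb_pos: "0 < Fb" and f_bound: "\<And>x. \<bar>f x\<bar> \<le> Fb"
    and Cc_nonneg: "0 \<le> Cc" and cyc_mean_bound: "\<And>x. cyc_mean (\<lambda>x. ennreal \<bar>f x\<bar>) x \<le> ennreal Cc"
begin

abbreviation fa :: "'e \<Rightarrow> ennreal" where "fa x \<equiv> ennreal \<bar>f x\<bar>"

definition piece :: "nat \<Rightarrow> 'v \<Rightarrow> real" where "piece n w = enn2real (occ fa n w)"

lemma fa_measurable[measurable]: "fa \<in> borel_measurable borel" by measurable

lemma occ_fa_le:
  assumes w: "w \<in> space Om'" shows "occ fa n w \<le> ennreal (Fb * wait n w)"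
proof -
  have "occ fa n w \<le> (\<integral>\<^sup>+s. ennreal Fb * indicator {T n w..<T (Suc n) w} s \<partial>lborel)"
    unfolding occ_def using f_bound by (intro nn_integral_mono) (auto simp: indicator_def intro: ennreal_leI)
  also have "\<dots> = ennreal Fb * ennreal (wait n w)"
    using T_increasing[OF w, of n] by (simp add: nn_integral_cmult)
  also have "\<dots> = ennreal (Fb * wait n w)"
    using Fb_pos T_increasing[OF w, of n] by (intro ennreal_mult[symmetric]) auto
  finally show ?thesis .
qed

lemma occ_fa_eq: "w \<in> space Om' \<Longrightarrow> occ fa n w = ennreal (piece n w)"
  unfolding piece_def using occ_fa_le[of w n] by (intro ennreal_enn2real[symmetric]) (auto intro: le_less_trans)

lemma piece_nonneg: "0 \<le> piece n w" by (simp add: piece_def)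

lemma piece_le: "w \<in> space Om' \<Longrightarrow> piece n w \<le> Fb * wait n w"
  using occ_fa_le[of w n] occ_fa_eq[of w n] Fb_pos T_increasing[of w n] by simp

lemma piece_F: "piece n \<in> borel_measurable (F (Suc n))"
  using occ_F[OF fa_measurable, of n] unfolding piece_def[abs_def] by measurable

text \<open>Among all functions with values in \<open>[0, Fb]\<close> and a given integral over a time interval, the one
  concentrated at the end of the interval minimises the integral against a decreasing weight.\<close>

lemma exp_piece_le:
  assumes w: "w \<in> space Om'" and th: "0 < th"
  shows "ennreal (exp (th * piece n w) - 1) \<le> ennreal th * weighted_occ fa (\<lambda>s. ennreal (exp (th * Fb * s))) n w"
proof -
  define v where "v = piece n w"
  define l where "l = T n w"
  define r where "r = T (Suc n) w"
  \<comment> \<open>The function equal to \<open>Fb\<close> on \<open>[s0, r)\<close> and 0 before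
    has the same integral \<open>v\<close>.\<close>
  define s0 where "s0 = r - v / Fb"
  define wt where "wt s = exp (th * Fb * (r - s))" for s
  have lr: "l < r" using T_increasing[OF w] by (simp add: l_def r_def)
  have v0: "0 \<le> v" by (simp add: v_def piece_nonneg)
  have s0: "l \<le> s0" "s0 \<le> r"
    using piece_le[OF w, of n] Fb_pos v0 by (auto simp: s0_def v_def l_def r_def field_simps)
  have Zm[measurable]: "(\<lambda>s. Z1 Z (max 0 s) w) \<in> borel \<rightarrow>\<^sub>M borel"
    using measurable_compose[OF _ Z1_measurable_pair, of "\<lambda>s. (s, w)" borel] w by simp
  define h where "h s = \<bar>f (Z1 Z (max 0 s) w)\<bar>" for s
  have [measurable]: "h \<in> borel_measurable borel" unfolding h_def by measurable
  have h: "0 \<le> h s" "h s \<le> Fb" for s by (auto simp: h_def f_bound)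
  have [measurable]: "wt \<in> borel_measurable borel" unfolding wt_def by measurable
  have wpos: "0 < wt s" for s by (simp add: wt_def)
  have wdec: "wt t \<le> wt s" if "s \<le> t" for s t using that th Fb_pos by (simp add: wt_def mult_left_mono)
  have m0: "max 0 s = s" if "s \<in> {l..<r}" for s using that T_nonneg[OF w, of n] by (simp add: l_def)
  have occv: "(\<integral>\<^sup>+s. indicator {l..<r} s * ennreal (h s) \<partial>lborel) = ennreal v"
  proof -
    have "(\<integral>\<^sup>+s. indicator {l..<r} s * ennreal (h s) \<partial>lborel) = occ fa n w"
      unfolding occ_def l_def[symmetric] r_def[symmetric]
      by (intro nn_integral_cong) (auto simp: indicator_def h_def m0)
    then show ?thesis using occ_fa_eq[OF w] by (simp add: v_def)
  qed
  have wocc: "weighted_occ fa (\<lambda>s. ennreal (exp (th * Fb * s))) n w = (\<integral>\<^sup>+s. indicator {l..<r} s * ennreal (h s * wt s) \<partial>lborel)"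
    unfolding weighted_occ_def l_def[symmetric] r_def[symmetric]
    by (intro nn_integral_cong) (auto simp: indicator_def h_def m0 wt_def ennreal_mult)
  \<comment> \<open>Both sides carry a term with \<open>wt s0\<close> so that nothing is subtracted;
    the integrals of these terms are equal and cancel at the end. The inequality is (Fb - h s)(wt s0
    - wt s) \<ge> 0 after \<open>s0\<close>, and monotonicity of \<open>wt\<close> before.\<close>
  have pt: "indicator {l..<r} s * ennreal (h s) * ennreal (wt s0) + indicator {s0..<r} s * ennreal (Fb * wt s) \<le>
     indicator {l..<r} s * ennreal (h s * wt s) + indicator {s0..<r} s * ennreal (Fb * wt s0)" for s
  proof -
    consider "s \<notin> {l..<r}" | "s \<in> {l..<r}" "s < s0" | "s \<in> {s0..<r}" using s0 by force
    then show ?thesis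
    proof cases
      case 1
      then show ?thesis using s0 by (auto simp: indicator_def)
    next
      case 2
      then have "h s * wt s0 \<le> h s * wt s" using h wdec[of s s0] by (intro mult_left_mono) auto
      then show ?thesis using 2 h wpos by (simp add: ennreal_mult[symmetric] less_imp_le ennreal_leI)
    next
      case 3
      then have "0 \<le> (Fb - h s) * (wt s0 - wt s)" using h wdec[of s0 s] by (intro mult_nonneg_nonneg) auto
      then have "h s * wt s0 + Fb * wt s \<le> h s * wt s + Fb * wt s0" by (simp add: algebra_simps)
      then show ?thesis using 3 s0 h wpos Fb_pos
        by (simp add: ennreal_mult[symmetric] ennreal_plus[symmetric] less_imp_le ennreal_leI del: ennreal_plus)
    qed
  qed
  have int_w: "(\<integral>\<^sup>+s. indicator {s0..<r} s * ennreal (Fb * wt s) \<partial>lborel) = ennreal ((exp (th * v) - 1) / th)"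
  proof -
    have "(\<integral>\<^sup>+s. ennreal (Fb * wt s) * indicator {s0..r} s \<partial>lborel) = ennreal (- (wt r / th) - (- (wt s0 / th)))"
      by (rule nn_integral_FTC_Icc[where F = "\<lambda>s. - (wt s / th)"])
        (use th Fb_pos s0 in \<open>auto simp: wt_def[abs_def] intro!: derivative_eq_intros\<close>)
    also have "- (wt r / th) - (- (wt s0 / th)) = (exp (th * v) - 1) / th"
      using Fb_pos th by (simp add: wt_def s0_def field_simps)
    also have "(\<integral>\<^sup>+s. ennreal (Fb * wt s) * indicator {s0..r} s \<partial>lborel) = (\<integral>\<^sup>+s. indicator {s0..<r} s * ennreal (Fb * wt s) \<partial>lborel)"
    proof (rule nn_integral_cong_AE)
      show "AE s in lborel. ennreal (Fb * wt s) * indicator {s0..r} s = indicator {s0..<r} s * ennreal (Fb * wt s)"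
        using AE_lborel_singleton[of r] by eventually_elim (auto simp: indicator_def)
    qed
    finally show ?thesis .
  qed
  have c1: "(\<integral>\<^sup>+s. indicator {l..<r} s * ennreal (h s) * ennreal (wt s0) \<partial>lborel) = ennreal (v * wt s0)"
    using occv v0 wpos[of s0] by (simp add: nn_integral_multc ennreal_mult[symmetric] less_imp_le)
  have c2: "(\<integral>\<^sup>+s. indicator {s0..<r} s * ennreal (Fb * wt s0) \<partial>lborel) = ennreal (v * wt s0)"
  proof -
    have "(\<integral>\<^sup>+s. indicator {s0..<r} s * ennreal (Fb * wt s0) \<partial>lborel) = ennreal (r - s0) * ennreal (Fb * wt s0)"
      using s0 by (subst nn_integral_multc) auto
    also have "\<dots> = ennreal ((r - s0) * (Fb * wt s0))"
      using s0 Fb_pos wpos[of s0] by (intro ennreal_mult[symmetric]) auto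
    also have "(r - s0) * (Fb * wt s0) = v * wt s0" using Fb_pos by (simp add: s0_def)
    finally show ?thesis .
  qed
  have "ennreal (v * wt s0) + ennreal ((exp (th * v) - 1) / th) =
    (\<integral>\<^sup>+s. indicator {l..<r} s * ennreal (h s) * ennreal (wt s0) + indicator {s0..<r} s * ennreal (Fb * wt s) \<partial>lborel)"
    unfolding c1[symmetric] int_w[symmetric] by (rule nn_integral_add[symmetric]) measurable
  also have "\<dots> \<le> (\<integral>\<^sup>+s. indicator {l..<r} s * ennreal (h s * wt s) + indicator {s0..<r} s * ennreal (Fb * wt s0) \<partial>lborel)"
    by (intro nn_integral_mono pt)
  also have "\<dots> = weighted_occ fa (\<lambda>s. ennreal (exp (th * Fb * s))) n w + ennreal (v * wt s0)"
    unfolding wocc c2[symmetric] by (rule nn_integral_add) measurable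
  also have "\<dots> = ennreal (v * wt s0) + weighted_occ fa (\<lambda>s. ennreal (exp (th * Fb * s))) n w"
    by (rule add.commute)
  finally have "ennreal ((exp (th * v) - 1) / th) \<le> weighted_occ fa (\<lambda>s. ennreal (exp (th * Fb * s))) n w"
    unfolding ennreal_add_left_cancel_le by simp
  then have "ennreal th * ennreal ((exp (th * v) - 1) / th) \<le> ennreal th * weighted_occ fa (\<lambda>s. ennreal (exp (th * Fb * s))) n w"
    by (rule mult_left_mono) simp
  moreover have "ennreal th * ennreal ((exp (th * v) - 1) / th) = ennreal (exp (th * v) - 1)"
    using th v0 by (simp add: ennreal_mult[symmetric])
  ultimately show ?thesis by (simp add: v_def)
qed

text \<open>The exponential weight has mean 1 / (1 - th Fb). The occupation integral enters
  linearly, so these bounds can be summed over a cycle and compared with the mean integral of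
  |f|.\<close>

lemma exp_piece_law:
  assumes \<pi>: "\<pi> \<in> inits" and G: "G \<in> sets (F n)" and th: "0 < th" "th * Fb < 1"
  shows "(\<integral>\<^sup>+w. indicator G w * ennreal (exp (th * piece n w) - 1) \<partial>PP \<pi>) \<le>
    ennreal (th / (1 - th * Fb)) * (\<integral>\<^sup>+w. indicator G w * occ fa n w \<partial>PP \<pi>)"
proof -
  let ?wt = "\<lambda>s. ennreal (exp (th * Fb * s))"
  note [measurable] = G_PP[OF \<pi> G]
  have wm: "?wt \<in> borel_measurable borel" by measurable
  have "(\<integral>\<^sup>+w. indicator G w * ennreal (exp (th * piece n w) - 1) \<partial>PP \<pi>) \<le>
     (\<integral>\<^sup>+w. indicator G w * (ennreal th * weighted_occ fa ?wt n w) \<partial>PP \<pi>)"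
    by (intro nn_integral_mono mult_left_mono exp_piece_le th) (auto simp: space_PP[OF \<pi>])
  also have "\<dots> = (\<integral>\<^sup>+w. indicator G w * weighted_occ fa (\<lambda>s. ennreal th * ?wt s) n w \<partial>PP \<pi>)"
  proof (intro nn_integral_cong)
    fix w assume "w \<in> space (PP \<pi>)"
    then have w: "w \<in> space Om'" by (simp add: space_PP[OF \<pi>])
    have [measurable]: "(\<lambda>s. Z1 Z (max 0 (T n w + s)) w) \<in> borel \<rightarrow>\<^sub>M borel"
      using measurable_compose[OF _ Z1_max_pair_measurable, of "\<lambda>s. (w, s)" borel] w by simp
    have [measurable]: "(\<lambda>s. indicator {s<..} (wait n w) :: ennreal) \<in> borel_measurable borel"
    proof -
      have "(\<lambda>s. if s < wait n w then 1 else 0 :: ennreal) \<in> borel_measurable borel" by measurable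
      then show ?thesis by (simp add: indicator_def)
    qed
    have e: "weighted_occ fa (\<lambda>s. ennreal th * ?wt s) n w = (\<integral>\<^sup>+s. ennreal th * (indicator {0<..} s * (indicator {s<..} (wait n w) * (fa (Z1 Z (max 0 (T n w + s)) w) * ?wt (wait n w - s)))) \<partial>lborel)"
      by (subst weighted_occ_shift[OF w]) (auto intro!: nn_integral_cong simp: ac_simps)
    also have "\<dots> = ennreal th * weighted_occ fa ?wt n w"
      unfolding weighted_occ_shift[OF w fa_measurable wm] by (rule nn_integral_cmult) measurable
    finally show "indicator G w * (ennreal th * weighted_occ fa ?wt n w) = indicator G w * weighted_occ fa (\<lambda>s. ennreal th * ?wt s) n w"
      by simp
  qed
  also have "\<dots> = (\<integral>\<^sup>+r. ennreal th * ?wt r \<partial>exp_law) * (\<integral>\<^sup>+w. indicator G w * occ fa n w \<partial>PP \<pi>)"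
    by (rule weighted_occ_law[OF \<pi> G]) measurable
  also have "(\<integral>\<^sup>+r. ennreal th * ?wt r \<partial>exp_law) = ennreal th * ennreal (1 / (1 - th * Fb))"
    using exp_law_exp[OF th(2)] by (subst nn_integral_cmult) auto
  also have "\<dots> = ennreal (th / (1 - th * Fb))"
    using th by (subst ennreal_mult[symmetric]) auto
  finally show ?thesis .
qed

end

section \<open>Exponential moments of cycles\<close>

text \<open>Terms are removed one by one from the left; each summand keeps the exponential of what
  comes after it, to which a conditional estimate can be applied.\<close>

lemma exp_sum_telescope:
  fixes t :: "nat \<Rightarrow> real"
  shows "exp (\<Sum>i<N. t i) = 1 + (\<Sum>i<N. (exp (t i) - 1) * exp (\<Sum>l\<in>{Suc i..<N}. t l))"
proof (induction N arbitrary: t)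
  case (Suc N)
  have sh: "(\<Sum>l\<in>{Suc (Suc i)..<Suc N}. t l) = (\<Sum>l\<in>{Suc i..<N}. t (Suc l))" for i
    by (rule sum.shift_bounds_Suc_ivl)
  have h: "(\<Sum>l\<in>{Suc 0..<Suc N}. t l) = (\<Sum>i<N. t (Suc i))"
    by (subst sum.shift_bounds_Suc_ivl) (simp add: atLeast0LessThan)
  have "exp (\<Sum>i<Suc N. t i) = exp (t 0) * exp (\<Sum>i<N. t (Suc i))"
    by (simp only: sum.lessThan_Suc_shift exp_add)
  also have "\<dots> = (exp (t 0) - 1) * exp (\<Sum>i<N. t (Suc i)) + exp (\<Sum>i<N. t (Suc i))"
    by (simp add: algebra_simps)
  also have "\<dots> = (exp (t 0) - 1) * exp (\<Sum>i<N. t (Suc i)) + (1 + (\<Sum>i<N. (exp (t (Suc i)) - 1) * exp (\<Sum>l\<in>{Suc i..<N}. t (Suc l))))"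
    using Suc.IH[of "\<lambda>i. t (Suc i)"] by simp
  also have "\<dots> = 1 + (\<Sum>i<Suc N. (exp (t i) - 1) * exp (\<Sum>l\<in>{Suc i..<Suc N}. t l))"
  proof -
    have "(\<Sum>i<Suc N. (exp (t i) - 1) * exp (\<Sum>l\<in>{Suc i..<Suc N}. t l)) =
      (exp (t 0) - 1) * exp (\<Sum>l\<in>{Suc 0..<Suc N}. t l) + (\<Sum>i<N. (exp (t (Suc i)) - 1) * exp (\<Sum>l\<in>{Suc (Suc i)..<Suc N}. t l))"
      by (rule sum.lessThan_Suc_shift)
    then show ?thesis unfolding sh h by simp
  qed
  finally show ?case .
qed simp

text \<open>It bounds the exponential of a signed integral by that of the integral of |f| while
  keeping track of the linear terms. For negative \<open>y\<close> monotonicity on the positive axis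
  is combined with sinh u \<ge> u.\<close>

lemma exp_minus_self_mono_abs:
  fixes x y :: real
  assumes "\<bar>y\<bar> \<le> x" shows "exp y - y \<le> exp x - x"
proof -
  have pos: "exp y - y \<le> exp x - x" if "0 \<le> y" "y \<le> x" for x y :: real
  proof -
    have "exp y * 1 \<le> exp y * exp (x - y) - (x - y)"
    proof -
      have "1 + (x - y) \<le> exp (x - y)" by (rule exp_ge_add_one_self)
      then have "exp y * (1 + (x - y)) \<le> exp y * exp (x - y)" by (intro mult_left_mono) auto
      moreover have "1 * (x - y) \<le> exp y * (x - y)" using that by (intro mult_right_mono) auto
      ultimately show ?thesis by (simp add: algebra_simps)
    qed
    then show ?thesis by (simp add: exp_add[symmetric])
  qed
  have sinh: "2 * u \<le> exp u - exp (- u)" if "0 \<le> u" for u :: real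
  proof -
    have "exp 0 - exp (- 0) - 2 * 0 \<le> exp u - exp (- u) - 2 * u"
    proof (rule DERIV_nonneg_imp_nondecreasing[OF that])
      fix v :: real
      have "0 \<le> (exp (v / 2) - exp (- (v / 2)))\<^sup>2" by simp
      also have "\<dots> = exp v + exp (- v) - 2"
        by (simp add: power2_eq_square algebra_simps exp_add[symmetric])
      finally show "\<exists>D. ((\<lambda>u. exp u - exp (- u) - 2 * u) has_real_derivative D) (at v) \<and> 0 \<le> D"
        by (intro exI[of _ "exp v + exp (- v) - 2"]) (auto intro!: derivative_eq_intros)
    qed
    then show ?thesis by simp
  qed
  show ?thesis
  proof (cases "0 \<le> y")
    case True
    then show ?thesis using pos assms by simp
  next
    case False
    then have "exp y - y \<le> exp (- y) - (- y)" using sinh[of "- y"] by simp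
    also have "\<dots> \<le> exp x - x" using False assms by (intro pos) auto
    finally show ?thesis .
  qed
qed

lemma (in nummelin_splitting) csum_occ_measurable:
  "g \<in> borel_measurable borel \<Longrightarrow> csum (occ g) n \<in> borel_measurable Om'"
  by (rule csum_measurable) (rule occ_measurable)

context bounded_functional
begin

definition Kb :: real where "Kb = Fb + Cc"

lemma Kb_pos: "0 < Kb" using Fb_pos Cc_nonneg by (simp add: Kb_def)

lemma Fb_le_Kb: "Fb \<le> Kb" and Cc_le_Kb: "Cc \<le> Kb"
  using Fb_pos Cc_nonneg by (auto simp: Kb_def)

definition acc :: "nat \<Rightarrow> nat \<Rightarrow> 'v \<Rightarrow> real" where
  "acc N n w = (\<Sum>i<N. if no_hit n (n + i) w then piece (n + i) w else 0)"

lemma piece_measurable[measurable]: "piece n \<in> borel_measurable Om'"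
  by (rule measurable_F_Om'[OF piece_F])

lemma acc_measurable[measurable]: "acc N n \<in> borel_measurable Om'"
  unfolding acc_def[abs_def] by measurable

text \<open>The rest after increment \<open>i\<close> is replaced by a fresh sum from
  \<open>n + i + 1\<close>, which ignores a possible hit at its own start and is therefore at least
  as large.\<close>

lemma exp_acc_le:
  assumes th: "0 < th"
  shows "exp (th * acc N n w) \<le> 1 + (\<Sum>i<N. if no_hit n (n + i) w
    then (exp (th * piece (n + i) w) - 1) * exp (th * acc (N - Suc i) (n + Suc i) w) else 0)"
proof -
  define t where "t i = th * (if no_hit n (n + i) w then piece (n + i) w else 0)" for i
  have "exp (th * acc N n w) = exp (\<Sum>i<N. t i)" by (simp add: acc_def t_def sum_distrib_left)
  also have "\<dots> = 1 + (\<Sum>i<N. (exp (t i) - 1) * exp (\<Sum>l\<in>{Suc i..<N}. t l))" by (rule exp_sum_telescope)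
  also have "(\<Sum>i<N. (exp (t i) - 1) * exp (\<Sum>l\<in>{Suc i..<N}. t l)) \<le> (\<Sum>i<N. if no_hit n (n + i) w
    then (exp (th * piece (n + i) w) - 1) * exp (th * acc (N - Suc i) (n + Suc i) w) else 0)"
  proof (rule sum_mono)
    fix i assume "i \<in> {..<N}"
    then have i: "i < N" by simp
    have "(\<Sum>l\<in>{Suc i..<N}. t l) = (\<Sum>l<N - Suc i. t (l + Suc i))"
      using i sum.shift_bounds_nat_ivl[of t 0 "Suc i" "N - Suc i"] by (simp add: atLeast0LessThan)
    also have "\<dots> \<le> (\<Sum>l<N - Suc i. th * (if no_hit (n + Suc i) (n + Suc i + l) w then piece (n + Suc i + l) w else 0))"
    proof (rule sum_mono)
      fix l
      have "no_hit (n + Suc i) (n + Suc i + l) w" if "no_hit n (n + (l + Suc i)) w"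
        using that by (simp add: no_hit_def)
      moreover have e: "n + (l + Suc i) = n + Suc i + l" by simp
      ultimately show "t (l + Suc i) \<le> th * (if no_hit (n + Suc i) (n + Suc i + l) w then piece (n + Suc i + l) w else 0)"
        using th piece_nonneg[of "n + Suc i + l" w] unfolding t_def e by simp
    qed
    also have "\<dots> = th * acc (N - Suc i) (n + Suc i) w" unfolding acc_def sum_distrib_left ..
    finally have le: "exp (\<Sum>l\<in>{Suc i..<N}. t l) \<le> exp (th * acc (N - Suc i) (n + Suc i) w)" by simp
    have "0 \<le> exp (th * piece (n + i) w) - 1" using th piece_nonneg[of "n + i" w] by simp
    with le show "(exp (t i) - 1) * exp (\<Sum>l\<in>{Suc i..<N}. t l) \<le> (if no_hit n (n + i) w
      then (exp (th * piece (n + i) w) - 1) * exp (th * acc (N - Suc i) (n + Suc i) w) else 0)"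
      by (auto simp: t_def intro: mult_left_mono)
  qed
  finally show ?thesis by simp
qed

text \<open>A discrete version of the lemma of Khas'minskii: expanding the exponential of a sum from its last
  increment, each increment is controlled by the potential and the rest by the same bound.\<close>

lemma mgf_truncated:
  assumes th: "0 < th" "th * Kb < 1"
  shows "\<pi> \<in> inits \<Longrightarrow> G \<in> sets (F n) \<Longrightarrow>
    (\<integral>\<^sup>+w. indicator G w * ennreal (exp (th * acc N n w)) \<partial>PP \<pi>) \<le>
    emeasure (PP \<pi>) G + ennreal (th / (1 - th * Kb)) * (\<integral>\<^sup>+w. indicator G w * cyc_mean fa (Y n w) \<partial>PP \<pi>)"
\<comment> \<open>Strong induction: the rest after increment \<open>i\<close> has horizon
  \<open>N - Suc i\<close>, for all \<open>i\<close> at once.\<close>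
proof (induction N arbitrary: \<pi> n G rule: less_induct)
  case (less N)
  note \<pi> = less.prems(1) and G = less.prems(2)
  \<comment> \<open>\<open>M\<close> is the claimed bound with the mean integral replaced by
    \<open>Cc\<close>. As Kb = Fb + Cc, multiplying the factor th / (1 - th Fb) of one increment by
    \<open>M\<close> gives th / (1 - th Kb), and the induction closes.\<close>
  define M where "M = 1 + th * Cc / (1 - th * Kb)"
  have thF: "th * Fb < 1" using th Fb_le_Kb by (smt (verit) mult_left_mono)
  have M: "M * (th / (1 - th * Fb)) = th / (1 - th * Kb)" "0 \<le> M"
  proof -
    have "M = (1 - th * Fb) / (1 - th * Kb)" using th by (simp add: M_def Kb_def field_simps)
    then show "M * (th / (1 - th * Fb)) = th / (1 - th * Kb)" using thF by simp
    show "0 \<le> M" using th Cc_nonneg by (simp add: M_def)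
  qed
  have IH: "(\<integral>\<^sup>+w. indicator H w * ennreal (exp (th * acc N' l w)) \<partial>PP \<pi>) \<le> (\<integral>\<^sup>+w. indicator H w * ennreal M \<partial>PP \<pi>)"
    if N': "N' < N" and H: "H \<in> sets (F l)" for N' l H
  proof -
    note [measurable] = G_PP[OF \<pi> H]
    have "(\<integral>\<^sup>+w. indicator H w * cyc_mean fa (Y l w) \<partial>PP \<pi>) \<le> (\<integral>\<^sup>+w. ennreal Cc * indicator H w \<partial>PP \<pi>)"
      by (intro nn_integral_mono) (auto simp: indicator_def cyc_mean_bound)
    also have "\<dots> = ennreal Cc * emeasure (PP \<pi>) H" by (rule nn_integral_cmult_indicator) measurable
    finally have 1: "(\<integral>\<^sup>+w. indicator H w * cyc_mean fa (Y l w) \<partial>PP \<pi>) \<le> ennreal Cc * emeasure (PP \<pi>) H" .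
    have "(\<integral>\<^sup>+w. indicator H w * ennreal (exp (th * acc N' l w)) \<partial>PP \<pi>) \<le>
      emeasure (PP \<pi>) H + ennreal (th / (1 - th * Kb)) * (\<integral>\<^sup>+w. indicator H w * cyc_mean fa (Y l w) \<partial>PP \<pi>)"
      by (rule less.IH[OF N' \<pi> H])
    also have "\<dots> \<le> emeasure (PP \<pi>) H + ennreal (th / (1 - th * Kb)) * (ennreal Cc * emeasure (PP \<pi>) H)"
      by (intro add_left_mono mult_left_mono 1) simp
    also have "\<dots> = (1 + ennreal (th / (1 - th * Kb)) * ennreal Cc) * emeasure (PP \<pi>) H"
      by (simp add: distrib_right mult.assoc)
    also have "1 + ennreal (th / (1 - th * Kb)) * ennreal Cc = ennreal M"
      using th Cc_nonneg by (simp add: M_def ennreal_mult[symmetric] ennreal_plus[symmetric] ennreal_1[symmetric] del: ennreal_plus ennreal_1)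
    also have "ennreal M * emeasure (PP \<pi>) H = (\<integral>\<^sup>+w. indicator H w * ennreal M \<partial>PP \<pi>)"
      by (subst mult.commute[of "indicator H _"], subst nn_integral_cmult_indicator) auto
    finally show ?thesis .
  qed
  note [measurable] = G_PP[OF \<pi> G] measurable_PP[OF \<pi> acc_measurable] measurable_PP[OF \<pi> piece_measurable]
    measurable_PP[OF \<pi> no_hit_measurable] measurable_PP[OF \<pi> occ_measurable[OF fa_measurable]]
  let ?t = "\<lambda>i w. indicator G w * ennreal (if no_hit n (n + i) w
    then (exp (th * piece (n + i) w) - 1) * exp (th * acc (N - Suc i) (n + Suc i) w) else 0)"
  have tpos: "0 \<le> exp (th * piece j w) - 1" for j w using th piece_nonneg[of j w] by simp
  have step: "(\<integral>\<^sup>+w. ?t i w \<partial>PP \<pi>) \<le> ennreal (th / (1 - th * Kb)) * (\<integral>\<^sup>+w. indicator G w * (if no_hit n (n + i) w then occ fa (n + i) w else 0) \<partial>PP \<pi>)"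
    if i: "i < N" for i
  proof -
    define H where "H = G \<inter> {w\<in>space Om'. no_hit n (n + i) w}"
    have H: "H \<in> sets (F (n + i))" using G F_mono[of n "n + i"] no_hit_F by (auto simp: H_def)
    have H': "H \<in> sets (F (n + Suc i))" using H F_Suc[of "n + i"] by auto
    note [measurable] = G_PP[OF \<pi> H]
    define \<xi> where "\<xi> w = indicator H w * ennreal (exp (th * piece (n + i) w) - 1)" for w
    have \<xi>: "\<xi> \<in> borel_measurable (F (n + Suc i))"
    proof -
      have [measurable]: "piece (n + i) \<in> borel_measurable (F (n + Suc i))" using piece_F[of "n + i"] by simp
      note [measurable] = H'
      show ?thesis unfolding \<xi>_def[abs_def] by measurable
    qed
    have "(\<integral>\<^sup>+w. ?t i w \<partial>PP \<pi>) = (\<integral>\<^sup>+w. \<xi> w * ennreal (exp (th * acc (N - Suc i) (n + Suc i) w)) \<partial>PP \<pi>)"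
      using tpos by (intro nn_integral_cong) (auto simp: \<xi>_def H_def indicator_def space_PP[OF \<pi>] ennreal_mult)
    also have "\<dots> \<le> (\<integral>\<^sup>+w. \<xi> w * ennreal M \<partial>PP \<pi>)"
      by (rule nn_integral_past_le[OF \<pi> _ _ IH \<xi>]) (use i in auto)
    also have "\<dots> = (\<integral>\<^sup>+w. indicator H w * ennreal (exp (th * piece (n + i) w) - 1) \<partial>PP \<pi>) * ennreal M"
      unfolding \<xi>_def by (rule nn_integral_multc) measurable
    also have "\<dots> \<le> (ennreal (th / (1 - th * Fb)) * (\<integral>\<^sup>+w. indicator H w * occ fa (n + i) w \<partial>PP \<pi>)) * ennreal M"
      by (intro mult_right_mono exp_piece_law[OF \<pi> H th(1) thF]) simp
    also have "\<dots> = (ennreal M * ennreal (th / (1 - th * Fb))) * (\<integral>\<^sup>+w. indicator H w * occ fa (n + i) w \<partial>PP \<pi>)"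
      by (simp add: ac_simps)
    also have "ennreal M * ennreal (th / (1 - th * Fb)) = ennreal (th / (1 - th * Kb))"
      using M th thF by (subst ennreal_mult[symmetric]) auto
    also have "(\<integral>\<^sup>+w. indicator H w * occ fa (n + i) w \<partial>PP \<pi>) = (\<integral>\<^sup>+w. indicator G w * (if no_hit n (n + i) w then occ fa (n + i) w else 0) \<partial>PP \<pi>)"
      by (intro nn_integral_cong) (auto simp: H_def indicator_def space_PP[OF \<pi>])
    finally show ?thesis .
  qed
  have "(\<integral>\<^sup>+w. indicator G w * ennreal (exp (th * acc N n w)) \<partial>PP \<pi>) \<le> (\<integral>\<^sup>+w. indicator G w + (\<Sum>i<N. ?t i w) \<partial>PP \<pi>)"
  proof (intro nn_integral_mono)
    fix w
    have nn: "0 \<le> (if no_hit n (n + i) w then (exp (th * piece (n + i) w) - 1) * exp (th * acc (N - Suc i) (n + Suc i) w) else 0)" for i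
      using tpos by simp
    have "ennreal (exp (th * acc N n w)) \<le> ennreal (1 + (\<Sum>i<N. if no_hit n (n + i) w
      then (exp (th * piece (n + i) w) - 1) * exp (th * acc (N - Suc i) (n + Suc i) w) else 0))"
      by (intro ennreal_leI exp_acc_le th)
    also have "\<dots> = 1 + (\<Sum>i<N. ennreal (if no_hit n (n + i) w
      then (exp (th * piece (n + i) w) - 1) * exp (th * acc (N - Suc i) (n + Suc i) w) else 0))"
      using nn by (subst ennreal_plus) (auto intro!: sum_nonneg simp only: ennreal_1 sum_ennreal)
    finally show "indicator G w * ennreal (exp (th * acc N n w)) \<le> indicator G w + (\<Sum>i<N. ?t i w)"
      by (auto simp: indicator_def)
  qed
  also have "\<dots> = (\<integral>\<^sup>+w. indicator G w \<partial>PP \<pi>) + (\<integral>\<^sup>+w. (\<Sum>i<N. ?t i w) \<partial>PP \<pi>)"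
    by (rule nn_integral_add) measurable
  also have "(\<integral>\<^sup>+w. (\<Sum>i<N. ?t i w) \<partial>PP \<pi>) = (\<Sum>i<N. \<integral>\<^sup>+w. ?t i w \<partial>PP \<pi>)"
    by (rule nn_integral_sum) measurable
  also have "\<dots> \<le> (\<Sum>i<N. ennreal (th / (1 - th * Kb)) * (\<integral>\<^sup>+w. indicator G w * (if no_hit n (n + i) w then occ fa (n + i) w else 0) \<partial>PP \<pi>))"
    by (intro sum_mono step) simp
  also have "\<dots> = ennreal (th / (1 - th * Kb)) * (\<integral>\<^sup>+w. (\<Sum>i<N. indicator G w * (if no_hit n (n + i) w then occ fa (n + i) w else 0)) \<partial>PP \<pi>)"
    by (subst nn_integral_sum) (measurable, simp add: sum_distrib_left)
  also have "\<dots> \<le> ennreal (th / (1 - th * Kb)) * (\<integral>\<^sup>+w. indicator G w * csum (occ fa) n w \<partial>PP \<pi>)"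
    unfolding sum_distrib_left[symmetric] csum_def
    by (intro mult_left_mono nn_integral_mono sum_le_suminf) auto
  also have "\<dots> = ennreal (th / (1 - th * Kb)) * (\<integral>\<^sup>+w. indicator G w * cyc_mean fa (Y n w) \<partial>PP \<pi>)"
    by (simp only: cyc_law[OF \<pi> G fa_measurable])
  finally show ?case by (simp add: add_left_mono)
qed

definition tot :: "nat \<Rightarrow> 'v \<Rightarrow> real" where "tot n w = enn2real (csum (occ fa) n w)"

lemma tot_measurable[measurable]: "tot n \<in> borel_measurable Om'"
  using csum_occ_measurable[OF fa_measurable, of n] unfolding tot_def[abs_def] by measurable

end

context nummelin_splitting
begin

lemma csum_add:
  "(\<And>j. u j w = v j w + wt j w) \<Longrightarrow> csum u n w = csum v n w + csum wt n w"
  unfolding csum_def by (subst suminf_add) (auto intro!: suminf_cong)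

lemma csum_finite:
  assumes "\<exists>i>n. w \<in> hits i"
  shows "\<exists>N0. \<forall>N\<ge>N0. \<forall>u. csum u n w = (\<Sum>i<N. if no_hit n (n + i) w then u (n + i) w else 0)"
proof -
  obtain i where i: "n < i" "w \<in> hits i" using assms by blast
  have "\<not> no_hit n (n + l) w" if "Suc i - n \<le> l" for l
  proof
    assume "no_hit n (n + l) w"
    moreover have "n < i \<and> i < n + l" using i that by linarith
    ultimately show False using i by (auto simp: no_hit_def)
  qed
  then have "csum u n w = (\<Sum>i<N. if no_hit n (n + i) w then u (n + i) w else 0)" if "Suc i - n \<le> N" for N u
    unfolding csum_def using that by (intro suminf_finite) auto
  then show ?thesis by blast
qed

end

context bounded_functional
begin

lemma csum_fa_finite:
  assumes "w \<in> space Om'" "\<exists>i>n. w \<in> hits i"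
  shows "csum (occ fa) n w = ennreal (tot n w)" "\<exists>N0. \<forall>N\<ge>N0. acc N n w = tot n w"
proof -
  obtain N0 where N0': "\<forall>N\<ge>N0. \<forall>u. csum u n w = (\<Sum>i<N. if no_hit n (n + i) w then u (n + i) w else 0)"
    using csum_finite[OF assms(2)] ..
  have N0: "csum (occ fa) n w = (\<Sum>i<N. if no_hit n (n + i) w then occ fa (n + i) w else 0)" if "N0 \<le> N" for N
    by (rule N0'[rule_format, OF that])
  have e: "(\<Sum>i<N. if no_hit n (n + i) w then occ fa (n + i) w else 0) = ennreal (acc N n w)" for N
  proof -
    have "ennreal (acc N n w) = (\<Sum>i<N. ennreal (if no_hit n (n + i) w then piece (n + i) w else 0))"
      unfolding acc_def by (rule sum_ennreal[symmetric]) (simp add: piece_nonneg)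
    then show ?thesis by (simp add: occ_fa_eq[OF assms(1)] if_distrib cong: if_cong)
  qed
  have nn: "0 \<le> acc N n w" for N unfolding acc_def by (intro sum_nonneg) (simp add: piece_nonneg)
  have "acc N n w = tot n w" if "N \<ge> N0" for N
    unfolding tot_def N0[OF that] e using nn by simp
  then show "\<exists>N0. \<forall>N\<ge>N0. acc N n w = tot n w" by blast
  then show "csum (occ fa) n w = ennreal (tot n w)" unfolding N0[OF order_refl] e tot_def using nn by simp
qed

text \<open>Fatou's lemma: almost surely a further hit occurs, and from then on the truncation has
  no effect.\<close>

lemma mgf_full:
  assumes th: "0 < th" "th * Kb < 1" and \<pi>: "\<pi> \<in> inits" and G: "G \<in> sets (F n)"
  shows "(\<integral>\<^sup>+w. indicator G w * ennreal (exp (th * tot n w)) \<partial>PP \<pi>) \<le>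
    emeasure (PP \<pi>) G + ennreal (th / (1 - th * Kb)) * (\<integral>\<^sup>+w. indicator G w * cyc_mean fa (Y n w) \<partial>PP \<pi>)"
proof -
  note [measurable] = G_PP[OF \<pi> G] measurable_PP[OF \<pi> acc_measurable]
  have "(\<integral>\<^sup>+w. indicator G w * ennreal (exp (th * tot n w)) \<partial>PP \<pi>) \<le>
    (\<integral>\<^sup>+w. liminf (\<lambda>N. indicator G w * ennreal (exp (th * acc N n w))) \<partial>PP \<pi>)"
  proof (rule nn_integral_mono_AE)
    show "AE w in PP \<pi>. indicator G w * ennreal (exp (th * tot n w)) \<le> liminf (\<lambda>N. indicator G w * ennreal (exp (th * acc N n w)))"
      using AE_cyc_index[OF \<pi>] AE_space
    proof eventually_elim
      fix w assume "(\<forall>n. \<exists>i>n. w \<in> hits i) \<and> (\<forall>k. \<exists>j. cyc_index j w = k)" "w \<in> space (PP \<pi>)"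
      then obtain N0 where "\<And>N. N \<ge> N0 \<Longrightarrow> acc N n w = tot n w"
        using csum_fa_finite(2)[of w n] by (auto simp: space_PP[OF \<pi>])
      then show "indicator G w * ennreal (exp (th * tot n w)) \<le> liminf (\<lambda>N. indicator G w * ennreal (exp (th * acc N n w)))"
        by (intro Liminf_bounded) (auto simp: eventually_sequentially intro!: exI[of _ N0])
    qed
  qed
  also have "\<dots> \<le> liminf (\<lambda>N. \<integral>\<^sup>+w. indicator G w * ennreal (exp (th * acc N n w)) \<partial>PP \<pi>)"
    by (rule nn_integral_liminf) measurable
  also have "\<dots> \<le> emeasure (PP \<pi>) G + ennreal (th / (1 - th * Kb)) * (\<integral>\<^sup>+w. indicator G w * cyc_mean fa (Y n w) \<partial>PP \<pi>)"
    by (intro order_trans[OF Liminf_le_Limsup Limsup_bounded] always_eventually allI mgf_truncated[OF th \<pi> G]) simp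
  finally show ?thesis .
qed

abbreviation fp :: "'e \<Rightarrow> ennreal" where "fp x \<equiv> ennreal (f x)"
abbreviation fn :: "'e \<Rightarrow> ennreal" where "fn x \<equiv> ennreal (- f x)"

lemma fp_fn_measurable[measurable]: "fp \<in> borel_measurable borel" "fn \<in> borel_measurable borel"
  by measurable

lemma occ_fa_split:
  assumes w: "w \<in> space Om'" shows "occ fa j w = occ fp j w + occ fn j w"
proof -
  have Zm[measurable]: "(\<lambda>s. Z1 Z (max 0 s) w) \<in> borel \<rightarrow>\<^sub>M borel"
    using measurable_compose[OF _ Z1_measurable_pair, of "\<lambda>s. (s, w)" borel] w by simp
  have o: "occ g j w = (\<integral>\<^sup>+s. indicator {T j w..<T (Suc j) w} s * g (Z1 Z (max 0 s) w) \<partial>lborel)" for g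
    unfolding occ_def using T_nonneg[OF w, of j] by (intro nn_integral_cong) (auto simp: indicator_def max_def)
  have "occ fa j w = (\<integral>\<^sup>+s. indicator {T j w..<T (Suc j) w} s * fp (Z1 Z (max 0 s) w) + indicator {T j w..<T (Suc j) w} s * fn (Z1 Z (max 0 s) w) \<partial>lborel)"
  proof -
    have "ennreal \<bar>r\<bar> = ennreal r + ennreal (- r)" for r :: real
      by (cases "0 \<le> r") (simp_all add: ennreal_neg)
    then show ?thesis unfolding o by (simp add: distrib_left)
  qed
  also have "\<dots> = occ fp j w + occ fn j w"
    unfolding o by (rule nn_integral_add) measurable
  finally show ?thesis .
qed

definition val :: "nat \<Rightarrow> 'v \<Rightarrow> real" where "val j w = enn2real (occ fp j w) - enn2real (occ fn j w)"

lemma abs_val_le: "w \<in> space Om' \<Longrightarrow> \<bar>val j w\<bar> \<le> piece j w"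
proof -
  assume w: "w \<in> space Om'"
  have fin: "occ fp j w + occ fn j w < top"
    unfolding occ_fa_split[OF w, symmetric] occ_fa_eq[OF w] by simp
  have "piece j w = enn2real (occ fp j w) + enn2real (occ fn j w)"
    unfolding piece_def occ_fa_split[OF w] using fin by (intro enn2real_plus) auto
  then show ?thesis unfolding val_def using enn2real_nonneg[of "occ fp j w"] enn2real_nonneg[of "occ fn j w"] by linarith
qed

definition sgt :: "nat \<Rightarrow> 'v \<Rightarrow> real" where
  "sgt n w = enn2real (csum (occ fp) n w) - enn2real (csum (occ fn) n w)"

lemma sgt_measurable[measurable]: "sgt n \<in> borel_measurable Om'"
  using csum_occ_measurable[OF fp_fn_measurable(1), of n] csum_occ_measurable[OF fp_fn_measurable(2), of n]
  unfolding sgt_def[abs_def] by measurable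

lemma tot_split:
  assumes w: "w \<in> space Om'" "\<exists>i>n. w \<in> hits i"
  shows "tot n w = enn2real (csum (occ fp) n w) + enn2real (csum (occ fn) n w)"
    "csum (occ fp) n w < top" "csum (occ fn) n w < top"
proof -
  have add: "csum (occ fa) n w = csum (occ fp) n w + csum (occ fn) n w"
    by (rule csum_add) (rule occ_fa_split[OF w(1)])
  moreover have "csum (occ fa) n w < top" using csum_fa_finite(1)[OF w] by simp
  ultimately have "csum (occ fp) n w + csum (occ fn) n w < top" by (simp only:)
  then show lt: "csum (occ fp) n w < top" "csum (occ fn) n w < top"
    unfolding ennreal_add_less_top by simp_all
  show "tot n w = enn2real (csum (occ fp) n w) + enn2real (csum (occ fn) n w)"
    unfolding tot_def add using lt by (rule enn2real_plus)
qed

end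

section \<open>Centered functions\<close>

text \<open>The condition \<mu>(f) = 0 in terms of positive and negative parts, transported to a
  cycle by \<open>mu_eq\<close>.\<close>

locale centered_functional = bounded_functional Om P X \<mu> \<Lambda> p a C \<nu> x0 Om' PP \<phi> Z T f Fb Cc
  for Om :: "'w measure" and P :: "'e::polish_space \<Rightarrow> 'w measure" and X \<mu> \<Lambda> p a C \<nu> x0
    and Om' :: "'v measure" and PP \<phi> Z T f Fb Cc +
  assumes centered: "(\<integral>\<^sup>+x. cyc_mean (\<lambda>x. ennreal (f x)) x \<partial>\<nu>) = (\<integral>\<^sup>+x. cyc_mean (\<lambda>x. ennreal (- f x)) x \<partial>\<nu>)"
begin

text \<open>An upper bound for the exponential moment of a signed cycle; its excess over 1 is
  quadratic in \<open>th\<close> near 0, as Bernstein's method requires.\<close>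

definition bern :: "real \<Rightarrow> real" where "bern th = 1 + Cc * Kb * th\<^sup>2 / (1 - th * Kb)"

lemma cyc_mean_add:
  "cyc_mean fa x = cyc_mean fp x + cyc_mean fn x"
proof -
  let ?R = "return borel x"
  note [measurable] = measurable_PP[OF return_inits csum_occ_measurable[OF fp_fn_measurable(1)]]
    measurable_PP[OF return_inits csum_occ_measurable[OF fp_fn_measurable(2)]]
  have "cyc_mean fa x = (\<integral>\<^sup>+w. csum (occ fa) 0 w \<partial>PP ?R)" by (rule cyc_mean_return[OF fa_measurable, symmetric])
  also have "\<dots> = (\<integral>\<^sup>+w. csum (occ fp) 0 w + csum (occ fn) 0 w \<partial>PP ?R)"
  proof (intro nn_integral_cong)
    fix w assume "w \<in> space (PP ?R)"
    then have w: "w \<in> space Om'" by (simp add: space_PP[OF return_inits])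
    show "csum (occ fa) 0 w = csum (occ fp) 0 w + csum (occ fn) 0 w"
      by (rule csum_add) (rule occ_fa_split[OF w])
  qed
  also have "\<dots> = (\<integral>\<^sup>+w. csum (occ fp) 0 w \<partial>PP ?R) + (\<integral>\<^sup>+w. csum (occ fn) 0 w \<partial>PP ?R)"
    by (rule nn_integral_add) measurable
  finally show ?thesis by (simp add: cyc_mean_return)
qed

text \<open>Centering makes the means of the two parts equal, so each is half of the mean integral
  of |f| and at most half of \<open>Cc\<close>.\<close>

lemma cyc_mean_halves:
  obtains h where "0 \<le> h" "2 * h \<le> Cc" "(\<integral>\<^sup>+x. cyc_mean fp x \<partial>\<nu>) = ennreal h" "(\<integral>\<^sup>+x. cyc_mean fn x \<partial>\<nu>) = ennreal h"
    "(\<integral>\<^sup>+x. cyc_mean fa x \<partial>\<nu>) = ennreal (2 * h)"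
proof -
  interpret N: prob_space \<nu> by (rule nu_borel)
  have [measurable]: "cyc_mean fp \<in> borel_measurable \<nu>" "cyc_mean fn \<in> borel_measurable \<nu>"
    using cyc_mean_measurable fp_fn_measurable nu_borel(2) by (auto cong: measurable_cong_sets)
  have add: "(\<integral>\<^sup>+x. cyc_mean fa x \<partial>\<nu>) = (\<integral>\<^sup>+x. cyc_mean fp x \<partial>\<nu>) + (\<integral>\<^sup>+x. cyc_mean fn x \<partial>\<nu>)"
    unfolding cyc_mean_add by (rule nn_integral_add) measurable
  have "(\<integral>\<^sup>+x. cyc_mean fa x \<partial>\<nu>) \<le> (\<integral>\<^sup>+x. ennreal Cc \<partial>\<nu>)" by (intro nn_integral_mono cyc_mean_bound)
  also have "\<dots> = ennreal Cc" by (simp add: N.emeasure_space_1)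
  finally have le: "(\<integral>\<^sup>+x. cyc_mean fa x \<partial>\<nu>) \<le> ennreal Cc" .
  have "(\<integral>\<^sup>+x. cyc_mean fp x \<partial>\<nu>) + (\<integral>\<^sup>+x. cyc_mean fn x \<partial>\<nu>) < top"
    unfolding add[symmetric] using le by (rule le_less_trans) simp
  then have "(\<integral>\<^sup>+x. cyc_mean fp x \<partial>\<nu>) < top" unfolding ennreal_add_less_top by simp
  then obtain h where h: "0 \<le> h" "(\<integral>\<^sup>+x. cyc_mean fp x \<partial>\<nu>) = ennreal h" by (cases "\<integral>\<^sup>+x. cyc_mean fp x \<partial>\<nu>") auto
  have sum: "(\<integral>\<^sup>+x. cyc_mean fa x \<partial>\<nu>) = ennreal (2 * h)"
    unfolding add centered[symmetric] h(2) using h(1) by (simp add: ennreal_plus[symmetric] del: ennreal_plus)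
  show thesis
    by (rule that[of h]) (use h sum le centered Cc_nonneg in auto)
qed

text \<open>The signed exponential is at most the exponential of \<open>th * tot\<close> minus 2 th
  times the integral of the part of f with the opposite sign. That part has mean \<open>h\<close>,
  half of the mean of |f|, so in the bound from \<open>mgf_full\<close> the linear terms
  cancel.\<close>

lemma signed_mgf:
  assumes th: "0 < th" "th * Kb < 1" and \<epsilon>: "\<epsilon> = 1 \<or> \<epsilon> = - 1"
    and \<pi>: "\<pi> \<in> inits" and G: "G \<in> sets (F j)"
  shows "(\<integral>\<^sup>+w. indicator (G \<inter> hits j) w * ennreal (exp (th * (\<epsilon> * sgt (Suc j) w))) \<partial>PP \<pi>) \<le> ennreal (bern th) * emeasure (PP \<pi>) (G \<inter> hits j)"
proof -
  interpret PP: prob_space "PP \<pi>" by (rule PP_prob_space[OF \<pi>])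
  define H where "H = G \<inter> hits j"
  have H: "H \<in> sets (F (Suc j))" unfolding H_def using G F_Suc[of j] hits_F[of j "Suc j"] by auto
  note [measurable] = G_PP[OF \<pi> H] measurable_PP[OF \<pi> sgt_measurable] measurable_PP[OF \<pi> tot_measurable]
  obtain h where h: "0 \<le> h" "2 * h \<le> Cc" "(\<integral>\<^sup>+x. cyc_mean fp x \<partial>\<nu>) = ennreal h" "(\<integral>\<^sup>+x. cyc_mean fn x \<partial>\<nu>) = ennreal h"
    "(\<integral>\<^sup>+x. cyc_mean fa x \<partial>\<nu>) = ennreal (2 * h)" by (rule cyc_mean_halves)
  define pr where "pr = measure (PP \<pi>) H"
  have pr: "emeasure (PP \<pi>) H = ennreal pr" "0 \<le> pr" by (simp_all add: pr_def PP.emeasure_eq_measure)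
  \<comment> \<open>The part of f with sign opposite to \<open>\<epsilon>\<close>:
    \<open>tot\<close> and \<open>\<epsilon> * sgt\<close> differ by twice its sum over the
    cycle.\<close>
  define g where "g = (if \<epsilon> = 1 then fn else fp)"
  have g[measurable]: "g \<in> borel_measurable borel" unfolding g_def by (cases "\<epsilon> = 1") auto
  note [measurable] = measurable_PP[OF \<pi> csum_occ_measurable[OF g]]
  define E1 where "E1 = (\<integral>\<^sup>+w. indicator H w * ennreal (exp (th * (\<epsilon> * sgt (Suc j) w))) \<partial>PP \<pi>)"
  have "(\<integral>\<^sup>+w. indicator H w * csum (occ g) (Suc j) w \<partial>PP \<pi>) = ennreal pr * ennreal h"
    using cyc_regen[OF \<pi> G g] h(3,4) pr unfolding H_def g_def by (auto split: if_splits)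
  then have E2: "(\<integral>\<^sup>+w. indicator H w * (ennreal (2 * th) * csum (occ g) (Suc j) w) \<partial>PP \<pi>) = ennreal (2 * th * (pr * h))"
    using pr h(1) th by (subst mult.left_commute, subst nn_integral_cmult) (auto simp: ennreal_mult[symmetric])
  \<comment> \<open>The linear term stays on the left, which avoids subtraction in
    \<open>ennreal\<close> until finiteness is known.\<close>
  have "E1 + ennreal (2 * th * (pr * h)) =
    (\<integral>\<^sup>+w. indicator H w * ennreal (exp (th * (\<epsilon> * sgt (Suc j) w))) + indicator H w * (ennreal (2 * th) * csum (occ g) (Suc j) w) \<partial>PP \<pi>)"
    unfolding E1_def E2[symmetric] by (rule nn_integral_add[symmetric]) measurable
  also have "\<dots> \<le> (\<integral>\<^sup>+w. indicator H w * ennreal (exp (th * tot (Suc j) w)) \<partial>PP \<pi>)"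
  proof (rule nn_integral_mono_AE)
    show "AE w in PP \<pi>. indicator H w * ennreal (exp (th * (\<epsilon> * sgt (Suc j) w))) + indicator H w * (ennreal (2 * th) * csum (occ g) (Suc j) w)
      \<le> indicator H w * ennreal (exp (th * tot (Suc j) w))"
      using AE_cyc_index[OF \<pi>] AE_space
    proof eventually_elim
      fix w assume "(\<forall>n. \<exists>i>n. w \<in> hits i) \<and> (\<forall>k. \<exists>j. cyc_index j w = k)" "w \<in> space (PP \<pi>)"
      then have w: "w \<in> space Om'" "\<exists>i>Suc j. w \<in> hits i" by (auto simp: space_PP[OF \<pi>])
      define P1 where "P1 = enn2real (csum (occ fp) (Suc j) w)"
      define N1 where "N1 = enn2real (csum (occ fn) (Suc j) w)"
      have nn: "0 \<le> P1" "0 \<le> N1" by (auto simp: P1_def N1_def)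
      have t: "tot (Suc j) w = P1 + N1" "sgt (Suc j) w = P1 - N1"
        using tot_split(1)[OF w] by (auto simp: P1_def N1_def sgt_def)
      have gv: "csum (occ g) (Suc j) w = ennreal (if \<epsilon> = 1 then N1 else P1)"
        using tot_split(2,3)[OF w] by (auto simp: g_def P1_def N1_def)
      have "\<bar>th * (\<epsilon> * (P1 - N1))\<bar> \<le> th * (P1 + N1)"
      proof -
        have "\<bar>\<epsilon> * (P1 - N1)\<bar> \<le> P1 + N1" using \<epsilon> nn by auto
        then show ?thesis using th by (simp add: abs_mult)
      qed
      from exp_minus_self_mono_abs[OF this]
      have le: "exp (th * (\<epsilon> * (P1 - N1))) + 2 * th * (if \<epsilon> = 1 then N1 else P1) \<le> exp (th * (P1 + N1))"
        using \<epsilon> by (auto simp: algebra_simps)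
      have "ennreal (exp (th * (\<epsilon> * (P1 - N1)))) + ennreal (2 * th) * ennreal (if \<epsilon> = 1 then N1 else P1) \<le> ennreal (exp (th * (P1 + N1)))"
      proof -
        define c where "c = (if \<epsilon> = 1 then N1 else P1)"
        have c: "0 \<le> c" using nn by (simp add: c_def)
        have "ennreal (exp (th * (\<epsilon> * (P1 - N1)))) + ennreal (2 * th) * ennreal c =
          ennreal (exp (th * (\<epsilon> * (P1 - N1))) + 2 * th * c)"
          using c th by (subst ennreal_plus) (auto simp: ennreal_mult)
        also have "\<dots> \<le> ennreal (exp (th * (P1 + N1)))" using le unfolding c_def by (rule ennreal_leI)
        finally show ?thesis unfolding c_def .
      qed
      then show "indicator H w * ennreal (exp (th * (\<epsilon> * sgt (Suc j) w))) + indicator H w * (ennreal (2 * th) * csum (occ g) (Suc j) w)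
      \<le> indicator H w * ennreal (exp (th * tot (Suc j) w))"
        unfolding t gv distrib_left[symmetric] by (rule mult_left_mono) simp
    qed
  qed
  also have "\<dots> \<le> emeasure (PP \<pi>) H + ennreal (th / (1 - th * Kb)) * (\<integral>\<^sup>+w. indicator H w * cyc_mean fa (Y (Suc j) w) \<partial>PP \<pi>)"
    by (rule mgf_full[OF th \<pi> H])
  also have "(\<integral>\<^sup>+w. indicator H w * cyc_mean fa (Y (Suc j) w) \<partial>PP \<pi>) = ennreal pr * ennreal (2 * h)"
    using hit_law[OF \<pi> G cyc_mean_measurable[OF fa_measurable]] h(5) pr by (simp add: H_def)
  also have "emeasure (PP \<pi>) H + ennreal (th / (1 - th * Kb)) * (ennreal pr * ennreal (2 * h)) = ennreal (pr + th / (1 - th * Kb) * (pr * (2 * h)))"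
    using pr h(1) th by (simp add: ennreal_mult[symmetric] ennreal_plus[symmetric] del: ennreal_plus)
  finally have fin: "E1 + ennreal (2 * th * (pr * h)) \<le> ennreal (pr + th / (1 - th * Kb) * (pr * (2 * h)))" .
  have "E1 \<le> E1 + ennreal (2 * th * (pr * h))" by simp
  also note fin
  also have "ennreal (pr + th / (1 - th * Kb) * (pr * (2 * h))) < top" by simp
  finally have "E1 < top" .
  then obtain e where e: "E1 = ennreal e" "0 \<le> e" by (cases E1) auto
  have "0 \<le> pr + th / (1 - th * Kb) * (pr * (2 * h))" using pr h(1) th by simp
  then have "e + 2 * th * (pr * h) \<le> pr + th / (1 - th * Kb) * (pr * (2 * h))"
    using fin e pr h(1) th by (simp add: ennreal_plus[symmetric] del: ennreal_plus)
  then have "e \<le> pr + (th / (1 - th * Kb) - th) * (pr * (2 * h))"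
    by (simp only: left_diff_distrib mult_2_right distrib_left distrib_right mult.commute[of 2] mult.assoc, (linarith)?)
  also have "th / (1 - th * Kb) - th = th\<^sup>2 * Kb / (1 - th * Kb)"
    using th by (simp add: field_simps power2_eq_square)
  finally have "e \<le> pr + (th\<^sup>2 * Kb / (1 - th * Kb)) * (pr * (2 * h))" .
  also have "pr + (th\<^sup>2 * Kb / (1 - th * Kb)) * (pr * (2 * h)) \<le> pr + (th\<^sup>2 * Kb / (1 - th * Kb)) * (pr * Cc)"
    using pr h(2) th Kb_pos by (intro add_left_mono mult_left_mono) auto
  also have "\<dots> = bern th * pr" by (simp add: bern_def algebra_simps)
  finally have "E1 \<le> ennreal (bern th * pr)" unfolding e by (rule ennreal_leI)
  also have "\<dots> = ennreal (bern th) * ennreal pr"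
    using pr th Cc_nonneg Kb_pos by (intro ennreal_mult) (auto simp: bern_def)
  finally show ?thesis unfolding E1_def H_def[symmetric] pr .
qed

end

section \<open>Product estimates over successive cycles\<close>

context nummelin_splitting
begin

text \<open>One step of a product estimate, at the start of cycle \<open>k + 1\<close>. If this
  start has index \<open>i + 1\<close>, then \<open>z\<close> has to be known in \<open>F i\<close>;
  this admits cycles up to \<open>k - 1\<close> but not cycle \<open>k\<close>, whose last interval
  begins at \<open>T i\<close>.\<close>

lemma cycle_step:
  assumes \<pi>: "\<pi> \<in> inits"
    and \<Phi>: "\<And>n. \<Phi> n \<in> borel_measurable Om'" and \<zeta>: "\<And>i. \<zeta> i \<in> borel_measurable (F i)"
    and bound: "\<And>j G. G \<in> sets (F j) \<Longrightarrow>
      (\<integral>\<^sup>+w. indicator (G \<inter> hits j) w * \<Phi> (Suc j) w \<partial>PP \<pi>) \<le> \<beta> * emeasure (PP \<pi>) (G \<inter> hits j)"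
    and z: "\<And>w i. w \<in> pre_start k i \<inter> hits i \<Longrightarrow> z w = \<zeta> i w"
    and \<Phi>s: "\<And>w i. w \<in> pre_start k i \<inter> hits i \<Longrightarrow> \<Phi>s w = \<Phi> (Suc i) w"
  shows "(\<integral>\<^sup>+w. z w * \<Phi>s w \<partial>PP \<pi>) \<le> \<beta> * (\<integral>\<^sup>+w. z w \<partial>PP \<pi>)"
proof -
  let ?I = "\<lambda>i. indicator (pre_start k i \<inter> hits i)"
  have pm: "pre_start k i \<inter> hits i \<in> sets (PP \<pi>)" for i
    using F_into_Om'[OF pre_start_F] hits_measurable by (simp add: sets_PP[OF \<pi>])
  note [measurable] = pm measurable_PP[OF \<pi> \<Phi>] measurable_PP[OF \<pi> measurable_F_Om'[OF \<zeta>]]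
  \<comment> \<open>Almost surely exactly one \<open>i\<close> is the index of the hit that precedes
    cycle \<open>k + 1\<close>.\<close>
  have single: "AE w in PP \<pi>. (\<Sum>i. ?I i w * g i w) = h w"
    if gh: "\<And>w i. w \<in> pre_start k i \<inter> hits i \<Longrightarrow> h w = g i w" for g and h :: "'v \<Rightarrow> ennreal"
  proof -
    have "AE w in PP \<pi>. w \<in> started (Suc k)"
      using AE_cyc_index[OF \<pi>] AE_space by eventually_elim (auto simp: started_def space_PP[OF \<pi>])
    then show ?thesis
    proof eventually_elim
      fix w assume "w \<in> started (Suc k)"
      then obtain i where i: "w \<in> pre_start k i \<inter> hits i" unfolding started_Suc by blast
      have "(\<Sum>j. ?I j w * g j w) = ?I i w * g i w"
      proof (rule suminf_single_ennreal)
        fix j assume "j \<noteq> i"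
        then have "(pre_start k j \<inter> hits j) \<inter> (pre_start k i \<inter> hits i) = {}"
          using disjoint_pre_start[of k] unfolding disjoint_family_on_def by blast
        then have "w \<notin> pre_start k j \<inter> hits j" using i by blast
        then show "?I j w * g j w = 0" by (simp del: Int_iff)
      qed
      also have "\<dots> = h w" using i gh[OF i] by (simp only: indicator_simps mult_1_left)
      finally show "(\<Sum>j. ?I j w * g j w) = h w" .
    qed
  qed
  have z\<Phi>: "z w * \<Phi>s w = \<zeta> i w * \<Phi> (Suc i) w" if "w \<in> pre_start k i \<inter> hits i" for w i
    using z[OF that] \<Phi>s[OF that] by simp
  have "(\<integral>\<^sup>+w. z w * \<Phi>s w \<partial>PP \<pi>) = (\<integral>\<^sup>+w. (\<Sum>i. ?I i w * (\<zeta> i w * \<Phi> (Suc i) w)) \<partial>PP \<pi>)"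
  proof (rule nn_integral_cong_AE)
    have "AE w in PP \<pi>. (\<Sum>i. ?I i w * (\<zeta> i w * \<Phi> (Suc i) w)) = z w * \<Phi>s w"
      by (rule single) (rule z\<Phi>)
    then show "AE w in PP \<pi>. z w * \<Phi>s w = (\<Sum>i. ?I i w * (\<zeta> i w * \<Phi> (Suc i) w))"
      by eventually_elim simp
  qed
  also have "\<dots> = (\<Sum>i. \<integral>\<^sup>+w. ?I i w * (\<zeta> i w * \<Phi> (Suc i) w) \<partial>PP \<pi>)"
    by (rule nn_integral_suminf) measurable
  also have "\<dots> \<le> (\<Sum>i. \<beta> * (\<integral>\<^sup>+w. ?I i w * \<zeta> i w \<partial>PP \<pi>))"
  proof (rule suminf_le)
    fix i
    note hits_measurable[measurable] \<Phi>[measurable]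
    have [measurable]: "(indicator (hits i) :: _ \<Rightarrow> ennreal) \<in> borel_measurable Om'" by measurable
    define \<xi> where "\<xi> w = indicator (pre_start k i) w * \<zeta> i w" for w
    have \<xi>: "\<xi> \<in> borel_measurable (F i)"
      unfolding \<xi>_def[abs_def] using pre_start_F[of k i] \<zeta>[of i] by measurable
    have "(\<integral>\<^sup>+w. ?I i w * (\<zeta> i w * \<Phi> (Suc i) w) \<partial>PP \<pi>) = (\<integral>\<^sup>+w. \<xi> w * (indicator (hits i) w * \<Phi> (Suc i) w) \<partial>PP \<pi>)"
      by (intro nn_integral_cong) (simp add: \<xi>_def indicator_inter_arith ac_simps)
    also have "\<dots> \<le> (\<integral>\<^sup>+w. \<xi> w * (indicator (hits i) w * \<beta>) \<partial>PP \<pi>)"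
    proof (rule nn_integral_past_le[OF \<pi> _ _ _ \<xi>])
      fix G assume G: "G \<in> sets (F i)"
      have Gh: "G \<inter> hits i \<in> sets (PP \<pi>)" using F_into_Om'[OF G] hits_measurable by (simp add: sets_PP[OF \<pi>])
      have "(\<integral>\<^sup>+w. indicator G w * (indicator (hits i) w * \<Phi> (Suc i) w) \<partial>PP \<pi>) =
        (\<integral>\<^sup>+w. indicator (G \<inter> hits i) w * \<Phi> (Suc i) w \<partial>PP \<pi>)"
        by (intro nn_integral_cong) (simp add: indicator_inter_arith mult.assoc)
      also have "\<dots> \<le> \<beta> * emeasure (PP \<pi>) (G \<inter> hits i)" by (rule bound[OF G])
      also have "\<dots> = (\<integral>\<^sup>+w. \<beta> * indicator (G \<inter> hits i) w \<partial>PP \<pi>)"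
        by (rule nn_integral_cmult_indicator[OF Gh, symmetric])
      also have "\<dots> = (\<integral>\<^sup>+w. indicator G w * (indicator (hits i) w * \<beta>) \<partial>PP \<pi>)"
        by (intro nn_integral_cong) (simp add: indicator_inter_arith ac_simps)
      finally show "(\<integral>\<^sup>+w. indicator G w * (indicator (hits i) w * \<Phi> (Suc i) w) \<partial>PP \<pi>) \<le> \<dots>" .
    qed measurable
    also have "\<dots> = (\<integral>\<^sup>+w. \<beta> * (?I i w * \<zeta> i w) \<partial>PP \<pi>)"
      by (intro nn_integral_cong) (simp add: \<xi>_def indicator_inter_arith ac_simps)
    also have "\<dots> = \<beta> * (\<integral>\<^sup>+w. ?I i w * \<zeta> i w \<partial>PP \<pi>)"
      by (rule nn_integral_cmult) measurable
    finally show "(\<integral>\<^sup>+w. ?I i w * (\<zeta> i w * \<Phi> (Suc i) w) \<partial>PP \<pi>) \<le> \<dots>" .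
  qed auto
  also have "\<dots> = \<beta> * (\<integral>\<^sup>+w. (\<Sum>i. ?I i w * \<zeta> i w) \<partial>PP \<pi>)"
  proof -
    have "(\<integral>\<^sup>+w. (\<Sum>i. ?I i w * \<zeta> i w) \<partial>PP \<pi>) = (\<Sum>i. \<integral>\<^sup>+w. ?I i w * \<zeta> i w \<partial>PP \<pi>)"
      by (rule nn_integral_suminf) measurable
    then show ?thesis by simp
  qed
  also have "(\<integral>\<^sup>+w. (\<Sum>i. ?I i w * \<zeta> i w) \<partial>PP \<pi>) = (\<integral>\<^sup>+w. z w \<partial>PP \<pi>)"
    by (rule nn_integral_cong_AE) (rule single, rule z)
  finally show ?thesis .
qed

definition cyc_total :: "(nat \<Rightarrow> 'v \<Rightarrow> ennreal) \<Rightarrow> nat \<Rightarrow> 'v \<Rightarrow> ennreal" where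
  "cyc_total u k w = (\<Sum>j. if cyc_index j w = k then u j w else 0)"

text \<open>A truncation determined by the intervals before \<open>T i\<close>, hence measurable for
  \<open>F i\<close>; it coincides with the full sum once cycle \<open>k\<close> is over.\<close>

definition cyc_part :: "(nat \<Rightarrow> 'v \<Rightarrow> ennreal) \<Rightarrow> nat \<Rightarrow> nat \<Rightarrow> 'v \<Rightarrow> ennreal" where
  "cyc_part u k i w = (\<Sum>j<i. if cyc_index j w = k then u j w else 0)"

lemma cyc_total_eq_part:
  assumes "k < cyc_index i w" shows "cyc_total u k w = cyc_part u k i w"
  unfolding cyc_total_def cyc_part_def
proof (rule suminf_finite)
  fix j assume "j \<notin> {..<i}"
  then have "cyc_index i w \<le> cyc_index j w" by (intro cyc_index_mono) simp
  then show "(if cyc_index j w = k then u j w else 0) = 0" using assms by simp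
qed simp

lemma cyc_part_F:
  assumes u: "\<And>j. u j \<in> borel_measurable (F (Suc j))" shows "cyc_part u k i \<in> borel_measurable (F i)"
  unfolding cyc_part_def[abs_def]
proof (rule borel_measurable_sum)
  fix j assume "j \<in> {..<i}"
  then have ji: "Suc j \<le> i" "j \<le> i" by auto
  note [measurable] = measurable_F_mono[OF ji(1) u] measurable_F_mono[OF ji(2) cyc_index_F]
  show "(\<lambda>w. if cyc_index j w = k then u j w else 0) \<in> borel_measurable (F i)" by measurable
qed

lemma cyc_total_measurable:
  assumes [measurable]: "\<And>j. u j \<in> borel_measurable Om'" shows "cyc_total u k \<in> borel_measurable Om'"
  unfolding cyc_total_def[abs_def] by measurable

lemma cyc_total_start:
  assumes w: "w \<in> pre_start k i \<inter> hits i" shows "cyc_total u (Suc k) w = csum u (Suc i) w"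
proof -
  have sp: "w \<in> space Om'" using w by (simp add: pre_start_def)
  have "cyc_total u (Suc k) w = (\<Sum>i. indicator (pre_start k i \<inter> hits i) w * csum u (Suc i) w)"
    unfolding cyc_total_def by (rule cycle_sum_Suc[OF sp])
  also have "\<dots> = indicator (pre_start k i \<inter> hits i) w * csum u (Suc i) w"
  proof (rule suminf_single_ennreal)
    fix j assume "j \<noteq> i"
    then have "(pre_start k j \<inter> hits j) \<inter> (pre_start k i \<inter> hits i) = {}"
      using disjoint_pre_start[of k] unfolding disjoint_family_on_def by blast
    then have "w \<notin> pre_start k j \<inter> hits j" using w by blast
    then show "indicator (pre_start k j \<inter> hits j) w * csum u (Suc j) w = 0" by (simp del: Int_iff)
  qed
  finally show ?thesis using w by (simp only: indicator_simps mult_1_left)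
qed

text \<open>The automaton \<open>elig\<close>, \<open>cyc_index\<close> read off a sequence of values of \<open>W\<close> that begins at the start of a
  cycle.\<close>

primrec fresh :: "nat \<Rightarrow> (nat \<Rightarrow> ('e \<times> real \<times> 'e) \<times> real) \<Rightarrow> bool \<times> nat" where
  "fresh 0 s = (False, 0)"
| "fresh (Suc j) s = (if fst (fresh j s) \<and> fst (s j) \<in> hit_set then (False, Suc (snd (fresh j s))) else (True, snd (fresh j s)))"

lemma fresh_measurable: "fresh j \<in> SWs \<rightarrow>\<^sub>M count_space UNIV"
proof (induction j)
  case 0
  show ?case by (subst measurable_cong[of _ _ "\<lambda>_. (False, 0)"]) auto
next
  case (Suc j)
  note [measurable] = Suc
  have [measurable]: "Measurable.pred SWs (\<lambda>s. fst (fresh j s))" "(\<lambda>s. snd (fresh j s)) \<in> SWs \<rightarrow>\<^sub>M count_space UNIV"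
    by (auto intro: measurable_compose[OF Suc])
  have [measurable]: "(\<lambda>s. (False, Suc (snd (fresh j s)))) \<in> SWs \<rightarrow>\<^sub>M count_space UNIV"
    "(\<lambda>s. (True, snd (fresh j s))) \<in> SWs \<rightarrow>\<^sub>M count_space UNIV"
    by (auto intro: measurable_compose[OF Suc])
  have "(\<lambda>s. if fst (fresh j s) \<and> fst (s j) \<in> hit_set then (False, Suc (snd (fresh j s))) else (True, snd (fresh j s))) \<in> SWs \<rightarrow>\<^sub>M count_space UNIV"
    by measurable
  then show ?case by (subst measurable_cong) auto
qed

lemma fresh_eq:
  assumes w: "w \<in> space Om'" and r: "\<not> elig r w"
  shows "elig (r + j) w = fst (fresh j (W_seq r w)) \<and> cyc_index (r + j) w = cyc_index r w + snd (fresh j (W_seq r w))"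
proof (induction j)
  case 0
  show ?case using r by simp
next
  case (Suc j)
  have h: "fst (W_seq r w j) \<in> hit_set \<longleftrightarrow> w \<in> hits (r + j)"
    unfolding hits_iff[OF w] by (simp add: W_seq_def W_def)
  show ?case unfolding fresh.simps h using Suc by auto
qed

text \<open>The occupation integral of the constant 1 is the waiting time, so lengths of cycles,
  unlike integrals of f, are functions of the sequence of jumps.\<close>

definition fresh_len :: "nat \<Rightarrow> (nat \<Rightarrow> ('e \<times> real \<times> 'e) \<times> real) \<Rightarrow> ennreal" where
  "fresh_len l s = (\<Sum>j. if snd (fresh j s) = l then ennreal (snd (s j)) else 0)"

lemma fresh_len_measurable[measurable]: "fresh_len l \<in> borel_measurable SWs"
proof -
  have [measurable]: "(\<lambda>s. snd (fresh j s)) \<in> SWs \<rightarrow>\<^sub>M count_space UNIV" for j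
    by (auto intro: measurable_compose[OF fresh_measurable])
  show ?thesis unfolding fresh_len_def[abs_def] by measurable
qed

abbreviation len :: "nat \<Rightarrow> 'v \<Rightarrow> ennreal" where "len \<equiv> cyc_total (occ (\<lambda>_. 1))"

lemma len_measurable[measurable]: "len k \<in> borel_measurable Om'"
  by (rule cyc_total_measurable) (rule occ_measurable, simp)

lemma len_fresh:
  assumes w: "w \<in> space Om'" and r: "\<not> elig r w"
  shows "len (cyc_index r w + l) w = fresh_len l (W_seq r w)"
proof -
  have "len (cyc_index r w + l) w = (\<Sum>j. if cyc_index (r + j) w = cyc_index r w + l then occ (\<lambda>_. 1) (r + j) w else 0)"
    unfolding cyc_total_def
  proof (rule suminf_eq_offset_ennreal)
    fix j assume "j < r"
    from cycle_start_less[OF r this] show "(if cyc_index j w = cyc_index r w + l then occ (\<lambda>_. 1) j w else 0) = 0" by simp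
  qed
  also have "\<dots> = fresh_len l (W_seq r w)"
    unfolding fresh_len_def
    by (intro suminf_cong) (simp add: fresh_eq[OF w r] occ_one[OF w] W_seq_def[abs_def] W_def)
  finally show ?thesis .
qed

lemma len_fresh_start:
  assumes w: "w \<in> pre_start k i \<inter> hits i" shows "len (Suc k + l) w = fresh_len l (W_seq (Suc i) w)"
proof -
  have sp: "w \<in> space Om'" using w by (simp add: pre_start_def)
  have 1: "\<not> elig (Suc i) w" and 2: "cyc_index (Suc i) w = Suc k" using pre_start_hits[OF sp, of k i] w by blast+
  from len_fresh[OF sp 1, of l] show ?thesis unfolding 2 .
qed

lemma len_fresh_0: "w \<in> space Om' \<Longrightarrow> len l w = fresh_len l (W_seq 0 w)"
  using len_fresh[of w 0 l] by simp

lemma T_sum: "w \<in> space Om' \<Longrightarrow> T r w = (\<Sum>j<r. wait j w)"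
  by (induction r) (simp_all add: T_0)

lemma regen_time_eq_sum:
  assumes w: "w \<in> space Om'" and ex: "\<exists>j. cyc_index j w = k"
  shows "regen_time C a Z T k w = (\<Sum>l<k. len l w)" "regen_time C a Z T k w < \<infinity>"
proof -
  obtain r where r: "\<not> elig r w" "cyc_index r w = k" using ex cycle_start_exists by metis
  have least: "r \<le> j" if "k \<le> cyc_index j w" for j
    using cycle_start_less[OF r(1), of j] r(2) that by (meson leI leD)
  have lt: "cyc_index j w < k \<longleftrightarrow> j < r" for j
    using least[of j] cycle_start_less[OF r(1), of j] cyc_index_mono[of r j w] r(2) by (cases "j < r") auto
  have iff: "0 \<le> t \<Longrightarrow> regen_time C a Z T k w \<le> ennreal t \<longleftrightarrow> T r w \<le> t" for t
    unfolding regen_time_le_iff[OF w] using least r T_le[OF w] by (meson order_refl order_trans)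
  have le: "regen_time C a Z T k w \<le> ennreal (T r w)" using iff T_nonneg[OF w] by simp
  then have fin: "regen_time C a Z T k w < top" by (rule le_less_trans) simp
  then obtain c where c: "regen_time C a Z T k w = ennreal c" "0 \<le> c" by (cases "regen_time C a Z T k w") auto
  then have "T r w \<le> c" using iff[of c] by simp
  then have e: "regen_time C a Z T k w = ennreal (T r w)" using le c by (intro antisym) (auto intro: ennreal_leI)
  have "(\<Sum>l<k. len l w) = (\<Sum>l<k. \<Sum>j<r. if cyc_index j w = l then occ (\<lambda>_. 1) j w else 0)"
    by (intro sum.cong refl, subst cyc_total_eq_part[of _ r]) (auto simp: r(2) cyc_part_def)
  also have "\<dots> = (\<Sum>j<r. \<Sum>l<k. if cyc_index j w = l then occ (\<lambda>_. 1) j w else 0)"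
    by (rule sum.swap)
  also have "\<dots> = (\<Sum>j<r. ennreal (wait j w))"
    by (intro sum.cong refl) (auto simp: lt occ_one[OF w])
  also have "\<dots> = ennreal (\<Sum>j<r. wait j w)" using wait_pos[OF w] by (intro sum_ennreal) (auto intro: less_imp_le)
  also have "(\<Sum>j<r. wait j w) = T r w" by (rule T_sum[OF w, symmetric])
  finally show "regen_time C a Z T k w = (\<Sum>l<k. len l w)" using e by (simp only:)
  show "regen_time C a Z T k w < \<infinity>" using fin by simp
qed

lemma W_seq_bound:
  assumes \<pi>: "\<pi> \<in> inits" and G: "G \<in> sets (F j)" and \<Psi>: "\<Psi> \<in> borel_measurable SWs"
  shows "(\<integral>\<^sup>+w. indicator (G \<inter> hits j) w * \<Psi> (W_seq (Suc j) w) \<partial>PP \<pi>) \<le> (\<integral>\<^sup>+w. \<Psi> (W_seq 0 w) \<partial>PP \<nu>) * emeasure (PP \<pi>) (G \<inter> hits j)"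
  using regeneration[OF markov_seq_W_seq \<pi> G \<Psi>] by (simp add: mult.commute)

text \<open>\<open>enn2real\<close> sends an infinite length to 0, which is harmless because cycles
  are almost surely finite; the shape is that of \<open>cycle_laplace\<close>.\<close>

definition elap :: "real \<Rightarrow> ennreal \<Rightarrow> ennreal" where "elap l x = ennreal (exp (- l * enn2real x))"

lemma elap_measurable[measurable]: "elap l \<in> borel_measurable borel"
  unfolding elap_def[abs_def] by measurable

text \<open>The earlier factors involve cycles up to \<open>2 * m + e - 2\<close>, so one full cycle
  separates them from cycle \<open>2 * m + e\<close> and \<open>cycle_step\<close> applies.\<close>

lemma prod_elap_bound:
  assumes \<pi>: "\<pi> \<in> inits" and e: "e = 1 \<or> e = (2 :: nat)"
  shows "(\<integral>\<^sup>+w. (\<Prod>k<m. elap l (len (2 * k + e) w)) \<partial>PP \<pi>) \<le> (\<integral>\<^sup>+w. elap l (len 0 w) \<partial>PP \<nu>) ^ m"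
proof (induction m)
  case 0
  interpret PP: prob_space "PP \<pi>" by (rule PP_prob_space[OF \<pi>])
  show ?case by (simp add: PP.emeasure_space_1)
next
  case (Suc m)
  let ?k = "2 * m + e - 1"
  have k: "2 * m + e = Suc ?k" using e by auto
  have \<beta>: "(\<integral>\<^sup>+w. elap l (len 0 w) \<partial>PP \<nu>) = (\<integral>\<^sup>+w. elap l (fresh_len 0 (W_seq 0 w)) \<partial>PP \<nu>)"
    by (intro nn_integral_cong) (simp add: len_fresh_0 space_PP[OF nu_inits])
  have one: "(\<lambda>_. 1) \<in> borel_measurable (borel :: 'e measure)" by simp
  have "(\<integral>\<^sup>+w. (\<Prod>k<m. elap l (len (2 * k + e) w)) * elap l (len (2 * m + e) w) \<partial>PP \<pi>) \<le>
     (\<integral>\<^sup>+w. elap l (len 0 w) \<partial>PP \<nu>) * (\<integral>\<^sup>+w. (\<Prod>k<m. elap l (len (2 * k + e) w)) \<partial>PP \<pi>)"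
    unfolding \<beta>
  proof (rule cycle_step[OF \<pi>, where \<Phi> = "\<lambda>n w. elap l (fresh_len 0 (W_seq n w))" and k = ?k and
      \<zeta> = "\<lambda>i w. \<Prod>k<m. elap l (cyc_part (occ (\<lambda>_. 1)) (2 * k + e) i w)"])
    have m: "(\<lambda>s. elap l (fresh_len 0 s)) \<in> borel_measurable SWs" by measurable
    show "(\<lambda>w. elap l (fresh_len 0 (W_seq n w))) \<in> borel_measurable Om'" for n
      by (rule measurable_compose[OF W_seq_measurable m])
    show "(\<lambda>w. \<Prod>k<m. elap l (cyc_part (occ (\<lambda>_. 1)) (2 * k + e) i w)) \<in> borel_measurable (F i)" for i
    proof -
      have [measurable]: "cyc_part (occ (\<lambda>_. 1)) q i \<in> borel_measurable (F i)" for q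
        by (rule cyc_part_F) (rule occ_F[OF one])
      show ?thesis by measurable
    qed
    show "(\<integral>\<^sup>+w. indicator (G \<inter> hits j) w * elap l (fresh_len 0 (W_seq (Suc j) w)) \<partial>PP \<pi>) \<le>
      (\<integral>\<^sup>+w. elap l (fresh_len 0 (W_seq 0 w)) \<partial>PP \<nu>) * emeasure (PP \<pi>) (G \<inter> hits j)" if "G \<in> sets (F j)" for j G
      by (rule W_seq_bound[OF \<pi> that m])
    fix w i assume w: "w \<in> pre_start ?k i \<inter> hits i"
    show "(\<Prod>k<m. elap l (len (2 * k + e) w)) = (\<Prod>k<m. elap l (cyc_part (occ (\<lambda>_. 1)) (2 * k + e) i w))"
      by (intro prod.cong refl, subst cyc_total_eq_part[of _ i]) (use w e in \<open>auto simp: pre_start_def\<close>)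
    show "elap l (len (2 * m + e) w) = elap l (fresh_len 0 (W_seq (Suc i) w))"
      using len_fresh_start[OF w, of 0] k by simp
  qed
  also have "\<dots> \<le> (\<integral>\<^sup>+w. elap l (len 0 w) \<partial>PP \<nu>) * (\<integral>\<^sup>+w. elap l (len 0 w) \<partial>PP \<nu>) ^ m"
    by (intro mult_left_mono Suc.IH) simp
  finally show ?case by simp
qed

text \<open>Blocks of \<open>k\<close> consecutive cycles, with one cycle skipped before each; the
  skipped indices are the multiples of \<open>k + 1\<close>. The skipped cycle separates the blocks,
  and inside a block no independence is used.\<close>

lemma block_bound:
  assumes \<pi>: "\<pi> \<in> inits"
  shows "(\<integral>\<^sup>+w. (\<Prod>b<i. if (\<Sum>l<k. len (b * Suc k + 1 + l) w) \<le> ennreal t then 1 else 0) \<partial>PP \<pi>) \<le>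
    (\<integral>\<^sup>+w. (if (\<Sum>l<k. len l w) \<le> ennreal t then 1 else 0) \<partial>PP \<nu>) ^ i"
proof (induction i)
  case 0
  interpret PP: prob_space "PP \<pi>" by (rule PP_prob_space[OF \<pi>])
  show ?case by (simp add: PP.emeasure_space_1)
next
  case (Suc i)
  define ind :: "ennreal \<Rightarrow> ennreal" where "ind x = (if x \<le> ennreal t then 1 else 0)" for x
  have [measurable]: "ind \<in> borel_measurable borel" unfolding ind_def[abs_def] by measurable
  let ?k = "i * Suc k"
  have one: "(\<lambda>_. 1) \<in> borel_measurable (borel :: 'e measure)" by simp
  have \<beta>: "(\<integral>\<^sup>+w. ind (\<Sum>l<k. len l w) \<partial>PP \<nu>) = (\<integral>\<^sup>+w. ind (\<Sum>l<k. fresh_len l (W_seq 0 w)) \<partial>PP \<nu>)"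
    by (intro nn_integral_cong) (simp add: len_fresh_0 space_PP[OF nu_inits])
  have "(\<integral>\<^sup>+w. (\<Prod>b<i. ind (\<Sum>l<k. len (b * Suc k + 1 + l) w)) * ind (\<Sum>l<k. len (i * Suc k + 1 + l) w) \<partial>PP \<pi>) \<le>
     (\<integral>\<^sup>+w. ind (\<Sum>l<k. len l w) \<partial>PP \<nu>) * (\<integral>\<^sup>+w. (\<Prod>b<i. ind (\<Sum>l<k. len (b * Suc k + 1 + l) w)) \<partial>PP \<pi>)"
    unfolding \<beta>
  proof (rule cycle_step[OF \<pi>, where \<Phi> = "\<lambda>n w. ind (\<Sum>l<k. fresh_len l (W_seq n w))" and k = ?k and
      \<zeta> = "\<lambda>i' w. \<Prod>b<i. ind (\<Sum>l<k. cyc_part (occ (\<lambda>_. 1)) (b * Suc k + 1 + l) i' w)"])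
    have m: "(\<lambda>s. ind (\<Sum>l<k. fresh_len l s)) \<in> borel_measurable SWs" by measurable
    show "(\<lambda>w. ind (\<Sum>l<k. fresh_len l (W_seq n w))) \<in> borel_measurable Om'" for n
      by (rule measurable_compose[OF W_seq_measurable m])
    show "(\<lambda>w. \<Prod>b<i. ind (\<Sum>l<k. cyc_part (occ (\<lambda>_. 1)) (b * Suc k + 1 + l) i' w)) \<in> borel_measurable (F i')" for i'
    proof -
      have [measurable]: "cyc_part (occ (\<lambda>_. 1)) q i' \<in> borel_measurable (F i')" for q
        by (rule cyc_part_F) (rule occ_F[OF one])
      show ?thesis by measurable
    qed
    show "(\<integral>\<^sup>+w. indicator (G \<inter> hits j) w * ind (\<Sum>l<k. fresh_len l (W_seq (Suc j) w)) \<partial>PP \<pi>) \<le>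
      (\<integral>\<^sup>+w. ind (\<Sum>l<k. fresh_len l (W_seq 0 w)) \<partial>PP \<nu>) * emeasure (PP \<pi>) (G \<inter> hits j)" if "G \<in> sets (F j)" for j G
      by (rule W_seq_bound[OF \<pi> that m])
    fix w i' assume w: "w \<in> pre_start ?k i' \<inter> hits i'"
    have less: "b * Suc k + 1 + l < cyc_index i' w" if "b < i" "l < k" for b l
    proof -
      have "Suc b * Suc k \<le> i * Suc k" using that(1) by (intro mult_le_mono1) simp
      then show ?thesis using w that(2) by (simp add: pre_start_def)
    qed
    show "(\<Prod>b<i. ind (\<Sum>l<k. len (b * Suc k + 1 + l) w)) = (\<Prod>b<i. ind (\<Sum>l<k. cyc_part (occ (\<lambda>_. 1)) (b * Suc k + 1 + l) i' w))"
      by (intro prod.cong refl arg_cong[where f = ind] sum.cong cyc_total_eq_part less) auto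
    show "ind (\<Sum>l<k. len (i * Suc k + 1 + l) w) = ind (\<Sum>l<k. fresh_len l (W_seq (Suc i') w))"
      using len_fresh_start[OF w] by (intro arg_cong[where f = ind] sum.cong refl) simp
  qed
  also have "\<dots> \<le> (\<integral>\<^sup>+w. ind (\<Sum>l<k. len l w) \<partial>PP \<nu>) * (\<integral>\<^sup>+w. ind (\<Sum>l<k. len l w) \<partial>PP \<nu>) ^ i"
    using Suc.IH by (intro mult_left_mono) (auto simp: ind_def)
  finally show ?case by (simp add: ind_def)
qed

lemma AE_regen_time:
  assumes \<pi>: "\<pi> \<in> inits"
  shows "AE w in PP \<pi>. \<forall>k. regen_time C a Z T k w = (\<Sum>l<k. len l w) \<and> (\<Sum>l<k. len l w) < top"
  using AE_cyc_index[OF \<pi>] AE_space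
proof eventually_elim
  fix w assume h: "(\<forall>n. \<exists>i>n. w \<in> hits i) \<and> (\<forall>k. \<exists>j. cyc_index j w = k)" and sp: "w \<in> space (PP \<pi>)"
  have w: "w \<in> space Om'" using sp by (simp add: space_PP[OF \<pi>])
  have ex: "\<exists>j. cyc_index j w = k" for k using h by blast
  show "\<forall>k. regen_time C a Z T k w = (\<Sum>l<k. len l w) \<and> (\<Sum>l<k. len l w) < top"
  proof (intro allI conjI)
    fix k
    show e: "regen_time C a Z T k w = (\<Sum>l<k. len l w)" by (rule regen_time_eq_sum(1)[OF w ex])
    show "(\<Sum>l<k. len l w) < top" using regen_time_eq_sum(2)[OF w ex, of k] unfolding e by simp
  qed
qed

lemma AE_len_finite:
  assumes \<pi>: "\<pi> \<in> inits" shows "AE w in PP \<pi>. \<forall>k. len k w < top"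
  using AE_regen_time[OF \<pi>]
proof eventually_elim
  fix w assume h: "\<forall>k. regen_time C a Z T k w = (\<Sum>l<k. len l w) \<and> (\<Sum>l<k. len l w) < top"
  show "\<forall>k. len k w < top"
  proof
    fix k
    have "(\<Sum>l<Suc k. len l w) < top" using h by blast
    then show "len k w < top" by (simp only: sum.lessThan_Suc ennreal_add_less_top)
  qed
qed

lemma AE_cycle_length:
  assumes \<pi>: "\<pi> \<in> inits" shows "AE w in PP \<pi>. cycle_length C a Z T w = len 1 w \<and> len 1 w < top"
  using AE_regen_time[OF \<pi>] AE_len_finite[OF \<pi>]
proof eventually_elim
  fix w assume h: "\<forall>k. regen_time C a Z T k w = (\<Sum>l<k. len l w) \<and> (\<Sum>l<k. len l w) < top"
    and f: "\<forall>k. len k w < top"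
  have r: "regen_time C a Z T 2 w = len 0 w + len 1 w" "regen_time C a Z T 1 w = len 0 w"
    using h[rule_format, of 2] h[rule_format, of 1] by (simp_all only: numeral_2_eq_2 One_nat_def sum.lessThan_Suc lessThan_0 sum.empty add_0)
  show "cycle_length C a Z T w = len 1 w \<and> len 1 w < top"
    unfolding cycle_length_def r using f[rule_format, of 0] f[rule_format, of 1] by (simp only: ennreal_add_diff_cancel_left less_top simp_thms)
qed

text \<open>Regeneration is summed over the possible starts of the cycle. This moves statements from
  cycle 1, which defines \<open>cycle_length\<close>, to cycle 0 under \<open>\<nu>\<close>.\<close>

lemma nn_integral_len_law:
  assumes \<pi>: "\<pi> \<in> inits" and \<psi>[measurable]: "\<psi> \<in> borel_measurable borel"
  shows "(\<integral>\<^sup>+w. \<psi> (len (Suc k) w) \<partial>PP \<pi>) = (\<integral>\<^sup>+w. \<psi> (len 0 w) \<partial>PP \<nu>)"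
proof -
  define \<beta> where "\<beta> = (\<integral>\<^sup>+w. \<psi> (fresh_len 0 (W_seq 0 w)) \<partial>PP \<nu>)"
  have m: "(\<lambda>s. \<psi> (fresh_len 0 s)) \<in> borel_measurable SWs" by measurable
  let ?I = "\<lambda>i. indicator (pre_start k i \<inter> hits i)"
  have pm: "pre_start k i \<inter> hits i \<in> sets (PP \<pi>)" for i
    using F_into_Om'[OF pre_start_F] hits_measurable by (simp add: sets_PP[OF \<pi>])
  note [measurable] = pm measurable_PP[OF \<pi> measurable_compose[OF W_seq_measurable m]]
  have "(\<integral>\<^sup>+w. \<psi> (len (Suc k) w) \<partial>PP \<pi>) = (\<integral>\<^sup>+w. (\<Sum>i. ?I i w * \<psi> (fresh_len 0 (W_seq (Suc i) w))) \<partial>PP \<pi>)"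
  proof (rule nn_integral_cong_AE)
    have "AE w in PP \<pi>. w \<in> started (Suc k)"
      using AE_cyc_index[OF \<pi>] AE_space by eventually_elim (auto simp: started_def space_PP[OF \<pi>])
    then show "AE w in PP \<pi>. \<psi> (len (Suc k) w) = (\<Sum>i. ?I i w * \<psi> (fresh_len 0 (W_seq (Suc i) w)))"
    proof eventually_elim
      fix w assume "w \<in> started (Suc k)"
      then obtain i where i: "w \<in> pre_start k i \<inter> hits i" unfolding started_Suc by blast
      have "(\<Sum>j. ?I j w * \<psi> (fresh_len 0 (W_seq (Suc j) w))) = ?I i w * \<psi> (fresh_len 0 (W_seq (Suc i) w))"
      proof (rule suminf_single_ennreal)
        fix j assume "j \<noteq> i"
        then have "(pre_start k j \<inter> hits j) \<inter> (pre_start k i \<inter> hits i) = {}"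
          using disjoint_pre_start[of k] unfolding disjoint_family_on_def by blast
        then have "w \<notin> pre_start k j \<inter> hits j" using i by blast
        then show "?I j w * \<psi> (fresh_len 0 (W_seq (Suc j) w)) = 0" by (simp del: Int_iff)
      qed
      also have "\<dots> = \<psi> (len (Suc k) w)" using i len_fresh_start[OF i, of 0] by (simp only: indicator_simps mult_1_left add_0_right)
      finally show "\<psi> (len (Suc k) w) = (\<Sum>j. ?I j w * \<psi> (fresh_len 0 (W_seq (Suc j) w)))" by simp
    qed
  qed
  also have "\<dots> = (\<Sum>i. \<integral>\<^sup>+w. ?I i w * \<psi> (fresh_len 0 (W_seq (Suc i) w)) \<partial>PP \<pi>)"
    by (rule nn_integral_suminf) measurable
  also have "\<dots> = (\<Sum>i. emeasure (PP \<pi>) (pre_start k i \<inter> hits i) * \<beta>)"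
    unfolding \<beta>_def by (intro suminf_cong regeneration[OF markov_seq_W_seq \<pi> pre_start_F m])
  also have "\<dots> = emeasure (PP \<pi>) (started (Suc k)) * \<beta>"
    by (simp add: emeasure_started_Suc[OF \<pi>])
  also have "\<dots> = \<beta>" by (simp add: emeasure_started[OF \<pi>])
  also have "\<beta> = (\<integral>\<^sup>+w. \<psi> (len 0 w) \<partial>PP \<nu>)"
    unfolding \<beta>_def by (intro nn_integral_cong) (simp add: len_fresh_0 space_PP[OF nu_inits])
  finally show ?thesis .
qed

end

section \<open>Tail estimates\<close>

lemma sum_odd_even:
  fixes g :: "nat \<Rightarrow> 'a::comm_monoid_add"
  shows "g 0 + (\<Sum>k<m. g (2 * k + 1) + g (2 * k + 2)) = (\<Sum>l<2 * m + 1. g l)"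
proof (induction m)
  case (Suc m)
  have "g 0 + (\<Sum>k<Suc m. g (2 * k + 1) + g (2 * k + 2)) = (g 0 + (\<Sum>k<m. g (2 * k + 1) + g (2 * k + 2))) + (g (2 * m + 1) + g (2 * m + 2))"
    by (simp only: sum.lessThan_Suc add.assoc)
  also have "\<dots> = (\<Sum>l<Suc (Suc (2 * m + 1)). g l)"
    unfolding Suc by (simp only: sum.lessThan_Suc add.assoc) (simp add: ac_simps)
  finally show ?case by simp
qed simp

text \<open>Partial sums frozen on reaching \<open>y\<close>: a moment bound at the last index then
  controls the maximum over all indices, as in Doob's argument.\<close>

primrec stopped :: "real \<Rightarrow> (nat \<Rightarrow> real) \<Rightarrow> nat \<Rightarrow> real" where
  "stopped y g 0 = 0"
| "stopped y g (Suc m) = (if y \<le> stopped y g m then stopped y g m else stopped y g m + g m)"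

lemma stopped_cong: "(\<And>k. k < m \<Longrightarrow> g k = h k) \<Longrightarrow> stopped y g m = stopped y h m"
  by (induction m) auto

lemma stopped_measurable:
  assumes "\<And>k. k < m \<Longrightarrow> (\<lambda>w. g w k) \<in> borel_measurable M"
  shows "(\<lambda>w. stopped y (g w) m) \<in> borel_measurable M"
  using assms
proof (induction m)
  case (Suc m)
  then have [measurable]: "(\<lambda>w. stopped y (g w) m) \<in> borel_measurable M" "(\<lambda>w. g w m) \<in> borel_measurable M" by auto
  show ?case by simp
qed simp

lemma stopped_ge_of_crossing:
  assumes "0 < y" "n \<le> m" "y \<le> (\<Sum>k<n. g k)" shows "y \<le> stopped y g m"
proof -
  have "y \<le> stopped y g m \<or> (stopped y g m = (\<Sum>k<m. g k) \<and> (\<forall>n\<le>m. (\<Sum>k<n. g k) < y))" for m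
  proof (induction m)
    case 0
    then show ?case using assms(1) by simp
  next
    case (Suc m)
    then show ?case
    proof
      assume "stopped y g m = (\<Sum>k<m. g k) \<and> (\<forall>n\<le>m. (\<Sum>k<n. g k) < y)"
      then have 1: "stopped y g m = (\<Sum>k<m. g k)" and 2: "\<And>n. n \<le> m \<Longrightarrow> (\<Sum>k<n. g k) < y" by auto
      have 3: "stopped y g (Suc m) = (\<Sum>k<Suc m. g k)" using 1 2[of m] by simp
      show ?case
      proof (cases "y \<le> (\<Sum>k<Suc m. g k)")
        case False
        then have "\<forall>n\<le>Suc m. (\<Sum>k<n. g k) < y" using 2 by (auto simp: le_Suc_eq)
        then show ?thesis using 3 by simp
      qed (use 3 in simp)
    qed simp
  qed
  from this[of m] show ?thesis using assms(2,3) by (meson not_less)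
qed

section \<open>The number of regenerations\<close>

context nummelin_splitting
begin

lemma regen_time_measurable[measurable]: "regen_time C a Z T k \<in> borel_measurable Om'"
proof (rule borel_measurableI_le)
  fix y :: ennreal
  show "{w \<in> space Om'. regen_time C a Z T k w \<le> y} \<in> sets Om'"
  proof (cases y)
    case (real t)
    note [measurable] = T_measurable
    have "{w \<in> space Om'. regen_time C a Z T k w \<le> y} = {w \<in> space Om'. \<exists>j. k \<le> cyc_index j w \<and> T j w \<le> t}"
      using regen_time_le_iff real by auto
    also have "\<dots> \<in> sets Om'" by measurable
    finally show ?thesis .
  qed simp
qed

lemma len_0_eq: "len 0 w = csum (occ (\<lambda>_. 1)) 0 w"
  unfolding cyc_total_def by (rule cycle_sum_0)

lemma cycle_laplace_eq:
  assumes "0 \<le> l"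
  shows "ennreal (cycle_laplace C a \<nu> PP Z T l) = (\<integral>\<^sup>+w. elap l (len 0 w) \<partial>PP \<nu>)" "0 \<le> cycle_laplace C a \<nu> PP Z T l"
    "cycle_laplace C a \<nu> PP Z T l \<le> 1"
proof -
  interpret PP: prob_space "PP \<nu>" by (rule PP_prob_space[OF nu_inits])
  have m: "(\<lambda>w. exp (- l * enn2real (cycle_length C a Z T w))) \<in> borel_measurable (PP \<nu>)"
    unfolding cycle_length_def by (rule measurable_PP[OF nu_inits]) measurable
  have b: "exp (- l * enn2real x) \<le> 1" for x using assms by simp
  have int: "integrable (PP \<nu>) (\<lambda>w. exp (- l * enn2real (cycle_length C a Z T w)))"
    by (rule PP.integrable_const_bound[where B = 1]) (use m b in auto)
  have "ennreal (cycle_laplace C a \<nu> PP Z T l) = (\<integral>\<^sup>+w. ennreal (exp (- l * enn2real (cycle_length C a Z T w))) \<partial>PP \<nu>)"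
    unfolding cycle_laplace_def by (rule nn_integral_eq_integral[OF int, symmetric]) simp
  also have "\<dots> = (\<integral>\<^sup>+w. elap l (len 1 w) \<partial>PP \<nu>)"
    by (rule nn_integral_cong_AE) (use AE_cycle_length[OF nu_inits] in eventually_elim, simp add: elap_def)
  also have "\<dots> = (\<integral>\<^sup>+w. elap l (len 0 w) \<partial>PP \<nu>)"
    using nn_integral_len_law[OF nu_inits elap_measurable, of l 0] by simp
  finally show "ennreal (cycle_laplace C a \<nu> PP Z T l) = (\<integral>\<^sup>+w. elap l (len 0 w) \<partial>PP \<nu>)" .
  show "0 \<le> cycle_laplace C a \<nu> PP Z T l"
    unfolding cycle_laplace_def by (rule integral_nonneg_AE) simp
  have "cycle_laplace C a \<nu> PP Z T l \<le> (LINT w|PP \<nu>. 1)"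
    unfolding cycle_laplace_def by (rule integral_mono[OF int]) (use b in auto)
  then show "cycle_laplace C a \<nu> PP Z T l \<le> 1" by (simp add: PP.prob_space)
qed

text \<open>The mean length is the total mass of \<open>\<mu>\<close>, so positive recurrence is the
  same as a finite mean cycle.\<close>

lemma nn_integral_cycle_length: "(\<integral>\<^sup>+w. cycle_length C a Z T w \<partial>PP \<nu>) = emeasure \<mu> (space \<mu>)"
proof -
  have "(\<integral>\<^sup>+w. cycle_length C a Z T w \<partial>PP \<nu>) = (\<integral>\<^sup>+w. len 1 w \<partial>PP \<nu>)"
    by (rule nn_integral_cong_AE) (use AE_cycle_length[OF nu_inits] in eventually_elim, simp)
  also have "\<dots> = (\<integral>\<^sup>+w. len 0 w \<partial>PP \<nu>)"
    using nn_integral_len_law[OF nu_inits, of "\<lambda>x. x" 0] by simp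
  also have "\<dots> = (\<integral>\<^sup>+x. cyc_mean (\<lambda>_. 1) x \<partial>\<nu>)"
    unfolding len_0_eq by (rule cyc_mean_start[OF nu_inits]) simp
  also have "\<dots> = emeasure \<mu> (space \<mu>)"
    using mu_eq[of "\<lambda>_. 1"] by simp
  finally show ?thesis .
qed

lemma cycle_mean_ge_2:
  assumes "emeasure \<mu> (space \<mu>) < \<infinity>"
  shows "2 \<le> cycle_mean C a \<nu> PP Z T" "(\<integral>\<^sup>+w. cycle_length C a Z T w \<partial>PP \<nu>) = ennreal (cycle_mean C a \<nu> PP Z T)"
proof -
  interpret N: prob_space \<nu> by (rule nu_borel)
  show e: "(\<integral>\<^sup>+w. cycle_length C a Z T w \<partial>PP \<nu>) = ennreal (cycle_mean C a \<nu> PP Z T)"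
    unfolding cycle_mean_def using assms by (simp add: nn_integral_cycle_length less_top)
  have "ennreal 2 = (\<integral>\<^sup>+x. 2 \<partial>\<nu>)" by (simp add: N.emeasure_space_1)
  also have "\<dots> \<le> (\<integral>\<^sup>+x. cyc_mean (\<lambda>_. 1) x \<partial>\<nu>)" by (intro nn_integral_mono cyc_mean_one_ge)
  also have "\<dots> = (\<integral>\<^sup>+w. cycle_length C a Z T w \<partial>PP \<nu>)"
    using mu_eq[of "\<lambda>_. 1"] by (simp add: nn_integral_cycle_length)
  finally show "2 \<le> cycle_mean C a \<nu> PP Z T" unfolding e
    by (subst (asm) ennreal_le_iff) (auto simp: cycle_mean_def)
qed

text \<open>If the first \<open>N + 1\<close> cycles take at most \<open>t\<close>, then the odd or
  the even ones, without cycle 0, take at most \<open>t / 2\<close>. Chernoff's bound for each class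
  gives the factor 2 and the exponent \<open>N div 2\<close>.\<close>

lemma regen_tail_laplace:
  assumes \<pi>: "\<pi> \<in> inits" and l: "0 \<le> l" and t: "0 \<le> t"
  shows "emeasure (PP \<pi>) {w\<in>space Om'. regen_time C a Z T (Suc N) w \<le> ennreal t} \<le>
    ennreal (2 * (exp (l * t / 2) * cycle_laplace C a \<nu> PP Z T l ^ (N div 2)))"
proof -
  define m where "m = N div 2"
  let ?E = "{w\<in>space Om'. regen_time C a Z T (Suc N) w \<le> ennreal t}"
  let ?P = "\<lambda>e w. \<Prod>k<m. elap l (len (2 * k + e) w)"
  note [measurable] = measurable_PP[OF \<pi> len_measurable]
  have E: "?E \<in> sets (PP \<pi>)" unfolding sets_PP[OF \<pi>] by measurable
  have key: "1 \<le> ennreal (exp (l * t / 2)) * ?P e w"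
    if fin: "\<forall>k. len k w < top" and le: "(\<Sum>k<m. enn2real (len (2 * k + e) w)) \<le> t / 2" for e w
  proof -
    have "?P e w = ennreal (\<Prod>k<m. exp (- l * enn2real (len (2 * k + e) w)))"
      unfolding elap_def by (rule prod_ennreal) simp
    also have "(\<Prod>k<m. exp (- l * enn2real (len (2 * k + e) w))) = exp (- l * (\<Sum>k<m. enn2real (len (2 * k + e) w)))"
      by (simp add: exp_sum sum_distrib_left)
    finally have "ennreal (exp (l * t / 2)) * ?P e w = ennreal (exp (l * (t / 2 - (\<Sum>k<m. enn2real (len (2 * k + e) w)))))"
      by (simp add: ennreal_mult[symmetric] exp_add[symmetric] algebra_simps)
    moreover have "0 \<le> l * (t / 2 - (\<Sum>k<m. enn2real (len (2 * k + e) w)))" using l le by simp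
    then have "1 \<le> exp (l * (t / 2 - (\<Sum>k<m. enn2real (len (2 * k + e) w))))" by simp
    ultimately show ?thesis using ennreal_leI[of 1] by simp
  qed
  have "emeasure (PP \<pi>) ?E = (\<integral>\<^sup>+w. indicator ?E w \<partial>PP \<pi>)" using E by simp
  also have "\<dots> \<le> (\<integral>\<^sup>+w. ennreal (exp (l * t / 2)) * ?P 1 w + ennreal (exp (l * t / 2)) * ?P 2 w \<partial>PP \<pi>)"
  proof (rule nn_integral_mono_AE)
    show "AE w in PP \<pi>. indicator ?E w \<le> ennreal (exp (l * t / 2)) * ?P 1 w + ennreal (exp (l * t / 2)) * ?P 2 w"
      using AE_regen_time[OF \<pi>] AE_len_finite[OF \<pi>]
    proof eventually_elim
      fix w assume h: "\<forall>k. regen_time C a Z T k w = (\<Sum>l<k. len l w) \<and> (\<Sum>l<k. len l w) < top"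
        and fin: "\<forall>k. len k w < top"
      define x where "x k = enn2real (len k w)" for k
      have x: "len k w = ennreal (x k)" "0 \<le> x k" for k using fin[rule_format, of k] by (simp_all add: x_def)
      show "indicator ?E w \<le> ennreal (exp (l * t / 2)) * ?P 1 w + ennreal (exp (l * t / 2)) * ?P 2 w"
      proof (cases "w \<in> ?E")
        case True
        then have "regen_time C a Z T (Suc N) w \<le> ennreal t" by blast
        moreover have r: "regen_time C a Z T (Suc N) w = (\<Sum>k<Suc N. len k w)" using h by blast
        ultimately have "(\<Sum>k<Suc N. len k w) \<le> ennreal t" by (simp only: r)
        then have "(\<Sum>k<Suc N. x k) \<le> t" unfolding x(1) using x(2) t by (simp add: sum_ennreal del: sum.lessThan_Suc)
        moreover have "(\<Sum>k<2 * m + 1. x k) \<le> (\<Sum>k<Suc N. x k)"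
          using x(2) by (intro sum_mono2) (auto simp: m_def)
        moreover have "(\<Sum>k<m. x (2 * k + 1)) + (\<Sum>k<m. x (2 * k + 2)) \<le> (\<Sum>k<2 * m + 1. x k)"
          using sum_odd_even[of x m] x(2)[of 0] by (simp add: sum.distrib)
        ultimately have "(\<Sum>k<m. x (2 * k + 1)) \<le> t / 2 \<or> (\<Sum>k<m. x (2 * k + 2)) \<le> t / 2" by linarith
        then have "1 \<le> ennreal (exp (l * t / 2)) * ?P 1 w \<or> 1 \<le> ennreal (exp (l * t / 2)) * ?P 2 w"
          unfolding x_def using key[OF fin] by blast
        then have "1 \<le> ennreal (exp (l * t / 2)) * ?P 1 w + ennreal (exp (l * t / 2)) * ?P 2 w"
          by (auto intro: add_increasing add_increasing2)
        then show ?thesis using True by (simp only: indicator_simps)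
      next
        case False
        then have "indicator ?E w = (0 :: ennreal)" by (rule indicator_simps)
        then show ?thesis by simp
      qed
    qed
  qed
  also have "\<dots> = ennreal (exp (l * t / 2)) * (\<integral>\<^sup>+w. ?P 1 w \<partial>PP \<pi>) + ennreal (exp (l * t / 2)) * (\<integral>\<^sup>+w. ?P 2 w \<partial>PP \<pi>)"
    by (simp add: nn_integral_add nn_integral_cmult)
  also have "\<dots> \<le> ennreal (exp (l * t / 2)) * (\<integral>\<^sup>+w. elap l (len 0 w) \<partial>PP \<nu>) ^ m + ennreal (exp (l * t / 2)) * (\<integral>\<^sup>+w. elap l (len 0 w) \<partial>PP \<nu>) ^ m"
    by (intro add_mono mult_left_mono prod_elap_bound[OF \<pi>]) auto
  also have "\<dots> = ennreal (2 * (exp (l * t / 2) * cycle_laplace C a \<nu> PP Z T l ^ (N div 2)))"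
    unfolding cycle_laplace_eq(1)[OF l, symmetric] m_def
    using cycle_laplace_eq(2)[OF l]
    by (simp add: ennreal_power ennreal_mult[symmetric] ennreal_plus[symmetric] del: ennreal_plus)
  finally show ?thesis .
qed

text \<open>Each block takes at most as long as all cycles together, and each factor in
  \<open>block_bound\<close> is the probability under \<open>\<nu>\<close> that \<open>k\<close>
  cycles take at most \<open>t\<close>.\<close>

lemma regen_tail_blocks:
  assumes \<pi>: "\<pi> \<in> inits" and t: "0 \<le> t"
  shows "emeasure (PP \<pi>) {w\<in>space Om'. regen_time C a Z T (i * Suc k) w \<le> ennreal t} \<le>
    emeasure (PP \<nu>) {w\<in>space Om'. regen_time C a Z T k w \<le> ennreal t} ^ i"
proof -
  let ?E = "{w\<in>space Om'. regen_time C a Z T (i * Suc k) w \<le> ennreal t}"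
  let ?H = "{w\<in>space Om'. regen_time C a Z T k w \<le> ennreal t}"
  have E: "?E \<in> sets (PP \<pi>)" "?H \<in> sets (PP \<nu>)" unfolding sets_PP[OF \<pi>] sets_PP[OF nu_inits] by measurable
  have "emeasure (PP \<pi>) ?E = (\<integral>\<^sup>+w. indicator ?E w \<partial>PP \<pi>)" using E by simp
  also have "\<dots> \<le> (\<integral>\<^sup>+w. (\<Prod>b<i. if (\<Sum>l<k. len (b * Suc k + 1 + l) w) \<le> ennreal t then 1 else 0) \<partial>PP \<pi>)"
  proof (rule nn_integral_mono_AE)
    show "AE w in PP \<pi>. indicator ?E w \<le> (\<Prod>b<i. if (\<Sum>l<k. len (b * Suc k + 1 + l) w) \<le> ennreal t then 1 else 0 :: ennreal)"
      using AE_regen_time[OF \<pi>]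
    proof eventually_elim
      fix w assume h: "\<forall>k. regen_time C a Z T k w = (\<Sum>l<k. len l w) \<and> (\<Sum>l<k. len l w) < top"
      show "indicator ?E w \<le> (\<Prod>b<i. if (\<Sum>l<k. len (b * Suc k + 1 + l) w) \<le> ennreal t then 1 else 0 :: ennreal)"
      proof (cases "w \<in> ?E")
        case True
        then have "regen_time C a Z T (i * Suc k) w \<le> ennreal t" by blast
        then have le: "(\<Sum>l<i * Suc k. len l w) \<le> ennreal t" using h by metis
        have "(\<Sum>l<k. len (b * Suc k + 1 + l) w) \<le> ennreal t" if "b < i" for b
        proof -
          have "(\<Sum>l<k. len (b * Suc k + 1 + l) w) = (\<Sum>l\<in>(\<lambda>l. b * Suc k + 1 + l) ` {..<k}. len l w)"
            by (subst sum.reindex) (auto simp: inj_on_def)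
          also have "\<dots> \<le> (\<Sum>l<i * Suc k. len l w)"
          proof (rule sum_mono2)
            have "Suc b * Suc k \<le> i * Suc k" using that by (intro mult_le_mono1) simp
            then show "(\<lambda>l. b * Suc k + 1 + l) ` {..<k} \<subseteq> {..<i * Suc k}" by auto
          qed auto
          finally show ?thesis using le by simp
        qed
        then have "(\<Prod>b<i. if (\<Sum>l<k. len (b * Suc k + 1 + l) w) \<le> ennreal t then 1 else 0 :: ennreal) = 1"
          by (intro prod.neutral) simp
        then show ?thesis by (simp only:) (simp add: indicator_def)
      next
        case False
        then have "indicator ?E w = (0 :: ennreal)" by (rule indicator_simps)
        then show ?thesis by simp
      qed
    qed
  qed
  also have "\<dots> \<le> (\<integral>\<^sup>+w. (if (\<Sum>l<k. len l w) \<le> ennreal t then 1 else 0) \<partial>PP \<nu>) ^ i"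
    by (rule block_bound[OF \<pi>])
  also have "(\<integral>\<^sup>+w. (if (\<Sum>l<k. len l w) \<le> ennreal t then 1 else 0) \<partial>PP \<nu>) = (\<integral>\<^sup>+w. indicator ?H w \<partial>PP \<nu>)"
  proof (rule nn_integral_cong_AE)
    show "AE w in PP \<nu>. (if (\<Sum>l<k. len l w) \<le> ennreal t then 1 else 0 :: ennreal) = indicator ?H w"
      using AE_regen_time[OF nu_inits] AE_space
    proof eventually_elim
      fix w assume "\<forall>k. regen_time C a Z T k w = (\<Sum>l<k. len l w) \<and> (\<Sum>l<k. len l w) < top" "w \<in> space (PP \<nu>)"
      then have "regen_time C a Z T k w = (\<Sum>l<k. len l w)" "w \<in> space Om'" by (auto simp: space_PP[OF nu_inits])
      then show "(if (\<Sum>l<k. len l w) \<le> ennreal t then 1 else 0 :: ennreal) = indicator ?H w"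
        unfolding indicator_def of_bool_def by (simp only: mem_Collect_eq simp_thms)
    qed
  qed
  also have "\<dots> = emeasure (PP \<nu>) ?H" using E by simp
  finally show ?thesis .
qed

lemma cyc_index_le: "cyc_index j w \<le> j"
  by (induction j) auto

text \<open>Every cycle contains at least one jump, so counting jumps bounds the count of
  regenerations; the mean is then finite by the tail of the jump times.\<close>

lemma regen_count_le:
  assumes w: "w \<in> space Om'" and t: "0 \<le> t"
  shows "regen_count C a Z T t w \<le> (\<Sum>n. if T n w \<le> t then 1 else 0)"
  unfolding regen_count_def
proof (rule SUP_least)
  fix n assume "n \<in> {n. regen_time C a Z T n w \<le> ennreal t}"
  then obtain j where "n \<le> cyc_index j w" "T j w \<le> t" using regen_time_le_iff[OF w t] by auto
  then have Tn: "T i w \<le> t" if "i < n" for i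
    using T_le[OF w, of i j] cyc_index_le[of j w] that by simp
  have "(of_nat n :: ennreal) = (\<Sum>i<n. if T i w \<le> t then 1 else 0)" using Tn by simp
  also have "\<dots> \<le> (\<Sum>n. if T n w \<le> t then 1 else 0)" by (rule sum_le_suminf) auto
  finally show "of_nat n \<le> (\<Sum>n. if T n w \<le> t then 1 else 0 :: ennreal)" .
qed

lemma regen_count_mean:
  assumes \<pi>: "\<pi> \<in> inits" and t: "0 \<le> t"
  shows "(\<integral>\<^sup>+w. regen_count C a Z T t w \<partial>PP \<pi>) < top"
    "of_nat k * emeasure (PP \<pi>) {w\<in>space Om'. regen_time C a Z T k w \<le> ennreal t} \<le> (\<integral>\<^sup>+w. regen_count C a Z T t w \<partial>PP \<pi>)"
proof -
  note [measurable] = measurable_PP[OF \<pi> T_measurable]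
  have "(\<integral>\<^sup>+w. regen_count C a Z T t w \<partial>PP \<pi>) \<le> (\<integral>\<^sup>+w. (\<Sum>n. if T n w \<le> t then 1 else 0) \<partial>PP \<pi>)"
    by (intro nn_integral_mono regen_count_le t) (simp add: space_PP[OF \<pi>])
  also have "\<dots> = (\<Sum>n. \<integral>\<^sup>+w. (if T n w \<le> t then 1 else 0) \<partial>PP \<pi>)"
    by (rule nn_integral_suminf) measurable
  also have "\<dots> \<le> (\<Sum>n. ennreal (exp t * (1 / 2) ^ n))"
  proof (rule suminf_le)
    fix n
    have "(\<integral>\<^sup>+w. (if T n w \<le> t then 1 else 0) \<partial>PP \<pi>) = (\<integral>\<^sup>+w. indicator {w\<in>space (PP \<pi>). T n w \<le> t} w \<partial>PP \<pi>)"
      by (intro nn_integral_cong) (simp add: indicator_def)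
    also have "\<dots> = emeasure (PP \<pi>) {w\<in>space (PP \<pi>). T n w \<le> t}" by (rule nn_integral_indicator) measurable
    finally show "(\<integral>\<^sup>+w. (if T n w \<le> t then 1 else 0) \<partial>PP \<pi>) \<le> ennreal (exp t * (1 / 2) ^ n)"
      using T_tail[OF \<pi>] by (simp add: space_PP[OF \<pi>])
  qed auto
  also have "\<dots> = ennreal (\<Sum>n. exp t * (1 / 2) ^ n)"
    by (rule suminf_ennreal2) (auto intro!: summable_mult summable_geometric)
  also have "\<dots> < top" by simp
  finally show "(\<integral>\<^sup>+w. regen_count C a Z T t w \<partial>PP \<pi>) < top" .
  let ?H = "{w\<in>space Om'. regen_time C a Z T k w \<le> ennreal t}"
  have H: "?H \<in> sets (PP \<pi>)" unfolding sets_PP[OF \<pi>] by measurable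
  have "of_nat k * emeasure (PP \<pi>) ?H = (\<integral>\<^sup>+w. of_nat k * indicator ?H w \<partial>PP \<pi>)"
    by (rule nn_integral_cmult_indicator[OF H, symmetric])
  also have "\<dots> \<le> (\<integral>\<^sup>+w. regen_count C a Z T t w \<partial>PP \<pi>)"
  proof (rule nn_integral_mono)
    fix w
    show "of_nat k * indicator ?H w \<le> regen_count C a Z T t w"
      unfolding regen_count_def by (cases "w \<in> ?H") (auto intro: SUP_upper)
  qed
  finally show "of_nat k * emeasure (PP \<pi>) ?H \<le> (\<integral>\<^sup>+w. regen_count C a Z T t w \<partial>PP \<pi>)" .
qed

text \<open>By time 0 only the jump \<open>T 0\<close> has occurred and no regeneration with
  positive index; hence 0 serves as \<open>t0\<close>.\<close>

lemma v_star_0: "v_star C a \<nu> PP Z T 0 = 1"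
proof -
  have "regen_count C a Z T 0 w = 0" if w: "w \<in> space Om'" for w
  proof -
    have "n = 0" if "regen_time C a Z T n w \<le> ennreal 0" for n
    proof -
      have "\<exists>j. n \<le> cyc_index j w \<and> T j w \<le> 0" by (rule iffD1[OF regen_time_le_iff[OF w order_refl] that])
      then obtain j where j: "n \<le> cyc_index j w" "T j w \<le> 0" by blast
      then have "j = 0" using T_less[OF w, of 0 j] T_0[OF w] by (cases j) auto
      then show ?thesis using j by simp
    qed
    then have "{n. regen_time C a Z T n w \<le> ennreal 0} = {0}" by auto
    then show ?thesis unfolding regen_count_def by simp
  qed
  then have "(\<integral>\<^sup>+w. regen_count C a Z T 0 w \<partial>PP \<nu>) = (\<integral>\<^sup>+w. 0 \<partial>PP \<nu>)"
    by (intro nn_integral_cong) (simp add: space_PP[OF nu_inits])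
  then show ?thesis by (simp add: v_star_def)
qed

end

section \<open>Maximal inequality for a parity class\<close>

context centered_functional
begin

definition xi :: "nat \<Rightarrow> 'v \<Rightarrow> real" where
  "xi k w = enn2real (cyc_total (occ fp) k w) - enn2real (cyc_total (occ fn) k w)"

definition xi_part :: "nat \<Rightarrow> nat \<Rightarrow> 'v \<Rightarrow> real" where
  "xi_part k i w = enn2real (cyc_part (occ fp) k i w) - enn2real (cyc_part (occ fn) k i w)"

lemma xi_part_F: "xi_part k i \<in> borel_measurable (F i)"
  using cyc_part_F[of "occ fp" k i, OF occ_F[OF fp_fn_measurable(1)]] cyc_part_F[of "occ fn" k i, OF occ_F[OF fp_fn_measurable(2)]]
  unfolding xi_part_def[abs_def] by measurable

lemma xi_measurable[measurable]: "xi k \<in> borel_measurable Om'"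
  using cyc_total_measurable[of "occ fp" k, OF occ_measurable[OF fp_fn_measurable(1)]]
    cyc_total_measurable[of "occ fn" k, OF occ_measurable[OF fp_fn_measurable(2)]]
  unfolding xi_def[abs_def] by measurable

lemma xi_eq_part: "k < cyc_index i w \<Longrightarrow> xi k w = xi_part k i w"
  by (simp add: xi_def xi_part_def cyc_total_eq_part)

lemma xi_start: "w \<in> pre_start k i \<inter> hits i \<Longrightarrow> xi (Suc k) w = sgt (Suc i) w"
  unfolding xi_def sgt_def by (simp only: cyc_total_start)

text \<open>The exponential is split into a part already frozen and a part still running. Only the
  latter acquires the factor \<open>bern th\<close>; the former may be multiplied by it too, since
  the factor is at least 1.\<close>

lemma mgf_stopped:
  assumes \<pi>: "\<pi> \<in> inits" and th: "0 < th" "th * Kb < 1" and \<epsilon>: "\<epsilon> = 1 \<or> \<epsilon> = - 1" and e: "e = 1 \<or> e = (2 :: nat)"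
  shows "(\<integral>\<^sup>+w. ennreal (exp (th * stopped y (\<lambda>k. \<epsilon> * xi (2 * k + e) w) m)) \<partial>PP \<pi>) \<le> ennreal (bern th ^ m)"
proof (induction m)
  case 0
  interpret PP: prob_space "PP \<pi>" by (rule PP_prob_space[OF \<pi>])
  show ?case by (simp add: PP.emeasure_space_1)
next
  case (Suc m)
  have b1: "1 \<le> bern th" using th Cc_nonneg Kb_pos by (simp add: bern_def)
  let ?k = "2 * m + e - 1"
  have k: "2 * m + e = Suc ?k" using e by auto
  define s where "s w = stopped y (\<lambda>k. \<epsilon> * xi (2 * k + e) w) m" for w
  have sm[measurable]: "s \<in> borel_measurable Om'" unfolding s_def[abs_def] by (rule stopped_measurable) measurable
  note [measurable] = measurable_PP[OF \<pi> sm] measurable_PP[OF \<pi> xi_measurable]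
  define z where "z w = (if y \<le> s w then 0 else ennreal (exp (th * s w)))" for w
  define z' where "z' w = (if y \<le> s w then ennreal (exp (th * s w)) else 0)" for w
  have [measurable]: "z \<in> borel_measurable (PP \<pi>)" "z' \<in> borel_measurable (PP \<pi>)"
    unfolding z_def[abs_def] z'_def[abs_def] by measurable
  have step: "(\<integral>\<^sup>+w. z w * ennreal (exp (th * (\<epsilon> * xi (2 * m + e) w))) \<partial>PP \<pi>) \<le> ennreal (bern th) * (\<integral>\<^sup>+w. z w \<partial>PP \<pi>)"
  proof (rule cycle_step[OF \<pi>, where \<Phi> = "\<lambda>n w. ennreal (exp (th * (\<epsilon> * sgt n w)))" and k = ?k and
      \<zeta> = "\<lambda>i w. if y \<le> stopped y (\<lambda>k. \<epsilon> * xi_part (2 * k + e) i w) m then 0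
        else ennreal (exp (th * stopped y (\<lambda>k. \<epsilon> * xi_part (2 * k + e) i w) m))"])
    show "(\<lambda>w. ennreal (exp (th * (\<epsilon> * sgt n w)))) \<in> borel_measurable Om'" for n by measurable
    show "(\<lambda>w. if y \<le> stopped y (\<lambda>k. \<epsilon> * xi_part (2 * k + e) i w) m then 0
        else ennreal (exp (th * stopped y (\<lambda>k. \<epsilon> * xi_part (2 * k + e) i w) m))) \<in> borel_measurable (F i)" for i
    proof -
      have [measurable]: "(\<lambda>w. stopped y (\<lambda>k. \<epsilon> * xi_part (2 * k + e) i w) m) \<in> borel_measurable (F i)"
        by (rule stopped_measurable) (intro borel_measurable_times borel_measurable_const xi_part_F)
      show ?thesis by measurable
    qed
    show "(\<integral>\<^sup>+w. indicator (G \<inter> hits j) w * ennreal (exp (th * (\<epsilon> * sgt (Suc j) w))) \<partial>PP \<pi>) \<le> ennreal (bern th) * emeasure (PP \<pi>) (G \<inter> hits j)"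
      if "G \<in> sets (F j)" for j G by (rule signed_mgf[OF th \<epsilon> \<pi> that])
    fix w i assume w: "w \<in> pre_start ?k i \<inter> hits i"
    have "s w = stopped y (\<lambda>k. \<epsilon> * xi_part (2 * k + e) i w) m"
      unfolding s_def by (rule stopped_cong, subst xi_eq_part) (use w e in \<open>auto simp: pre_start_def\<close>)
    then show "z w = (if y \<le> stopped y (\<lambda>k. \<epsilon> * xi_part (2 * k + e) i w) m then 0
        else ennreal (exp (th * stopped y (\<lambda>k. \<epsilon> * xi_part (2 * k + e) i w) m)))" by (simp add: z_def)
    show "ennreal (exp (th * (\<epsilon> * xi (2 * m + e) w))) = ennreal (exp (th * (\<epsilon> * sgt (Suc i) w)))"
    proof -
      have "xi (2 * m + e) w = xi (Suc ?k) w" by (rule arg_cong[where f = "\<lambda>k. xi k w"]) (rule k)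
      also have "\<dots> = sgt (Suc i) w" by (rule xi_start[OF w])
      finally show ?thesis by (rule arg_cong)
    qed
  qed
  have "(\<integral>\<^sup>+w. ennreal (exp (th * stopped y (\<lambda>k. \<epsilon> * xi (2 * k + e) w) (Suc m))) \<partial>PP \<pi>) =
     (\<integral>\<^sup>+w. z' w + z w * ennreal (exp (th * (\<epsilon> * xi (2 * m + e) w))) \<partial>PP \<pi>)"
    by (intro nn_integral_cong) (simp add: z_def z'_def s_def distrib_left exp_add ennreal_mult)
  also have "\<dots> = (\<integral>\<^sup>+w. z' w \<partial>PP \<pi>) + (\<integral>\<^sup>+w. z w * ennreal (exp (th * (\<epsilon> * xi (2 * m + e) w))) \<partial>PP \<pi>)"
    by (rule nn_integral_add) measurable
  also have "\<dots> \<le> ennreal (bern th) * (\<integral>\<^sup>+w. z' w \<partial>PP \<pi>) + ennreal (bern th) * (\<integral>\<^sup>+w. z w \<partial>PP \<pi>)"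
  proof (rule add_mono[OF _ step])
    have "1 * (\<integral>\<^sup>+w. z' w \<partial>PP \<pi>) \<le> ennreal (bern th) * (\<integral>\<^sup>+w. z' w \<partial>PP \<pi>)"
      using ennreal_leI[OF b1] by (intro mult_right_mono) auto
    then show "(\<integral>\<^sup>+w. z' w \<partial>PP \<pi>) \<le> ennreal (bern th) * (\<integral>\<^sup>+w. z' w \<partial>PP \<pi>)" by simp
  qed
  also have "\<dots> = ennreal (bern th) * (\<integral>\<^sup>+w. z' w + z w \<partial>PP \<pi>)"
    by (subst nn_integral_add) (auto simp: distrib_left)
  also have "(\<integral>\<^sup>+w. z' w + z w \<partial>PP \<pi>) = (\<integral>\<^sup>+w. ennreal (exp (th * s w)) \<partial>PP \<pi>)"
    by (intro nn_integral_cong) (simp add: z_def z'_def)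
  also have "ennreal (bern th) * \<dots> \<le> ennreal (bern th) * ennreal (bern th ^ m)"
    unfolding s_def by (intro mult_left_mono Suc.IH) simp
  also have "\<dots> = ennreal (bern th * bern th ^ m)" by (rule ennreal_mult[symmetric]) (use b1 in auto)
  also have "bern th * bern th ^ m = bern th ^ Suc m" by (rule power_Suc[symmetric])
  finally show ?case .
qed

text \<open>Bernstein's inequality: the optimal \<open>th\<close> is \<open>y / (2 q K\<^sup>2 + K y)\<close>.\<close>

lemma cycle_sum_deviation:
  assumes \<pi>: "\<pi> \<in> inits" and \<epsilon>: "\<epsilon> = 1 \<or> \<epsilon> = - 1" and e: "e = 1 \<or> e = (2 :: nat)" and y: "0 < y" and q: "real m \<le> q" "0 < q"
  shows "emeasure (PP \<pi>) {w\<in>space Om'. \<exists>n\<le>m. y \<le> (\<Sum>k<n. \<epsilon> * xi (2 * k + e) w)} \<le>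
    ennreal (exp (- (y\<^sup>2 / (4 * q * Kb\<^sup>2 + 2 * Kb * y))))"
proof -
  define D where "D = 2 * q * Kb\<^sup>2 + Kb * y"
  define th where "th = y / D"
  have D: "0 < D" using q y Kb_pos by (simp add: D_def add_pos_pos)
  have th: "0 < th" using y D by (simp add: th_def)
  \<comment> \<open>With \<open>q > 0\<close> in place of \<open>m\<close> this is positive even
    when there are no cycles to sum.\<close>
  have thK: "1 - th * Kb = 2 * q * Kb\<^sup>2 / D" using D by (simp add: th_def D_def field_simps)
  then have "0 < 1 - th * Kb" using q Kb_pos D by simp
  then have thK1: "th * Kb < 1" by simp
  define wt where "wt = Cc * Kb * th\<^sup>2 / (1 - th * Kb)"
  have w0: "0 \<le> wt" using Cc_nonneg Kb_pos thK1 by (simp add: wt_def)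
  have "q * wt \<le> q * (Kb * Kb * th\<^sup>2 / (1 - th * Kb))"
    unfolding wt_def using q Cc_le_Kb Kb_pos thK1 by (intro mult_left_mono divide_right_mono mult_right_mono) auto
  also have "\<dots> = th\<^sup>2 * D / 2" unfolding thK using q Kb_pos D by (simp add: power2_eq_square)
  also have "\<dots> = th * y / 2" using D by (simp add: th_def power2_eq_square)
  \<comment> \<open>Half of the exponent \<open>th * y\<close> is spent on the moments; the other
    half is the result.\<close>
  finally have qw: "q * wt \<le> th * y / 2" .
  have "bern th ^ m \<le> exp wt ^ m"
    using w0 exp_ge_add_one_self[of wt] by (intro power_mono) (auto simp: bern_def wt_def)
  also have "\<dots> = exp (real m * wt)" by (simp add: exp_of_nat_mult)
  also have "\<dots> \<le> exp (q * wt)" using q w0 by (simp add: mult_right_mono)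
  also have "\<dots> \<le> exp (th * y / 2)" using qw by simp
  finally have bern: "bern th ^ m \<le> exp (th * y / 2)" .
  let ?A = "{w\<in>space Om'. \<exists>n\<le>m. y \<le> (\<Sum>k<n. \<epsilon> * xi (2 * k + e) w)}"
  let ?s = "\<lambda>w. stopped y (\<lambda>k. \<epsilon> * xi (2 * k + e) w) m"
  have sm: "?s \<in> borel_measurable Om'" by (rule stopped_measurable) measurable
  have A: "?A \<in> sets (PP \<pi>)"
  proof -
    have m: "{w\<in>space Om'. y \<le> (\<Sum>k<n. \<epsilon> * xi (2 * k + e) w)} \<in> sets Om'" for n by measurable
    have "(\<Union>n\<in>{..m}. {w\<in>space Om'. y \<le> (\<Sum>k<n. \<epsilon> * xi (2 * k + e) w)}) \<in> sets Om'"
      by (rule sets.finite_UN[OF finite_atMost m])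
    also have "(\<Union>n\<in>{..m}. {w\<in>space Om'. y \<le> (\<Sum>k<n. \<epsilon> * xi (2 * k + e) w)}) = ?A" by blast
    finally show ?thesis by (simp only: sets_PP[OF \<pi>])
  qed
  note [measurable] = measurable_PP[OF \<pi> sm]
  have "emeasure (PP \<pi>) ?A = (\<integral>\<^sup>+w. indicator ?A w \<partial>PP \<pi>)" by (rule nn_integral_indicator[OF A, symmetric])
  also have "\<dots> \<le> (\<integral>\<^sup>+w. ennreal (exp (- (th * y))) * ennreal (exp (th * ?s w)) \<partial>PP \<pi>)"
  proof (rule nn_integral_mono)
    fix w
    show "indicator ?A w \<le> ennreal (exp (- (th * y))) * ennreal (exp (th * ?s w))"
    proof (cases "w \<in> ?A")
      case True
      then have "y \<le> ?s w" using stopped_ge_of_crossing[OF y] by blast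
      then have "1 \<le> exp (th * (?s w - y))" using th by simp
      also have "exp (th * (?s w - y)) = exp (- (th * y)) * exp (th * ?s w)"
        by (simp add: exp_add[symmetric] algebra_simps)
      finally have "ennreal 1 \<le> ennreal (exp (- (th * y)) * exp (th * ?s w))" by (rule ennreal_leI)
      then show ?thesis using True by (simp add: ennreal_mult)
    next
      case False
      then have "indicator ?A w = (0 :: ennreal)" by (rule indicator_simps)
      then show ?thesis by simp
    qed
  qed
  also have "\<dots> = ennreal (exp (- (th * y))) * (\<integral>\<^sup>+w. ennreal (exp (th * ?s w)) \<partial>PP \<pi>)"
    by (rule nn_integral_cmult) measurable
  also have "\<dots> \<le> ennreal (exp (- (th * y))) * ennreal (bern th ^ m)"
    by (intro mult_left_mono mgf_stopped[OF \<pi> th thK1 \<epsilon> e]) simp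
  also have "\<dots> \<le> ennreal (exp (- (th * y))) * ennreal (exp (th * y / 2))"
    by (intro mult_left_mono ennreal_leI bern) simp
  also have "\<dots> = ennreal (exp (- (th * y / 2)))"
    by (simp add: ennreal_mult[symmetric] exp_add[symmetric])
  also have "th * y / 2 = y\<^sup>2 / (4 * q * Kb\<^sup>2 + 2 * Kb * y)"
    by (simp add: th_def D_def power2_eq_square algebra_simps)
  finally show ?thesis .
qed

end

section \<open>The incomplete cycles at the two ends\<close>

context centered_functional
begin

text \<open>The parameter makes the share 21/100 of a threshold c yield the exponent c / (6 Kb),
  because 50/63 times 21/100 is 1/6. The resulting factor 63/13 is below 2
  \<open>exp 1\<close>.\<close>

lemma end_bound:
  fixes th defines "th \<equiv> 50 / (63 * Kb)"
  shows "0 < th" "th * Kb < 1" "1 / (1 - th * Kb) = 63 / 13" "1 + th * Cc / (1 - th * Kb) \<le> 63 / 13"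
    "1 + th * Cc / (1 - th * Kb) = (1 - th * Fb) * (63 / 13)" "th * Fb < 1"
proof -
  show "0 < th" using Kb_pos by (simp add: th_def)
  have tk: "th * Kb = 50 / 63" using Kb_pos by (simp add: th_def)
  show "th * Kb < 1" "1 / (1 - th * Kb) = 63 / 13" unfolding tk by simp_all
  have c: "th * Cc = 50 / 63 - th * Fb" using tk by (simp add: Kb_def algebra_simps)
  have f0: "0 \<le> th * Fb" using \<open>0 < th\<close> Fb_pos by simp
  have "th * Fb \<le> th * Kb" using \<open>0 < th\<close> Fb_le_Kb by (intro mult_left_mono) auto
  then show "th * Fb < 1" using tk by simp
  show "1 + th * Cc / (1 - th * Kb) = (1 - th * Fb) * (63 / 13)" unfolding c tk by (simp add: field_simps)
  then show "1 + th * Cc / (1 - th * Kb) \<le> 63 / 13" using f0 by simp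
qed

lemma mgf_const:
  assumes th: "0 < th" "th * Kb < 1" and \<pi>: "\<pi> \<in> inits" and G: "G \<in> sets (F n)"
  shows "(\<integral>\<^sup>+w. indicator G w * ennreal (exp (th * tot n w)) \<partial>PP \<pi>) \<le> ennreal (1 + th * Cc / (1 - th * Kb)) * emeasure (PP \<pi>) G"
proof -
  note [measurable] = G_PP[OF \<pi> G]
  have "(\<integral>\<^sup>+w. indicator G w * cyc_mean fa (Y n w) \<partial>PP \<pi>) \<le> (\<integral>\<^sup>+w. ennreal Cc * indicator G w \<partial>PP \<pi>)"
    by (intro nn_integral_mono) (auto simp: indicator_def cyc_mean_bound)
  also have "\<dots> = ennreal Cc * emeasure (PP \<pi>) G" by (rule nn_integral_cmult_indicator) measurable
  finally have 1: "(\<integral>\<^sup>+w. indicator G w * cyc_mean fa (Y n w) \<partial>PP \<pi>) \<le> ennreal Cc * emeasure (PP \<pi>) G" .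
  have "(\<integral>\<^sup>+w. indicator G w * ennreal (exp (th * tot n w)) \<partial>PP \<pi>) \<le>
    emeasure (PP \<pi>) G + ennreal (th / (1 - th * Kb)) * (\<integral>\<^sup>+w. indicator G w * cyc_mean fa (Y n w) \<partial>PP \<pi>)"
    by (rule mgf_full[OF th \<pi> G])
  also have "\<dots> \<le> emeasure (PP \<pi>) G + ennreal (th / (1 - th * Kb)) * (ennreal Cc * emeasure (PP \<pi>) G)"
    by (intro add_left_mono mult_left_mono 1) simp
  also have "\<dots> = (1 + ennreal (th / (1 - th * Kb)) * ennreal Cc) * emeasure (PP \<pi>) G"
    by (simp add: distrib_right mult.assoc)
  also have "1 + ennreal (th / (1 - th * Kb)) * ennreal Cc = ennreal (1 + th * Cc / (1 - th * Kb))"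
    using th Cc_nonneg by (simp add: ennreal_mult[symmetric] ennreal_plus[symmetric] ennreal_1[symmetric] del: ennreal_plus ennreal_1)
  finally show ?thesis .
qed

lemma initial_tail:
  assumes \<pi>: "\<pi> \<in> inits"
  shows "emeasure (PP \<pi>) {w\<in>space Om'. c \<le> tot 0 w} \<le> ennreal (63 / 13 * exp (- (50 / (63 * Kb) * c)))"
proof -
  interpret PP: prob_space "PP \<pi>" by (rule PP_prob_space[OF \<pi>])
  define th where "th = 50 / (63 * Kb)"
  note t = end_bound[folded th_def]
  note [measurable] = measurable_PP[OF \<pi> tot_measurable]
  let ?A = "{w\<in>space (PP \<pi>). c \<le> tot 0 w}"
  have "emeasure (PP \<pi>) ?A = (\<integral>\<^sup>+w. indicator ?A w \<partial>PP \<pi>)" by simp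
  also have "\<dots> \<le> (\<integral>\<^sup>+w. ennreal (exp (- (th * c))) * (indicator (space Om') w * ennreal (exp (th * tot 0 w))) \<partial>PP \<pi>)"
  proof (rule nn_integral_mono)
    fix w
    have "ennreal 1 \<le> ennreal (exp (th * (tot 0 w - c)))" if "c \<le> tot 0 w"
      using that t(1) by (intro ennreal_leI) simp
    then show "indicator ?A w \<le> ennreal (exp (- (th * c))) * (indicator (space Om') w * ennreal (exp (th * tot 0 w)))"
      by (auto simp: indicator_def space_PP[OF \<pi>] ennreal_mult[symmetric] exp_add[symmetric] algebra_simps)
  qed
  also have "\<dots> = ennreal (exp (- (th * c))) * (\<integral>\<^sup>+w. indicator (space Om') w * ennreal (exp (th * tot 0 w)) \<partial>PP \<pi>)"
  proof (rule nn_integral_cmult, rule measurable_PP[OF \<pi>])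
    show "(\<lambda>w. indicator (space Om') w * ennreal (exp (th * tot 0 w))) \<in> borel_measurable Om'" by measurable
  qed
  also have "\<dots> \<le> ennreal (exp (- (th * c))) * (ennreal (1 + th * Cc / (1 - th * Kb)) * emeasure (PP \<pi>) (space Om'))"
    by (intro mult_left_mono mgf_const[OF t(1,2) \<pi> space_top_F]) simp
  also have "\<dots> \<le> ennreal (exp (- (th * c))) * ennreal (63 / 13)"
    using t(4) by (simp add: PP.emeasure_space_1[unfolded space_PP[OF \<pi>]] mult_left_mono ennreal_leI)
  also have "\<dots> = ennreal (63 / 13 * exp (- (th * c)))" by (simp add: ennreal_mult[symmetric] mult.commute)
  finally show ?thesis by (simp add: th_def space_PP[OF \<pi>])
qed

text \<open>The waiting time that straddles \<open>t\<close> has an exponential residual, which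
  contributes 1 / (1 - th Fb); the rest of the cycle contributes \<open>M\<close>, given the past
  before \<open>T (j+1)\<close>. The product is exactly 63/13.\<close>

lemma overshoot_mgf:
  assumes \<pi>: "\<pi> \<in> inits"
  defines "th \<equiv> 50 / (63 * Kb)"
  shows "(\<integral>\<^sup>+w. (if T j w \<le> t \<and> t < T (Suc j) w then ennreal (exp (th * (Fb * (T (Suc j) w - t) + tot (Suc j) w))) else 0) \<partial>PP \<pi>) \<le>
    ennreal (63 / 13) * emeasure (PP \<pi>) {w\<in>space Om'. T j w \<le> t \<and> t < T (Suc j) w}"
proof -
  note b = end_bound[folded th_def]
  note [measurable] = T_F[of j "Suc j", simplified] T_F[of "Suc j" "Suc j", simplified]
  define \<xi> where "\<xi> w = (if T j w \<le> t \<and> t < T (Suc j) w then ennreal (exp (th * (Fb * (T (Suc j) w - t)))) else 0)" for w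
  have \<xi>: "\<xi> \<in> borel_measurable (F (Suc j))" unfolding \<xi>_def[abs_def] by measurable
  define M where "M = 1 + th * Cc / (1 - th * Kb)"
  have "(\<integral>\<^sup>+w. (if T j w \<le> t \<and> t < T (Suc j) w then ennreal (exp (th * (Fb * (T (Suc j) w - t) + tot (Suc j) w))) else 0) \<partial>PP \<pi>) =
    (\<integral>\<^sup>+w. \<xi> w * ennreal (exp (th * tot (Suc j) w)) \<partial>PP \<pi>)"
    by (intro nn_integral_cong) (simp add: \<xi>_def distrib_left exp_add ennreal_mult)
  also have "\<dots> \<le> (\<integral>\<^sup>+w. \<xi> w * ennreal M \<partial>PP \<pi>)"
  proof (rule nn_integral_past_le[OF \<pi> _ _ _ \<xi>])
    fix G assume G: "G \<in> sets (F (Suc j))"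
    have "(\<integral>\<^sup>+w. indicator G w * ennreal M \<partial>PP \<pi>) = ennreal M * emeasure (PP \<pi>) G"
      by (subst mult.commute) (rule nn_integral_cmult_indicator[OF G_PP[OF \<pi> G]])
    then show "(\<integral>\<^sup>+w. indicator G w * ennreal (exp (th * tot (Suc j) w)) \<partial>PP \<pi>) \<le> (\<integral>\<^sup>+w. indicator G w * ennreal M \<partial>PP \<pi>)"
      using mgf_const[OF b(1,2) \<pi> G] by (simp add: M_def)
  qed measurable
  also have "\<dots> = (\<integral>\<^sup>+w. \<xi> w \<partial>PP \<pi>) * ennreal M"
    by (rule nn_integral_multc) (rule measurable_PP[OF \<pi> measurable_F_Om'[OF \<xi>]])
  also have "(\<integral>\<^sup>+w. \<xi> w \<partial>PP \<pi>) = ennreal (1 / (1 - th * Fb)) * emeasure (PP \<pi>) {w\<in>space Om'. T j w \<le> t \<and> t < T (Suc j) w}"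
  proof -
    \<comment> \<open>On \<open>T j \<le> t\<close> the waiting time has to exceed
      \<open>t - T j\<close>, and by memorylessness the excess is again exponential.\<close>
    have law: "(\<integral>\<^sup>+w. (if T j w \<le> t \<and> t < T (Suc j) w then wt (T (Suc j) w - t) else 0) \<partial>PP \<pi>) =
      (\<integral>\<^sup>+w. (if T j w \<le> t then ennreal (exp (- (t - T j w))) else 0) \<partial>PP \<pi>) * (\<integral>\<^sup>+r. wt r \<partial>exp_law)"
      if wt[measurable]: "wt \<in> borel_measurable borel" for wt
    proof -
      note [measurable] = T_F[of j j, simplified]
      define \<psi> where "\<psi> z = (if T j (fst z) \<le> t then indicator {t - T j (fst z)<..} (snd z) * wt (snd z - (t - T j (fst z))) else 0)" for z
      have \<psi>: "\<psi> \<in> borel_measurable (F j \<Otimes>\<^sub>M borel)"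
      proof -
        have "(\<lambda>z. if T j (fst z) \<le> t then (if t - T j (fst z) < snd z then 1 else 0) * wt (snd z - (t - T j (fst z))) else 0) \<in> borel_measurable (F j \<Otimes>\<^sub>M borel)"
          by measurable
        also have "(\<lambda>z. if T j (fst z) \<le> t then (if t - T j (fst z) < snd z then 1 else 0) * wt (snd z - (t - T j (fst z))) else 0) = \<psi>"
          by (rule ext) (auto simp: \<psi>_def indicator_def)
        finally show ?thesis .
      qed
      have "(\<integral>\<^sup>+w. (if T j w \<le> t \<and> t < T (Suc j) w then wt (T (Suc j) w - t) else 0) \<partial>PP \<pi>) = (\<integral>\<^sup>+w. \<psi> (w, wait j w) \<partial>PP \<pi>)"
        by (intro nn_integral_cong) (auto simp: \<psi>_def indicator_def)
      also have "\<dots> = (\<integral>\<^sup>+w. (\<integral>\<^sup>+r. \<psi> (w, r) \<partial>exp_law) \<partial>PP \<pi>)"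
        by (rule wait_independent[OF \<pi> \<psi>])
      also have "\<dots> = (\<integral>\<^sup>+w. (if T j w \<le> t then ennreal (exp (- (t - T j w))) else 0) * (\<integral>\<^sup>+r. wt r \<partial>exp_law) \<partial>PP \<pi>)"
      proof (intro nn_integral_cong)
        fix w
        show "(\<integral>\<^sup>+r. \<psi> (w, r) \<partial>exp_law) = (if T j w \<le> t then ennreal (exp (- (t - T j w))) else 0) * (\<integral>\<^sup>+r. wt r \<partial>exp_law)"
          using exp_law_shift[OF wt, of "t - T j w"] by (simp add: \<psi>_def)
      qed
      also have "\<dots> = (\<integral>\<^sup>+w. (if T j w \<le> t then ennreal (exp (- (t - T j w))) else 0) \<partial>PP \<pi>) * (\<integral>\<^sup>+r. wt r \<partial>exp_law)"
      proof (rule nn_integral_multc)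
        note [measurable] = measurable_PP[OF \<pi> T_measurable]
        show "(\<lambda>w. if T j w \<le> t then ennreal (exp (- (t - T j w))) else 0) \<in> borel_measurable (PP \<pi>)" by measurable
      qed
      finally show ?thesis .
    qed
    note [measurable] = measurable_PP[OF \<pi> T_measurable]
    interpret E: prob_space exp_law by (rule exp_law_prob)
    have "(\<integral>\<^sup>+w. \<xi> w \<partial>PP \<pi>) = (\<integral>\<^sup>+w. (if T j w \<le> t then ennreal (exp (- (t - T j w))) else 0) \<partial>PP \<pi>) * (\<integral>\<^sup>+r. ennreal (exp (th * Fb * r)) \<partial>exp_law)"
    proof -
      have "(\<lambda>r. ennreal (exp (th * Fb * r))) \<in> borel_measurable borel" by measurable
      from law[OF this] show ?thesis by (simp only: \<xi>_def mult.assoc)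
    qed
    also have "(\<integral>\<^sup>+w. (if T j w \<le> t then ennreal (exp (- (t - T j w))) else 0) \<partial>PP \<pi>) =
      (\<integral>\<^sup>+w. (if T j w \<le> t \<and> t < T (Suc j) w then 1 else 0) \<partial>PP \<pi>)"
      using law[of "\<lambda>_. 1"] by (simp add: E.emeasure_space_1[simplified])
    also have "\<dots> = (\<integral>\<^sup>+w. indicator {w\<in>space (PP \<pi>). T j w \<le> t \<and> t < T (Suc j) w} w \<partial>PP \<pi>)"
      by (intro nn_integral_cong) (simp add: indicator_def)
    also have "\<dots> = emeasure (PP \<pi>) {w\<in>space (PP \<pi>). T j w \<le> t \<and> t < T (Suc j) w}"
      by (rule nn_integral_indicator) measurable
    also have "(\<integral>\<^sup>+r. ennreal (exp (th * Fb * r)) \<partial>exp_law) = ennreal (1 / (1 - th * Fb))" by (rule exp_law_exp[OF b(6)])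
    finally show ?thesis by (simp add: space_PP[OF \<pi>] mult.commute)
  qed
  also have "(ennreal (1 / (1 - th * Fb)) * emeasure (PP \<pi>) {w\<in>space Om'. T j w \<le> t \<and> t < T (Suc j) w}) * ennreal M =
    (ennreal (1 / (1 - th * Fb)) * ennreal M) * emeasure (PP \<pi>) {w\<in>space Om'. T j w \<le> t \<and> t < T (Suc j) w}"
    by (simp add: ac_simps)
  also have "ennreal (1 / (1 - th * Fb)) * ennreal M = ennreal (63 / 13)"
  proof -
    have M: "M = (1 - th * Fb) * (63 / 13)" unfolding M_def by (rule b(5))
    have p: "0 < 1 - th * Fb" using b(6) by simp
    have "ennreal (1 / (1 - th * Fb)) * ennreal M = ennreal (1 / (1 - th * Fb) * M)"
      by (rule ennreal_mult[symmetric]) (use p in \<open>simp_all add: M\<close>)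
    also have "1 / (1 - th * Fb) * M = 63 / 13"
    proof -
      have "1 / d * (d * b) = b" if "0 < d" for d b :: real using that by simp
      then show ?thesis unfolding M using p by blast
    qed
    finally show ?thesis .
  qed
  finally show ?thesis .
qed

text \<open>The cycle running at \<open>t\<close> is completed and the excess after \<open>t\<close>
  is estimated, since the excess is controlled conditionally on the past of \<open>t\<close>. On the
  running waiting interval |f| is bounded by \<open>Fb\<close>.\<close>

definition overshoot :: "real \<Rightarrow> real \<Rightarrow> 'v set" where
  "overshoot t c = {w\<in>space Om'. \<exists>j. T j w \<le> t \<and> t < T (Suc j) w \<and> c \<le> Fb * (T (Suc j) w - t) + tot (Suc j) w}"

lemma overshoot_measurable[measurable]: "overshoot t c \<in> sets Om'"
proof -
  note [measurable] = T_measurable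
  show ?thesis unfolding overshoot_def by measurable
qed

text \<open>The events that \<open>[T j, T (j+1))\<close> contains \<open>t\<close> are disjoint, so
  the moment bounds for single \<open>j\<close> add up without loss.\<close>

lemma overshoot_tail:
  assumes \<pi>: "\<pi> \<in> inits"
  shows "emeasure (PP \<pi>) (overshoot t c) \<le> ennreal (63 / 13 * exp (- (50 / (63 * Kb) * c)))"
proof -
  interpret PP: prob_space "PP \<pi>" by (rule PP_prob_space[OF \<pi>])
  define th where "th = 50 / (63 * Kb)"
  note b = end_bound[folded th_def]
  note [measurable] = measurable_PP[OF \<pi> T_measurable] measurable_PP[OF \<pi> tot_measurable]
  have O: "overshoot t c \<in> sets (PP \<pi>)" unfolding sets_PP[OF \<pi>] by measurable
  let ?g = "\<lambda>j w. (if T j w \<le> t \<and> t < T (Suc j) w then ennreal (exp (th * (Fb * (T (Suc j) w - t) + tot (Suc j) w))) else 0)"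
  let ?B = "\<lambda>j. {w\<in>space Om'. T j w \<le> t \<and> t < T (Suc j) w}"
  have Bm: "?B j \<in> sets (PP \<pi>)" for j unfolding space_PP[OF \<pi>, symmetric] by measurable
  have "emeasure (PP \<pi>) (overshoot t c) = (\<integral>\<^sup>+w. indicator (overshoot t c) w \<partial>PP \<pi>)" using O by simp
  also have "\<dots> \<le> (\<integral>\<^sup>+w. ennreal (exp (- (th * c))) * (\<Sum>j. ?g j w) \<partial>PP \<pi>)"
  proof (rule nn_integral_mono)
    fix w
    show "indicator (overshoot t c) w \<le> ennreal (exp (- (th * c))) * (\<Sum>j. ?g j w)"
    proof (cases "w \<in> overshoot t c")
      case True
      then obtain j where j: "T j w \<le> t" "t < T (Suc j) w" "c \<le> Fb * (T (Suc j) w - t) + tot (Suc j) w"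
        by (auto simp: overshoot_def)
      define v where "v = Fb * (T (Suc j) w - t) + tot (Suc j) w"
      have "ennreal 1 \<le> ennreal (exp (th * (v - c)))" using j(3) b(1) by (intro ennreal_leI) (simp add: v_def)
      also have "\<dots> = ennreal (exp (- (th * c))) * ennreal (exp (th * v))"
        by (simp add: ennreal_mult[symmetric] exp_add[symmetric] algebra_simps)
      also have "ennreal (exp (th * v)) = (\<Sum>i\<in>{j}. ?g i w)" using j by (simp add: v_def)
      also have "ennreal (exp (- (th * c))) * (\<Sum>i\<in>{j}. ?g i w) \<le> ennreal (exp (- (th * c))) * (\<Sum>j. ?g j w)"
        by (intro mult_left_mono sum_le_suminf) auto
      finally show ?thesis using True by simp
    qed simp
  qed
  also have "\<dots> = ennreal (exp (- (th * c))) * (\<integral>\<^sup>+w. (\<Sum>j. ?g j w) \<partial>PP \<pi>)"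
    by (rule nn_integral_cmult) measurable
  also have "(\<integral>\<^sup>+w. (\<Sum>j. ?g j w) \<partial>PP \<pi>) = (\<Sum>j. \<integral>\<^sup>+w. ?g j w \<partial>PP \<pi>)"
    by (rule nn_integral_suminf) measurable
  also have "ennreal (exp (- (th * c))) * (\<Sum>j. \<integral>\<^sup>+w. ?g j w \<partial>PP \<pi>) \<le> ennreal (exp (- (th * c))) * (\<Sum>j. ennreal (63 / 13) * emeasure (PP \<pi>) (?B j))"
    using overshoot_mgf[OF \<pi>, folded th_def] by (intro mult_left_mono suminf_le) auto
  also have "(\<Sum>j. ennreal (63 / 13) * emeasure (PP \<pi>) (?B j)) = ennreal (63 / 13) * emeasure (PP \<pi>) (\<Union>j. ?B j)"
  proof -
    have "disjoint_family ?B"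
      unfolding disjoint_family_on_def
    proof (intro ballI impI equals0I)
      fix i j :: nat and w assume ne: "i \<noteq> j" and w: "w \<in> ?B i \<inter> ?B j"
      then have sp: "w \<in> space Om'" by simp
      have "Suc i \<le> j \<or> Suc j \<le> i" using ne by auto
      then show False using T_le[OF sp, of "Suc i" j] T_le[OF sp, of "Suc j" i] w by auto
    qed
    then show ?thesis using Bm by (subst suminf_emeasure[symmetric]) auto
  qed
  also have "ennreal (exp (- (th * c))) * (ennreal (63 / 13) * emeasure (PP \<pi>) (\<Union>j. ?B j)) \<le> ennreal (exp (- (th * c))) * (ennreal (63 / 13) * 1)"
    by (intro mult_left_mono PP.emeasure_le_1) auto
  also have "\<dots> = ennreal (63 / 13 * exp (- (th * c)))" by (simp add: ennreal_mult[symmetric] mult.commute)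
  finally show ?thesis by (simp add: th_def)
qed

section \<open>Decomposition of the path integral\<close>

definition path_int :: "real \<Rightarrow> 'v \<Rightarrow> real" where
  "path_int t w = (LINT s:{0..t}|lborel. f (Z1 Z s w))"

lemma path_integrable:
  assumes w: "w \<in> space Om'" and "bounded A" "A \<in> sets borel"
  shows "set_integrable lborel A (\<lambda>s. f (Z1 Z (max 0 s) w))"
proof -
  have Zm[measurable]: "(\<lambda>s. Z1 Z (max 0 s) w) \<in> borel \<rightarrow>\<^sub>M borel"
    using measurable_compose[OF _ Z1_measurable_pair, of "\<lambda>s. (s, w)" borel] w by simp
  have [measurable]: "A \<in> sets borel" by fact
  show ?thesis unfolding set_integrable_def
  proof (rule integrableI_bounded_set_indicator[where B = Fb])
    show "emeasure lborel A < \<infinity>" using assms(2) by (rule emeasure_bounded_finite)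
    show "AE s in lborel. s \<in> A \<longrightarrow> norm (f (Z1 Z (max 0 s) w)) \<le> Fb" using f_bound by auto
  qed measurable
qed

text \<open>Intervals open on the left fit the additivity of \<open>path_int\<close>; changing the
  end points has no effect on Lebesgue integrals.\<close>

lemma val_eq_integral:
  assumes w: "w \<in> space Om'"
  shows "val j w = (LINT s:{T j w<..T (Suc j) w}|lborel. f (Z1 Z (max 0 s) w))"
proof -
  let ?h = "\<lambda>s. f (Z1 Z (max 0 s) w)"
  let ?I = "{T j w<..T (Suc j) w}"
  have o: "occ (\<lambda>x. ennreal (\<sigma> * f x)) j w = (\<integral>\<^sup>+s. ennreal (\<sigma> * (indicator ?I s * ?h s)) \<partial>lborel)" for \<sigma>
  proof -
    have "AE s in lborel. indicator {T j w..<T (Suc j) w} s * ennreal (\<sigma> * f (Z1 Z s w)) = ennreal (\<sigma> * (indicator ?I s * ?h s))"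
      using AE_lborel_singleton[of "T j w"] AE_lborel_singleton[of "T (Suc j) w"]
      by eventually_elim (use T_nonneg[OF w, of j] in \<open>auto simp: indicator_def max_def\<close>)
    then show ?thesis unfolding occ_def by (rule nn_integral_cong_AE)
  qed
  have "integrable lborel (\<lambda>s. indicator ?I s * ?h s)"
    using path_integrable[OF w, of ?I] by (simp add: set_integrable_def)
  from real_lebesgue_integral_def[OF this] show ?thesis
    using o[of 1] o[of "- 1"] by (simp add: val_def set_lebesgue_integral_def)
qed

lemma path_int_eq: "path_int t w = (LINT s:{0..t}|lborel. f (Z1 Z (max 0 s) w))"
  unfolding path_int_def set_lebesgue_integral_def by (intro Bochner_Integration.integral_cong) (auto simp: indicator_def)

lemma path_int_add:
  assumes w: "w \<in> space Om'" and "0 \<le> s" "s \<le> t"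
  shows "path_int t w = path_int s w + (LINT s:{s<..t}|lborel. f (Z1 Z (max 0 s) w))"
proof -
  have "{0..t} = {0..s} \<union> {s<..t}" using assms(2,3) by auto
  then show ?thesis unfolding path_int_eq
    by (simp only:) (rule set_integral_Un, auto intro!: path_integrable[OF w])
qed

lemma path_int_T:
  assumes w: "w \<in> space Om'" shows "path_int (T n w) w = (\<Sum>j<n. val j w)"
proof (induction n)
  case 0
  have "(LINT s:{0..0}|lborel. f (Z1 Z s w)) = (LINT (s::real)|lborel. 0)"
    unfolding set_lebesgue_integral_def
  proof (rule Bochner_Integration.integral_cong_AE)
    have Zm[measurable]: "(\<lambda>s. Z1 Z (max 0 s) w) \<in> borel \<rightarrow>\<^sub>M borel"
      using measurable_compose[OF _ Z1_measurable_pair, of "\<lambda>s. (s, w)" borel] w by simp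
    have "(\<lambda>s. indicator {0..0::real} s *\<^sub>R f (Z1 Z (max 0 s) w)) \<in> borel_measurable lborel" by measurable
    then show "(\<lambda>s. indicator {0..0::real} s *\<^sub>R f (Z1 Z s w)) \<in> borel_measurable lborel"
      by (rule measurable_cong[THEN iffD1, rotated]) (auto simp: indicator_def)
    show "AE s in lborel. indicator {0..0::real} s *\<^sub>R f (Z1 Z s w) = 0"
      using AE_lborel_singleton[of 0] by eventually_elim (auto simp: indicator_def)
  qed simp
  then show ?case by (simp add: path_int_def T_0[OF w])
next
  case (Suc n)
  then show ?case
    using path_int_add[OF w T_nonneg[OF w, of n] less_imp_le[OF T_increasing[OF w, of n]]] val_eq_integral[OF w, of n] by simp
qed

lemma path_int_remainder:
  assumes w: "w \<in> space Om'" and "s \<le> t"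
  shows "\<bar>LINT s:{s<..t}|lborel. f (Z1 Z (max 0 s) w)\<bar> \<le> Fb * (t - s)"
proof -
  have i: "integrable lborel (\<lambda>u. indicator {s<..t} u *\<^sub>R f (Z1 Z (max 0 u) w))"
    using path_integrable[OF w, of "{s<..t}"] by (simp add: set_integrable_def)
  have "\<bar>LINT s:{s<..t}|lborel. f (Z1 Z (max 0 s) w)\<bar> \<le> (LINT u|lborel. \<bar>indicator {s<..t} u *\<^sub>R f (Z1 Z (max 0 u) w)\<bar>)"
    unfolding set_lebesgue_integral_def by (rule integral_abs_bound)
  also have "\<dots> \<le> (LINT u|lborel. Fb * indicator {s<..t} u)"
  proof (rule integral_mono)
    show "integrable lborel (\<lambda>u. Fb * indicator {s<..t} u)"
      by (rule integrable_mult_right, rule integrable_real_indicator, measurable) (simp add: emeasure_lborel_Ioc[OF assms(2)])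
    show "\<bar>indicator {s<..t} u *\<^sub>R f (Z1 Z (max 0 u) w)\<bar> \<le> Fb * indicator {s<..t} u" for u
      using f_bound by (cases "u \<in> {s<..t}") auto
  qed (use i in \<open>rule integrable_abs\<close>)
  also have "\<dots> = Fb * (t - s)" using assms(2) by simp
  finally show ?thesis .
qed

lemma xi_part_eq:
  assumes w: "w \<in> space Om'" shows "xi_part k i w = (\<Sum>j<i. if cyc_index j w = k then val j w else 0)"
proof -
  have lt: "occ fp j w < top" "occ fn j w < top" for j
  proof -
    have "occ fp j w + occ fn j w < top" unfolding occ_fa_split[OF w, symmetric] occ_fa_eq[OF w] by simp
    then show "occ fp j w < top" "occ fn j w < top" unfolding ennreal_add_less_top by simp_all
  qed
  have e: "enn2real (\<Sum>j<i. if cyc_index j w = k then u j else 0) = (\<Sum>j<i. if cyc_index j w = k then enn2real (u j) else 0)"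
    if "\<And>j. u j < top" for u :: "nat \<Rightarrow> ennreal"
    using that by (subst enn2real_sum) (auto intro!: sum.cong)
  show ?thesis
    unfolding xi_part_def cyc_part_def e[OF lt(1)] e[OF lt(2)] sum_subtractf[symmetric]
    by (intro sum.cong refl) (simp add: val_def)
qed

text \<open>The integral up to \<open>t\<close> is split into the first cycle, the complete cycles with odd and even index up
  to the one that contains \<open>t\<close>, and what has to be subtracted after \<open>t\<close>.\<close>

lemma path_decomposition:
  assumes w: "w \<in> space Om'" and reach: "\<And>k. \<exists>j. cyc_index j w = k" and hit: "\<And>n. \<exists>i>n. w \<in> hits i"
    and J: "T J w \<le> t" "t < T (Suc J) w" and k: "k = cyc_index J w"
  shows "\<bar>path_int t w\<bar> \<le> tot 0 w + \<bar>\<Sum>i<(k + 1) div 2. xi (2 * i + 1) w\<bar> + \<bar>\<Sum>i<k div 2. xi (2 * i + 2) w\<bar> +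
    (Fb * (T (Suc J) w - t) + tot (Suc J) w)"
proof -
  \<comment> \<open>The running cycle ends at \<open>T r'\<close>; the indices from
    \<open>Suc J\<close> below \<open>r'\<close> are what completes it.\<close>
  obtain r' where r': "\<not> elig r' w" "cyc_index r' w = Suc k" using reach cycle_start_exists by metis
  have lt: "cyc_index j w \<le> k \<longleftrightarrow> j < r'" for j
    using cycle_start_less[OF r'(1), of j] cyc_index_mono[of r' j w] r'(2) by (cases "j < r'") auto
  have Jr: "Suc J \<le> r'" using lt[of J] k by simp
  have t0: "0 \<le> t" using J(1) T_nonneg[OF w, of J] by simp
  have "(\<Sum>l<Suc k. xi l w) = (\<Sum>l<Suc k. \<Sum>j<r'. if cyc_index j w = l then val j w else 0)"
    by (intro sum.cong refl) (simp add: xi_eq_part[of _ r'] r'(2) xi_part_eq[OF w])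
  also have "\<dots> = (\<Sum>j<r'. \<Sum>l<Suc k. if cyc_index j w = l then val j w else 0)" by (rule sum.swap)
  also have "\<dots> = (\<Sum>j<r'. val j w)"
  proof (intro sum.cong refl)
    fix j assume "j \<in> {..<r'}"
    then have "cyc_index j w < Suc k" using lt[of j] by simp
    then show "(\<Sum>l<Suc k. if cyc_index j w = l then val j w else 0) = val j w" by (simp del: sum.lessThan_Suc)
  qed
  also have "{..<r'} = {..<Suc J} \<union> {Suc J..<r'}" using Jr by auto
  also have "(\<Sum>j\<in>{..<Suc J} \<union> {Suc J..<r'}. val j w) = (\<Sum>j<Suc J. val j w) + (\<Sum>j\<in>{Suc J..<r'}. val j w)"
    by (rule sum.union_disjoint) auto
  also have "(\<Sum>j<Suc J. val j w) = path_int t w + (LINT s:{t<..T (Suc J) w}|lborel. f (Z1 Z (max 0 s) w))"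
    unfolding path_int_T[OF w, symmetric] by (rule path_int_add[OF w t0]) (use J in simp)
  finally have main: "path_int t w = (\<Sum>l<Suc k. xi l w) - (LINT s:{t<..T (Suc J) w}|lborel. f (Z1 Z (max 0 s) w)) - (\<Sum>j\<in>{Suc J..<r'}. val j w)"
    by simp
  have r1: "\<bar>LINT s:{t<..T (Suc J) w}|lborel. f (Z1 Z (max 0 s) w)\<bar> \<le> Fb * (T (Suc J) w - t)"
    by (rule path_int_remainder[OF w]) (use J in simp)
  \<comment> \<open>\<open>tot (Suc J)\<close> ignores a hit at \<open>Suc J\<close> itself, so it
    may extend beyond the cycle; as a sum of nonnegative terms it still dominates.\<close>
  have r2: "\<bar>\<Sum>j\<in>{Suc J..<r'}. val j w\<bar> \<le> tot (Suc J) w"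
  proof -
    obtain N0 where N0: "\<And>N. N \<ge> N0 \<Longrightarrow> acc N (Suc J) w = tot (Suc J) w"
      using csum_fa_finite(2)[OF w hit, of "Suc J"] by blast
    define N where "N = max N0 (r' - Suc J)"
    obtain r where r: "r \<le> J" "\<not> elig r w" "cyc_index r w = k" using cycle_start_exists[of J w] k by auto
    have nh: "no_hit (Suc J) j w" if "Suc J \<le> j" "j < r'" for j
    proof -
      have "cyc_index (r + (j - r)) w = k"
        using lt[of j] cyc_index_mono[of J j w] k that r(1) by simp
      then have "no_hit r (r + (j - r)) w" using cycle_no_hit[OF r(2), of "j - r"] r(3) by metis
      then show ?thesis using r(1) that by (simp add: no_hit_def)
    qed
    have "\<bar>\<Sum>j\<in>{Suc J..<r'}. val j w\<bar> \<le> (\<Sum>j\<in>{Suc J..<r'}. piece j w)"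
      by (rule order_trans[OF sum_abs sum_mono]) (rule abs_val_le[OF w])
    also have "\<dots> = (\<Sum>i<r' - Suc J. piece (Suc J + i) w)"
      using sum.shift_bounds_nat_ivl[of "\<lambda>j. piece j w" 0 "Suc J" "r' - Suc J"] Jr by (simp add: atLeast0LessThan add.commute)
    also have "\<dots> = (\<Sum>i<r' - Suc J. if no_hit (Suc J) (Suc J + i) w then piece (Suc J + i) w else 0)"
      using nh by (intro sum.cong refl) auto
    also have "\<dots> \<le> acc N (Suc J) w"
      unfolding acc_def by (rule sum_mono2) (auto simp: N_def piece_nonneg)
    also have "\<dots> = tot (Suc J) w" by (rule N0) (simp add: N_def)
    finally show ?thesis .
  qed
  have x0: "\<bar>xi 0 w\<bar> \<le> tot 0 w"
  proof -
    have e: "cyc_total u 0 w = csum u 0 w" for u unfolding cyc_total_def by (rule cycle_sum_0)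
    show ?thesis unfolding xi_def e tot_split(1)[OF w hit]
      using enn2real_nonneg[of "csum (occ fp) 0 w"] enn2real_nonneg[of "csum (occ fn) 0 w"] by linarith
  qed
  \<comment> \<open>Among 1, ..., k there are \<open>(k + 1) div 2\<close> odd and
    \<open>k div 2\<close> even indices.\<close>
  have split: "(\<Sum>l<Suc k. xi l w) = xi 0 w + (\<Sum>i<(k + 1) div 2. xi (2 * i + 1) w) + (\<Sum>i<k div 2. xi (2 * i + 2) w)"
  proof (induction k)
    case (Suc k)
    show ?case
    proof (cases "even k")
      case True
      then obtain q where "k = 2 * q" by (rule evenE)
      then show ?thesis using Suc by (simp add: sum.lessThan_Suc)
    next
      case False
      then obtain q where "k = 2 * q + 1" by (rule oddE)
      then show ?thesis using Suc by (simp add: sum.lessThan_Suc)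
    qed
  qed simp
  show ?thesis using main r1 r2 x0 split by linarith
qed

text \<open>The shares 29/100 for each parity class and 21/100 for each end add up to 1. Outside the
  event in the last term the cycle running at \<open>t\<close> has index at most
  \<open>N\<close>.\<close>

lemma deviation:
  assumes \<pi>: "\<pi> \<in> inits" and t: "0 \<le> t" and c: "0 < c"
  shows "emeasure (PP \<pi>) {w\<in>space Om'. c \<le> \<bar>path_int t w\<bar>} \<le>
    4 * ennreal (exp (- ((29 / 100 * c)\<^sup>2 / (2 * (real N + 1) * Kb\<^sup>2 + 2 * Kb * (29 / 100 * c))))) +
    4 * ennreal (exp 1) * ennreal (exp (- (c / (6 * Kb)))) +
    emeasure (PP \<pi>) {w\<in>space Om'. regen_time C a Z T (Suc N) w \<le> ennreal t}"
proof -
  define y where "y = 29 / 100 * c"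
  \<comment> \<open>The number of odd indices up to \<open>N\<close>, which dominates that of the
    positive even ones; \<open>q\<close> is its bound without rounding.\<close>
  define m where "m = (N + 1) div 2"
  define q where "q = (real N + 1) / 2"
  have q: "real m \<le> q" "0 < q"
  proof -
    have "2 * m \<le> N + 1" unfolding m_def by simp
    then have "real (2 * m) \<le> real (N + 1)" by (simp only: of_nat_le_iff)
    then show "real m \<le> q" by (simp add: q_def)
  qed (simp add: q_def)
  have y: "0 < y" using c by (simp add: y_def)
  define A where "A \<epsilon> e = {w\<in>space Om'. \<exists>n\<le>m. y \<le> (\<Sum>k<n. \<epsilon> * xi (2 * k + e) w)}" for \<epsilon> :: real and e :: nat
  define S where "S = {w\<in>space Om'. 21 / 100 * c \<le> tot 0 w}"
  define V where "V = overshoot t (21 / 100 * c)"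
  define R where "R = {w\<in>space Om'. regen_time C a Z T (Suc N) w \<le> ennreal t}"
  have meas: "A \<epsilon> e \<in> sets (PP \<pi>)" "S \<in> sets (PP \<pi>)" "V \<in> sets (PP \<pi>)" "R \<in> sets (PP \<pi>)" for \<epsilon> e
  proof -
    have m: "{w\<in>space Om'. y \<le> (\<Sum>k<n. \<epsilon> * xi (2 * k + e) w)} \<in> sets Om'" for n by measurable
    have "(\<Union>n\<in>{..m}. {w\<in>space Om'. y \<le> (\<Sum>k<n. \<epsilon> * xi (2 * k + e) w)}) \<in> sets Om'"
      by (rule sets.finite_UN[OF finite_atMost m])
    also have "(\<Union>n\<in>{..m}. {w\<in>space Om'. y \<le> (\<Sum>k<n. \<epsilon> * xi (2 * k + e) w)}) = A \<epsilon> e" unfolding A_def by blast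
    finally show "A \<epsilon> e \<in> sets (PP \<pi>)" by (simp only: sets_PP[OF \<pi>])
    show "S \<in> sets (PP \<pi>)" "V \<in> sets (PP \<pi>)" "R \<in> sets (PP \<pi>)"
      unfolding sets_PP[OF \<pi>] S_def V_def R_def by measurable
  qed
  have "emeasure (PP \<pi>) {w\<in>space Om'. c \<le> \<bar>path_int t w\<bar>} \<le> emeasure (PP \<pi>) (((A 1 1 \<union> A (- 1) 1) \<union> (A 1 2 \<union> A (- 1) 2)) \<union> (S \<union> V) \<union> R)"
  proof (rule emeasure_mono_AE)
    show "AE w in PP \<pi>. w \<in> {w\<in>space Om'. c \<le> \<bar>path_int t w\<bar>} \<longrightarrow> w \<in> ((A 1 1 \<union> A (- 1) 1) \<union> (A 1 2 \<union> A (- 1) 2)) \<union> (S \<union> V) \<union> R"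
      using AE_cyc_index[OF \<pi>] AE_T_unbounded[OF \<pi>]
    proof (rule AE_mp[OF AE_conjI], intro AE_I2 impI)
      fix w assume hu: "((\<forall>n. \<exists>i>n. w \<in> hits i) \<and> (\<forall>k. \<exists>j. cyc_index j w = k)) \<and> (\<forall>t. \<exists>n. t < T n w)"
        and in_dev: "w \<in> {w\<in>space Om'. c \<le> \<bar>path_int t w\<bar>}"
      from hu have h: "(\<forall>n. \<exists>i>n. w \<in> hits i) \<and> (\<forall>k. \<exists>j. cyc_index j w = k)" and unb: "\<forall>t. \<exists>n. t < T n w" by blast+
      from in_dev have w: "w \<in> space Om'" and ge: "c \<le> \<bar>path_int t w\<bar>" by auto
      obtain J where J: "T J w \<le> t" "t < T (Suc J) w" using current_index_exists[OF w unb t] by blast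
      define k where "k = cyc_index J w"
      show "w \<in> ((A 1 1 \<union> A (- 1) 1) \<union> (A 1 2 \<union> A (- 1) 2)) \<union> (S \<union> V) \<union> R"
      proof (cases "Suc N \<le> k")
        case True
        then have "w \<in> R" using regen_time_le_current[OF w J, of "Suc N"] w unfolding R_def k_def by blast
        then show ?thesis by blast
      next
        case False
        then have n: "(k + 1) div 2 \<le> m" "k div 2 \<le> m" unfolding m_def by auto
        have "\<bar>path_int t w\<bar> \<le> tot 0 w + \<bar>\<Sum>i<(k + 1) div 2. xi (2 * i + 1) w\<bar> + \<bar>\<Sum>i<k div 2. xi (2 * i + 2) w\<bar> +
          (Fb * (T (Suc J) w - t) + tot (Suc J) w)"
          using h by (intro path_decomposition[OF w _ _ J k_def]) blast+
        then have "21 / 100 * c \<le> tot 0 w \<or> y \<le> \<bar>\<Sum>i<(k + 1) div 2. xi (2 * i + 1) w\<bar> \<or> y \<le> \<bar>\<Sum>i<k div 2. xi (2 * i + 2) w\<bar> \<or>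
          21 / 100 * c \<le> Fb * (T (Suc J) w - t) + tot (Suc J) w"
          using ge unfolding y_def by linarith
        moreover have "w \<in> A 1 e \<union> A (- 1) e" if "y \<le> \<bar>\<Sum>i<n. xi (2 * i + e) w\<bar>" "n \<le> m" for n e
        proof -
          have "y \<le> (\<Sum>i<n. 1 * xi (2 * i + e) w) \<or> y \<le> (\<Sum>i<n. - 1 * xi (2 * i + e) w)"
            using that(1) by (auto simp: sum_negf abs_if split: if_splits)
          then show ?thesis using w that(2) unfolding A_def by blast
        qed
        moreover have "w \<in> V" if "21 / 100 * c \<le> Fb * (T (Suc J) w - t) + tot (Suc J) w"
          unfolding V_def overshoot_def using w J that by blast
        moreover have "w \<in> S" if "21 / 100 * c \<le> tot 0 w" unfolding S_def using w that by blast
        ultimately show ?thesis using n by blast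
      qed
    qed
  qed (use meas in auto)
  also have "\<dots> \<le> ((emeasure (PP \<pi>) (A 1 1) + emeasure (PP \<pi>) (A (- 1) 1)) + (emeasure (PP \<pi>) (A 1 2) + emeasure (PP \<pi>) (A (- 1) 2))) +
      (emeasure (PP \<pi>) S + emeasure (PP \<pi>) V) + emeasure (PP \<pi>) R"
    by (intro order_trans[OF emeasure_subadditive] add_mono order_refl) (use meas in auto)
  also have "\<dots> \<le> ((ennreal (exp (- (y\<^sup>2 / (4 * q * Kb\<^sup>2 + 2 * Kb * y)))) + ennreal (exp (- (y\<^sup>2 / (4 * q * Kb\<^sup>2 + 2 * Kb * y))))) +
      (ennreal (exp (- (y\<^sup>2 / (4 * q * Kb\<^sup>2 + 2 * Kb * y)))) + ennreal (exp (- (y\<^sup>2 / (4 * q * Kb\<^sup>2 + 2 * Kb * y)))))) +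
      (ennreal (2 * exp 1 * exp (- (c / (6 * Kb)))) + ennreal (2 * exp 1 * exp (- (c / (6 * Kb))))) + emeasure (PP \<pi>) R"
  proof (intro add_mono order_refl)
    have e: "50 / (63 * Kb) * (21 / 100 * c) = c / (6 * Kb)" by simp
    \<comment> \<open>63/13 is less than 5, and 5/2 is a lower bound for
      \<open>exp 1\<close>.\<close>
    have "63 / 13 * exp (- (c / (6 * Kb))) \<le> 2 * exp 1 * exp (- (c / (6 * Kb)))"
    proof (rule mult_right_mono)
      have "(5 / 2 :: real) \<le> exp 1" using exp_lower_Taylor_quadratic[of 1] by simp
      then show "63 / 13 \<le> 2 * exp (1::real)" by simp
    qed simp
    then have le: "ennreal (63 / 13 * exp (- (c / (6 * Kb)))) \<le> ennreal (2 * exp 1 * exp (- (c / (6 * Kb))))" by (rule ennreal_leI)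
    show "emeasure (PP \<pi>) S \<le> ennreal (2 * exp 1 * exp (- (c / (6 * Kb))))"
      using initial_tail[OF \<pi>, of "21 / 100 * c"] le unfolding e S_def by (rule order_trans)
    show "emeasure (PP \<pi>) V \<le> ennreal (2 * exp 1 * exp (- (c / (6 * Kb))))"
      using overshoot_tail[OF \<pi>, of t "21 / 100 * c"] le unfolding e V_def by (rule order_trans)
  qed (unfold A_def, (intro cycle_sum_deviation[OF \<pi> _ _ y q]; simp)+)
  also have "\<dots> = 4 * ennreal (exp (- (y\<^sup>2 / (4 * q * Kb\<^sup>2 + 2 * Kb * y)))) + 4 * ennreal (exp 1) * ennreal (exp (- (c / (6 * Kb)))) + emeasure (PP \<pi>) R"
  proof -
    have "ennreal (2 * exp 1 * exp (- (c / (6 * Kb)))) + ennreal (2 * exp 1 * exp (- (c / (6 * Kb)))) = ennreal (4 * (exp 1 * exp (- (c / (6 * Kb)))))"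
      by (simp add: ennreal_plus[symmetric] del: ennreal_plus)
    also have "\<dots> = ennreal 4 * ennreal (exp 1 * exp (- (c / (6 * Kb))))" by (rule ennreal_mult) auto
    also have "\<dots> = 4 * ennreal (exp 1) * ennreal (exp (- (c / (6 * Kb))))" by (simp add: ennreal_mult mult.assoc)
    finally have 1: "ennreal (2 * exp 1 * exp (- (c / (6 * Kb)))) + ennreal (2 * exp 1 * exp (- (c / (6 * Kb)))) = \<dots>" .
    have 2: "(x + x) + (x + x) = 4 * x" for x :: ennreal
      by (simp add: mult_2[symmetric] mult.assoc[symmetric])
    show ?thesis unfolding 1 2 ..
  qed
  also have "4 * q = 2 * (real N + 1)" by (simp add: q_def)
  finally show ?thesis unfolding y_def R_def .
qed

end

section \<open>The deviation inequalities\<close>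

lemma eexp_ereal: "eexp (ereal z) = ennreal (exp z)"
  by (simp add: eexp_def)

lemma one_le_eexp: "0 \<le> z \<Longrightarrow> 1 \<le> eexp z"
  by (cases z) (auto simp: eexp_def)

text \<open>In the null-recurrent case the number of cycles carries a factor \<open>exp 1\<close>,
  which has to stay below 295/100 for the constant 42 to suffice.\<close>

lemma exp_one_le: "exp 1 \<le> (287 / 100 :: real)"
proof -
  have "exp (1 / 8) \<le> (1 + 1 / 8 + (1 / 8)\<^sup>2 :: real)" by (rule exp_bound) auto
  then have "exp (1 / 8) ^ 8 \<le> (1 + 1 / 8 + (1 / 8)\<^sup>2 :: real) ^ 8" by (intro power_mono) auto
  moreover have "exp (1 / 8) ^ 8 = (exp 1 :: real)" by (simp add: exp_of_nat_mult[symmetric])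
  ultimately have "exp 1 \<le> (1 + 1 / 8 + (1 / 8)\<^sup>2 :: real) ^ 8" by simp
  also have "\<dots> \<le> 287 / 100" by (simp add: power2_eq_square power_divide)
  finally show ?thesis .
qed

lemma min_square_mult_max: "0 < (x::real) \<Longrightarrow> min (x\<^sup>2) x * max x 1 = x\<^sup>2"
  by (cases "x \<le> 1") (auto simp: min_def max_def power2_eq_square mult_le_cancel_left1)

text \<open>Bounds for single \<open>l\<close> pass to the supremum even if it may be infinite: a
  positive \<open>p\<close> forces it to be finite, and for \<open>p = 0\<close> the claim is
  trivial.\<close>

lemma le_exp_SUP_rate:
  fixes r :: "real \<Rightarrow> real"
  assumes q: "0 < q" and I: "I \<noteq> {}" and p: "\<And>l. l \<in> I \<Longrightarrow> p \<le> ennreal (2 * exp (- (q * r l)))"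
  shows "p \<le> 8 * eexp (- (ereal q * (SUP l\<in>I. ereal (r l))))"
proof (cases "p = 0")
  case False
  obtain l0 where l0: "l0 \<in> I" using I by blast
  have "p < top" using p[OF l0] by (rule le_less_trans) simp
  then obtain s where s: "p = ennreal s" "0 < s"
    using False by (cases p) auto
  have b: "r l \<le> - ln (s / 2) / q" if "l \<in> I" for l
  proof -
    have "s \<le> 2 * exp (- (q * r l))" using p[OF that] s by (simp add: ennreal_le_iff)
    then have "s / 2 \<le> exp (- (q * r l))" by simp
    then have "ln (s / 2) \<le> ln (exp (- (q * r l)))" using s(2) by (subst ln_le_cancel_iff) auto
    then have "ln (s / 2) \<le> - (q * r l)" by simp
    then show ?thesis using q by (simp add: field_simps)
  qed
  have "(SUP l\<in>I. ereal (r l)) \<le> ereal (- ln (s / 2) / q)" by (intro SUP_least) (simp only: ereal_less_eq(3) b)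
  moreover have "ereal (r l0) \<le> (SUP l\<in>I. ereal (r l))" using l0 by (rule SUP_upper)
  ultimately obtain R where R: "(SUP l\<in>I. ereal (r l)) = ereal R" "R \<le> - ln (s / 2) / q"
    by (cases "SUP l\<in>I. ereal (r l)") auto
  have "q * R \<le> - ln (s / 2)" using R(2) q by (simp add: field_simps)
  then have "exp (ln (s / 2)) \<le> exp (- (q * R))" by simp
  then have "s \<le> 8 * exp (- (q * R))" using s(2) exp_gt_zero[of "- (q * R)"] by (simp del: exp_gt_zero)
  then have "ennreal s \<le> ennreal (8 * exp (- (q * R)))" by (rule ennreal_leI)
  also have "\<dots> = 8 * eexp (- (ereal q * ereal R))" by (simp add: eexp_ereal ennreal_mult)
  finally show ?thesis by (simp add: R s(1))
qed simp

text \<open>The numbers of the final estimates: the share \<open>29/100\<close> of the threshold leaves room to replace the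
  constant of Bernstein's inequality by \<open>42\<close>.\<close>

lemma bernstein_exponent:
  fixes K B V D c x e :: real
  assumes K: "0 < K" and B: "B = max (K\<^sup>2) K" and c: "0 < c" and D: "0 \<le> D"
    and x: "0 < x" and e: "0 \<le> e" and N: "D \<le> 295 / 100 * V * max x 1" and cV: "c \<le> V * max x 1"
    and sq: "e * V * x\<^sup>2 \<le> c\<^sup>2"
  shows "e * min (x\<^sup>2) x / (42 * B) \<le> (29 / 100 * c)\<^sup>2 / (D * K\<^sup>2 + 2 * K * (29 / 100 * c))"
proof -
  have B0: "0 < B" and KB: "K\<^sup>2 \<le> B" "K \<le> B" using K B by auto
  \<comment> \<open>The coefficients 295/100 and 58/100 add up to 353/100, while 42 times the square
    of 29/100 is 3.5322.\<close>
  have "D * K\<^sup>2 + 2 * K * (29 / 100 * c) \<le> 295 / 100 * (V * max x 1) * B + 58 / 100 * (V * max x 1) * B"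
  proof (rule add_mono)
    show "D * K\<^sup>2 \<le> 295 / 100 * (V * max x 1) * B" using N D KB(1) by (intro mult_mono) (auto simp: mult.assoc)
    have "c * K \<le> (V * max x 1) * B" using cV c KB(2) K by (intro mult_mono) auto
    then show "2 * K * (29 / 100 * c) \<le> 58 / 100 * (V * max x 1) * B" by (simp add: algebra_simps)
  qed
  then have den: "D * K\<^sup>2 + 2 * K * (29 / 100 * c) \<le> 353 / 100 * (V * max x 1) * B" by (simp add: algebra_simps)
  have pos: "0 < D * K\<^sup>2 + 2 * K * (29 / 100 * c)" using D K c by (intro add_nonneg_pos) auto
  have m0: "0 \<le> e * min (x\<^sup>2) x" using e x by auto
  have "e * min (x\<^sup>2) x * (D * K\<^sup>2 + 2 * K * (29 / 100 * c)) \<le> e * min (x\<^sup>2) x * (353 / 100 * (V * max x 1) * B)"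
    using den m0 by (rule mult_left_mono)
  also have "\<dots> = 353 / 100 * B * (e * V * (min (x\<^sup>2) x * max x 1))" by (simp only: mult_ac)
  also have "\<dots> = 353 / 100 * B * (e * V * x\<^sup>2)" unfolding min_square_mult_max[OF x] ..
  also have "\<dots> \<le> 353 / 100 * B * c\<^sup>2" using sq B0 by (intro mult_left_mono) auto
  also have "\<dots> \<le> 35322 / 10000 * B * c\<^sup>2" using B0 by (intro mult_right_mono) auto
  also have "\<dots> = (29 / 100 * c)\<^sup>2 * (42 * B)" by (simp add: power2_eq_square)
  finally show ?thesis using pos B0 by (simp add: divide_le_eq pos_le_divide_eq mult.commute)
qed

section \<open>Transfer to the original process and the rate function\<close>

context nummelin_splitting
begin

text \<open>The event is a measurable functional of the path of \<open>X\<close>, so it is pulled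
  back along the projection \<open>\<phi>\<close>, under which the path becomes
  \<open>Z1\<close>.\<close>

lemma prob_path_integral_eq:
  fixes f :: "'e \<Rightarrow> real"
  assumes \<pi>: "\<pi> \<in> inits" and [measurable]: "f \<in> borel_measurable borel"
  shows "emeasure (law_from P \<pi>) {w\<in>space Om. c \<le> \<bar>LINT s:{0..t}|lborel. f (X s w)\<bar>} =
    emeasure (PP \<pi>) {w\<in>space Om'. c \<le> \<bar>LINT s:{0..t}|lborel. f (Z1 Z s w)\<bar>}"
proof -
  note [measurable] = X_measurable_pair
  define g where "g w = (LINT s:{0..t}|lborel. f (X s w))" for w
  have g_eq: "g w = (LINT s|lborel. indicator {0..t} s *\<^sub>R f (X (max 0 s) w))" for w
    unfolding g_def set_lebesgue_integral_def by (intro Bochner_Integration.integral_cong) (auto simp: indicator_def)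
  have "(\<lambda>z. X (max 0 (snd z)) (fst z)) \<in> Om \<Otimes>\<^sub>M borel \<rightarrow>\<^sub>M borel"
    using measurable_compose[OF measurable_pair_swap' X_measurable_pair] by (simp add: case_prod_beta)
  then have "(\<lambda>(w, s). indicator {0..t} s *\<^sub>R f (X (max 0 s) w)) \<in> borel_measurable (Om \<Otimes>\<^sub>M lborel)"
    unfolding case_prod_beta by measurable
  then have [measurable]: "g \<in> borel_measurable Om"
    unfolding g_eq[abs_def] by (rule sigma_finite_measure.borel_measurable_lebesgue_integral[OF sigma_finite_lborel])
  have S: "{w\<in>space Om. c \<le> \<bar>g w\<bar>} \<in> sets Om" by measurable
  have "emeasure (law_from P \<pi>) {w\<in>space Om. c \<le> \<bar>g w\<bar>} = emeasure (distr (PP \<pi>) Om \<phi>) {w\<in>space Om. c \<le> \<bar>g w\<bar>}"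
    by (simp only: extension_law[OF \<pi>])
  also have "\<dots> = emeasure (PP \<pi>) (\<phi> -` {w\<in>space Om. c \<le> \<bar>g w\<bar>} \<inter> space (PP \<pi>))"
    by (rule emeasure_distr[OF measurable_PP[OF \<pi> extension_measurable] S])
  also have "\<phi> -` {w\<in>space Om. c \<le> \<bar>g w\<bar>} \<inter> space (PP \<pi>) = {w\<in>space Om'. c \<le> \<bar>LINT s:{0..t}|lborel. f (Z1 Z s w)\<bar>}"
  proof -
    have "g (\<phi> w) = (LINT s:{0..t}|lborel. f (Z1 Z s w))" if "w \<in> space Om'" for w
      unfolding g_def set_lebesgue_integral_def
      by (intro Bochner_Integration.integral_cong) (auto simp: indicator_def Z1_is_X[OF that])
    then show ?thesis using measurable_space[OF extension_measurable] by (auto simp: space_PP[OF \<pi>])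
  qed
  finally show ?thesis by (simp only: g_def)
qed

text \<open>With M = 2 t / m and N the integer part of M y, \<open>N div 2\<close> is at least 3/8
  of M y, that is t y times 3 / (4 m), because M y \<ge> 8; this is where t > 4 m enters. Dividing t
  / 2 by 3 t / (4 m) explains the argument 2/3 m of the rate function.\<close>

lemma regen_tail_rate:
  assumes \<pi>: "\<pi> \<in> inits" and fin: "emeasure \<mu> (space \<mu>) < \<infinity>" and m: "m = cycle_mean C a \<nu> PP Z T"
    and t: "4 * m < t" and y: "1 \<le> y"
  shows "emeasure (PP \<pi>) {w\<in>space Om'. regen_time C a Z T (Suc (nat \<lfloor>2 * t / m * y\<rfloor>)) w \<le> ennreal t} \<le>
    8 * eexp (- (ereal (t * y * (3 / (4 * m))) * cycle_rate C a \<nu> PP Z T (2 / 3 * m)))"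
proof -
  have m2: "2 \<le> m" using cycle_mean_ge_2(1)[OF fin] m by simp
  define M where "M = 2 * t / m"
  define N where "N = nat \<lfloor>M * y\<rfloor>"
  have M: "8 < M" using t m2 by (simp add: M_def field_simps)
  have My: "8 \<le> M * y" using mult_mono[of 8 M 1 y] M y by simp
  have "M * y - 1 \<le> real N" unfolding N_def using My by linarith
  moreover have "real N \<le> 2 * real (N div 2) + 1"
  proof -
    have "N \<le> 2 * (N div 2) + 1" by arith
    then have "real N \<le> real (2 * (N div 2) + 1)" by (simp only: of_nat_le_iff)
    then show ?thesis by simp
  qed
  ultimately have N2: "3 / 8 * (M * y) \<le> real (N div 2)" using My by linarith
  define q where "q = t * y * (3 / (4 * m))"
  have q: "q = 3 / 8 * (M * y)" using m2 by (simp add: q_def M_def field_simps)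
  have q0: "0 < q" using My q by simp
  show ?thesis unfolding cycle_rate_def q_def[symmetric] M_def[symmetric] N_def[symmetric]
  proof (rule le_exp_SUP_rate[OF q0])
    fix l :: real assume "l \<in> {0<..}"
    then have l: "0 < l" by simp
    let ?F = "cycle_laplace C a \<nu> PP Z T l"
    note F = cycle_laplace_eq(2,3)[OF less_imp_le[OF l]]
    have t0: "0 \<le> t" using t m2 by simp
    have "emeasure (PP \<pi>) {w\<in>space Om'. regen_time C a Z T (Suc N) w \<le> ennreal t} \<le> ennreal (2 * (exp (l * t / 2) * ?F ^ (N div 2)))"
      by (rule regen_tail_laplace[OF \<pi> less_imp_le[OF l] t0])
    also have "\<dots> \<le> ennreal (2 * exp (- (q * (- l * (2 / 3 * m) - ln ?F))))"
    proof (intro ennreal_leI mult_left_mono)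
      show "exp (l * t / 2) * ?F ^ (N div 2) \<le> exp (- (q * (- l * (2 / 3 * m) - ln ?F)))"
      proof (cases "?F = 0")
        case True
        have "N div 2 \<noteq> 0" using N2 My by (intro notI) simp
        then have z: "0 ^ (N div 2) = (0 :: real)" by (simp add: zero_power)
        show ?thesis unfolding True z by simp
      next
        case False
        then have F0: "0 < ?F" using F by simp
        have "?F ^ (N div 2) = exp (real (N div 2) * ln ?F)" using F0 by (simp add: exp_of_nat_mult)
        moreover have "real (N div 2) * ln ?F \<le> q * ln ?F"
          using N2 F F0 unfolding q by (intro mult_right_mono_neg) auto
        moreover have "l * t / 2 \<le> q * (l * (2 / 3 * m))"
        proof -
          have "q * (l * (2 / 3 * m)) = l * t / 2 * y" using m2 by (simp add: q_def field_simps)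
          then show ?thesis using y l t0 mult_left_mono[of 1 y "l * t / 2"] by simp
        qed
        ultimately have "exp (l * t / 2) * ?F ^ (N div 2) \<le> exp (q * (l * (2 / 3 * m))) * exp (q * ln ?F)"
          by (intro mult_mono) auto
        also have "\<dots> = exp (- (q * (- l * (2 / 3 * m) - ln ?F)))"
          by (simp add: exp_add[symmetric] algebra_simps)
        finally show ?thesis .
      qed
    qed simp
    finally show "emeasure (PP \<pi>) {w\<in>space Om'. regen_time C a Z T (Suc N) w \<le> ennreal t} \<le>
      ennreal (2 * exp (- (q * (- l * (2 / 3 * m) - ln ?F))))" .
  next
    have "(1::real) \<in> {0<..}" by simp
    then show "{0<..} \<noteq> ({} :: real set)" unfolding ex_in_conv[symmetric] by (rule exI)
  qed
qed

text \<open>The right derivative of the Laplace transform at 0 is minus the mean. For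
  \<open>u\<close> below the mean, some small l has transform less than 1 - l u \<le> exp (- l u),
  which makes one term of the supremum positive.\<close>

lemma cycle_rate_positive:
  assumes fin: "emeasure \<mu> (space \<mu>) < \<infinity>" and u: "u < cycle_mean C a \<nu> PP Z T"
  shows "0 < cycle_rate C a \<nu> PP Z T u"
proof -
  interpret PP: prob_space "PP \<nu>" by (rule PP_prob_space[OF nu_inits])
  define L where "L w = enn2real (cycle_length C a Z T w)" for w
  have [measurable]: "(\<lambda>w. cycle_length C a Z T w) \<in> borel_measurable (PP \<nu>)"
    unfolding cycle_length_def by (rule measurable_PP[OF nu_inits]) measurable
  have Lm[measurable]: "L \<in> borel_measurable (PP \<nu>)" unfolding L_def[abs_def] by measurable
  have L0: "0 \<le> L w" for w by (simp add: L_def)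
  have "AE w in PP \<nu>. cycle_length C a Z T w \<noteq> \<infinity>"
    by (rule nn_integral_noteq_infinite) (use cycle_mean_ge_2(2)[OF fin] in auto)
  then have "(\<integral>\<^sup>+w. ennreal (L w) \<partial>PP \<nu>) = (\<integral>\<^sup>+w. cycle_length C a Z T w \<partial>PP \<nu>)"
    by (intro nn_integral_cong_AE) (auto simp: L_def top.not_eq_extremum elim!: eventually_mono)
  then have LE: "(\<integral>\<^sup>+w. ennreal (L w) \<partial>PP \<nu>) = ennreal (cycle_mean C a \<nu> PP Z T)" using cycle_mean_ge_2(2)[OF fin] by simp
  have Li: "integrable (PP \<nu>) L" by (rule integrableI_nonneg) (use L0 LE in auto)
  have Lint: "(LINT w|PP \<nu>. L w) = cycle_mean C a \<nu> PP Z T"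
    using LE L0 cycle_mean_ge_2(1)[OF fin] by (simp add: integral_eq_nn_integral)
  \<comment> \<open>Along this sequence the difference quotients converge to \<open>L\<close> and
    are dominated by \<open>L\<close>, so dominated convergence yields the derivative.\<close>
  define l where "l n = inverse (real (Suc n))" for n
  have l0: "0 < l n" for n by (simp add: l_def)
  define D where "D n w = (1 - exp (- l n * L w)) / l n" for n w
  have Dm[measurable]: "D n \<in> borel_measurable (PP \<nu>)" for n unfolding D_def[abs_def] by measurable
  have Dlim: "(\<lambda>n. D n w) \<longlonglongrightarrow> L w" for w
  proof -
    have "((\<lambda>y. 1 - exp (- y * L w)) has_real_derivative L w) (at 0)"
      by (auto intro!: derivative_eq_intros)
    then have "((\<lambda>y. (1 - exp (- y * L w)) / y) \<longlongrightarrow> L w) (at 0)"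
      by (simp add: has_field_derivative_iff)
    moreover have "filterlim l (at 0) sequentially"
      unfolding filterlim_at l_def[abs_def] using LIMSEQ_inverse_real_of_nat by (auto simp: l_def)
    ultimately show ?thesis unfolding D_def by (rule filterlim_compose)
  qed
  have Db: "norm (D n w) \<le> L w" for n w
  proof -
    have "1 + (- l n * L w) \<le> exp (- l n * L w)" by (rule exp_ge_add_one_self)
    then have "D n w \<le> L w" using l0[of n] by (simp add: D_def divide_le_eq mult.commute)
    moreover have "0 \<le> D n w" using l0[of n] L0[of w] by (simp add: D_def)
    ultimately show ?thesis by simp
  qed
  have "(\<lambda>n. LINT w|PP \<nu>. D n w) \<longlonglongrightarrow> (LINT w|PP \<nu>. L w)"
    by (rule integral_dominated_convergence[where w = L]) (use Dlim Db Li in auto)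
  then have "eventually (\<lambda>n. u < (LINT w|PP \<nu>. D n w)) sequentially"
    using u unfolding Lint by (rule order_tendstoD)
  then obtain n where n: "u < (LINT w|PP \<nu>. D n w)" using eventually_happens[of _ sequentially] by auto
  have Ei: "integrable (PP \<nu>) (\<lambda>w. exp (- l n * L w))"
    by (rule PP.integrable_const_bound[where B = 1]) (use l0[of n] L0 in auto)
  define E where "E = cycle_laplace C a \<nu> PP Z T (l n)"
  have E_eq: "E = (LINT w|PP \<nu>. exp (- l n * L w))" by (simp add: E_def cycle_laplace_def L_def)
  have "(LINT w|PP \<nu>. D n w) = (1 - E) / l n"
    unfolding D_def E_eq using Ei by (simp add: PP.prob_space)
  then have "l n * u < 1 - E" using n l0[of n] by (simp add: less_divide_eq mult.commute)
  then have "E < 1 + (- (l n * u))" by simp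
  also have "\<dots> \<le> exp (- (l n * u))" by (rule exp_ge_add_one_self)
  finally have "E < exp (- (l n * u))" .
  moreover have "0 < E" unfolding E_eq by (rule PP.expectation_greater[OF Ei]) simp
  ultimately have "ln E < ln (exp (- (l n * u)))" by (subst ln_less_cancel_iff) auto
  then have "0 < ereal (- l n * u - ln E)" by simp
  also have "\<dots> \<le> cycle_rate C a \<nu> PP Z T u"
    unfolding cycle_rate_def E_def by (rule SUP_upper) (simp add: l0)
  finally show ?thesis .
qed

end

section \<open>The two recurrence regimes\<close>

context centered_functional
begin

lemma deviation_positive_recurrent:
  assumes \<pi>: "\<pi> \<in> inits" and fin: "emeasure \<mu> (space \<mu>) < \<infinity>" and m: "m = cycle_mean C a \<nu> PP Z T"
    and t: "4 * m < t" and x: "0 < x" and \<eta>: "0 \<le> \<eta>" "\<eta> \<le> 1 / 2"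
    and M: "M = 2 * t / m" and B: "B = max (Kb\<^sup>2) Kb"
  shows "emeasure (PP \<pi>) {w\<in>space Om'. M powr (1 / 2 + \<eta>) * x \<le> \<bar>path_int t w\<bar>} \<le>
    4 * ennreal (exp (- (M powr (2 * \<eta>) * min (x\<^sup>2) x / (42 * B)))) +
    4 * ennreal (exp 1) * ennreal (exp (- (M powr (1 / 2 + \<eta>) * x / (6 * Kb)))) +
    8 * eexp (- (ereal (t * max x 1 * (3 / (4 * m))) * cycle_rate C a \<nu> PP Z T (2 / 3 * m)))"
proof -
  have m2: "2 \<le> m" using cycle_mean_ge_2(1)[OF fin] m by simp
  have t0: "0 \<le> t" using t m2 by simp
  have M8: "8 < M" using t m2 by (simp add: M field_simps)
  define N where "N = nat \<lfloor>M * max x 1\<rfloor>"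
  define c where "c = M powr (1 / 2 + \<eta>) * x"
  have c0: "0 < c" using M8 x by (simp add: c_def)
  have My: "8 \<le> M * max x 1" using mult_mono[of 8 M 1 "max x 1"] M8 by simp
  have N: "real N \<le> M * max x 1" unfolding N_def using My by linarith
  have "M powr (2 * \<eta>) * min (x\<^sup>2) x / (42 * B) \<le> (29 / 100 * c)\<^sup>2 / (2 * (real N + 1) * Kb\<^sup>2 + 2 * Kb * (29 / 100 * c))"
  proof (rule bernstein_exponent[OF Kb_pos B c0 _ x])
    \<comment> \<open>The rounding term 2 is absorbed by M \<open>max x 1\<close>, which is at least
      8.\<close>
    have "2 * (real N + 1) \<le> 2 * (M * max x 1) + 95 / 100 * 8" using N by simp
    also have "\<dots> \<le> 2 * (M * max x 1) + 95 / 100 * (M * max x 1)" using My by (intro add_left_mono mult_left_mono) auto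
    also have "\<dots> = 295 / 100 * (M * max x 1)" by (simp only: distrib_right[symmetric]) simp
    finally show "2 * (real N + 1) \<le> 295 / 100 * M * max x 1" by (simp only: mult.assoc)
    have "M powr (1 / 2 + \<eta>) \<le> M powr 1" using M8 \<eta> by (intro powr_mono) auto
    then have "M powr (1 / 2 + \<eta>) \<le> M" using M8 by simp
    then show "c \<le> M * max x 1" unfolding c_def using M8 x by (intro mult_mono) auto
    have "M powr (2 * \<eta>) * M = (M powr (1 / 2 + \<eta>))\<^sup>2"
    proof -
      have "M powr (2 * \<eta>) * M = M powr (2 * \<eta>) * M powr 1" using M8 by simp
      also have "\<dots> = M powr ((1 / 2 + \<eta>) + (1 / 2 + \<eta>))" unfolding powr_add[symmetric] by (simp add: algebra_simps)
      also have "\<dots> = (M powr (1 / 2 + \<eta>))\<^sup>2" unfolding powr_add power2_eq_square ..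
      finally show ?thesis .
    qed
    then show "M powr (2 * \<eta>) * M * x\<^sup>2 \<le> c\<^sup>2" by (simp add: c_def power_mult_distrib)
  qed simp_all
  then have 1: "ennreal (exp (- ((29 / 100 * c)\<^sup>2 / (2 * (real N + 1) * Kb\<^sup>2 + 2 * Kb * (29 / 100 * c))))) \<le>
    ennreal (exp (- (M powr (2 * \<eta>) * min (x\<^sup>2) x / (42 * B))))" by (intro ennreal_leI) (simp only: exp_le_cancel_iff neg_le_iff_le)
  have 2: "emeasure (PP \<pi>) {w\<in>space Om'. regen_time C a Z T (Suc N) w \<le> ennreal t} \<le>
    8 * eexp (- (ereal (t * max x 1 * (3 / (4 * m))) * cycle_rate C a \<nu> PP Z T (2 / 3 * m)))"
    unfolding N_def M by (rule regen_tail_rate[OF \<pi> fin m t]) simp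
  show ?thesis unfolding c_def[symmetric]
    by (rule order_trans[OF deviation[OF \<pi> t0 c0, of N] add_mono[OF add_mono[OF mult_left_mono[OF 1] order_refl] 2]]) simp
qed

text \<open>By Markov's inequality about \<open>exp 1\<close> times \<open>v\<close> regenerations
  fit into \<open>[0, t]\<close> with probability at most \<open>exp (- 1)\<close>, and about h / 2
  blocks of this size give the last term. The factor 8 saves ln 8 blocks, which pays for rounding up
  their number.\<close>

lemma deviation_null_recurrent:
  assumes \<pi>: "\<pi> \<in> inits" and t: "0 \<le> t" and x: "0 < x" and \<eta>: "0 < \<eta>" "\<eta> \<le> 1 / 2"
    and v: "v = v_star C a \<nu> PP Z T t" and B: "B = max (Kb\<^sup>2) Kb"
  shows "emeasure (PP \<pi>) {w\<in>space Om'. v powr (1 / 2 + \<eta>) * x \<le> \<bar>path_int t w\<bar>} \<le>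
    4 * ennreal (exp (- (v powr \<eta> * min (x\<^sup>2) x / (42 * B)))) +
    4 * ennreal (exp 1) * ennreal (exp (- (v powr (1 / 2 + \<eta>) * x / (6 * Kb)))) +
    8 * ennreal (exp (- (1 / 2 * v powr \<eta> * max x 1)))"
proof -
  interpret PP: prob_space "PP \<pi>" by (rule PP_prob_space[OF \<pi>])
  interpret PPn: prob_space "PP \<nu>" by (rule PP_prob_space[OF nu_inits])
  define wt where "wt = enn2real (\<integral>\<^sup>+w. regen_count C a Z T t w \<partial>PP \<nu>)"
  have wt: "(\<integral>\<^sup>+w. regen_count C a Z T t w \<partial>PP \<nu>) = ennreal wt" "0 \<le> wt" "v = wt + 1"
    using regen_count_mean(1)[OF nu_inits t] by (simp_all add: wt_def v v_star_def)
  have v1: "1 \<le> v" using wt by simp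
  define h where "h = v powr \<eta> * max x 1"
  have h1: "1 \<le> h" unfolding h_def using v1 \<eta> mult_mono[of 1 "v powr \<eta>" 1 "max x 1"] by (simp add: ge_one_powr_ge_zero)
  show ?thesis
  \<comment> \<open>For small \<open>h\<close> the last term alone is at least 1.\<close>
  proof (cases "h / 2 \<le> ln 8")
    case True
    have "exp (h / 2) \<le> 8" using True by (metis exp_le_cancel_iff exp_ln zero_less_numeral)
    then have "1 \<le> 8 * exp (- (h / 2))" by (simp add: exp_minus field_simps)
    then have "ennreal 1 \<le> ennreal (8 * exp (- (h / 2)))" by (rule ennreal_leI)
    then have "1 \<le> 8 * ennreal (exp (- (h / 2)))" by (simp add: ennreal_mult)
    then have "emeasure (PP \<pi>) {w\<in>space Om'. v powr (1 / 2 + \<eta>) * x \<le> \<bar>path_int t w\<bar>} \<le> 8 * ennreal (exp (- (h / 2)))"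
      by (rule order_trans[OF PP.emeasure_le_1])
    also have "h / 2 = 1 / 2 * v powr \<eta> * max x 1" by (simp add: h_def)
    finally show ?thesis by (rule order_trans) simp
  next
    case False
    \<comment> \<open>Since ln 8 \<ge> 1, rounding up keeps \<open>i\<close> below h / 2.\<close>
    define i where "i = nat \<lceil>h / 2 - ln 8\<rceil>"
    have i: "h / 2 - ln 8 \<le> real i" "real i \<le> h / 2 - ln 8 + 1" "0 < i" using False unfolding i_def by linarith+
    have "exp 1 \<le> (8 :: real)" using exp_one_le by simp
    then have "1 \<le> ln (8 :: real)" by (simp add: ln_ge_iff)
    then have ih: "real i \<le> h / 2" using i(2) by simp
    \<comment> \<open>The maximum with 1 permits division by \<open>k\<close> even if the mean count
      is 0. The at most two units lost in \<open>Suc k\<close> are covered by \<open>exp 1\<close>,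
      as \<open>v\<close> is the mean count plus 1.\<close>
    define k where "k = max 1 (nat \<lceil>exp 1 * wt\<rceil>)"
    have k: "exp 1 * wt \<le> real k" "real (Suc k) \<le> exp 1 * v" "0 < k"
    proof -
      have e2: "2 \<le> exp (1::real)" using exp_ge_add_one_self[of 1] by simp
      have ew: "0 \<le> exp 1 * wt" using wt(2) by simp
      have r: "real (nat \<lceil>exp 1 * wt\<rceil>) \<le> exp 1 * wt + 1" "exp 1 * wt \<le> real (nat \<lceil>exp 1 * wt\<rceil>)" using ew by linarith+
      show "exp 1 * wt \<le> real k" using r(2) unfolding k_def by simp
      have "real k \<le> exp 1 * wt + 1" unfolding k_def of_nat_max using r(1) ew by linarith
      then show "real (Suc k) \<le> exp 1 * v" unfolding wt(3) distrib_left using e2 by simp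
      show "0 < k" by (simp add: k_def)
    qed
    have pk: "emeasure (PP \<nu>) {w\<in>space Om'. regen_time C a Z T k w \<le> ennreal t} \<le> ennreal (exp (- 1))"
    proof -
      let ?A = "{w\<in>space Om'. regen_time C a Z T k w \<le> ennreal t}"
      have A: "emeasure (PP \<nu>) ?A = ennreal (measure (PP \<nu>) ?A)" by (rule PPn.emeasure_eq_measure)
      have "of_nat k * emeasure (PP \<nu>) ?A \<le> ennreal wt" using regen_count_mean(2)[OF nu_inits t, of k] wt(1) by simp
      then have "ennreal (real k * measure (PP \<nu>) ?A) \<le> ennreal wt"
        unfolding A by (simp add: ennreal_mult ennreal_of_nat_eq_real_of_nat)
      then have "real k * measure (PP \<nu>) ?A \<le> wt" using wt(2) by (simp add: ennreal_le_iff)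
      moreover have "wt \<le> real k * exp (- 1)" using k(1) by (simp add: exp_minus field_simps)
      ultimately have "real k * measure (PP \<nu>) ?A \<le> real k * exp (- 1)" by simp
      then have "measure (PP \<nu>) ?A \<le> exp (- 1)" using k(3) by (simp add: mult_le_cancel_left)
      then show ?thesis unfolding A by (rule ennreal_leI)
    qed
    define N where "N = i * Suc k - 1"
    have N: "Suc N = i * Suc k" using i(3) by (simp add: N_def)
    have "emeasure (PP \<pi>) {w\<in>space Om'. regen_time C a Z T (Suc N) w \<le> ennreal t} \<le> ennreal (exp (- 1)) ^ i"
      unfolding N by (rule order_trans[OF regen_tail_blocks[OF \<pi> t] power_mono[OF pk]]) simp
    also have "\<dots> = ennreal (exp (- real i))" by (simp add: ennreal_power exp_of_nat_mult[symmetric])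
    also have "\<dots> \<le> ennreal (8 * exp (- (h / 2)))"
    proof (rule ennreal_leI)
      have "exp (- real i) \<le> exp (ln 8 + - (h / 2))" using i(1) by simp
      also have "\<dots> = 8 * exp (- (h / 2))" unfolding exp_add by simp
      finally show "exp (- real i) \<le> 8 * exp (- (h / 2))" .
    qed
    also have "\<dots> = 8 * ennreal (exp (- (h / 2)))" by (simp add: ennreal_mult)
    also have "h / 2 = 1 / 2 * v powr \<eta> * max x 1" by (simp add: h_def)
    finally have tail: "emeasure (PP \<pi>) {w\<in>space Om'. regen_time C a Z T (Suc N) w \<le> ennreal t} \<le>
      8 * ennreal (exp (- (1 / 2 * v powr \<eta> * max x 1)))" .
    define c where "c = v powr (1 / 2 + \<eta>) * x"
    have c0: "0 < c" using v1 x by (simp add: c_def)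
    have vv: "v powr (1 + \<eta>) = v * v powr \<eta>" using v1 by (simp add: powr_add)
    have "v powr \<eta> * min (x\<^sup>2) x / (42 * B) \<le> (29 / 100 * c)\<^sup>2 / (2 * (real N + 1) * Kb\<^sup>2 + 2 * Kb * (29 / 100 * c))"
    proof (rule bernstein_exponent[OF Kb_pos B c0 _ x])
      have "real N + 1 = real i * real (Suc k)" using arg_cong[OF N, of real] by (simp only: of_nat_mult of_nat_Suc add.commute)
      also have "\<dots> \<le> h / 2 * (exp 1 * v)" using ih k(2) h1 by (intro mult_mono) auto
      finally have "2 * (real N + 1) \<le> exp 1 * (v * h)" by (simp add: algebra_simps)
      also have "\<dots> \<le> 295 / 100 * (v * h)" using exp_one_le v1 h1 by (intro mult_right_mono) auto
      also have "v * h = v powr (1 + \<eta>) * max x 1" unfolding h_def vv by simp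
      finally show "2 * (real N + 1) \<le> 295 / 100 * v powr (1 + \<eta>) * max x 1" by (simp only: mult.assoc)
      have "v powr (1 / 2 + \<eta>) \<le> v powr (1 + \<eta>)" using v1 by (intro powr_mono) auto
      then show "c \<le> v powr (1 + \<eta>) * max x 1" unfolding c_def using x by (intro mult_mono) auto
      have "v powr \<eta> * v powr (1 + \<eta>) = (v powr (1 / 2 + \<eta>))\<^sup>2"
        unfolding power2_eq_square powr_add[symmetric] by (simp add: algebra_simps)
      then show "v powr \<eta> * v powr (1 + \<eta>) * x\<^sup>2 \<le> c\<^sup>2" by (simp add: c_def power_mult_distrib)
    qed simp_all
    then have 1: "ennreal (exp (- ((29 / 100 * c)\<^sup>2 / (2 * (real N + 1) * Kb\<^sup>2 + 2 * Kb * (29 / 100 * c))))) \<le>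
      ennreal (exp (- (v powr \<eta> * min (x\<^sup>2) x / (42 * B))))" by (intro ennreal_leI) (simp only: exp_le_cancel_iff neg_le_iff_le)
    show ?thesis unfolding c_def[symmetric]
      by (rule order_trans[OF deviation[OF \<pi> t c0, of N] add_mono[OF add_mono[OF mult_left_mono[OF 1] order_refl] tail]]) simp
  qed
qed

end

section \<open>Degenerate cases and extended real quotients\<close>

context nummelin_splitting
begin

text \<open>The cases follow the behaviour of the bounds: for infinite K the quotients vanish and
  the bound is at least 1; for f = 0 a positive threshold is exceeded with probability 0; otherwise
  K is a positive real.\<close>

lemma centered_functional_or_trivial:
  fixes f :: "'e \<Rightarrow> real"
  assumes [measurable]: "f \<in> borel_measurable borel" and bdd: "bounded (range f)" and f0: "(LINT x|\<mu>. f x) = 0"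
  obtains (infinite) "K_const C a PP Z T f = \<infinity>" | (zero) "f = (\<lambda>_. 0)"
    | (centered) Fb Cc where "centered_functional Om P X \<mu> \<Lambda> p a C \<nu> x0 Om' PP \<phi> Z T f Fb Cc"
        "K_const C a PP Z T f = ereal (Fb + Cc)"
proof -
  define Fb where "Fb = (SUP x. \<bar>f x\<bar>)"
  obtain b where "\<And>x. \<bar>f x\<bar> \<le> b" using bdd unfolding bounded_iff by auto
  then have bd: "bdd_above (range (\<lambda>x. \<bar>f x\<bar>))" by (intro bdd_aboveI) auto
  then have Fb: "\<bar>f x\<bar> \<le> Fb" for x unfolding Fb_def by (rule cSUP_upper[OF UNIV_I])
  have Fb_eq: "(SUP x. ereal \<bar>f x\<bar>) = ereal Fb"
  proof (rule antisym)
    show "(SUP x. ereal \<bar>f x\<bar>) \<le> ereal Fb" using Fb by (intro SUP_least) simp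
    obtain S where S: "(SUP x. ereal \<bar>f x\<bar>) = ereal S"
    proof (cases "SUP x. ereal \<bar>f x\<bar>")
      case PInf
      then show ?thesis using \<open>(SUP x. ereal \<bar>f x\<bar>) \<le> ereal Fb\<close> by simp
    next
      case MInf
      then show ?thesis using SUP_upper[OF UNIV_I, of "\<lambda>x. ereal \<bar>f x\<bar>" x0] by simp
    qed
    have "\<bar>f x\<bar> \<le> S" for x using SUP_upper[OF UNIV_I, of "\<lambda>x. ereal \<bar>f x\<bar>" x] unfolding S by simp
    then show "ereal Fb \<le> (SUP x. ereal \<bar>f x\<bar>)" unfolding S Fb_def by (auto intro: cSUP_least)
  qed
  let ?c = "C_const C a PP Z T f"
  have cyc_le: "cyc_mean (\<lambda>x. ennreal \<bar>f x\<bar>) x \<le> ?c" for x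
    unfolding C_const_eq[OF assms(1)] by (rule SUP_upper) simp
  consider (inf) "?c = top" | (zero) "f = (\<lambda>_. 0)" | (main) "?c < top" "f \<noteq> (\<lambda>_. 0)"
    by (cases "?c = top") (auto simp: top.not_eq_extremum)
  then show thesis
  proof cases
    case inf
    then have "K_const C a PP Z T f = \<infinity>" unfolding K_const_def Fb_eq by simp
    then show ?thesis by (rule infinite)
  next
    case zero
    then show ?thesis by (rule that(2))
  next
    case main
    define Cc where "Cc = enn2real ?c"
    have c: "?c = ennreal Cc" "0 \<le> Cc" using main(1) by (simp_all add: Cc_def)
    from main(2) obtain y where "f y \<noteq> 0" by (auto simp: fun_eq_iff)
    then have Fb0: "0 < Fb" using Fb[of y] by simp
    have \<nu>: "emeasure \<nu> (space \<nu>) = 1"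
      using \<nu>_prob unfolding space_prob_algebra by (simp add: prob_space.emeasure_space_1)
    have "(\<integral>\<^sup>+x. ennreal \<bar>f x\<bar> \<partial>\<mu>) = (\<integral>\<^sup>+x. cyc_mean (\<lambda>x. ennreal \<bar>f x\<bar>) x \<partial>\<nu>)"
      by (rule mu_eq) measurable
    also have "\<dots> \<le> (\<integral>\<^sup>+x. ennreal Cc \<partial>\<nu>)" using cyc_le unfolding c(1) by (intro nn_integral_mono) simp
    also have "\<dots> < top" by (simp add: \<nu>)
    finally have fin: "(\<integral>\<^sup>+x. ennreal \<bar>f x\<bar> \<partial>\<mu>) < top" .
    have fm: "f \<in> borel_measurable \<mu>" using measurable_cong_sets[OF sets_\<mu> refl] assms(1) by blast
    have int: "integrable \<mu> f" using fin fm by (intro integrableI_bounded) auto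
    have split: "(\<integral>\<^sup>+x. ennreal (\<sigma> * f x) \<partial>\<mu>) < top" if "\<bar>\<sigma>\<bar> = 1" for \<sigma>
    proof -
      have "(\<integral>\<^sup>+x. ennreal (\<sigma> * f x) \<partial>\<mu>) \<le> (\<integral>\<^sup>+x. ennreal \<bar>f x\<bar> \<partial>\<mu>)"
      proof (intro nn_integral_mono ennreal_leI)
        fix x show "\<sigma> * f x \<le> \<bar>f x\<bar>" using that abs_ge_self[of "\<sigma> * f x"] by (simp add: abs_mult)
      qed
      then show ?thesis using fin by (rule le_less_trans)
    qed
    have "enn2real (\<integral>\<^sup>+x. ennreal (f x) \<partial>\<mu>) = enn2real (\<integral>\<^sup>+x. ennreal (- f x) \<partial>\<mu>)"
      using real_lebesgue_integral_def[OF int] f0 by simp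
    from arg_cong[OF this, of ennreal] have "(\<integral>\<^sup>+x. ennreal (f x) \<partial>\<mu>) = (\<integral>\<^sup>+x. ennreal (- f x) \<partial>\<mu>)"
      unfolding ennreal_enn2real[OF split[of 1, unfolded mult_1_left abs_one, OF refl]]
        ennreal_enn2real[OF split[of "- 1", unfolded mult_minus1 abs_minus_cancel abs_one, OF refl]] .
    moreover have "(\<integral>\<^sup>+x. ennreal (f x) \<partial>\<mu>) = (\<integral>\<^sup>+x. cyc_mean (\<lambda>x. ennreal (f x)) x \<partial>\<nu>)" by (rule mu_eq) measurable
    moreover have "(\<integral>\<^sup>+x. ennreal (- f x) \<partial>\<mu>) = (\<integral>\<^sup>+x. cyc_mean (\<lambda>x. ennreal (- f x)) x \<partial>\<nu>)" by (rule mu_eq) measurable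
    ultimately have cent: "(\<integral>\<^sup>+x. cyc_mean (\<lambda>x. ennreal (f x)) x \<partial>\<nu>) = (\<integral>\<^sup>+x. cyc_mean (\<lambda>x. ennreal (- f x)) x \<partial>\<nu>)" by simp
    have "centered_functional Om P X \<mu> \<Lambda> p a C \<nu> x0 Om' PP \<phi> Z T f Fb Cc"
      by unfold_locales (use Fb Fb0 c cyc_le cent in auto)
    moreover have "K_const C a PP Z T f = ereal (Fb + Cc)"
      unfolding K_const_def Fb_eq c(1) using c(2) by (simp add: enn2ereal_ennreal)
    ultimately show ?thesis by (rule centered)
  qed
qed

lemma K_const_nonneg: "0 \<le> K_const C a PP Z T f"
proof -
  have "0 \<le> ereal \<bar>f x0\<bar>" by simp
  also have "\<dots> \<le> (SUP x. ereal \<bar>f x\<bar>)" by (rule SUP_upper) simp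
  finally show ?thesis unfolding K_const_def by simp
qed

lemma B_const_nonneg: "0 \<le> B_const C a PP Z T f"
  unfolding B_const_def using K_const_nonneg by (simp add: max.coboundedI2)

lemma prob_le_1: "\<pi> \<in> inits \<Longrightarrow> emeasure (PP \<pi>) A \<le> 1"
  by (rule prob_space.emeasure_le_1[OF PP_prob_space])

end

lemma eexp_quotient_ge_1:
  assumes "r \<le> 0 \<or> d = \<infinity>" "0 \<le> d"
  shows "1 \<le> eexp (- (ereal r / d))"
proof (rule one_le_eexp)
  show "0 \<le> - (ereal r / d)"
  proof (cases "d = \<infinity>")
    case False
    then have "ereal r \<le> 0" using assms(1) by simp
    then have "ereal r / d \<le> 0" unfolding divide_ereal_def
      using ereal_inverse_nonneg_iff assms(2) by (simp add: ereal_mult_le_0_iff)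
    then show ?thesis by simp
  qed simp
qed

lemma one_le_four_mult: "1 \<le> (y::ennreal) \<Longrightarrow> 1 \<le> 4 * y + u + wt"
proof -
  assume "1 \<le> y"
  also have "y = 1 * y" by simp
  also have "1 * y \<le> 4 * y" by (rule mult_right_mono) auto
  also have "\<dots> \<le> 4 * y + u + wt" by (simp add: add.assoc)
  finally show ?thesis .
qed

lemma eexp_mono: "y \<le> z \<Longrightarrow> eexp y \<le> eexp z"
  by (cases y; cases z) (auto simp: eexp_def)

text \<open>It passes from the sharper exponent obtained in the proof to the one with m in the
  denominator; if B vanishes, both quotients are infinite.\<close>

lemma ereal_quotient_le:
  fixes B :: ereal
  assumes m: "0 < m" and B: "0 \<le> B" and r: "0 < r" "r \<le> s * m"
  shows "ereal r / (42 * ereal m * B) \<le> ereal s / (42 * B)"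
proof -
  have s: "0 < s" using r m by (metis less_le_trans zero_less_mult_pos2)
  show ?thesis
  proof (cases B)
    case (real b)
    then consider "b = 0" | "0 < b" using B by fastforce
    then show ?thesis
    proof cases
      case 1
      then show ?thesis using real r s by simp
    next
      case 2
      then have "r / (42 * m * b) \<le> s / (42 * b)" using m r(2) by (simp add: field_simps)
      then show ?thesis using real 2 m by simp
    qed
  qed (use B m in auto)
qed

lemma ereal_quotient_eq:
  fixes K :: ereal
  assumes q: "0 < q" and K: "0 \<le> K"
  shows "ereal r / (6 * K * ereal q) = ereal (r / q) / (6 * K)"
proof (cases K)
  case (real k)
  show ?thesis
  proof (cases "k = 0")
    case True
    then show ?thesis using real q by (auto simp: divide_ereal_def zero_less_divide_iff divide_less_0_iff)
  next
    case False
    then show ?thesis using real q by (simp add: field_simps)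
  qed
qed (use K q in auto)

theorem theorem3p1:
  fixes Om :: "'w measure"
    and P :: "'e::polish_space \<Rightarrow> 'w measure"
    and X :: "real \<Rightarrow> 'w \<Rightarrow> 'e"
    and \<mu> \<Lambda> \<nu> :: "'e measure"
    and p :: "real \<Rightarrow> 'e \<Rightarrow> 'e \<Rightarrow> real"
    and a :: real
    and C :: "'e set"
    and x0 :: 'e
    and Om' :: "'v measure"
    and PP :: "'e measure \<Rightarrow> 'v measure"
    and \<phi> :: "'v \<Rightarrow> 'w"
    and Z :: "('v, 'e) split_process"
    and T :: "nat \<Rightarrow> 'v \<Rightarrow> real"
    and f :: "'e \<Rightarrow> real"
  assumes "nummelin_splitting Om P X \<mu> \<Lambda> p a C \<nu> x0 Om' PP \<phi> Z T"
    and "special P X \<mu> f"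
    and "bounded (range f)"
    and "(LINT x|\<mu>. f x) = 0"
  shows
    "let K = K_const C a PP Z T f;
         B = B_const C a PP Z T f;
         m = cycle_mean C a \<nu> PP Z T;
         rate = cycle_rate C a \<nu> PP Z T;
         v = v_star C a \<nu> PP Z T;
         prob_ge = (\<lambda>\<pi> t c. emeasure (law_from P \<pi>)
           {\<omega> \<in> space Om. \<bar>LINT s:{0..t}|lborel. f (X s \<omega>)\<bar> \<ge> c})
     in
     (positive_recurrent \<mu> \<longrightarrow>
        (\<forall>u<m. rate u > 0) \<and>
        (\<forall>(\<eta>::real) (x::real) \<pi> (t::real).
           0 < \<eta> \<and> \<eta> \<le> 1/2 \<and> \<pi> \<in> space (prob_algebra borel) \<and> t > 4 * m \<longrightarrow>
           prob_ge \<pi> t (t powr (1/2 + \<eta>) * (2 / m) powr (1/2 + \<eta>) * x) \<le>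
             4 * eexp (- (ereal (t powr (2 * \<eta>) * min (x\<^sup>2) x) / (42 * ereal m * B)))
           + 4 * ennreal (exp 1) *
               eexp (- (ereal (2 powr (1/2 + \<eta>) * t powr (1/2 + \<eta>) * x) / (6 * K * ereal (m powr (1/2 + \<eta>)))))
           + 8 * eexp (- (ereal (t * max x 1 * (3 / (4 * m))) * rate (2/3 * m)))) \<and>
        (\<forall>(x::real) \<pi> (t::real).
           \<pi> \<in> space (prob_algebra borel) \<and> t > 4 * m \<longrightarrow>
           prob_ge \<pi> t (sqrt t * x * (sqrt 2 / sqrt m)) \<le>
             4 * eexp (- (ereal (min (x\<^sup>2) x) / (42 * B)))
           + 4 * ennreal (exp 1) *
               eexp (- (ereal (sqrt 2 * sqrt t * x) / (6 * K * ereal (sqrt m))))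
           + 8 * eexp (- (ereal (t * max x 1 * (3 / (4 * m))) * rate (2/3 * m)))))
     \<and>
     (null_recurrent \<mu> \<longrightarrow>
        (\<exists>t0\<ge>0. v t0 = 1 \<and>
          (\<forall>t\<ge>t0. \<forall>(x::real) (\<eta>::real) \<pi>.
             0 < \<eta> \<and> \<eta> \<le> 1/2 \<and> \<pi> \<in> space (prob_algebra borel) \<longrightarrow>
             prob_ge \<pi> t (v t powr (1/2 + \<eta>) * x) \<le>
               4 * eexp (- (ereal (v t powr \<eta> * min (x\<^sup>2) x) / (42 * B)))
             + 4 * ennreal (exp 1) * eexp (- (ereal (v t powr (1/2 + \<eta>) * x) / (6 * K)))
             + 8 * eexp (- (ereal (1/2 * v t powr \<eta> * max x 1))))))"
proof -
  interpret nummelin_splitting Om P X \<mu> \<Lambda> p a C \<nu> x0 Om' PP \<phi> Z T by fact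
  have f: "f \<in> borel_measurable borel" using assms(2) unfolding special_def by blast
  define K where "K = K_const C a PP Z T f"
  define B where "B = B_const C a PP Z T f"
  define m where "m = cycle_mean C a \<nu> PP Z T"
  define rate where "rate = cycle_rate C a \<nu> PP Z T"
  define v where "v = v_star C a \<nu> PP Z T"
  define dev where "dev \<pi> t c = emeasure (law_from P \<pi>) {w \<in> space Om. \<bar>LINT s:{0..t}|lborel. f (X s w)\<bar> \<ge> c}"
    for \<pi> t c
  note folds = K_def[symmetric] B_def[symmetric] m_def[symmetric] rate_def[symmetric] v_def[symmetric] dev_def[symmetric]
  have dev_eq: "dev \<pi> t c = emeasure (PP \<pi>) {w\<in>space Om'. c \<le> \<bar>LINT s:{0..t}|lborel. f (Z1 Z s w)\<bar>}"
    if "\<pi> \<in> inits" for \<pi> t c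
    unfolding dev_def by (rule prob_path_integral_eq[OF that f])
  have dev_le_1: "dev \<pi> t c \<le> 1" if "\<pi> \<in> inits" for \<pi> t c
    unfolding dev_eq[OF that] by (rule prob_le_1[OF that])
  have B_eq: "B = max (K\<^sup>2) K" by (simp add: B_def B_const_def K_def)
  have K0: "0 \<le> K" and B0: "0 \<le> B" unfolding K_def B_def by (rule K_const_nonneg, rule B_const_nonneg)
  have min_nonpos: "s * min (x\<^sup>2) x \<le> 0" if "x \<le> 0" "0 \<le> s" for s x :: real
    using that by (intro mult_nonneg_nonpos) (auto simp: min_le_iff_disj)
  \<comment> \<open>For x \<le> 0 the minimum is nonpositive, and for an infinite denominator the
    quotient is 0; in both cases the first term alone is at least 1.\<close>
  have triv: "dev \<pi> t c \<le> 4 * eexp (- (ereal (s * min (x\<^sup>2) x) / d)) + u + wt"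
    if "\<pi> \<in> inits" "x \<le> 0 \<or> d = \<infinity>" "0 \<le> s" "0 \<le> d" for \<pi> t c s d u wt and x :: real
  proof -
    have "1 \<le> eexp (- (ereal (s * min (x\<^sup>2) x) / d))"
      by (rule eexp_quotient_ge_1) (use that(2-4) min_nonpos in auto)
    then show ?thesis using dev_le_1[OF that(1)] one_le_four_mult order_trans by blast
  qed
  have zero: "dev \<pi> t c = 0" if "\<pi> \<in> inits" "f = (\<lambda>_. 0)" "0 < c" for \<pi> t c
    unfolding dev_eq[OF that(1)] using that(2,3) by (simp add: set_lebesgue_integral_def)
  \<comment> \<open>Stated in terms of 2 t / m and with \<eta> = 0 included, so that both
    inequalities of the positive recurrent case follow.\<close>
  have pos: "(\<forall>u<m. rate u > 0) \<and>
      (\<forall>\<eta> x \<pi> t. 0 \<le> \<eta> \<and> \<eta> \<le> 1/2 \<and> \<pi> \<in> inits \<and> t > 4 * m \<longrightarrow>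
         dev \<pi> t ((2 * t / m) powr (1/2 + \<eta>) * x) \<le>
           4 * eexp (- (ereal ((2 * t / m) powr (2 * \<eta>) * min (x\<^sup>2) x) / (42 * B)))
         + 4 * ennreal (exp 1) * eexp (- (ereal ((2 * t / m) powr (1/2 + \<eta>) * x) / (6 * K)))
         + 8 * eexp (- (ereal (t * max x 1 * (3 / (4 * m))) * rate (2/3 * m)))) \<and> 2 \<le> m"
    if "positive_recurrent \<mu>"
  proof -
    have fin: "emeasure \<mu> (space \<mu>) < \<infinity>" using that by (simp add: positive_recurrent_def)
    have m2: "2 \<le> m" unfolding m_def by (rule cycle_mean_ge_2(1)[OF fin])
    have "dev \<pi> t ((2 * t / m) powr (1/2 + \<eta>) * x) \<le>
           4 * eexp (- (ereal ((2 * t / m) powr (2 * \<eta>) * min (x\<^sup>2) x) / (42 * B)))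
         + 4 * ennreal (exp 1) * eexp (- (ereal ((2 * t / m) powr (1/2 + \<eta>) * x) / (6 * K)))
         + 8 * eexp (- (ereal (t * max x 1 * (3 / (4 * m))) * rate (2/3 * m)))"
      if \<eta>: "0 \<le> \<eta>" "\<eta> \<le> 1/2" and \<pi>: "\<pi> \<in> inits" and t: "t > 4 * m" for \<eta> x \<pi> t
    proof (cases "x \<le> 0")
      case True
      then show ?thesis using B0 by (intro triv[OF \<pi>]) auto
    next
      case False
      then have x: "0 < x" by simp
      have M0: "0 < 2 * t / m" using t m2 by simp
      show ?thesis
      proof (cases rule: centered_functional_or_trivial[OF f assms(3,4)])
        case 1
        then have "B = \<infinity>" by (simp add: B_eq K_def)
        then show ?thesis by (intro triv[OF \<pi>]) auto
      next
        \<comment> \<open>Here K and B are 0 and the first two terms of the bound vanish, so the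
          probability itself has to be 0.\<close>
        case 2
        have "0 < (2 * t / m) powr (1/2 + \<eta>) * x"
          by (intro mult_pos_pos x powr_gt_zero[THEN iffD2]) (use M0 in linarith)
        from zero[OF \<pi> 2 this] show ?thesis by simp
      next
        case (3 Fb Cc)
        interpret cf: centered_functional Om P X \<mu> \<Lambda> p a C \<nu> x0 Om' PP \<phi> Z T f Fb Cc by (rule 3(1))
        have K: "K = ereal cf.Kb" using 3(2) by (simp add: K_def cf.Kb_def)
        have Bk: "B = ereal (max (cf.Kb\<^sup>2) cf.Kb)" unfolding B_eq K by (simp add: ereal_power max_def)
        show ?thesis
          using cf.deviation_positive_recurrent[OF \<pi> fin m_def t x \<eta> refl refl] cf.Kb_pos
          unfolding dev_eq[OF \<pi>] cf.path_int_def K Bk rate_def by (simp add: eexp_ereal max_def)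
      qed
    qed
    moreover have "\<forall>u<m. rate u > 0" unfolding m_def rate_def using cycle_rate_positive[OF fin] by blast
    ultimately show ?thesis using m2 by blast
  qed
  have null: "dev \<pi> t (v t powr (1/2 + \<eta>) * x) \<le>
        4 * eexp (- (ereal (v t powr \<eta> * min (x\<^sup>2) x) / (42 * B)))
      + 4 * ennreal (exp 1) * eexp (- (ereal (v t powr (1/2 + \<eta>) * x) / (6 * K)))
      + 8 * eexp (- (ereal (1/2 * v t powr \<eta> * max x 1)))"
    if \<eta>: "0 < \<eta>" "\<eta> \<le> 1/2" and \<pi>: "\<pi> \<in> inits" and t: "0 \<le> t" for \<eta> x \<pi> t
  proof (cases "x \<le> 0")
    case True
    then show ?thesis using B0 by (intro triv[OF \<pi>]) auto
  next
    case False
    then have x: "0 < x" by simp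
    have v0: "0 < v t" by (simp add: v_def v_star_def add_nonneg_pos)
    show ?thesis
    proof (cases rule: centered_functional_or_trivial[OF f assms(3,4)])
      case 1
      then have "B = \<infinity>" by (simp add: B_eq K_def)
      then show ?thesis by (intro triv[OF \<pi>]) auto
    next
      case 2
      have "0 < v t powr (1/2 + \<eta>) * x"
        by (intro mult_pos_pos x powr_gt_zero[THEN iffD2]) (use v0 in linarith)
      from zero[OF \<pi> 2 this] show ?thesis by simp
    next
      case (3 Fb Cc)
      interpret cf: centered_functional Om P X \<mu> \<Lambda> p a C \<nu> x0 Om' PP \<phi> Z T f Fb Cc by (rule 3(1))
      have K: "K = ereal cf.Kb" using 3(2) by (simp add: K_def cf.Kb_def)
      have Bk: "B = ereal (max (cf.Kb\<^sup>2) cf.Kb)" unfolding B_eq K by (simp add: ereal_power max_def)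
      show ?thesis
        using cf.deviation_null_recurrent[OF \<pi> t x \<eta> refl refl] cf.Kb_pos
        unfolding dev_eq[OF \<pi>] cf.path_int_def K Bk v_def by (simp add: eexp_ereal max_def)
    qed
  qed
  show ?thesis
    unfolding Let_def folds
  proof (intro conjI impI)
    assume pr: "positive_recurrent \<mu>"
    note p = pos[OF pr]
    note p2 = p[THEN conjunct2, THEN conjunct1, rule_format]
    have m2: "2 \<le> m" by (rule p[THEN conjunct2, THEN conjunct2])
    show "\<forall>u<m. rate u > 0" by (rule p[THEN conjunct1])
    show "\<forall>\<eta> x \<pi> t. 0 < \<eta> \<and> \<eta> \<le> 1/2 \<and> \<pi> \<in> inits \<and> t > 4 * m \<longrightarrow>
           dev \<pi> t (t powr (1/2 + \<eta>) * (2 / m) powr (1/2 + \<eta>) * x) \<le>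
             4 * eexp (- (ereal (t powr (2 * \<eta>) * min (x\<^sup>2) x) / (42 * ereal m * B)))
           + 4 * ennreal (exp 1) *
               eexp (- (ereal (2 powr (1/2 + \<eta>) * t powr (1/2 + \<eta>) * x) / (6 * K * ereal (m powr (1/2 + \<eta>)))))
           + 8 * eexp (- (ereal (t * max x 1 * (3 / (4 * m))) * rate (2/3 * m)))"
    proof (intro allI impI)
      fix \<eta> x :: real and \<pi> t assume h: "0 < \<eta> \<and> \<eta> \<le> 1/2 \<and> \<pi> \<in> inits \<and> t > 4 * m"
      then have \<eta>: "0 < \<eta>" "\<eta> \<le> 1/2" and \<pi>: "\<pi> \<in> inits" and t: "t > 4 * m" by auto
      have t0: "0 < t" using t m2 by simp
      show "dev \<pi> t (t powr (1/2 + \<eta>) * (2 / m) powr (1/2 + \<eta>) * x) \<le>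
             4 * eexp (- (ereal (t powr (2 * \<eta>) * min (x\<^sup>2) x) / (42 * ereal m * B)))
           + 4 * ennreal (exp 1) *
               eexp (- (ereal (2 powr (1/2 + \<eta>) * t powr (1/2 + \<eta>) * x) / (6 * K * ereal (m powr (1/2 + \<eta>)))))
           + 8 * eexp (- (ereal (t * max x 1 * (3 / (4 * m))) * rate (2/3 * m)))"
      proof (cases "x \<le> 0")
        case True
        then show ?thesis using B0 m2 by (intro triv[OF \<pi>]) (auto intro!: ereal_0_le_mult)
      next
        case False
        then have x: "0 < x" by simp
        have M1: "t powr (1/2 + \<eta>) * (2 / m) powr (1/2 + \<eta>) = (2 * t / m) powr (1/2 + \<eta>)"
          using t0 m2 by (simp add: powr_mult[symmetric] mult.commute)
        have M2: "(2 * t / m) powr (1/2 + \<eta>) * x = 2 powr (1/2 + \<eta>) * t powr (1/2 + \<eta>) * x / m powr (1/2 + \<eta>)"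
          using t0 m2 by (simp add: powr_divide powr_mult)
        have "dev \<pi> t ((2 * t / m) powr (1/2 + \<eta>) * x) \<le>
           4 * eexp (- (ereal ((2 * t / m) powr (2 * \<eta>) * min (x\<^sup>2) x) / (42 * B)))
         + 4 * ennreal (exp 1) * eexp (- (ereal ((2 * t / m) powr (1/2 + \<eta>) * x) / (6 * K)))
         + 8 * eexp (- (ereal (t * max x 1 * (3 / (4 * m))) * rate (2/3 * m)))"
          by (rule p2) (use \<eta> \<pi> t in auto)
        also have "ereal ((2 * t / m) powr (1/2 + \<eta>) * x) / (6 * K) =
          ereal (2 powr (1/2 + \<eta>) * t powr (1/2 + \<eta>) * x) / (6 * K * ereal (m powr (1/2 + \<eta>)))"
          unfolding M2 by (rule ereal_quotient_eq[symmetric]) (use m2 K0 in auto)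
        also have "eexp (- (ereal ((2 * t / m) powr (2 * \<eta>) * min (x\<^sup>2) x) / (42 * B))) \<le>
          eexp (- (ereal (t powr (2 * \<eta>) * min (x\<^sup>2) x) / (42 * ereal m * B)))"
        proof (intro eexp_mono ereal_minus_le_minus[THEN iffD2] ereal_quotient_le)
          have mn: "0 < min (x\<^sup>2) x" using x by simp
          show "0 < t powr (2 * \<eta>) * min (x\<^sup>2) x" using mn t0 by simp
          \<comment> \<open>Here 2 \<eta> \<le> 1 and m \<ge> 2 enter: the exponent with (2 t / m)
            powr (2 \<eta>) is at least the one with t powr (2 \<eta>) / m.\<close>
          have "(2 / m) powr 1 \<le> (2 / m) powr (2 * \<eta>)" using m2 \<eta> by (intro powr_mono') auto
          then have "1 \<le> (2 / m) powr (2 * \<eta>) * m" using m2 by (simp add: field_simps)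
          then have "t powr (2 * \<eta>) * 1 \<le> t powr (2 * \<eta>) * ((2 / m) powr (2 * \<eta>) * m)" by (intro mult_left_mono) auto
          also have "\<dots> = (2 * t / m) powr (2 * \<eta>) * m"
            using t0 m2 by (simp add: powr_mult[symmetric] mult.assoc[symmetric] mult.commute)
          finally have "t powr (2 * \<eta>) * 1 * min (x\<^sup>2) x \<le> (2 * t / m) powr (2 * \<eta>) * m * min (x\<^sup>2) x"
            by (rule mult_right_mono[OF _ less_imp_le[OF mn]])
          then show "t powr (2 * \<eta>) * min (x\<^sup>2) x \<le> (2 * t / m) powr (2 * \<eta>) * min (x\<^sup>2) x * m"
            by (simp only: mult_1_right mult.assoc mult.commute[of m])
        qed (use m2 B0 in auto)
        finally show ?thesis unfolding M1 by (simp add: add_right_mono mult_left_mono)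
      qed
    qed
    show "\<forall>x \<pi> t. \<pi> \<in> inits \<and> t > 4 * m \<longrightarrow>
           dev \<pi> t (sqrt t * x * (sqrt 2 / sqrt m)) \<le>
             4 * eexp (- (ereal (min (x\<^sup>2) x) / (42 * B)))
           + 4 * ennreal (exp 1) * eexp (- (ereal (sqrt 2 * sqrt t * x) / (6 * K * ereal (sqrt m))))
           + 8 * eexp (- (ereal (t * max x 1 * (3 / (4 * m))) * rate (2/3 * m)))"
    proof (intro allI impI, elim conjE)
      fix x :: real and \<pi> t assume \<pi>: "\<pi> \<in> inits" and t: "t > 4 * m"
      have t0: "0 < t" using t m2 by simp
      \<comment> \<open>At \<eta> = 0 the power in the first exponent is 1 and m disappears from
        it.\<close>
      have "dev \<pi> t ((2 * t / m) powr (1/2 + 0) * x) \<le>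
         4 * eexp (- (ereal ((2 * t / m) powr (2 * 0) * min (x\<^sup>2) x) / (42 * B)))
       + 4 * ennreal (exp 1) * eexp (- (ereal ((2 * t / m) powr (1/2 + 0) * x) / (6 * K)))
       + 8 * eexp (- (ereal (t * max x 1 * (3 / (4 * m))) * rate (2/3 * m)))"
        by (rule p2) (use \<pi> t in auto)
      moreover have "(2 * t / m) powr (1/2 + 0) * x = sqrt t * x * (sqrt 2 / sqrt m)"
        using t0 m2 by (simp add: powr_half_sqrt real_sqrt_mult real_sqrt_divide)
      moreover have "(2 * t / m) powr (2 * 0) * min (x\<^sup>2) x = min (x\<^sup>2) x" using t0 m2 by simp
      moreover have "ereal (sqrt 2 * sqrt t * x) / (6 * K * ereal (sqrt m)) = ereal (sqrt t * x * (sqrt 2 / sqrt m)) / (6 * K)"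
      proof -
        have "sqrt t * x * (sqrt 2 / sqrt m) = sqrt 2 * sqrt t * x / sqrt m" by simp
        then show ?thesis using m2 K0 by (simp only:) (rule ereal_quotient_eq, auto)
      qed
      ultimately show "dev \<pi> t (sqrt t * x * (sqrt 2 / sqrt m)) \<le>
             4 * eexp (- (ereal (min (x\<^sup>2) x) / (42 * B)))
           + 4 * ennreal (exp 1) * eexp (- (ereal (sqrt 2 * sqrt t * x) / (6 * K * ereal (sqrt m))))
           + 8 * eexp (- (ereal (t * max x 1 * (3 / (4 * m))) * rate (2/3 * m)))" by (simp only:)
    qed
  next
    assume "null_recurrent \<mu>"
    show "\<exists>t0\<ge>0. v t0 = 1 \<and>
          (\<forall>t\<ge>t0. \<forall>x \<eta> \<pi>. 0 < \<eta> \<and> \<eta> \<le> 1/2 \<and> \<pi> \<in> inits \<longrightarrow>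
             dev \<pi> t (v t powr (1/2 + \<eta>) * x) \<le>
               4 * eexp (- (ereal (v t powr \<eta> * min (x\<^sup>2) x) / (42 * B)))
             + 4 * ennreal (exp 1) * eexp (- (ereal (v t powr (1/2 + \<eta>) * x) / (6 * K)))
             + 8 * eexp (- (ereal (1/2 * v t powr \<eta> * max x 1))))"
    proof (intro exI[of _ 0] conjI allI impI)
      show "(0::real) \<le> 0" by simp
      show "v 0 = 1" unfolding v_def by (rule v_star_0)
    qed (elim conjE, (rule null; assumption))
  qed
qed

end
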